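(* Let $P_0$ be a probability measure on a measurable space $\mathcal X$, let $X_1,X_2,\dots$ be i.i.d. with distribution $P_0$ under $E_0$, let $\tau$ be a random time with values in $\{1,2,\dots\}$, and let $h$ be a real-valued cost function of $\mathbf X_\tau=(X_1,\dots,X_\tau)$. Assume that one of the following two conditions (A), (B) holds. (A) $\tau$ is a stopping time with respect to a filtration $\{\mathcal F_t\}_{t\ge1}$ that contains the filtration generated by the sequence $\{X_t\}_{t\ge1}$; $\tau\le T$ a.s. for a deterministic time $T$; and $|h(\mathbf X_\tau)|\le\sum_{t=1}^T\Lambda_t(X_t)$ a.s. for some deterministic functions $\Lambda_t$ on $\mathcal X$ such that, for each $t$, $E_0[e^{\theta\Lambda_t(X)}]<\infty$ for $\theta$ in a neighborhood of $0$, where $X\sim P_0$. (B) $\tau$ is independent of $\{X_t\}_{t\ge1}$, $E_0[\tau^2]<\infty$, and $h(\mathbf X_\tau)$ is bounded a.s. Assume moreover that $\tilde g(X)$, $X\sim P_0$, is non-constant under $P_0$, where $$\tilde g(x)=\sum_{t=1}^\infty \tilde g_t(x),\qquad \tilde g_t(x)=E_0[h(\mathbf X_\tau);\tau\ge t\mid X_t=x].$$ Then, as $\eta\to0^+$, the optimal value of $$\max\ E_f[h(\mathbf X_\tau)]\quad\text{subject to}\quad D(P_f\|P_0)\le\eta,\ \ X_t\overset{i.i.d.}{\sim}P_f\ (t=1,2,\dots),\ \ P_f\in\mathcal P_0$$ (with $P_f$ the decision variable) satisfies $$\max E_f[h(\mathbf X_\tau)]=E_0[h(\mathbf X_\tau)]+\sqrt{2\,Var_0(\tilde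 g(X))}\,\eta^{1/2}+\frac{1}{Var_0(\tilde g(X))}\Big(\frac13\kappa_3(\tilde g(X))+\tilde\nu\Big)\eta+O(\eta^{3/2}),$$ where $\kappa_3(\tilde g(X))=E_0[(\tilde g(X)-E_0[\tilde g(X)])^3]$, $$\tilde\nu=E_0\big[(\tilde G(X,Y)-E_0[\tilde G(X,Y)])(\tilde g(X)-E_0[\tilde g(X)])(\tilde g(Y)-E_0[\tilde g(Y)])\big],$$ $X,Y$ are independent, each with distribution $P_0$, and $$\tilde G(x,y)=\sum_{t=1}^\infty\ \sum_{s\ge1,\ s\ne t}\tilde G_{ts}(x,y),\qquad \tilde G_{ts}(x,y)=E_0[h(\mathbf X_\tau);\tau\ge t\wedge s\mid X_t=x,X_s=y].$$
   Context: $E[Z;A]$ means $E[Z\mathbf 1_A]$, and $t\wedge s=\min(t,s)$. $\mathcal P_0$ is the set of all probability measures on $\mathcal X$ absolutely continuous with respect to $P_0$, and $D(P_f\|P_0)=E_0\big[\frac{dP_f}{dP_0}\log\frac{dP_f}{dP_0}\big]$ is the Kullback-Leibler divergence. $E_f[h(\mathbf X_\tau)]$ is the expectation of $h(\mathbf X_\tau)$ when the $X_t$ are i.i.d. with distribution $P_f$; in terms of the likelihood ratio $L=dP_f/dP_0$ it is written $E_0\big[h(\mathbf X_\tau)\prod_{t=1}^\tau L(X_t)\big]$. $Var_0$ is variance under $P_0$.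
   Formalization: In the definition of G̃_ts the event τ ≥ t∧s (minimum) is replaced by τ ≥ max(t,s), because with the minimum the double series defining G̃ diverges whenever g̃(X) is non-constant. *)

theory Defs
  imports "HOL-Probability.Probability" "HOL-Library.Landau_Symbols"
begin

section \<open>The random path, the cost and the random time\<close>

definition path :: "(nat \<Rightarrow> 'w \<Rightarrow> 'a) \<Rightarrow> ('w \<Rightarrow> nat) \<Rightarrow> 'w \<Rightarrow> 'a list" where
  "path X \<tau> \<omega> = map (\<lambda>t. X t \<omega>) [1..<Suc (\<tau> \<omega>)]"

definition path_cost :: "('a list \<Rightarrow> real) \<Rightarrow> (nat \<Rightarrow> 'w \<Rightarrow> 'a) \<Rightarrow> ('w \<Rightarrow> nat) \<Rightarrow> 'w \<Rightarrow> real" where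
  "path_cost h X \<tau> \<omega> = h (path X \<tau> \<omega>)"

definition measurable_cost :: "'a measure \<Rightarrow> ('a list \<Rightarrow> real) \<Rightarrow> bool" where
  "measurable_cost P0 h \<longleftrightarrow>
     (\<forall>n\<ge>1. (\<lambda>x. h (map x [1..<Suc n])) \<in> borel_measurable (PiM {1..n} (\<lambda>_. P0)))"

definition iid_sequence :: "'w measure \<Rightarrow> 'a measure \<Rightarrow> (nat \<Rightarrow> 'w \<Rightarrow> 'a) \<Rightarrow> bool" where
  "iid_sequence M P0 X \<longleftrightarrow>
     prob_space.indep_vars M (\<lambda>_. P0) X {1..} \<and> (\<forall>t\<ge>1. distr M P0 (X t) = P0)"

definition random_time :: "'w measure \<Rightarrow> ('w \<Rightarrow> nat) \<Rightarrow> bool" where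
  "random_time M \<tau> \<longleftrightarrow> \<tau> \<in> measurable M (count_space UNIV) \<and> (\<forall>\<omega>\<in>space M. 1 \<le> \<tau> \<omega>)"

text \<open>Nothing depends on \<open>F 0\<close>: time starts at \<open>1\<close> and \<open>\<tau> \<ge> 1\<close>, so any
  filtration indexed by \<open>t \<ge> 1\<close> can be extended by the trivial \<open>\<sigma>\<close>-algebra at \<open>0\<close>.
  The filtration may be strictly larger than the one generated by \<open>X\<close>.\<close>

definition cond_A ::
  "'w measure \<Rightarrow> 'a measure \<Rightarrow> (nat \<Rightarrow> 'w \<Rightarrow> 'a) \<Rightarrow> ('w \<Rightarrow> nat) \<Rightarrow> ('a list \<Rightarrow> real)
    \<Rightarrow> (nat \<Rightarrow> 'w measure) \<Rightarrow> bool" where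
  "cond_A M P0 X \<tau> h F \<longleftrightarrow>
     filtration (space M) F \<and> (\<forall>t. sets (F t) \<subseteq> sets M) \<and>
     (\<forall>t\<ge>1. X t \<in> measurable (F t) P0) \<and>
     stopping_time F \<tau> \<and>
     (\<exists>T \<Lambda>. (AE \<omega> in M. \<tau> \<omega> \<le> T) \<and>
        (\<forall>t\<in>{1..T}. \<Lambda> t \<in> borel_measurable P0 \<and>
           (\<forall>\<^sub>F \<theta> in nhds (0::real). integrable P0 (\<lambda>x. exp (\<theta> * \<Lambda> t x)))) \<and>
        (AE \<omega> in M. \<bar>path_cost h X \<tau> \<omega>\<bar> \<le> (\<Sum>t=1..T. \<Lambda> t (X t \<omega>))))"

definition cond_B ::
  "'w measure \<Rightarrow> 'a measure \<Rightarrow> (nat \<Rightarrow> 'w \<Rightarrow> 'a) \<Rightarrow> ('w \<Rightarrow> nat) \<Rightarrow> ('a list \<Rightarrow> real) \<Rightarrow> bool" where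
  "cond_B M P0 X \<tau> h \<longleftrightarrow>
     prob_space.indep_set M
       (sets (vimage_algebra (space M) \<tau> (count_space UNIV)))
       (sets (vimage_algebra (space M) (\<lambda>\<omega>. \<lambda>t\<in>{1..}. X t \<omega>) (PiM {1..} (\<lambda>_. P0)))) \<and>
     integrable M (\<lambda>\<omega>. (real (\<tau> \<omega>))\<^sup>2) \<and>
     (\<exists>C. AE \<omega> in M. \<bar>path_cost h X \<tau> \<omega>\<bar> \<le> C)"

text \<open>\<open>X\<close> is i.i.d. relative to \<open>F\<close>, and not only relative to its own filtration.\<close>

definition innovations :: "'w measure \<Rightarrow> 'a measure \<Rightarrow> (nat \<Rightarrow> 'w \<Rightarrow> 'a) \<Rightarrow> (nat \<Rightarrow> 'w measure) \<Rightarrow> bool" where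
  "innovations M P0 X F \<longleftrightarrow>
     (\<forall>t\<ge>1. prob_space.indep_set M (sets (F t)) (sets (vimage_algebra (space M) (X (Suc t)) P0)))"


section \<open>The optimization problem\<close>

text \<open>The Bochner integral of a non-integrable function is \<open>0\<close>. The integrability condition
  therefore keeps out the measures of infinite divergence, to which \<open>KL_divergence\<close> would
  assign the value \<open>0\<close>.\<close>

definition KL_ball :: "'a measure \<Rightarrow> real \<Rightarrow> 'a measure set" where
  "KL_ball P0 \<eta> = {Pf. prob_space Pf \<and> sets Pf = sets P0 \<and> absolutely_continuous P0 Pf \<and>
     integrable Pf (entropy_density (exp 1) P0 Pf) \<and> KL_divergence (exp 1) P0 Pf \<le> \<eta>}"

text \<open>\<open>E\<^sub>f[h(X\<^sub>\<tau>)]\<close>, by change of measure from \<open>P\<^sub>f\<close> to \<open>P\<^sub>0\<close>.\<close>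

definition expected_cost ::
  "'w measure \<Rightarrow> 'a measure \<Rightarrow> (nat \<Rightarrow> 'w \<Rightarrow> 'a) \<Rightarrow> ('w \<Rightarrow> nat) \<Rightarrow> ('a list \<Rightarrow> real)
    \<Rightarrow> 'a measure \<Rightarrow> real" where
  "expected_cost M P0 X \<tau> h Pf =
     (\<integral>\<omega>. path_cost h X \<tau> \<omega> * (\<Prod>t=1..\<tau> \<omega>. enn2real (RN_deriv P0 Pf (X t \<omega>))) \<partial>M)"

definition optimal_value ::
  "'w measure \<Rightarrow> 'a measure \<Rightarrow> (nat \<Rightarrow> 'w \<Rightarrow> 'a) \<Rightarrow> ('w \<Rightarrow> nat) \<Rightarrow> ('a list \<Rightarrow> real)
    \<Rightarrow> real \<Rightarrow> real" where
  "optimal_value M P0 X \<tau> h \<eta> = (SUP Pf\<in>KL_ball P0 \<eta>. expected_cost M P0 X \<tau> h Pf)"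


section \<open>The coefficients\<close>

text \<open>\<open>\<phi>\<close> is a version of \<open>y \<mapsto> E[Z | Y = y]\<close>, where \<open>Y\<close> takes values in \<open>N\<close>.\<close>

definition cond_exp_version ::
  "'w measure \<Rightarrow> ('w \<Rightarrow> real) \<Rightarrow> 'b measure \<Rightarrow> ('w \<Rightarrow> 'b) \<Rightarrow> ('b \<Rightarrow> real) \<Rightarrow> bool" where
  "cond_exp_version M Z N Y \<phi> \<longleftrightarrow> \<phi> \<in> borel_measurable N \<and>
     (AE \<omega> in M. \<phi> (Y \<omega>) = real_cond_exp M (vimage_algebra (space M) Y N) Z \<omega>)"

definition first_order_kernel ::
  "'w measure \<Rightarrow> 'a measure \<Rightarrow> (nat \<Rightarrow> 'w \<Rightarrow> 'a) \<Rightarrow> ('w \<Rightarrow> nat) \<Rightarrow> ('a list \<Rightarrow> real)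
    \<Rightarrow> (nat \<Rightarrow> 'a \<Rightarrow> real) \<Rightarrow> bool" where
  "first_order_kernel M P0 X \<tau> h g \<longleftrightarrow>
     (\<forall>t\<ge>1. cond_exp_version M (\<lambda>\<omega>. path_cost h X \<tau> \<omega> * indicator {\<omega>. t \<le> \<tau> \<omega>} \<omega>)
              P0 (X t) (g t))"

text \<open>The indicator in the kernel \<open>G t s\<close> is that of \<open>\<tau> \<ge> c t s\<close>. The terms of second order
  in the expansion of \<open>\<Prod>t=1..\<tau>. (1 + (L (X t) - 1))\<close> are those with \<open>t \<le> \<tau>\<close> and
  \<open>s \<le> \<tau>\<close>, that is \<open>c = max\<close>. With \<open>c = min\<close> the kernel \<open>G t s x y\<close> need not vanish
  as \<open>s \<rightarrow> \<infinity>\<close> (for bounded \<open>\<tau>\<close> and independent innovations it is \<open>g t x\<close> for all large \<open>s\<close>),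
  so the double series over \<open>t\<close> and \<open>s\<close> diverges; only its centred and integrated terms
  can be summed.\<close>

definition second_order_kernel ::
  "(nat \<Rightarrow> nat \<Rightarrow> nat) \<Rightarrow> 'w measure \<Rightarrow> 'a measure \<Rightarrow> (nat \<Rightarrow> 'w \<Rightarrow> 'a) \<Rightarrow> ('w \<Rightarrow> nat)
    \<Rightarrow> ('a list \<Rightarrow> real) \<Rightarrow> (nat \<Rightarrow> nat \<Rightarrow> 'a \<Rightarrow> 'a \<Rightarrow> real) \<Rightarrow> bool" where
  "second_order_kernel c M P0 X \<tau> h G \<longleftrightarrow>
     (\<forall>t\<ge>1. \<forall>s\<ge>1. s \<noteq> t \<longrightarrow>
        cond_exp_version M (\<lambda>\<omega>. path_cost h X \<tau> \<omega> * indicator {\<omega>. c t s \<le> \<tau> \<omega>} \<omega>)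
          (P0 \<Otimes>\<^sub>M P0) (\<lambda>\<omega>. (X t \<omega>, X s \<omega>)) (\<lambda>(x, y). G t s x y))"

definition g_sum :: "(nat \<Rightarrow> 'a \<Rightarrow> real) \<Rightarrow> 'a \<Rightarrow> real" where
  "g_sum g x = (\<Sum>t. g (Suc t) x)"

definition G_sum :: "(nat \<Rightarrow> nat \<Rightarrow> 'a \<Rightarrow> 'a \<Rightarrow> real) \<Rightarrow> 'a \<Rightarrow> 'a \<Rightarrow> real" where
  "G_sum G x y = (\<Sum>t. \<Sum>s. if s = t then 0 else G (Suc t) (Suc s) x y)"

definition G_partial_sum :: "(nat \<Rightarrow> nat \<Rightarrow> 'a \<Rightarrow> 'a \<Rightarrow> real) \<Rightarrow> nat \<Rightarrow> 'a \<Rightarrow> 'a \<Rightarrow> real" where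
  "G_partial_sum G N x y = (\<Sum>t=1..N. \<Sum>s\<in>{1..N} - {t}. G t s x y)"

definition kappa3 :: "'a measure \<Rightarrow> ('a \<Rightarrow> real) \<Rightarrow> real" where
  "kappa3 P f = (\<integral>x. (f x - (\<integral>u. f u \<partial>P)) ^ 3 \<partial>P)"

definition nu :: "'a measure \<Rightarrow> ('a \<Rightarrow> real) \<Rightarrow> ('a \<Rightarrow> 'a \<Rightarrow> real) \<Rightarrow> real" where
  "nu P f K =
     (\<integral>(x, y). (K x y - (\<integral>(u, v). K u v \<partial>(P \<Otimes>\<^sub>M P))) *
        (f x - (\<integral>u. f u \<partial>P)) * (f y - (\<integral>u. f u \<partial>P)) \<partial>(P \<Otimes>\<^sub>M P))"

end

theory Submission
  imports Defs
begin

text \<open>Along a density \<open>L = 1 + u\<close> the likelihood ratio is the product of the factors \<open>1 + u (X t)\<close> for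
\<open>t \<le> \<tau>\<close>.  It is expanded into elementary symmetric functions.  Against the cost, the part of degree
one has the mean \<open>\<integral>x. g_sum g x * u x \<partial>P0\<close>, the part of degree two has half the value at \<open>u\<close> of the
quadratic form of \<open>G_sum G\<close>, and the rest is \<open>O(\<eta> powr (3/2))\<close> uniformly over the divergence ball of
radius \<open>\<eta>\<close>.  The problem is thereby reduced to a static one: maximize a linear functional plus
a quadratic form in \<open>u\<close> over the densities of entropy at most \<open>\<eta>\<close>.

The static problem is solved by comparison with one density, proportional to \<open>exp (\<beta> * g)\<close> with
\<open>\<beta> = sqrt (2 * \<eta> / V)\<close>, where \<open>g\<close> is the centred \<open>g_sum\<close> and \<open>V\<close> its variance.  For every \<open>L\<close>, the linear
functional equals the entropy of \<open>L\<close> plus the logarithm of the partition function minus the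
divergence \<open>D\<close> of \<open>L\<close> from the tilted density, all divided by \<open>\<beta>\<close> (\<open>gibbs_variational_gap\<close>).  The term
\<open>- D / \<beta>\<close> is what makes the method work.  A weighted Pinsker inequality (\<open>weighted_entropy_bound\<close>) shows that
replacing \<open>L\<close> by the tilted density changes the quadratic form by at most a multiple of
\<open>\<beta> * sqrt D + D\<close>, and the sum of this and \<open>- D / \<beta>\<close> is at most a multiple of \<open>\<beta> ^ 3\<close>.  The terms that
remain are the Taylor expansions of the partition function, which produce the variance and the third
central moment, and the value of the quadratic form at \<open>\<beta> * g\<close>, which produces \<open>nu\<close>
(\<open>quadratic_value_upper\<close>).  The tilted density with a slightly corrected parameter lies in the ball and has
the same value up to \<open>O(\<beta> ^ 3)\<close> (\<open>quadratic_value_lower\<close>).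

All estimates refer to a weight \<open>a\<close> with an exponential moment: the kernels are dominated by \<open>a x\<close> and
by \<open>a x * a y\<close>, and \<open>\<integral>x. a x * \<bar>u x\<bar> \<partial>P0\<close> is \<open>O(sqrt \<eta>)\<close> on the ball.  For a bounded time
the cost is dominated by a product of such weights, and each of the at least three factors \<open>u (X t)\<close>
in the rest contributes one factor \<open>sqrt \<eta>\<close> (\<open>bounded_time_domination\<close>).  For an independent
time with a second moment and a bounded cost, the rest up to time \<open>n\<close> has to be bounded by a multiple of
\<open>n\<^sup>2 * \<eta> powr (3/2)\<close> (\<open>higher_part_L1\<close>).  To this end \<open>u\<close> is split into a bounded centred part and a
part of mean \<open>O(\<eta>)\<close>; the sums of the former profit from orthogonality.

The statement on the kernels with the minimum of the two times holds because, for \<open>t < s\<close>, on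
\<open>t \<le> \<tau> < s\<close> the centred function of \<open>X s\<close> is independent of the cost and of \<open>X t\<close>
(\<open>nu_partial_sums_tendsto\<close>).\<close>

section \<open>Entropy and exponential moments\<close>

lemma entropy_young:
  fixes s t :: real
  assumes "0 \<le> t"
  shows "s * (t - 1) - (exp s - 1 - s) \<le> t * ln t - t + 1"
proof (cases "t = 0")
  case True
  then show ?thesis by simp
next
  case False
  with assms have t: "t > 0" by simp
  have "1 + (s - ln t) \<le> exp (s - ln t)" by (rule exp_ge_add_one_self)
  also have "\<dots> = exp s / t" using t by (simp add: exp_diff)
  finally have "t * (1 + (s - ln t)) \<le> exp s"
    using t by (simp add: pos_le_divide_eq mult.commute)
  then show ?thesis by (simp add: algebra_simps)
qed

lemma exp_taylor_remainder:
  fixes x :: real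
  shows "\<bar>exp x - (\<Sum>m<n. x ^ m / fact m)\<bar> \<le> \<bar>x\<bar> ^ n * exp \<bar>x\<bar> / fact n"
proof -
  obtain t where t: "\<bar>t\<bar> \<le> \<bar>x\<bar>" "exp x = (\<Sum>m<n. x ^ m / fact m) + exp t / fact n * x ^ n"
    using Maclaurin_exp_le[of x n] by auto
  have "\<bar>exp x - (\<Sum>m<n. x ^ m / fact m)\<bar> = exp t * (\<bar>x\<bar> ^ n / fact n)"
    using t(2) by (simp add: abs_mult power_abs)
  also have "\<dots> \<le> exp \<bar>x\<bar> * (\<bar>x\<bar> ^ n / fact n)"
    using t(1) by (intro mult_right_mono) auto
  finally show ?thesis by (simp add: mult.commute)
qed

lemma exp_minus_linear_le: "\<bar>exp x - 1 - x\<bar> \<le> x\<^sup>2 * exp \<bar>x\<bar> / 2" for x :: real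
  using exp_taylor_remainder[of x 2] by (simp add: eval_nat_numeral algebra_simps)

lemma power_le_exp:
  fixes x :: real
  assumes "0 \<le> x"
  shows "x ^ n \<le> fact n * exp x"
proof -
  obtain t where t: "exp x = (\<Sum>m<Suc n. x ^ m / fact m) + exp t / fact (Suc n) * x ^ Suc n"
    using Maclaurin_exp_le[of x "Suc n"] by auto
  have "0 \<le> (\<Sum>m<n. x ^ m / fact m)" using assms by (intro sum_nonneg) auto
  moreover have "0 \<le> exp t / fact (Suc n) * x ^ Suc n" using assms by auto
  ultimately have "x ^ n / fact n \<le> exp x" unfolding t by simp
  then show ?thesis by (simp add: pos_divide_le_eq mult.commute)
qed

lemma power_mult_exp_le:
  fixes a c :: real
  assumes "0 \<le> a" "0 < c"
  shows "a ^ n \<le> fact n / c ^ n * exp (c * a)"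
  using power_le_exp[of "c * a" n] assms by (simp add: power_mult_distrib field_simps)

text \<open>A weighted Pinsker inequality.  By Young's inequality \<open>s (t - 1) \<le> (t ln t - t + 1) + (exp s - 1 - s)\<close>,
applied to \<open>t = L x / q x\<close> and \<open>s = \<plusminus> l a x\<close>, the weighted distance costs the divergence divided by
\<open>l\<close> plus an exponential moment of the weight multiplied by \<open>l\<close>.  The choice \<open>l = sqrt D\<close> gives the
square root of the divergence.\<close>
lemma weighted_entropy_bound:
  fixes a L q :: "'a \<Rightarrow> real"
  assumes [measurable]: "a \<in> borel_measurable P"
    and L: "integrable P L" "\<And>x. 0 \<le> L x"
    and q: "integrable P q" "\<And>x. 0 < q x"
    and a: "\<And>x. 0 \<le> a x"
    and ent: "integrable P (\<lambda>x. L x * ln (L x / q x))"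
    and em: "integrable P (\<lambda>x. q x * exp (\<theta> * a x))"
    and lam: "0 < l" "l \<le> \<theta> / 2"
  defines "D \<equiv> (\<integral>x. L x * ln (L x / q x) \<partial>P) - (\<integral>x. L x \<partial>P) + (\<integral>x. q x \<partial>P)"
  shows "0 \<le> D"
    and "integrable P (\<lambda>x. a x * \<bar>L x - q x\<bar>)"
    and "(\<integral>x. a x * \<bar>L x - q x\<bar> \<partial>P) \<le> D / l + l * (4 / \<theta>\<^sup>2 * (\<integral>x. q x * exp (\<theta> * a x) \<partial>P))"
proof -
  have [measurable]: "L \<in> borel_measurable P" "q \<in> borel_measurable P" using L q by auto
  have th: "\<theta> > 0" using lam by simp
  define \<phi> where "\<phi> = (\<lambda>x. L x * ln (L x / q x) - L x + q x)"
  have phi_int: "integrable P \<phi>" unfolding \<phi>_def using L q ent by auto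
  have Dphi: "D = (\<integral>x. \<phi> x \<partial>P)" unfolding D_def \<phi>_def using L q ent by simp
  have phi_eq: "\<phi> x = q x * (L x / q x * ln (L x / q x) - L x / q x + 1)" for x
    using q(2)[of x] by (simp add: \<phi>_def field_simps)
  have young: "\<phi> x \<ge> s * (L x - q x) - q x * (exp s - 1 - s)" for s x
  proof -
    have "q x * (s * (L x / q x - 1) - (exp s - 1 - s)) \<le> \<phi> x"
      unfolding phi_eq using q(2)[of x] L(2)[of x] by (intro mult_left_mono entropy_young) auto
    moreover have "q x * (s * (L x / q x - 1) - (exp s - 1 - s)) = s * (L x - q x) - q x * (exp s - 1 - s)"
      using q(2)[of x] by (simp add: field_simps)
    ultimately show ?thesis by linarith
  qed
  show "0 \<le> D" unfolding Dphi using young[of 0] by (intro Bochner_Integration.integral_nonneg) simp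
  define B where "B = (\<lambda>x. \<phi> x / l + l * (4 / \<theta>\<^sup>2 * (q x * exp (\<theta> * a x))))"
  have B_int: "integrable P B" unfolding B_def using phi_int em by auto
  have pt: "a x * \<bar>L x - q x\<bar> \<le> B x" for x
  proof -
    define s where "s = l * a x * sgn (L x - q x)"
    have sabs: "\<bar>s\<bar> \<le> l * a x" using lam a[of x] by (auto simp: s_def abs_mult sgn_if)
    have s1: "s * (L x - q x) = l * (a x * \<bar>L x - q x\<bar>)" by (simp add: s_def abs_sgn algebra_simps)
    have "exp s - 1 - s \<le> s\<^sup>2 * exp \<bar>s\<bar> / 2" using exp_minus_linear_le[of s] by linarith
    also have "\<dots> \<le> (l * a x)\<^sup>2 * exp (\<theta> / 2 * a x) / 2"
    proof -
      have "\<bar>s\<bar> ^ 2 \<le> (l * a x)\<^sup>2" using sabs by (intro power_mono) auto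
      moreover have "\<bar>s\<bar> \<le> \<theta> / 2 * a x" using sabs mult_right_mono[OF lam(2) a[of x]] by simp
      ultimately show ?thesis by (intro divide_right_mono mult_mono) auto
    qed
    also have "\<dots> = l\<^sup>2 * (a x ^ 2 * exp (\<theta> / 2 * a x)) / 2" by (simp add: power_mult_distrib)
    also have "\<dots> \<le> l\<^sup>2 * ((fact 2 / (\<theta>/2) ^ 2 * exp (\<theta>/2 * a x)) * exp (\<theta> / 2 * a x)) / 2"
      using power_mult_exp_le[OF a[of x], of "\<theta>/2" 2] th
      by (intro divide_right_mono mult_left_mono mult_right_mono) auto
    also have "\<dots> = l\<^sup>2 * (4 / \<theta>\<^sup>2 * exp (\<theta> * a x))"
      by (simp add: power_divide mult_exp_exp fact_numeral mult.commute)
    finally have "q x * (exp s - 1 - s) \<le> q x * (l\<^sup>2 * (4 / \<theta>\<^sup>2 * exp (\<theta> * a x)))"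
      using q(2)[of x] by (intro mult_left_mono) auto
    with young[of s x] s1 have "l * (a x * \<bar>L x - q x\<bar>) \<le> \<phi> x + q x * (l\<^sup>2 * (4 / \<theta>\<^sup>2 * exp (\<theta> * a x)))"
      by simp
    also have "\<dots> = l * B x" using lam by (simp add: B_def field_simps power2_eq_square)
    finally show ?thesis using lam by simp
  qed
  show int: "integrable P (\<lambda>x. a x * \<bar>L x - q x\<bar>)"
  proof (rule Bochner_Integration.integrable_bound[OF B_int])
    show "AE x in P. norm (a x * \<bar>L x - q x\<bar>) \<le> norm (B x)"
    proof (intro AE_I2)
      fix x
      show "norm (a x * \<bar>L x - q x\<bar>) \<le> norm (B x)"
        using pt[of x] a[of x] by simp
    qed
  qed simp
  have "(\<integral>x. a x * \<bar>L x - q x\<bar> \<partial>P) \<le> (\<integral>x. B x \<partial>P)"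
    using int B_int pt by (intro integral_mono) auto
  also have "\<dots> = D / l + l * (4 / \<theta>\<^sup>2 * (\<integral>x. q x * exp (\<theta> * a x) \<partial>P))"
    unfolding B_def Dphi using phi_int em by simp
  finally show "(\<integral>x. a x * \<bar>L x - q x\<bar> \<partial>P) \<le> \<dots>" .
qed

section \<open>Exponential tilting\<close>

lemma integral_pair_product:
  fixes f h :: "'a \<Rightarrow> real"
  assumes "prob_space P" and f: "integrable P f" and h: "integrable P h"
  shows "integrable (P \<Otimes>\<^sub>M P) (\<lambda>(x, y). f x * h y)"
    and "(\<integral>(x, y). f x * h y \<partial>(P \<Otimes>\<^sub>M P)) = (\<integral>x. f x \<partial>P) * (\<integral>x. h x \<partial>P)"
proof -
  interpret prob_space P by fact
  interpret PP: pair_prob_space P P ..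
  have [measurable]: "f \<in> borel_measurable P" "h \<in> borel_measurable P" using f h by auto
  show int: "integrable (P \<Otimes>\<^sub>M P) (\<lambda>(x, y). f x * h y)"
    by (rule PP.Fubini_integrable) (use f h in \<open>auto simp: abs_mult\<close>)
  show "(\<integral>(x, y). f x * h y \<partial>(P \<Otimes>\<^sub>M P)) = (\<integral>x. f x \<partial>P) * (\<integral>x. h x \<partial>P)"
    using PP.integral_fst'[OF int] by simp
qed

definition bilinear_form :: "'a measure \<Rightarrow> ('a \<Rightarrow> 'a \<Rightarrow> real) \<Rightarrow> ('a \<Rightarrow> real) \<Rightarrow> ('a \<Rightarrow> real) \<Rightarrow> real" where
  "bilinear_form P K u v = (\<integral>(x, y). K x y * u x * v y \<partial>(P \<Otimes>\<^sub>M P))"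

text \<open>The product bound makes the form of \<open>K\<close> continuous with respect to the norm
\<open>\<integral>x. a x * \<bar>u x\<bar> \<partial>P\<close>, which is the one that the weighted Pinsker inequality controls.\<close>
locale weighted_kernel = prob_space P for P :: "'a measure" +
  fixes a :: "'a \<Rightarrow> real" and K :: "'a \<Rightarrow> 'a \<Rightarrow> real"
  assumes a_measurable [measurable]: "a \<in> borel_measurable P"
    and a_ge_1: "1 \<le> a x"
    and K_measurable [measurable]: "(\<lambda>(x, y). K x y) \<in> borel_measurable (P \<Otimes>\<^sub>M P)"
    and K_bound: "AE (x, y) in P \<Otimes>\<^sub>M P. \<bar>K x y\<bar> \<le> a x * a y"
begin

lemma a_nonneg: "0 \<le> a x" using a_ge_1[of x] by linarith

lemma bilinear_form_bound:
  assumes [measurable]: "u \<in> borel_measurable P" "v \<in> borel_measurable P"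
    and u: "integrable P (\<lambda>x. a x * \<bar>u x\<bar>)" and v: "integrable P (\<lambda>x. a x * \<bar>v x\<bar>)"
  shows "integrable (P \<Otimes>\<^sub>M P) (\<lambda>(x, y). K x y * u x * v y)"
    and "\<bar>bilinear_form P K u v\<bar> \<le> (\<integral>x. a x * \<bar>u x\<bar> \<partial>P) * (\<integral>x. a x * \<bar>v x\<bar> \<partial>P)"
proof -
  note prod = integral_pair_product[OF prob_space_axioms u v]
  have bd: "AE p in P \<Otimes>\<^sub>M P. norm (case p of (x, y) \<Rightarrow> K x y * u x * v y)
      \<le> (case p of (x, y) \<Rightarrow> (a x * \<bar>u x\<bar>) * (a y * \<bar>v y\<bar>))"
    using K_bound
  proof eventually_elim
    case (elim p)
    obtain x y where p: "p = (x, y)" by force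
    have "\<bar>K x y\<bar> * (\<bar>u x\<bar> * \<bar>v y\<bar>) \<le> (a x * a y) * (\<bar>u x\<bar> * \<bar>v y\<bar>)"
      using elim by (intro mult_right_mono) (auto simp: p)
    then show ?case by (simp add: p abs_mult mult_ac)
  qed
  show int: "integrable (P \<Otimes>\<^sub>M P) (\<lambda>(x, y). K x y * u x * v y)"
  proof (rule Bochner_Integration.integrable_bound[OF prod(1)])
    show "AE p in P \<Otimes>\<^sub>M P. norm (case p of (x, y) \<Rightarrow> K x y * u x * v y)
      \<le> norm (case p of (x, y) \<Rightarrow> (a x * \<bar>u x\<bar>) * (a y * \<bar>v y\<bar>))"
      using bd by eventually_elim auto
  qed measurable
  have "\<bar>bilinear_form P K u v\<bar> \<le> (\<integral>p. norm (case p of (x, y) \<Rightarrow> K x y * u x * v y) \<partial>(P \<Otimes>\<^sub>M P))"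
    unfolding bilinear_form_def using integral_norm_bound[of "P \<Otimes>\<^sub>M P" "\<lambda>(x, y). K x y * u x * v y"] by simp
  also have "\<dots> \<le> (\<integral>(x, y). (a x * \<bar>u x\<bar>) * (a y * \<bar>v y\<bar>) \<partial>(P \<Otimes>\<^sub>M P))"
    by (rule integral_mono_AE[OF integrable_norm[OF int] prod(1) bd])
  finally show "\<bar>bilinear_form P K u v\<bar> \<le> (\<integral>x. a x * \<bar>u x\<bar> \<partial>P) * (\<integral>x. a x * \<bar>v x\<bar> \<partial>P)"
    unfolding prod(2) .
qed

lemma bilinear_form_add:
  assumes [measurable]: "u \<in> borel_measurable P" "v \<in> borel_measurable P"
    and u: "integrable P (\<lambda>x. a x * \<bar>u x\<bar>)" and v: "integrable P (\<lambda>x. a x * \<bar>v x\<bar>)"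
  shows "bilinear_form P K (\<lambda>x. u x + v x) (\<lambda>x. u x + v x) =
     bilinear_form P K u u + bilinear_form P K u v + bilinear_form P K v u + bilinear_form P K v v"
proof -
  have "bilinear_form P K (\<lambda>x. u x + v x) (\<lambda>x. u x + v x) =
    (\<integral>p. ((case p of (x, y) \<Rightarrow> K x y * u x * u y) + (case p of (x, y) \<Rightarrow> K x y * u x * v y))
       + ((case p of (x, y) \<Rightarrow> K x y * v x * u y) + (case p of (x, y) \<Rightarrow> K x y * v x * v y)) \<partial>(P \<Otimes>\<^sub>M P))"
    unfolding bilinear_form_def by (intro Bochner_Integration.integral_cong) (auto simp: algebra_simps)
  then show ?thesis
    unfolding bilinear_form_def
    by (simp add: bilinear_form_bound(1)[of u u] bilinear_form_bound(1)[of u v]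
        bilinear_form_bound(1)[of v u] bilinear_form_bound(1)[of v v] u v)
qed

text \<open>The quadratic form is perturbed by \<open>v\<close> at most linearly in the weighted norm of \<open>v\<close>,
  with a coefficient proportional to the size of \<open>u\<close>.\<close>

lemma quadratic_form_perturbation:
  assumes [measurable]: "u \<in> borel_measurable P" "v \<in> borel_measurable P"
    and u: "integrable P (\<lambda>x. a x * \<bar>u x\<bar>)" and v: "integrable P (\<lambda>x. a x * \<bar>v x\<bar>)"
  shows "\<bar>bilinear_form P K (\<lambda>x. u x + v x) (\<lambda>x. u x + v x) - bilinear_form P K u u\<bar>
     \<le> 2 * (\<integral>x. a x * \<bar>u x\<bar> \<partial>P) * (\<integral>x. a x * \<bar>v x\<bar> \<partial>P) + (\<integral>x. a x * \<bar>v x\<bar> \<partial>P)\<^sup>2"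
  using bilinear_form_bound(2)[of u v] bilinear_form_bound(2)[of v u] bilinear_form_bound(2)[of v v]
  unfolding bilinear_form_add[OF assms] power2_eq_square
  by (simp add: u v mult.commute[of "\<integral>x. a x * \<bar>v x\<bar> \<partial>P" "\<integral>x. a x * \<bar>u x\<bar> \<partial>P"])

end

text \<open>One weight \<open>a\<close> dominates \<open>g\<close> and has an exponential moment.  All constants below
depend on \<open>a\<close> and \<open>\<theta>\<close> only, and not on the parameter of the tilting.\<close>
locale tilting = prob_space P for P :: "'a measure" +
  fixes a g :: "'a \<Rightarrow> real" and \<theta> :: real
  assumes a_measurable' [measurable]: "a \<in> borel_measurable P"
    and a_ge_1': "1 \<le> a x"
    and theta_pos: "0 < \<theta>"
    and exp_moment: "integrable P (\<lambda>x. exp (\<theta> * a x))"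
    and g_measurable [measurable]: "g \<in> borel_measurable P"
    and g_bound: "\<bar>g x\<bar> \<le> a x"
    and g_centred: "(\<integral>x. g x \<partial>P) = 0"
begin

lemma a_nonneg': "0 \<le> a x" using a_ge_1'[of x] by linarith

text \<open>The exponential factor makes room for the remainders of the Taylor expansions of
\<open>exp (\<beta> g)\<close> as long as \<open>\<beta> \<le> \<theta> / 2\<close>.\<close>
definition moment :: "nat \<Rightarrow> real" where
  "moment n = (\<integral>x. a x ^ n * exp (\<theta> / 2 * a x) \<partial>P)"

lemma moment_integrable: "integrable P (\<lambda>x. a x ^ n * exp (\<theta> / 2 * a x))"
proof (rule Bochner_Integration.integrable_bound)
  show "integrable P (\<lambda>x. fact n / (\<theta>/2) ^ n * exp (\<theta> * a x))" using exp_moment by simp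
  show "AE x in P. norm (a x ^ n * exp (\<theta> / 2 * a x)) \<le> norm (fact n / (\<theta>/2) ^ n * exp (\<theta> * a x))"
  proof (intro AE_I2)
    fix x
    have "a x ^ n * exp (\<theta> / 2 * a x) \<le> (fact n / (\<theta>/2) ^ n * exp (\<theta>/2 * a x)) * exp (\<theta> / 2 * a x)"
      using theta_pos a_nonneg' by (intro mult_right_mono power_mult_exp_le) auto
    also have "\<dots> = fact n / (\<theta>/2) ^ n * exp (\<theta> * a x)"
      by (simp add: mult_exp_exp mult.assoc)
    finally show "norm (a x ^ n * exp (\<theta> / 2 * a x)) \<le> norm (fact n / (\<theta>/2) ^ n * exp (\<theta> * a x))"
      using theta_pos a_nonneg'[of x] by (simp add: abs_mult)
  qed
qed measurable

lemma moment_nonneg: "0 \<le> moment n"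
  unfolding moment_def using a_nonneg' by (intro Bochner_Integration.integral_nonneg) auto

lemma moment_dominates:
  assumes [measurable]: "f \<in> borel_measurable P"
    and bd: "\<And>x. \<bar>f x\<bar> \<le> C * (a x ^ n * exp (\<theta> / 2 * a x))"
  shows "integrable P f" and "\<bar>\<integral>x. f x \<partial>P\<bar> \<le> C * moment n"
proof -
  have int: "integrable P (\<lambda>x. C * (a x ^ n * exp (\<theta> / 2 * a x)))"
    using moment_integrable by simp
  show f: "integrable P f"
    by (rule Bochner_Integration.integrable_bound[OF int])
      (use bd in \<open>auto intro!: AE_I2 order.trans[OF bd] simp del: abs_mult\<close>)
  have "\<bar>\<integral>x. f x \<partial>P\<bar> \<le> (\<integral>x. \<bar>f x\<bar> \<partial>P)" by (rule integral_abs_bound)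
  also have "\<dots> \<le> (\<integral>x. C * (a x ^ n * exp (\<theta> / 2 * a x)) \<partial>P)"
    using f int bd by (intro integral_mono) auto
  also have "\<dots> = C * moment n" by (simp add: moment_def)
  finally show "\<bar>\<integral>x. f x \<partial>P\<bar> \<le> C * moment n" .
qed

lemma power_le_moment: "a x ^ n \<le> a x ^ n * exp (\<theta> / 2 * a x)"
  using a_nonneg'[of x] theta_pos by (simp add: mult_le_cancel_left1)

lemma dominated_by_power:
  assumes [measurable]: "f \<in> borel_measurable P"
    and bd: "\<And>x. \<bar>f x\<bar> \<le> C * a x ^ n" and "0 \<le> C"
  shows "integrable P f" and "\<bar>\<integral>x. f x \<partial>P\<bar> \<le> C * moment n"
  using assms(3) by (intro moment_dominates[where C = C and n = n] order.trans[OF bd]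
      mult_left_mono power_le_moment; simp)+

lemma a_integrable: "integrable P a" and a_integral_le: "(\<integral>x. a x \<partial>P) \<le> moment 1"
  using dominated_by_power[of a 1 1] a_nonneg' by auto

lemma g_power_integrable: "integrable P (\<lambda>x. g x ^ n)"
  by (rule dominated_by_power[of _ 1 n]) (auto simp: power_abs intro!: power_mono g_bound)

lemma g_integrable: "integrable P g" using g_power_integrable[of 1] by simp

definition exp_remainder :: "nat \<Rightarrow> real \<Rightarrow> 'a \<Rightarrow> real" where
  "exp_remainder n \<beta> x = exp (\<beta> * g x) - (\<Sum>m<n. (\<beta> * g x) ^ m / fact m)"

lemma exp_remainder_measurable [measurable]: "exp_remainder n \<beta> \<in> borel_measurable P"
  unfolding exp_remainder_def by measurable

lemma exp_remainder_le:
  assumes "0 \<le> \<beta>" "\<beta> \<le> \<theta> / 2"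
  shows "\<bar>exp_remainder n \<beta> x\<bar> \<le> \<beta> ^ n * (a x ^ n * exp (\<theta> / 2 * a x))"
proof -
  have ab: "\<bar>\<beta> * g x\<bar> \<le> \<beta> * a x" using assms g_bound[of x] by (auto simp: abs_mult intro: mult_left_mono)
  have "\<bar>exp_remainder n \<beta> x\<bar> \<le> \<bar>\<beta> * g x\<bar> ^ n * exp \<bar>\<beta> * g x\<bar> / fact n"
    unfolding exp_remainder_def by (rule exp_taylor_remainder)
  also have "\<dots> \<le> \<bar>\<beta> * g x\<bar> ^ n * exp \<bar>\<beta> * g x\<bar> / 1"
    by (intro divide_left_mono) auto
  also have "\<dots> \<le> (\<beta> * a x) ^ n * exp (\<theta> / 2 * a x)"
  proof -
    have "\<beta> * a x \<le> \<theta> / 2 * a x" using assms a_nonneg'[of x] by (intro mult_right_mono)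
    then show ?thesis using ab by (auto intro!: mult_mono power_mono)
  qed
  finally show ?thesis by (simp add: power_mult_distrib)
qed

lemma exp_remainder_integral:
  assumes [measurable]: "f \<in> borel_measurable P" and f: "\<And>x. \<bar>f x\<bar> \<le> a x ^ j"
    and b: "0 \<le> \<beta>" "\<beta> \<le> \<theta> / 2"
  shows "integrable P (\<lambda>x. f x * exp_remainder n \<beta> x)"
    and "\<bar>\<integral>x. f x * exp_remainder n \<beta> x \<partial>P\<bar> \<le> \<beta> ^ n * moment (n + j)"
proof -
  have "\<bar>f x * exp_remainder n \<beta> x\<bar> \<le> \<beta> ^ n * (a x ^ (n + j) * exp (\<theta> / 2 * a x))" for x
  proof -
    have "\<bar>f x\<bar> * \<bar>exp_remainder n \<beta> x\<bar> \<le> a x ^ j * (\<beta> ^ n * (a x ^ n * exp (\<theta> / 2 * a x)))"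
      by (intro mult_mono f exp_remainder_le b) (auto simp: a_nonneg')
    then show ?thesis by (simp add: abs_mult power_add mult_ac)
  qed
  then show "integrable P (\<lambda>x. f x * exp_remainder n \<beta> x)"
    "\<bar>\<integral>x. f x * exp_remainder n \<beta> x \<partial>P\<bar> \<le> \<beta> ^ n * moment (n + j)"
    by (auto intro!: moment_dominates[where C = "\<beta> ^ n" and n = "n + j"])
qed

definition partition :: "real \<Rightarrow> real" where
  "partition \<beta> = (\<integral>x. exp (\<beta> * g x) \<partial>P)"

definition tilt :: "real \<Rightarrow> 'a \<Rightarrow> real" where
  "tilt \<beta> x = exp (\<beta> * g x) / partition \<beta>"

lemma tilt_measurable [measurable]: "tilt \<beta> \<in> borel_measurable P"
  unfolding tilt_def by measurable

context
  fixes \<beta> :: real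
  assumes b: "0 \<le> \<beta>" "\<beta> \<le> \<theta> / 2"
begin

lemma exp_g_integrable: "integrable P (\<lambda>x. exp (\<beta> * g x))"
  using exp_remainder_integral(1)[of "\<lambda>_. 1" 0 \<beta> 0] b by (simp add: exp_remainder_def)

lemma g_exp_g_integrable: "integrable P (\<lambda>x. g x * exp (\<beta> * g x))"
  using exp_remainder_integral(1)[of g 1 \<beta> 0] b g_bound by (simp add: exp_remainder_def)

lemma partition_ge_1: "1 \<le> partition \<beta>"
proof -
  have "(\<integral>x. 1 + \<beta> * g x \<partial>P) \<le> partition \<beta>"
    unfolding partition_def using exp_g_integrable g_integrable
    by (intro integral_mono) (auto simp: exp_ge_add_one_self)
  then show ?thesis using g_integrable g_centred by (simp add: prob_space)
qed

lemma partition_expansion: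
  "\<bar>partition \<beta> - 1 - (\<integral>x. g x ^ 2 \<partial>P) / 2 * \<beta>\<^sup>2 - (\<integral>x. g x ^ 3 \<partial>P) / 6 * \<beta> ^ 3\<bar> \<le> \<beta> ^ 4 * moment 4"
proof -
  have "(\<integral>x. 1 * exp_remainder 4 \<beta> x \<partial>P) =
     (\<integral>x. exp (\<beta> * g x) - (1 + \<beta> * g x + \<beta>\<^sup>2 / 2 * g x ^ 2 + \<beta> ^ 3 / 6 * g x ^ 3) \<partial>P)"
    by (intro Bochner_Integration.integral_cong)
      (auto simp: exp_remainder_def eval_nat_numeral lessThan_Suc algebra_simps)
  also have "\<dots> = partition \<beta> - 1 - (\<integral>x. g x ^ 2 \<partial>P) / 2 * \<beta>\<^sup>2 - (\<integral>x. g x ^ 3 \<partial>P) / 6 * \<beta> ^ 3"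
    using exp_g_integrable g_power_integrable[of 2] g_power_integrable[of 3] g_integrable g_centred
    by (simp add: partition_def prob_space mult.commute)
  finally show ?thesis using exp_remainder_integral(2)[of "\<lambda>_. 1" 0 \<beta> 4] b by simp
qed

lemma partition_minus_1_le: "partition \<beta> - 1 \<le> \<beta>\<^sup>2 * moment 2"
proof -
  have "(\<integral>x. 1 * exp_remainder 2 \<beta> x \<partial>P) = (\<integral>x. exp (\<beta> * g x) - (1 + \<beta> * g x) \<partial>P)"
    by (intro Bochner_Integration.integral_cong)
      (auto simp: exp_remainder_def eval_nat_numeral lessThan_Suc algebra_simps)
  also have "\<dots> = partition \<beta> - 1"
    using exp_g_integrable g_integrable g_centred by (simp add: partition_def prob_space)
  finally show ?thesis using exp_remainder_integral(2)[of "\<lambda>_. 1" 0 \<beta> 2] b by simp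
qed

lemma partition_derivative_expansion:
  "\<bar>(\<integral>x. g x * exp (\<beta> * g x) \<partial>P) - (\<integral>x. g x ^ 2 \<partial>P) * \<beta> - (\<integral>x. g x ^ 3 \<partial>P) / 2 * \<beta>\<^sup>2\<bar> \<le> \<beta> ^ 3 * moment 4"
proof -
  have "(\<integral>x. g x * exp_remainder 3 \<beta> x \<partial>P) =
     (\<integral>x. g x * exp (\<beta> * g x) - (g x + \<beta> * g x ^ 2 + \<beta>\<^sup>2 / 2 * g x ^ 3) \<partial>P)"
    by (intro Bochner_Integration.integral_cong)
      (auto simp: exp_remainder_def eval_nat_numeral lessThan_Suc algebra_simps)
  also have "\<dots> = (\<integral>x. g x * exp (\<beta> * g x) \<partial>P) - (\<integral>x. g x ^ 2 \<partial>P) * \<beta> - (\<integral>x. g x ^ 3 \<partial>P) / 2 * \<beta>\<^sup>2"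
    using g_exp_g_integrable g_power_integrable[of 2] g_power_integrable[of 3] g_integrable g_centred
    by simp
  finally show ?thesis using exp_remainder_integral(2)[of g 1 \<beta> 3] b g_bound by simp
qed

lemma partition_derivative_le: "\<bar>\<integral>x. g x * exp (\<beta> * g x) \<partial>P\<bar> \<le> \<beta> * moment 2"
proof -
  have "(\<integral>x. g x * exp_remainder 1 \<beta> x \<partial>P) = (\<integral>x. g x * exp (\<beta> * g x) - g x \<partial>P)"
    by (intro Bochner_Integration.integral_cong) (auto simp: exp_remainder_def algebra_simps)
  also have "\<dots> = (\<integral>x. g x * exp (\<beta> * g x) \<partial>P)"
    using g_exp_g_integrable g_integrable g_centred by simp
  finally show ?thesis using exp_remainder_integral(2)[of g 1 \<beta> 1] b g_bound by (simp add: numeral_2_eq_2)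
qed

lemma tilt_pos: "0 < tilt \<beta> x"
  using partition_ge_1 by (simp add: tilt_def)

lemma tilt_integrable: "integrable P (tilt \<beta>)"
  unfolding tilt_def using exp_g_integrable by simp

lemma tilt_integral: "(\<integral>x. tilt \<beta> x \<partial>P) = 1"
  unfolding tilt_def using partition_ge_1 by (simp add: partition_def)

lemma inverse_partition: "0 \<le> 1 - 1 / partition \<beta>" "1 - 1 / partition \<beta> \<le> \<beta>\<^sup>2 * moment 2"
proof -
  show "0 \<le> 1 - 1 / partition \<beta>" using partition_ge_1 by simp
  have "1 - 1 / partition \<beta> = (partition \<beta> - 1) / partition \<beta>"
    using partition_ge_1 by (simp add: field_simps)
  also have "\<dots> \<le> (partition \<beta> - 1) / 1" using partition_ge_1 by (intro divide_left_mono) auto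
  finally show "1 - 1 / partition \<beta> \<le> \<beta>\<^sup>2 * moment 2" using partition_minus_1_le by simp
qed

text \<open>To first order the tilted density is \<open>1 + \<beta> g\<close>.  The two parts of the error are the second
order Taylor remainder of the exponential and the deviation of the normalization from \<open>1\<close>, which
is of second order because \<open>g\<close> is centred.\<close>

lemma tilt_first_order:
  "integrable P (\<lambda>x. a x * \<bar>tilt \<beta> x - 1 - \<beta> * g x\<bar>)"
  "(\<integral>x. a x * \<bar>tilt \<beta> x - 1 - \<beta> * g x\<bar> \<partial>P) \<le> \<beta>\<^sup>2 * (moment 3 + moment 2 * (moment 1 + \<beta> * moment 2))"
proof -
  let ?B = "\<lambda>x. \<beta>\<^sup>2 * (a x ^ 3 * exp (\<theta> / 2 * a x)) + (\<beta>\<^sup>2 * moment 2) * (a x + \<beta> * a x ^ 2)"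
  have pt: "a x * \<bar>tilt \<beta> x - 1 - \<beta> * g x\<bar> \<le> ?B x" for x
  proof -
    have e: "tilt \<beta> x - 1 - \<beta> * g x = exp_remainder 2 \<beta> x / partition \<beta> - (1 + \<beta> * g x) * (1 - 1 / partition \<beta>)"
      using partition_ge_1
      by (simp add: tilt_def exp_remainder_def eval_nat_numeral lessThan_Suc field_simps)
    have "\<bar>exp_remainder 2 \<beta> x\<bar> / partition \<beta> \<le> \<bar>exp_remainder 2 \<beta> x\<bar> / 1"
      using partition_ge_1 by (intro divide_left_mono) auto
    then have 1: "\<bar>exp_remainder 2 \<beta> x / partition \<beta>\<bar> \<le> \<beta>\<^sup>2 * (a x ^ 2 * exp (\<theta> / 2 * a x))"
      using exp_remainder_le[OF b, of 2 x] partition_ge_1 by simp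
    have "\<bar>\<beta> * g x\<bar> \<le> \<beta> * a x" using g_bound[of x] b by (simp add: abs_mult mult_left_mono)
    then have "\<bar>1 + \<beta> * g x\<bar> \<le> 1 + \<beta> * a x" by linarith
    then have "\<bar>(1 + \<beta> * g x) * (1 - 1 / partition \<beta>)\<bar> \<le> (1 + \<beta> * a x) * (\<beta>\<^sup>2 * moment 2)"
      unfolding abs_mult using inverse_partition b(1) a_nonneg'[of x] by (intro mult_mono) auto
    with 1 have "\<bar>tilt \<beta> x - 1 - \<beta> * g x\<bar> \<le> \<beta>\<^sup>2 * (a x ^ 2 * exp (\<theta> / 2 * a x)) + (1 + \<beta> * a x) * (\<beta>\<^sup>2 * moment 2)"
      unfolding e by linarith
    then have "a x * \<bar>tilt \<beta> x - 1 - \<beta> * g x\<bar>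
       \<le> a x * (\<beta>\<^sup>2 * (a x ^ 2 * exp (\<theta> / 2 * a x)) + (1 + \<beta> * a x) * (\<beta>\<^sup>2 * moment 2))"
      by (intro mult_left_mono) (auto simp: a_nonneg')
    also have "\<dots> = ?B x" by (simp add: eval_nat_numeral algebra_simps)
    finally show ?thesis .
  qed
  have a2: "integrable P (\<lambda>x. a x ^ 2)" "(\<integral>x. a x ^ 2 \<partial>P) \<le> moment 2"
    using dominated_by_power[of "\<lambda>x. a x ^ 2" 1 2] a_nonneg' by auto
  have Bint: "integrable P ?B" using moment_integrable a_integrable a2 by simp
  show int: "integrable P (\<lambda>x. a x * \<bar>tilt \<beta> x - 1 - \<beta> * g x\<bar>)"
  proof (rule Bochner_Integration.integrable_bound[OF Bint])
    show "AE x in P. norm (a x * \<bar>tilt \<beta> x - 1 - \<beta> * g x\<bar>) \<le> norm (?B x)"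
    proof (intro AE_I2)
      fix x
      have "0 \<le> a x * \<bar>tilt \<beta> x - 1 - \<beta> * g x\<bar>" using a_nonneg' by simp
      then show "norm (a x * \<bar>tilt \<beta> x - 1 - \<beta> * g x\<bar>) \<le> norm (?B x)"
        using pt[of x] unfolding real_norm_def by linarith
    qed
  qed measurable
  have "(\<integral>x. a x * \<bar>tilt \<beta> x - 1 - \<beta> * g x\<bar> \<partial>P) \<le> (\<integral>x. ?B x \<partial>P)"
    using int Bint pt by (intro integral_mono)
  also have "\<dots> = \<beta>\<^sup>2 * moment 3 + (\<beta>\<^sup>2 * moment 2) * ((\<integral>x. a x \<partial>P) + \<beta> * (\<integral>x. a x ^ 2 \<partial>P))"
    using moment_integrable a_integrable a2 by (simp add: moment_def)
  also have "\<dots> \<le> \<beta>\<^sup>2 * moment 3 + (\<beta>\<^sup>2 * moment 2) * (moment 1 + \<beta> * moment 2)"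
    using a_integral_le a2 b moment_nonneg
    by (intro add_left_mono mult_left_mono add_mono) auto
  finally show "(\<integral>x. a x * \<bar>tilt \<beta> x - 1 - \<beta> * g x\<bar> \<partial>P) \<le> \<beta>\<^sup>2 * (moment 3 + moment 2 * (moment 1 + \<beta> * moment 2))"
    by (simp add: algebra_simps)
qed

end

end

section \<open>The quadratic problem over an entropy ball\<close>

text \<open>The densities of the members of a divergence ball.  The value of \<open>ln\<close> at \<open>0\<close> does not
matter because of the factor \<open>L x\<close>.\<close>
definition entropy_ball_density :: "'a measure \<Rightarrow> real \<Rightarrow> ('a \<Rightarrow> real) \<Rightarrow> bool" where
  "entropy_ball_density P \<eta> L \<longleftrightarrow> L \<in> borel_measurable P \<and> (\<forall>x. 0 \<le> L x) \<and> integrable P L \<and>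
     (\<integral>x. L x \<partial>P) = 1 \<and> integrable P (\<lambda>x. L x * ln (L x)) \<and> (\<integral>x. L x * ln (L x) \<partial>P) \<le> \<eta>"

lemma eventually_linear_le:
  fixes c d :: real
  assumes "0 < d"
  shows "\<forall>\<^sub>F \<beta> in at_right 0. c * \<beta> \<le> d"
proof -
  have "((\<lambda>\<beta>. c * \<beta>) \<longlongrightarrow> c * 0) (at_right 0)" by (intro tendsto_intros)
  then have "\<forall>\<^sub>F \<beta> in at_right 0. c * \<beta> < d" using assms by (intro order_tendstoD(2)) auto
  then show ?thesis by eventually_elim simp
qed

lemma eventually_id_le:
  fixes d :: real
  assumes "0 < d"
  shows "\<forall>\<^sub>F \<beta> in at_right 0. \<beta> \<le> d"
  using eventually_linear_le[OF assms, of 1] by simp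

lemma eventually_pos: "\<forall>\<^sub>F \<beta> in at_right (0::real). 0 < \<beta>"
  by (simp add: eventually_at_filter)

text \<open>The weighted Pinsker inequality with respect to the reference measure itself, at
\<open>l = sqrt \<eta>\<close>: the whole ball is small in the weighted norm.\<close>
lemma entropy_ball_distance:
  assumes "prob_space P" and L: "entropy_ball_density P \<eta> L"
    and [measurable]: "a \<in> borel_measurable P" and a: "\<And>x. 0 \<le> a x"
    and em: "integrable P (\<lambda>x. exp (\<theta> * a x))"
    and eta: "0 < \<eta>" "sqrt \<eta> \<le> \<theta> / 2"
  shows "integrable P (\<lambda>x. a x * \<bar>L x - 1\<bar>)"
    and "(\<integral>x. a x * \<bar>L x - 1\<bar> \<partial>P) \<le> (1 + 4 / \<theta>\<^sup>2 * (\<integral>x. exp (\<theta> * a x) \<partial>P)) * sqrt \<eta>"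
proof -
  interpret prob_space P by fact
  have L': "integrable P L" "\<And>x. 0 \<le> L x" "integrable P (\<lambda>x. L x * ln (L x))"
    "(\<integral>x. L x \<partial>P) = 1" "(\<integral>x. L x * ln (L x) \<partial>P) \<le> \<eta>"
    using L by (auto simp: entropy_ball_density_def)
  note w = weighted_entropy_bound[of a P L "\<lambda>_. 1" \<theta> "sqrt \<eta>", OF _ L'(1,2) _ _ a]
  show "integrable P (\<lambda>x. a x * \<bar>L x - 1\<bar>)" using w(2) L' em eta by simp
  have "(\<integral>x. a x * \<bar>L x - 1\<bar> \<partial>P) \<le> (\<integral>x. L x * ln (L x) \<partial>P) / sqrt \<eta>
     + sqrt \<eta> * (4 / \<theta>\<^sup>2 * (\<integral>x. exp (\<theta> * a x) \<partial>P))"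
    using w(3) L' em eta by (simp add: prob_space)
  also have "(\<integral>x. L x * ln (L x) \<partial>P) / sqrt \<eta> \<le> \<eta> / sqrt \<eta>"
    using L' eta by (intro divide_right_mono) auto
  also have "\<eta> / sqrt \<eta> = sqrt \<eta>" using eta by (simp add: real_div_sqrt)
  finally show "(\<integral>x. a x * \<bar>L x - 1\<bar> \<partial>P) \<le> (1 + 4 / \<theta>\<^sup>2 * (\<integral>x. exp (\<theta> * a x) \<partial>P)) * sqrt \<eta>"
    by (simp add: algebra_simps)
qed

text \<open>The static problem: a linear functional and a quadratic form are maximized over the
densities of entropy at most \<open>\<eta>\<close>.  With \<open>\<eta> = V / 2 * \<beta>\<^sup>2\<close> the maximizer is close to the density tilted by
\<open>\<beta> g\<close>, and expansions in \<open>sqrt \<eta>\<close> become expansions in \<open>\<beta>\<close>.\<close>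
locale entropic_problem = tilting P a g \<theta> + weighted_kernel P a K
  for P :: "'a measure" and a g \<theta> K +
  assumes variance_pos: "0 < (\<integral>x. g x ^ 2 \<partial>P)"
begin

abbreviation "V \<equiv> (\<integral>x. g x ^ 2 \<partial>P)"
abbreviation "\<kappa> \<equiv> (\<integral>x. g x ^ 3 \<partial>P)"
abbreviation "\<nu> \<equiv> bilinear_form P K g g"

definition quadratic_value :: "('a \<Rightarrow> real) \<Rightarrow> real" where
  "quadratic_value L = (\<integral>x. g x * (L x - 1) \<partial>P) + bilinear_form P K (\<lambda>x. L x - 1) (\<lambda>x. L x - 1) / 2"

definition exp_mass :: real where "exp_mass = (\<integral>x. exp (\<theta> * a x) \<partial>P)"

lemma exp_mass_nonneg: "0 \<le> exp_mass" unfolding exp_mass_def by (intro Bochner_Integration.integral_nonneg) simp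

definition tilt_const :: real where "tilt_const = moment 3 + moment 2 * (moment 1 + moment 2)"

lemma tilt_const_nonneg: "0 \<le> tilt_const" unfolding tilt_const_def using moment_nonneg by (intro add_nonneg_nonneg mult_nonneg_nonneg)

lemma a_g_integrable: "integrable P (\<lambda>x. a x * \<bar>g x\<bar>)" "(\<integral>x. a x * \<bar>g x\<bar> \<partial>P) \<le> moment 2"
proof -
  have "\<bar>a x * \<bar>g x\<bar>\<bar> \<le> 1 * a x ^ 2" for x
    using g_bound[of x] a_nonneg'[of x] by (simp add: abs_mult power2_eq_square mult_left_mono)
  from dominated_by_power[OF _ this]
  show "integrable P (\<lambda>x. a x * \<bar>g x\<bar>)" "(\<integral>x. a x * \<bar>g x\<bar> \<partial>P) \<le> moment 2"
    using a_measurable g_measurable by auto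
qed

context
  fixes \<beta> :: real
  assumes b: "0 \<le> \<beta>" "\<beta> \<le> \<theta> / 2" "\<beta> \<le> 1"
begin

lemma tilt_remainder:
  "integrable P (\<lambda>x. a x * \<bar>tilt \<beta> x - 1 - \<beta> * g x\<bar>)"
  "(\<integral>x. a x * \<bar>tilt \<beta> x - 1 - \<beta> * g x\<bar> \<partial>P) \<le> tilt_const * \<beta>\<^sup>2"
proof -
  show "integrable P (\<lambda>x. a x * \<bar>tilt \<beta> x - 1 - \<beta> * g x\<bar>)" using b by (intro tilt_first_order)
  have "(\<integral>x. a x * \<bar>tilt \<beta> x - 1 - \<beta> * g x\<bar> \<partial>P) \<le> \<beta>\<^sup>2 * (moment 3 + moment 2 * (moment 1 + \<beta> * moment 2))"
    using b by (intro tilt_first_order)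
  also have "\<dots> \<le> \<beta>\<^sup>2 * (moment 3 + moment 2 * (moment 1 + 1 * moment 2))"
    using b moment_nonneg by (intro mult_left_mono add_left_mono mult_right_mono) auto
  finally show "(\<integral>x. a x * \<bar>tilt \<beta> x - 1 - \<beta> * g x\<bar> \<partial>P) \<le> tilt_const * \<beta>\<^sup>2" by (simp add: tilt_const_def mult.commute)
qed

lemma tilt_distance:
  "integrable P (\<lambda>x. a x * \<bar>tilt \<beta> x - 1\<bar>)"
  "(\<integral>x. a x * \<bar>tilt \<beta> x - 1\<bar> \<partial>P) \<le> (tilt_const + moment 2) * \<beta>"
proof -
  let ?B = "\<lambda>x. a x * \<bar>tilt \<beta> x - 1 - \<beta> * g x\<bar> + \<beta> * (a x * \<bar>g x\<bar>)"
  have Bint: "integrable P ?B" using tilt_remainder a_g_integrable by simp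
  have pt: "a x * \<bar>tilt \<beta> x - 1\<bar> \<le> ?B x" for x
  proof -
    have "\<bar>tilt \<beta> x - 1\<bar> \<le> \<bar>tilt \<beta> x - 1 - \<beta> * g x\<bar> + \<bar>\<beta> * g x\<bar>" by linarith
    then have "a x * \<bar>tilt \<beta> x - 1\<bar> \<le> a x * (\<bar>tilt \<beta> x - 1 - \<beta> * g x\<bar> + \<bar>\<beta> * g x\<bar>)"
      by (intro mult_left_mono) (auto simp: a_nonneg)
    then show ?thesis using b by (simp add: abs_mult algebra_simps)
  qed
  show int: "integrable P (\<lambda>x. a x * \<bar>tilt \<beta> x - 1\<bar>)"
  proof (rule Bochner_Integration.integrable_bound[OF Bint])
    show "AE x in P. norm (a x * \<bar>tilt \<beta> x - 1\<bar>) \<le> norm (?B x)"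
    proof (intro AE_I2)
      fix x
      have "0 \<le> a x * \<bar>tilt \<beta> x - 1\<bar>" using a_nonneg by simp
      then show "norm (a x * \<bar>tilt \<beta> x - 1\<bar>) \<le> norm (?B x)"
        using pt[of x] unfolding real_norm_def by linarith
    qed
  qed measurable
  have "(\<integral>x. a x * \<bar>tilt \<beta> x - 1\<bar> \<partial>P) \<le> (\<integral>x. ?B x \<partial>P)"
    using int Bint pt by (intro integral_mono)
  also have "\<dots> \<le> tilt_const * \<beta>\<^sup>2 + \<beta> * moment 2"
    using tilt_remainder a_g_integrable b by (simp add: add_mono mult_left_mono)
  also have "tilt_const * \<beta>\<^sup>2 \<le> tilt_const * \<beta>" using b tilt_const_nonneg by (intro mult_left_mono) (auto simp: power2_eq_square mult_left_le)
  finally show "(\<integral>x. a x * \<bar>tilt \<beta> x - 1\<bar> \<partial>P) \<le> (tilt_const + moment 2) * \<beta>"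
    by (simp add: algebra_simps)
qed

lemma tilt_quadratic_form:
  "\<bar>bilinear_form P K (\<lambda>x. tilt \<beta> x - 1) (\<lambda>x. tilt \<beta> x - 1) - \<nu> * \<beta>\<^sup>2\<bar> \<le> (2 * moment 2 * tilt_const + tilt_const\<^sup>2) * \<beta> ^ 3"
proof -
  let ?u = "\<lambda>x. \<beta> * g x" and ?v = "\<lambda>x. tilt \<beta> x - 1 - \<beta> * g x"
  have u: "integrable P (\<lambda>x. a x * \<bar>?u x\<bar>)" "(\<integral>x. a x * \<bar>?u x\<bar> \<partial>P) \<le> \<beta> * moment 2"
    using a_g_integrable b by (auto simp: abs_mult mult.left_commute mult_left_mono)
  have eq: "bilinear_form P K ?u ?u = \<nu> * \<beta>\<^sup>2"
  proof -
    have "bilinear_form P K ?u ?u = (\<integral>p. \<beta>\<^sup>2 * (case p of (x, y) \<Rightarrow> K x y * g x * g y) \<partial>(P \<Otimes>\<^sub>M P))"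
      unfolding bilinear_form_def
      by (intro Bochner_Integration.integral_cong) (auto simp: power2_eq_square algebra_simps)
    then show ?thesis by (simp add: bilinear_form_def mult.commute)
  qed
  have nn: "0 \<le> (\<integral>x. a x * \<bar>?v x\<bar> \<partial>P)" "0 \<le> (\<integral>x. a x * \<bar>?u x\<bar> \<partial>P)"
    using a_nonneg by (auto intro!: Bochner_Integration.integral_nonneg)
  have "\<bar>bilinear_form P K (\<lambda>x. ?u x + ?v x) (\<lambda>x. ?u x + ?v x) - bilinear_form P K ?u ?u\<bar>
     \<le> 2 * (\<integral>x. a x * \<bar>?u x\<bar> \<partial>P) * (\<integral>x. a x * \<bar>?v x\<bar> \<partial>P) + (\<integral>x. a x * \<bar>?v x\<bar> \<partial>P)\<^sup>2"
    by (intro quadratic_form_perturbation u tilt_remainder) simp_all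
  also have "\<dots> \<le> 2 * (\<beta> * moment 2) * (tilt_const * \<beta>\<^sup>2) + (tilt_const * \<beta>\<^sup>2)\<^sup>2"
    using u tilt_remainder nn b moment_nonneg by (intro add_mono mult_mono power_mono) auto
  also have "\<dots> = 2 * moment 2 * tilt_const * \<beta> ^ 3 + tilt_const\<^sup>2 * (\<beta> ^ 3 * \<beta>)"
    by (simp add: eval_nat_numeral)
  also have "\<dots> \<le> 2 * moment 2 * tilt_const * \<beta> ^ 3 + tilt_const\<^sup>2 * (\<beta> ^ 3 * 1)"
    using b by (intro add_left_mono mult_left_mono) auto
  finally show ?thesis unfolding eq by (simp add: algebra_simps)
qed

text \<open>The exact form of the Gibbs variational principle: the deficit in the linear objective
  is the divergence from the tilted law, and this divergence controls the weighted distance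
  to the tilted density.\<close>

lemma gibbs_variational_gap:
  assumes L: "entropy_ball_density P \<eta> L" and eta: "0 < \<eta>" "sqrt \<eta> \<le> \<theta> / 2"
  defines "D \<equiv> (\<integral>x. L x * ln (L x) \<partial>P) - \<beta> * (\<integral>x. g x * L x \<partial>P) + ln (partition \<beta>)"
  shows "integrable P (\<lambda>x. g x * L x)"
    and "0 \<le> D"
    and "integrable P (\<lambda>x. a x * \<bar>L x - tilt \<beta> x\<bar>)"
    and "\<And>l. 0 < l \<Longrightarrow> l \<le> \<theta> / 4 \<Longrightarrow> (\<integral>x. a x * \<bar>L x - tilt \<beta> x\<bar> \<partial>P) \<le> D / l + l * (16 / \<theta>\<^sup>2 * exp_mass)"
proof -
  have L': "integrable P L" "\<And>x. 0 \<le> L x" "integrable P (\<lambda>x. L x * ln (L x))"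
    "(\<integral>x. L x \<partial>P) = 1" "(\<integral>x. L x * ln (L x) \<partial>P) \<le> \<eta>"
    using L by (auto simp: entropy_ball_density_def)
  have [measurable]: "L \<in> borel_measurable P" using L' by auto
  have Lm: "integrable P (\<lambda>x. a x * \<bar>L x - 1\<bar>)"
    by (rule entropy_ball_distance(1)[OF prob_space_axioms L a_measurable a_nonneg exp_moment eta])
  show gL: "integrable P (\<lambda>x. g x * L x)"
  proof (rule Bochner_Integration.integrable_bound)
    show "integrable P (\<lambda>x. a x * \<bar>L x - 1\<bar> + a x)" using Lm a_integrable by simp
    show "AE x in P. norm (g x * L x) \<le> norm (a x * \<bar>L x - 1\<bar> + a x)"
    proof (intro AE_I2)
      fix x
      have "\<bar>g x\<bar> * \<bar>L x\<bar> \<le> a x * (\<bar>L x - 1\<bar> + 1)"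
        using g_bound[of x] a_nonneg[of x] by (intro mult_mono) auto
      then show "norm (g x * L x) \<le> norm (a x * \<bar>L x - 1\<bar> + a x)"
        using a_nonneg[of x] by (simp add: abs_mult algebra_simps)
    qed
  qed measurable
  note tp = tilt_pos[OF b(1,2)]
  have Z: "1 \<le> partition \<beta>" using b by (intro partition_ge_1)
  have ln_eq: "L x * ln (L x / tilt \<beta> x) = L x * ln (L x) - \<beta> * (g x * L x) + ln (partition \<beta>) * L x" for x
  proof (cases "L x = 0")
    case False
    then have "L x > 0" using L'(2)[of x] by simp
    then have "ln (L x / tilt \<beta> x) = ln (L x) - \<beta> * g x + ln (partition \<beta>)"
      using Z by (simp add: tilt_def ln_div ln_mult)
    then show ?thesis by (simp only:) (simp add: algebra_simps)
  qed simp
  have ent: "integrable P (\<lambda>x. L x * ln (L x / tilt \<beta> x))" unfolding ln_eq using L' gL by simp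
  have D: "D = (\<integral>x. L x * ln (L x / tilt \<beta> x) \<partial>P) - (\<integral>x. L x \<partial>P) + (\<integral>x. tilt \<beta> x \<partial>P)"
    unfolding ln_eq using L' gL tilt_integral[OF b(1,2)] by (simp add: D_def)
  have em_le: "tilt \<beta> x * exp (\<theta> / 2 * a x) \<le> exp (\<theta> * a x)" for x
  proof -
    have "\<beta> * g x \<le> \<theta> / 2 * a x"
      using b g_bound[of x] a_nonneg[of x] by (intro order.trans[OF mult_left_mono[of "g x" "a x"] mult_right_mono]) auto
    then have "exp (\<beta> * g x) * exp (\<theta> / 2 * a x) \<le> exp (\<theta> / 2 * a x) * exp (\<theta> / 2 * a x)"
      by (intro mult_right_mono) auto
    also have "\<dots> = exp (\<theta> * a x)" by (simp add: mult_exp_exp)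
    finally have 1: "exp (\<beta> * g x) * exp (\<theta> / 2 * a x) \<le> exp (\<theta> * a x)" .
    have "tilt \<beta> x \<le> exp (\<beta> * g x) / 1" unfolding tilt_def using Z by (intro divide_left_mono) auto
    then have "tilt \<beta> x * exp (\<theta> / 2 * a x) \<le> exp (\<beta> * g x) * exp (\<theta> / 2 * a x)"
      by (intro mult_right_mono) auto
    with 1 show ?thesis by linarith
  qed
  have em: "integrable P (\<lambda>x. tilt \<beta> x * exp (\<theta> / 2 * a x))"
  proof (rule Bochner_Integration.integrable_bound[OF exp_moment])
    show "AE x in P. norm (tilt \<beta> x * exp (\<theta> / 2 * a x)) \<le> norm (exp (\<theta> * a x))"
      using em_le tp by (intro AE_I2) (simp add: abs_mult order.strict_implies_order)
  qed measurable
  have em_int: "(\<integral>x. tilt \<beta> x * exp (\<theta> / 2 * a x) \<partial>P) \<le> exp_mass"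
    unfolding exp_mass_def using em exp_moment em_le by (intro integral_mono)
  note w = weighted_entropy_bound[of a P L "tilt \<beta>" "\<theta> / 2", OF a_measurable L'(1,2)
      tilt_integrable[OF b(1,2)] tp a_nonneg ent em, folded D]
  show "0 \<le> D" "integrable P (\<lambda>x. a x * \<bar>L x - tilt \<beta> x\<bar>)"
    using w(1,2)[of "\<theta> / 4"] theta_pos by auto
  fix l assume l: "0 < l" "l \<le> \<theta> / 4"
  have "(\<integral>x. a x * \<bar>L x - tilt \<beta> x\<bar> \<partial>P) \<le> D / l + l * (4 / (\<theta>/2)\<^sup>2 * (\<integral>x. tilt \<beta> x * exp (\<theta> / 2 * a x) \<partial>P))"
    using w(3)[of l] l by simp
  also have "\<dots> \<le> D / l + l * (4 / (\<theta>/2)\<^sup>2 * exp_mass)"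
    using l em_int by (intro add_left_mono mult_left_mono) auto
  finally show "(\<integral>x. a x * \<bar>L x - tilt \<beta> x\<bar> \<partial>P) \<le> D / l + l * (16 / \<theta>\<^sup>2 * exp_mass)"
    by (simp add: power_divide)
qed

end

text \<open>The optimal \<open>l\<close> is \<open>sqrt D\<close>; if \<open>D = 0\<close> one lets \<open>l\<close> tend to \<open>0\<close> instead.\<close>
lemma distance_le_sqrt_gap:
  fixes \<rho> D c l0 :: real
  assumes "\<And>l. 0 < l \<Longrightarrow> l \<le> l0 \<Longrightarrow> \<rho> \<le> D / l + l * c" and "0 \<le> D" "sqrt D \<le> l0" "0 < l0" "0 \<le> c"
  shows "\<rho> \<le> (1 + c) * sqrt D"
proof (cases "D = 0")
  case True
  have "\<rho> \<le> 0 + e" if "e > 0" for e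
  proof -
    define l where "l = min l0 (e / (c + 1))"
    have l: "0 < l" "l \<le> l0" using assms that by (auto simp: l_def)
    have "l * c \<le> e / (c + 1) * (c + 1)" using assms that by (intro mult_mono) (auto simp: l_def)
    then have "l * c \<le> e" using assms by simp
    then show ?thesis using assms(1)[OF l] True by simp
  qed
  then have "\<rho> \<le> 0" by (rule field_le_epsilon)
  then show ?thesis using True by simp
next
  case False
  with assms have "0 < sqrt D" by simp
  from assms(1)[OF this assms(3)] have "\<rho> \<le> D / sqrt D + sqrt D * c" .
  then show ?thesis using assms(2) by (simp add: real_div_sqrt algebra_simps)
qed

text \<open>Let \<open>D\<close> be the divergence of \<open>L\<close> from the density tilted by \<open>\<beta> g\<close>.  The variational principle
bounds the linear part by \<open>(\<eta> + ln (partition \<beta>)) / \<beta> - D / \<beta>\<close>, where \<open>\<eta> = V / 2 * \<beta>\<^sup>2\<close>.  In the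
quadratic part, passing from \<open>L\<close> to the tilted density costs at most a multiple of
\<open>\<beta> * sqrt D + D\<close>.  The gain \<open>D / \<beta>\<close> absorbs \<open>D\<close>, and it beats \<open>\<beta> * sqrt D\<close> up to a multiple of \<open>\<beta> ^ 3\<close>.\<close>
lemma quadratic_value_upper:
  "\<exists>C. \<forall>\<^sub>F \<beta> in at_right 0. \<forall>L. entropy_ball_density P (V / 2 * \<beta>\<^sup>2) L \<longrightarrow>
     quadratic_value L \<le> V * \<beta> + (\<kappa> / 6 + \<nu> / 2) * \<beta>\<^sup>2 + C * \<beta> ^ 3"
proof -
  define c0 where "c0 = 1 + 4 / \<theta>\<^sup>2 * exp_mass"
  define c3 where "c3 = 1 + 16 / \<theta>\<^sup>2 * exp_mass"
  define c1 where "c1 = tilt_const + moment 2"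
  define c5 where "c5 = V / 2 + moment 1 + c0 + moment 2"
  define C where "C = moment 4 + (2 * moment 2 * tilt_const + tilt_const\<^sup>2) / 2 + (c1 * c3)\<^sup>2 / 2"
  have c0: "1 \<le> c0" and c3: "1 \<le> c3" using exp_mass_nonneg by (auto simp: c0_def c3_def)
  have V: "0 < V" by (rule variance_pos)
  have th4: "0 < (\<theta> / 4)\<^sup>2" using theta_pos by simp
  have "\<forall>\<^sub>F \<beta> in at_right 0. \<forall>L. entropy_ball_density P (V / 2 * \<beta>\<^sup>2) L \<longrightarrow>
     quadratic_value L \<le> V * \<beta> + (\<kappa> / 6 + \<nu> / 2) * \<beta>\<^sup>2 + C * \<beta> ^ 3"
    using eventually_pos eventually_id_le[OF half_gt_zero[OF theta_pos]] eventually_id_le[OF zero_less_one]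
      eventually_linear_le[OF zero_less_one, of "sqrt (V / 2)"]
      eventually_linear_le[OF half_gt_zero[OF theta_pos], of "sqrt (V / 2)"]
      eventually_linear_le[OF th4, of c5] eventually_linear_le[OF zero_less_one, of "c3\<^sup>2"]
  proof (eventually_elim, intro allI impI)
    case (elim \<beta>)
    note b = less_imp_le[OF elim(1)] elim(2,3)
    fix L assume L: "entropy_ball_density P (V / 2 * \<beta>\<^sup>2) L"
    define \<eta> where "\<eta> = V / 2 * \<beta>\<^sup>2"
    have sq: "sqrt \<eta> = sqrt (V / 2) * \<beta>" using elim(1) unfolding \<eta>_def real_sqrt_mult by simp
    have eta0: "0 < \<eta>" using elim(1) V by (simp add: \<eta>_def)
    have eta: "sqrt \<eta> \<le> \<theta> / 2" "sqrt \<eta> \<le> 1" using elim(4,5) unfolding sq by simp_all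
    have L: "entropy_ball_density P \<eta> L" using L by (simp add: \<eta>_def)
    then have L': "integrable P L" "\<And>x. 0 \<le> L x" "(\<integral>x. L x \<partial>P) = 1" "(\<integral>x. L x * ln (L x) \<partial>P) \<le> \<eta>"
      by (auto simp: entropy_ball_density_def)
    have [measurable]: "L \<in> borel_measurable P" using L' by auto
    define D where "D = (\<integral>x. L x * ln (L x) \<partial>P) - \<beta> * (\<integral>x. g x * L x \<partial>P) + ln (partition \<beta>)"
    note gap = gibbs_variational_gap[OF b L eta0 eta(1), folded D_def]
    define \<rho> where "\<rho> = (\<integral>x. a x * \<bar>L x - tilt \<beta> x\<bar> \<partial>P)"
    have Z: "1 \<le> partition \<beta>" using b by (intro partition_ge_1)
    have lnZ: "ln (partition \<beta>) \<le> partition \<beta> - 1" using Z by (intro ln_le_minus_one) auto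
    note dist = entropy_ball_distance[OF prob_space_axioms L a_measurable a_nonneg exp_moment eta0 eta(1), folded exp_mass_def, folded c0_def]
    have gLb: "\<bar>\<integral>x. g x * L x \<partial>P\<bar> \<le> moment 1 + c0"
    proof -
      have "\<bar>g x * L x\<bar> \<le> a x * \<bar>L x - 1\<bar> + a x" for x
      proof -
        have "\<bar>g x\<bar> * \<bar>L x\<bar> \<le> a x * (\<bar>L x - 1\<bar> + 1)"
          using g_bound[of x] a_nonneg[of x] by (intro mult_mono) auto
        then show ?thesis by (simp add: abs_mult algebra_simps)
      qed
      then have "(\<integral>x. \<bar>g x * L x\<bar> \<partial>P) \<le> (\<integral>x. a x * \<bar>L x - 1\<bar> + a x \<partial>P)"
        using gap(1) dist(1) a_integrable by (intro integral_mono) auto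
      also have "\<dots> \<le> c0 * sqrt \<eta> + moment 1" using dist a_integrable a_integral_le by simp
      also have "c0 * sqrt \<eta> \<le> c0 * 1" using c0 eta by (intro mult_left_mono) auto
      finally show ?thesis using integral_abs_bound[of P "\<lambda>x. g x * L x"] by linarith
    qed
    (* The square root of D has to lie in the range of l that the exponential moment allows. *)
    have Dle: "sqrt D \<le> \<theta> / 4"
    proof -
      have "- (\<integral>x. g x * L x \<partial>P) \<le> moment 1 + c0" using gLb by linarith
      then have "\<beta> * (- (\<integral>x. g x * L x \<partial>P)) \<le> \<beta> * (moment 1 + c0)" using b by (intro mult_left_mono)
      then have "D \<le> \<eta> + \<beta> * (moment 1 + c0) + \<beta>\<^sup>2 * moment 2"
        unfolding D_def using L'(4) lnZ partition_minus_1_le[OF b(1,2)] by simp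
      also have "\<dots> \<le> V / 2 * \<beta> + \<beta> * (moment 1 + c0) + \<beta> * moment 2"
        unfolding \<eta>_def using b V moment_nonneg
        by (intro add_mono mult_left_mono mult_right_mono order.refl) (auto simp: power2_eq_square mult_left_le)
      also have "\<dots> = c5 * \<beta>" by (simp add: c5_def algebra_simps)
      also have "\<dots> \<le> (\<theta> / 4)\<^sup>2" using elim by simp
      finally have "D \<le> (\<theta> / 4)\<^sup>2" .
      then show ?thesis using theta_pos gap(2) by (intro real_le_lsqrt) auto
    qed
    define s where "s = sqrt D"
    have s: "0 \<le> s" "s\<^sup>2 = D" using gap(2) by (auto simp: s_def)
    have rho: "\<rho> \<le> c3 * s"
      unfolding \<rho>_def c3_def s_def
      by (rule distance_le_sqrt_gap[of "\<theta> / 4"]) (use gap(2,4) Dle theta_pos exp_mass_nonneg in auto)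
    have rho0: "0 \<le> \<rho>" unfolding \<rho>_def using a_nonneg by (intro Bochner_Integration.integral_nonneg) simp
    have td: "(\<integral>x. a x * \<bar>tilt \<beta> x - 1\<bar> \<partial>P) \<le> c1 * \<beta>" "0 \<le> (\<integral>x. a x * \<bar>tilt \<beta> x - 1\<bar> \<partial>P)"
      using tilt_distance[OF b] a_nonneg by (auto simp: c1_def intro!: Bochner_Integration.integral_nonneg)
    have quad: "bilinear_form P K (\<lambda>x. L x - 1) (\<lambda>x. L x - 1)
      \<le> \<nu> * \<beta>\<^sup>2 + (2 * moment 2 * tilt_const + tilt_const\<^sup>2) * \<beta> ^ 3 + 2 * (c1 * \<beta>) * (c3 * s) + (c3 * s)\<^sup>2"
    proof -
      have "bilinear_form P K (\<lambda>x. (tilt \<beta> x - 1) + (L x - tilt \<beta> x)) (\<lambda>x. (tilt \<beta> x - 1) + (L x - tilt \<beta> x))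
         - bilinear_form P K (\<lambda>x. tilt \<beta> x - 1) (\<lambda>x. tilt \<beta> x - 1)
         \<le> 2 * (\<integral>x. a x * \<bar>tilt \<beta> x - 1\<bar> \<partial>P) * \<rho> + \<rho>\<^sup>2"
        unfolding \<rho>_def
        by (rule order.trans[OF abs_ge_self quadratic_form_perturbation]) (use tilt_distance[OF b] gap(3) in auto)
      also have "\<dots> \<le> 2 * (c1 * \<beta>) * (c3 * s) + (c3 * s)\<^sup>2"
        using td rho rho0 by (intro add_mono mult_mono power_mono) auto
      finally show ?thesis using tilt_quadratic_form[OF b] by simp
    qed
    have lin: "(\<integral>x. g x * (L x - 1) \<partial>P) \<le> V * \<beta> + \<kappa> / 6 * \<beta>\<^sup>2 + moment 4 * \<beta> ^ 3 - s\<^sup>2 / \<beta>"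
    proof -
      have "(\<integral>x. g x * (L x - 1) \<partial>P) = (\<integral>x. g x * L x \<partial>P)"
        using gap(1) g_integrable g_centred by (simp add: right_diff_distrib)
      also have "\<dots> = ((\<integral>x. L x * ln (L x) \<partial>P) + ln (partition \<beta>) - D) / \<beta>"
        using elim(1) by (simp add: D_def field_simps)
      also have "\<dots> \<le> (V / 2 * \<beta>\<^sup>2 + (V / 2 * \<beta>\<^sup>2 + \<kappa> / 6 * \<beta> ^ 3 + \<beta> ^ 4 * moment 4) - s\<^sup>2) / \<beta>"
        using L'(4) lnZ partition_expansion[OF b(1,2)] elim(1) unfolding s(2) \<eta>_def
        by (intro divide_right_mono) linarith+
      also have "\<dots> = V * \<beta> + \<kappa> / 6 * \<beta>\<^sup>2 + moment 4 * \<beta> ^ 3 - s\<^sup>2 / \<beta>"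
        using elim(1) by (simp add: field_simps eval_nat_numeral)
      finally show ?thesis .
    qed
    have "quadratic_value L \<le> V * \<beta> + (\<kappa> / 6 + \<nu> / 2) * \<beta>\<^sup>2 + (moment 4 + (2 * moment 2 * tilt_const + tilt_const\<^sup>2) / 2) * \<beta> ^ 3
       + (c1 * c3 * \<beta> * s + c3\<^sup>2 * s\<^sup>2 / 2 - s\<^sup>2 / \<beta>)"
    proof -
      have "quadratic_value L \<le> (V * \<beta> + \<kappa> / 6 * \<beta>\<^sup>2 + moment 4 * \<beta> ^ 3 - s\<^sup>2 / \<beta>)
        + (\<nu> * \<beta>\<^sup>2 + (2 * moment 2 * tilt_const + tilt_const\<^sup>2) * \<beta> ^ 3 + 2 * (c1 * \<beta>) * (c3 * s) + (c3 * s)\<^sup>2) / 2"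
        unfolding quadratic_value_def by (intro add_mono divide_right_mono lin quad) simp
      then show ?thesis by (simp add: algebra_simps add_divide_distrib power_mult_distrib)
    qed
    moreover have "c1 * c3 * \<beta> * s + c3\<^sup>2 * s\<^sup>2 / 2 - s\<^sup>2 / \<beta> \<le> (c1 * c3)\<^sup>2 / 2 * \<beta> ^ 3"
    proof -
      have "c3\<^sup>2 * s\<^sup>2 \<le> s\<^sup>2 / \<beta>"
      proof -
        have "c3\<^sup>2 \<le> 1 / \<beta>" using elim by (simp add: field_simps)
        from mult_right_mono[OF this, of "s\<^sup>2"] show ?thesis by simp
      qed
      (* completing the square in s, the square root of D *)
      moreover have "0 \<le> (s - c1 * c3 * \<beta>\<^sup>2)\<^sup>2 / (2 * \<beta>)" using elim(1) by simp
      moreover have "(s - c1 * c3 * \<beta>\<^sup>2)\<^sup>2 / (2 * \<beta>) = s\<^sup>2 / \<beta> / 2 - c1 * c3 * \<beta> * s + (c1 * c3)\<^sup>2 / 2 * \<beta> ^ 3"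
        using elim(1) by (simp add: field_simps eval_nat_numeral)
      moreover have "r + q / 2 - p \<le> t" if "q \<le> p" "0 \<le> z" "z = p / 2 - r + t" for p q r t z :: real
        using that by linarith
      ultimately show ?thesis by blast
    qed
    ultimately show "quadratic_value L \<le> V * \<beta> + (\<kappa> / 6 + \<nu> / 2) * \<beta>\<^sup>2 + C * \<beta> ^ 3"
      unfolding C_def by (simp add: algebra_simps)
  qed
  then show ?thesis by blast
qed

end

text \<open>The entropy of the density tilted by \<open>b g\<close> is \<open>V / 2 * b\<^sup>2 + \<kappa> / 3 * b ^ 3\<close> up to fourth order.  The
parameter \<open>b = \<beta> - \<kappa> / (3 * V) * \<beta>\<^sup>2 - B * \<beta> ^ 3\<close> brings it below \<open>V / 2 * \<beta>\<^sup>2\<close>: the quadratic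
correction cancels the cubic term, and a large \<open>B\<close> absorbs all terms of fourth order, at a cost of
third order in the value.\<close>
lemma shrunk_parameter:
  fixes V \<kappa> C \<mu> :: real
  assumes V: "0 < V" and C: "0 \<le> C"
  shows "\<exists>C2. \<forall>\<^sub>F \<beta> in at_right 0. \<exists>b. 0 < b \<and> b \<le> 2 * \<beta> \<and>
     V / 2 * b\<^sup>2 + \<kappa> / 3 * b ^ 3 + C * b ^ 4 \<le> V / 2 * \<beta>\<^sup>2 \<and>
     V * \<beta> + (\<mu> - \<kappa> / 3) * \<beta>\<^sup>2 - C2 * \<beta> ^ 3 \<le> V * b + \<mu> * b\<^sup>2 - C * b ^ 3"
proof -
  define c where "c = \<kappa> / (3 * V)"
  define k where "k = \<bar>c\<bar> + 1"
  define B where "B = (V / 2 * k\<^sup>2 + 7 * k * \<bar>\<kappa>\<bar> / 3 + 16 * C) / V"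
  define C2 where "C2 = V * B + 3 * k * \<bar>\<mu>\<bar> + 8 * C"
  have k: "1 \<le> k" by (simp add: k_def)
  have B: "0 \<le> B" unfolding B_def using V C k by auto
  have VB: "V * B = V / 2 * k\<^sup>2 + 7 * k * \<bar>\<kappa>\<bar> / 3 + 16 * C" using V by (simp add: B_def)
  have Vc: "V * c = \<kappa> / 3" using V by (simp add: c_def)
  have "\<forall>\<^sub>F \<beta> in at_right 0. \<exists>b. 0 < b \<and> b \<le> 2 * \<beta> \<and>
     V / 2 * b\<^sup>2 + \<kappa> / 3 * b ^ 3 + C * b ^ 4 \<le> V / 2 * \<beta>\<^sup>2 \<and>
     V * \<beta> + (\<mu> - \<kappa> / 3) * \<beta>\<^sup>2 - C2 * \<beta> ^ 3 \<le> V * b + \<mu> * b\<^sup>2 - C * b ^ 3"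
    using eventually_pos eventually_linear_le[OF zero_less_one, of B]
      eventually_linear_le[of "1/2" k, OF half_gt_zero[OF zero_less_one]]
  proof eventually_elim
    case (elim \<beta>)
    define w where "w = c * \<beta> + B * \<beta>\<^sup>2"
    define b where "b = \<beta> * (1 - w)"
    have w: "\<bar>w\<bar> \<le> k * \<beta>"
    proof -
      have "\<bar>w\<bar> \<le> \<bar>c\<bar> * \<beta> + (B * \<beta>) * \<beta>"
        using abs_triangle_ineq[of "c * \<beta>" "B * \<beta>\<^sup>2"] elim B unfolding w_def by (simp add: abs_mult power2_eq_square)
      also have "(B * \<beta>) * \<beta> \<le> 1 * \<beta>" using elim by (intro mult_right_mono) auto
      finally show ?thesis by (simp add: k_def algebra_simps)
    qed
    have w1: "\<bar>w\<bar> \<le> 1 / 2" using w elim by linarith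
    have w2: "w\<^sup>2 \<le> k\<^sup>2 * \<beta>\<^sup>2"
      using power_mono[OF w, of 2] by (simp add: power_mult_distrib)
    have w2': "w\<^sup>2 \<le> \<bar>w\<bar>"
    proof -
      have "\<bar>w\<bar> * \<bar>w\<bar> \<le> 1 * \<bar>w\<bar>" using w1 by (intro mult_right_mono) auto
      then show ?thesis by (simp add: power2_eq_square)
    qed
    have b: "0 < b" using elim w1 by (simp add: b_def)
    have bu: "b \<le> 2 * \<beta>"
    proof -
      have "\<beta> * (1 - w) \<le> \<beta> * 2" using elim w1 by (intro mult_left_mono) auto
      then show ?thesis by (simp add: b_def mult.commute)
    qed
    have cube: "\<bar>(1 - w) ^ 3 - 1\<bar> \<le> 7 * k * \<beta>"
    proof -
      have "\<bar>w ^ 3\<bar> \<le> \<bar>w\<bar>" using w1 power_decreasing[of 1 3 "\<bar>w\<bar>"] by (simp add: power_abs)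
      moreover have "(1 - w) ^ 3 - 1 = - 3 * w + 3 * w\<^sup>2 - w ^ 3" by (simp add: eval_nat_numeral algebra_simps)
      moreover have "0 \<le> w\<^sup>2" by simp
      ultimately have "\<bar>(1 - w) ^ 3 - 1\<bar> \<le> 7 * \<bar>w\<bar>" using w2' by linarith
      then show ?thesis using w by linarith
    qed
    have b2: "b\<^sup>2 = \<beta>\<^sup>2 - 2 * c * \<beta> ^ 3 - 2 * B * \<beta> ^ 4 + \<beta>\<^sup>2 * w\<^sup>2"
      unfolding b_def by (simp add: w_def eval_nat_numeral algebra_simps)
    have b3eq: "b ^ 3 = \<beta> ^ 3 * (1 - w) ^ 3" unfolding b_def by (rule power_mult_distrib)
    have b4: "b ^ 4 \<le> 16 * \<beta> ^ 4"
      using power_mono[OF bu, of 4] b by (simp add: power_mult_distrib)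
    have b3: "b ^ 3 \<le> 8 * \<beta> ^ 3"
      using power_mono[OF bu, of 3] b by (simp add: power_mult_distrib)
    have "\<kappa> / 3 * b ^ 3 \<le> \<kappa> / 3 * \<beta> ^ 3 + \<bar>\<kappa>\<bar> / 3 * (7 * k * \<beta> ^ 4)"
    proof -
      have "\<kappa> / 3 * b ^ 3 = \<kappa> / 3 * \<beta> ^ 3 + \<beta> ^ 3 * (\<kappa> / 3 * ((1 - w) ^ 3 - 1))"
        unfolding b3eq by (simp add: algebra_simps)
      also have "\<kappa> / 3 * ((1 - w) ^ 3 - 1) \<le> \<bar>\<kappa> / 3\<bar> * \<bar>(1 - w) ^ 3 - 1\<bar>"
        using abs_ge_self[of "\<kappa> / 3 * ((1 - w) ^ 3 - 1)"] by (simp only: abs_mult)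
      also have "\<dots> \<le> \<bar>\<kappa> / 3\<bar> * (7 * k * \<beta>)" using cube by (intro mult_left_mono) auto
      finally show ?thesis using elim by (simp add: eval_nat_numeral mult_ac)
    qed
    moreover have "V / 2 * b\<^sup>2 \<le> V / 2 * \<beta>\<^sup>2 - \<kappa> / 3 * \<beta> ^ 3 - V * B * \<beta> ^ 4 + V / 2 * k\<^sup>2 * \<beta> ^ 4"
    proof -
      have "\<beta>\<^sup>2 * w\<^sup>2 \<le> k\<^sup>2 * \<beta> ^ 4"
        using mult_left_mono[OF w2, of "\<beta>\<^sup>2"] by (simp add: eval_nat_numeral mult_ac)
      then have "V / 2 * (\<beta>\<^sup>2 * w\<^sup>2) \<le> V / 2 * (k\<^sup>2 * \<beta> ^ 4)" using V by (intro mult_left_mono) auto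
      moreover have "V / 2 * b\<^sup>2 = V / 2 * \<beta>\<^sup>2 - V * c * \<beta> ^ 3 - V * B * \<beta> ^ 4 + V / 2 * (\<beta>\<^sup>2 * w\<^sup>2)"
        unfolding b2 by (simp add: algebra_simps)
      ultimately show ?thesis unfolding Vc by simp
    qed
    moreover have "C * b ^ 4 \<le> C * (16 * \<beta> ^ 4)" using b4 C by (intro mult_left_mono)
    moreover have "V * B * \<beta> ^ 4 = V / 2 * k\<^sup>2 * \<beta> ^ 4 + \<bar>\<kappa>\<bar> / 3 * (7 * k * \<beta> ^ 4) + C * (16 * \<beta> ^ 4)"
      unfolding VB by (simp add: algebra_simps)
    ultimately have ent: "V / 2 * b\<^sup>2 + \<kappa> / 3 * b ^ 3 + C * b ^ 4 \<le> V / 2 * \<beta>\<^sup>2" by linarith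
    have "\<mu> * \<beta>\<^sup>2 - 3 * k * \<bar>\<mu>\<bar> * \<beta> ^ 3 \<le> \<mu> * b\<^sup>2"
    proof -
      have eq: "\<mu> * b\<^sup>2 = \<mu> * \<beta>\<^sup>2 + \<beta>\<^sup>2 * (\<mu> * (- 2 * w + w\<^sup>2))"
        by (simp add: b_def eval_nat_numeral algebra_simps)
      have "\<bar>- 2 * w + w\<^sup>2\<bar> \<le> 3 * \<bar>w\<bar>" using w2' zero_le_power2[of w] by linarith
      also have "\<dots> \<le> 3 * (k * \<beta>)" using w by simp
      finally have "\<bar>\<mu>\<bar> * \<bar>- 2 * w + w\<^sup>2\<bar> \<le> \<bar>\<mu>\<bar> * (3 * (k * \<beta>))" by (intro mult_left_mono) auto
      then have "- (\<mu> * (- 2 * w + w\<^sup>2)) \<le> \<bar>\<mu>\<bar> * (3 * (k * \<beta>))"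
        unfolding abs_mult[symmetric] by linarith
      then have "\<beta>\<^sup>2 * (- (\<mu> * (- 2 * w + w\<^sup>2))) \<le> \<beta>\<^sup>2 * (\<bar>\<mu>\<bar> * (3 * (k * \<beta>)))" by (intro mult_left_mono) auto
      then show ?thesis unfolding eq by (simp add: eval_nat_numeral algebra_simps)
    qed
    moreover have "V * b = V * \<beta> - \<kappa> / 3 * \<beta>\<^sup>2 - V * B * \<beta> ^ 3"
    proof -
      have "V * b = V * \<beta> - (V * c) * \<beta>\<^sup>2 - V * B * \<beta> ^ 3"
        by (simp add: b_def w_def eval_nat_numeral algebra_simps)
      then show ?thesis unfolding Vc .
    qed
    moreover have "C * b ^ 3 \<le> C * (8 * \<beta> ^ 3)" using b3 C by (intro mult_left_mono)
    moreover have "C2 * \<beta> ^ 3 = V * B * \<beta> ^ 3 + 3 * k * \<bar>\<mu>\<bar> * \<beta> ^ 3 + C * (8 * \<beta> ^ 3)"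
      by (simp add: C2_def algebra_simps)
    ultimately have "V * \<beta> + \<mu> * \<beta>\<^sup>2 - \<kappa> / 3 * \<beta>\<^sup>2 - C2 * \<beta> ^ 3 \<le> V * b + \<mu> * b\<^sup>2 - C * b ^ 3"
      by linarith
    then have "V * \<beta> + (\<mu> - \<kappa> / 3) * \<beta>\<^sup>2 - C2 * \<beta> ^ 3 \<le> V * b + \<mu> * b\<^sup>2 - C * b ^ 3"
      by (simp only: left_diff_distrib)
    with b bu ent show ?case by blast
  qed
  then show ?thesis by blast
qed

context entropic_problem
begin

text \<open>Entropy and value of a tilted density in terms of the parameter.  The entropy is
\<open>b * (\<integral>x. g x * tilt b x \<partial>P) - ln (partition b)\<close>, so that both follow from the expansion of the
partition function and of its derivative.\<close>
lemma tilt_expansions: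
  assumes b: "0 \<le> b" "b \<le> \<theta> / 2" "b \<le> 1"
  defines "C \<equiv> 2 * (moment 4 + (moment 2)\<^sup>2) + (2 * moment 2 * tilt_const + tilt_const\<^sup>2) / 2"
  shows "entropy_ball_density P (V / 2 * b\<^sup>2 + \<kappa> / 3 * b ^ 3 + C * b ^ 4) (tilt b)"
    and "V * b + (\<kappa> / 2 + \<nu> / 2) * b\<^sup>2 - C * b ^ 3 \<le> quadratic_value (tilt b)"
proof -
  define Z where "Z = partition b"
  define N where "N = (\<integral>x. g x * exp (b * g x) \<partial>P)"
  define c where "c = moment 4 + (moment 2)\<^sup>2"
  define e where "e = (2 * moment 2 * tilt_const + tilt_const\<^sup>2) / 2"
  have c0: "0 \<le> c" unfolding c_def using moment_nonneg by simp
  have e0: "0 \<le> e" unfolding e_def using moment_nonneg tilt_const_nonneg by simp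
  have Ce: "C = 2 * c + e" by (simp add: C_def c_def e_def)
  have Z: "1 \<le> Z" unfolding Z_def using b by (intro partition_ge_1)
  have gt: "integrable P (\<lambda>x. g x * tilt b x)"
    using g_exp_g_integrable[OF b(1,2)] by (simp add: tilt_def)
  have gt_int: "(\<integral>x. g x * tilt b x \<partial>P) = N / Z"
    by (simp add: tilt_def N_def Z_def)
  have lin: "\<bar>N / Z - V * b - \<kappa> / 2 * b\<^sup>2\<bar> \<le> c * b ^ 3"
  proof -
    have "\<bar>N * (1 - 1 / Z)\<bar> \<le> (b * moment 2) * (b\<^sup>2 * moment 2)"
      unfolding abs_mult N_def Z_def using inverse_partition[OF b(1,2)] b moment_nonneg
      by (intro mult_mono partition_derivative_le) auto
    then have "\<bar>N - N / Z\<bar> \<le> (moment 2)\<^sup>2 * b ^ 3"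
      by (simp add: right_diff_distrib eval_nat_numeral mult_ac)
    moreover have "\<bar>N - V * b - \<kappa> / 2 * b\<^sup>2\<bar> \<le> moment 4 * b ^ 3"
      using partition_derivative_expansion[OF b(1,2)] by (simp add: N_def mult.commute)
    moreover have "c * b ^ 3 = moment 4 * b ^ 3 + (moment 2)\<^sup>2 * b ^ 3" by (simp add: c_def algebra_simps)
    ultimately show ?thesis by linarith
  qed
  have tl: "tilt b x * ln (tilt b x) = b * (g x * tilt b x) - ln Z * tilt b x" for x
  proof -
    have "ln (tilt b x) = b * g x - ln Z" using Z by (simp add: tilt_def ln_div Z_def[symmetric])
    then show ?thesis by (simp only:) (simp add: algebra_simps)
  qed
  have "(\<integral>x. tilt b x * ln (tilt b x) \<partial>P) = b * (N / Z) - ln Z"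
    unfolding tl using gt gt_int tilt_integrable[OF b(1,2)] tilt_integral[OF b(1,2)] by simp
  also have "\<dots> \<le> b * (V * b + \<kappa> / 2 * b\<^sup>2 + c * b ^ 3) - (V / 2 * b\<^sup>2 + \<kappa> / 6 * b ^ 3 - c * b ^ 4)"
  proof -
    have "N / Z \<le> V * b + \<kappa> / 2 * b\<^sup>2 + c * b ^ 3" using lin by linarith
    then have "b * (N / Z) \<le> b * (V * b + \<kappa> / 2 * b\<^sup>2 + c * b ^ 3)" using b by (intro mult_left_mono)
    (* ln Z is bounded from below by 1 - 1 / Z *)
    moreover have "(Z - 1) - (Z - 1)\<^sup>2 \<le> ln Z"
    proof -
      have "ln (1 / Z) \<le> 1 / Z - 1" using Z by (intro ln_le_minus_one) auto
      then have "1 - 1 / Z \<le> ln Z" using Z by (simp add: ln_div)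
      moreover have "(Z - 1) - (Z - 1)\<^sup>2 \<le> 1 - 1 / Z"
      proof -
        have "(Z - 1)\<^sup>2 / Z \<le> (Z - 1)\<^sup>2 / 1" using Z by (intro divide_left_mono) auto
        moreover have "1 - 1 / Z = (Z - 1) - (Z - 1)\<^sup>2 / Z"
          using Z by (simp add: field_simps power2_eq_square)
        ultimately show ?thesis by simp
      qed
      ultimately show ?thesis by linarith
    qed
    moreover have "(Z - 1)\<^sup>2 \<le> (moment 2)\<^sup>2 * b ^ 4"
    proof -
      have "(Z - 1)\<^sup>2 \<le> (b\<^sup>2 * moment 2)\<^sup>2"
        using Z partition_minus_1_le[OF b(1,2)] by (intro power_mono) (auto simp: Z_def)
      then show ?thesis by (simp add: power_mult_distrib mult.commute)
    qed
    moreover have "V / 2 * b\<^sup>2 + \<kappa> / 6 * b ^ 3 - moment 4 * b ^ 4 \<le> Z - 1"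
      using partition_expansion[OF b(1,2)] by (simp add: Z_def mult.commute[of "b ^ 4"] abs_le_iff)
    moreover have "c * b ^ 4 = moment 4 * b ^ 4 + (moment 2)\<^sup>2 * b ^ 4" by (simp add: c_def algebra_simps)
    ultimately show ?thesis by linarith
  qed
  also have "\<dots> = V / 2 * b\<^sup>2 + \<kappa> / 3 * b ^ 3 + 2 * c * b ^ 4"
    by (simp add: eval_nat_numeral algebra_simps)
  also have "\<dots> \<le> V / 2 * b\<^sup>2 + \<kappa> / 3 * b ^ 3 + C * b ^ 4"
    using e0 b by (simp add: Ce mult_right_mono)
  finally have ent: "(\<integral>x. tilt b x * ln (tilt b x) \<partial>P) \<le> V / 2 * b\<^sup>2 + \<kappa> / 3 * b ^ 3 + C * b ^ 4" .
  show "entropy_ball_density P (V / 2 * b\<^sup>2 + \<kappa> / 3 * b ^ 3 + C * b ^ 4) (tilt b)"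
    unfolding entropy_ball_density_def
  proof (intro conjI allI ent)
    show "0 \<le> tilt b x" for x using tilt_pos[OF b(1,2)] by (simp add: less_imp_le)
    show "integrable P (\<lambda>x. tilt b x * ln (tilt b x))"
      unfolding tl using gt tilt_integrable[OF b(1,2)] by simp
  qed (use tilt_integrable[OF b(1,2)] tilt_integral[OF b(1,2)] in auto)
  have "(\<integral>x. g x * (tilt b x - 1) \<partial>P) = N / Z"
    using gt gt_int g_integrable g_centred by (simp add: right_diff_distrib)
  moreover have "\<nu> * b\<^sup>2 - 2 * e * b ^ 3 \<le> bilinear_form P K (\<lambda>x. tilt b x - 1) (\<lambda>x. tilt b x - 1)"
  proof -
    have "2 * e = 2 * moment 2 * tilt_const + tilt_const\<^sup>2" by (simp add: e_def)
    from tilt_quadratic_form[OF b, folded this] show ?thesis by linarith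
  qed
  ultimately have q: "N / Z + (\<nu> * b\<^sup>2 - 2 * e * b ^ 3) / 2 \<le> quadratic_value (tilt b)"
    by (simp add: quadratic_value_def)
  have "V * b + (\<kappa> / 2 + \<nu> / 2) * b\<^sup>2 - C * b ^ 3
     = (V * b + \<kappa> / 2 * b\<^sup>2 - c * b ^ 3) + (\<nu> * b\<^sup>2 - 2 * e * b ^ 3) / 2 - c * b ^ 3"
    by (simp add: Ce algebra_simps diff_divide_distrib)
  moreover have "0 \<le> c * b ^ 3" using c0 b by simp
  moreover have "V * b + \<kappa> / 2 * b\<^sup>2 - c * b ^ 3 \<le> N / Z" using lin by linarith
  ultimately show "V * b + (\<kappa> / 2 + \<nu> / 2) * b\<^sup>2 - C * b ^ 3 \<le> quadratic_value (tilt b)"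
    using q by linarith
qed

lemma quadratic_value_lower:
  "\<exists>C. \<forall>\<^sub>F \<beta> in at_right 0. \<exists>L. entropy_ball_density P (V / 2 * \<beta>\<^sup>2) L \<and>
     V * \<beta> + (\<kappa> / 6 + \<nu> / 2) * \<beta>\<^sup>2 - C * \<beta> ^ 3 \<le> quadratic_value L"
proof -
  define C where "C = 2 * (moment 4 + (moment 2)\<^sup>2) + (2 * moment 2 * tilt_const + tilt_const\<^sup>2) / 2"
  have "0 \<le> C" unfolding C_def using moment_nonneg tilt_const_nonneg by simp
  from shrunk_parameter[OF variance_pos this, of \<kappa> "\<kappa> / 2 + \<nu> / 2"]
  obtain C2 where C2: "\<forall>\<^sub>F \<beta> in at_right 0. \<exists>b. 0 < b \<and> b \<le> 2 * \<beta> \<and>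
     V / 2 * b\<^sup>2 + \<kappa> / 3 * b ^ 3 + C * b ^ 4 \<le> V / 2 * \<beta>\<^sup>2 \<and>
     V * \<beta> + (\<kappa> / 2 + \<nu> / 2 - \<kappa> / 3) * \<beta>\<^sup>2 - C2 * \<beta> ^ 3 \<le> V * b + (\<kappa> / 2 + \<nu> / 2) * b\<^sup>2 - C * b ^ 3" by blast
  have "\<forall>\<^sub>F \<beta> in at_right 0. \<exists>L. entropy_ball_density P (V / 2 * \<beta>\<^sup>2) L \<and>
     V * \<beta> + (\<kappa> / 6 + \<nu> / 2) * \<beta>\<^sup>2 - C2 * \<beta> ^ 3 \<le> quadratic_value L"
    using C2 eventually_linear_le[OF half_gt_zero[OF theta_pos], of 2] eventually_linear_le[OF zero_less_one, of 2]
  proof eventually_elim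
    case (elim \<beta>)
    then obtain b where b: "0 < b" "b \<le> 2 * \<beta>" "V / 2 * b\<^sup>2 + \<kappa> / 3 * b ^ 3 + C * b ^ 4 \<le> V / 2 * \<beta>\<^sup>2"
     "V * \<beta> + (\<kappa> / 2 + \<nu> / 2 - \<kappa> / 3) * \<beta>\<^sup>2 - C2 * \<beta> ^ 3 \<le> V * b + (\<kappa> / 2 + \<nu> / 2) * b\<^sup>2 - C * b ^ 3" by blast
    have b': "0 \<le> b" "b \<le> \<theta> / 2" "b \<le> 1" using b elim by linarith+
    note t = tilt_expansions[OF b', folded C_def]
    have e: "\<kappa> / 2 + \<nu> / 2 - \<kappa> / 3 = \<kappa> / 6 + \<nu> / 2" by simp
    have "entropy_ball_density P (V / 2 * \<beta>\<^sup>2) (tilt b)"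
      using t(1) order.trans[OF _ b(3)] unfolding entropy_ball_density_def by blast
    moreover have "V * \<beta> + (\<kappa> / 6 + \<nu> / 2) * \<beta>\<^sup>2 - C2 * \<beta> ^ 3 \<le> quadratic_value (tilt b)"
      using order.trans[OF b(4) t(2)] unfolding e .
    ultimately show ?case by (intro exI[of _ "tilt b"] conjI)
  qed
  then show ?thesis by blast
qed

end

section \<open>Versions of conditional expectations and independence\<close>

lemma cond_exp_version_integral:
  assumes "prob_space M" and Y: "Y \<in> measurable M N" and Q: "distr M N Y = Q"
    and Z: "Z \<in> borel_measurable M" and ver: "cond_exp_version M Z N Y \<phi>"
    and psi: "\<psi> \<in> borel_measurable N" and int: "integrable M (\<lambda>\<omega>. \<psi> (Y \<omega>) * Z \<omega>)"
  shows "integrable Q (\<lambda>y. \<psi> y * \<phi> y)"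
    and "(\<integral>y. \<psi> y * \<phi> y \<partial>Q) = (\<integral>\<omega>. \<psi> (Y \<omega>) * Z \<omega> \<partial>M)"
proof -
  interpret prob_space M by fact
  define F where "F = vimage_algebra (space M) Y N"
  have F: "subalgebra M F"
    unfolding subalgebra_def F_def using Y by (simp add: measurable_iff_sets)
  interpret finite_measure_subalgebra M F by unfold_locales (rule F)
  have [measurable]: "\<phi> \<in> borel_measurable N"
    and ae: "AE \<omega> in M. \<phi> (Y \<omega>) = real_cond_exp M F Z \<omega>"
    using ver by (auto simp: cond_exp_version_def F_def)
  note [measurable] = Y psi Z
  have "Y \<in> measurable F N" unfolding F_def using Y by (intro measurable_vimage_algebra1) (auto simp: measurable_def)
  then have pF: "(\<lambda>\<omega>. \<psi> (Y \<omega>)) \<in> borel_measurable F" by (rule measurable_compose[OF _ psi])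
  note ce = real_cond_exp_intg[OF int pF Z]
  have ae': "AE \<omega> in M. \<psi> (Y \<omega>) * real_cond_exp M F Z \<omega> = \<psi> (Y \<omega>) * \<phi> (Y \<omega>)"
    using ae by eventually_elim simp
  have int': "integrable M (\<lambda>\<omega>. \<psi> (Y \<omega>) * \<phi> (Y \<omega>))"
    by (rule integrable_cong_AE_imp[OF ce(1)]) (use ae' in \<open>auto elim: AE_mp\<close>)
  then show "integrable Q (\<lambda>y. \<psi> y * \<phi> y)"
    unfolding Q[symmetric] by (subst integrable_distr_eq) auto
  have "(\<integral>y. \<psi> y * \<phi> y \<partial>Q) = (\<integral>\<omega>. \<psi> (Y \<omega>) * \<phi> (Y \<omega>) \<partial>M)"
    unfolding Q[symmetric] by (subst integral_distr) auto
  also have "\<dots> = (\<integral>\<omega>. \<psi> (Y \<omega>) * real_cond_exp M F Z \<omega> \<partial>M)"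
    by (rule integral_cong_AE) (use ae' in \<open>auto elim: AE_mp\<close>)
  also have "\<dots> = (\<integral>\<omega>. \<psi> (Y \<omega>) * Z \<omega> \<partial>M)" by (rule ce(2))
  finally show "(\<integral>y. \<psi> y * \<phi> y \<partial>Q) = (\<integral>\<omega>. \<psi> (Y \<omega>) * Z \<omega> \<partial>M)" .
qed

text \<open>An almost sure bound on a conditional expectation follows from bounds on the integrals
  over all events determined by the conditioning variable; one tests against the event on
  which the bound fails.\<close>

lemma cond_exp_version_bound:
  assumes M: "prob_space M" and Y: "Y \<in> measurable M N" and Q: "distr M N Y = Q"
    and Z: "integrable M Z" and ver: "cond_exp_version M Z N Y \<phi>"
    and b: "integrable Q b"
    and bd: "\<And>A. A \<in> sets N \<Longrightarrow> (\<integral>\<^sup>+\<omega>. ennreal \<bar>Z \<omega>\<bar> * indicator A (Y \<omega>) \<partial>M) \<le> (\<integral>\<^sup>+y. ennreal (b y) * indicator A y \<partial>Q)"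
    and b0: "\<And>y. 0 \<le> b y"
  shows "AE y in Q. \<bar>\<phi> y\<bar> \<le> b y"
proof -
  have sets_Q [measurable_cong]: "sets Q = sets N" using Q by auto
  have [measurable]: "b \<in> borel_measurable N" "\<phi> \<in> borel_measurable N" "Z \<in> borel_measurable M" "Y \<in> measurable M N"
    using b ver Z Y by (auto simp: cond_exp_version_def sets_Q cong: measurable_cong_sets)
  have one_sided: "AE y in Q. \<sigma> * \<phi> y \<le> b y" if s: "\<bar>\<sigma>\<bar> = 1" for \<sigma> :: real
  proof -
    define A where "A = {y \<in> space N. b y < \<sigma> * \<phi> y}"
    have A [measurable]: "A \<in> sets N" unfolding A_def by measurable
    have int: "integrable M (\<lambda>\<omega>. indicator A (Y \<omega>) * Z \<omega>)"
      by (rule Bochner_Integration.integrable_bound[OF Z]) (auto split: split_indicator)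
    note ce = cond_exp_version_integral[OF M Y Q _ ver, of "indicator A", OF _ _ int]
    have phi_int: "integrable Q (\<lambda>y. indicator A y * \<phi> y)" using ce(1) by simp
    have b_int: "integrable Q (\<lambda>y. indicator A y * b y)"
      by (rule Bochner_Integration.integrable_bound[OF b]) (auto split: split_indicator)
    have "ennreal (\<integral>\<omega>. \<bar>Z \<omega>\<bar> * indicator A (Y \<omega>) \<partial>M) = (\<integral>\<^sup>+\<omega>. ennreal \<bar>Z \<omega>\<bar> * indicator A (Y \<omega>) \<partial>M)"
    proof (subst nn_integral_eq_integral[symmetric])
      show "integrable M (\<lambda>\<omega>. \<bar>Z \<omega>\<bar> * indicator A (Y \<omega>))"
        using integrable_abs[OF int] by (simp add: abs_mult mult.commute)
    qed (auto intro!: nn_integral_cong split: split_indicator)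
    also have "\<dots> \<le> (\<integral>\<^sup>+y. ennreal (b y) * indicator A y \<partial>Q)" by (rule bd[OF A])
    also have "\<dots> = ennreal (\<integral>y. indicator A y * b y \<partial>Q)"
      by (subst nn_integral_eq_integral[symmetric, OF b_int])
        (auto intro!: nn_integral_cong simp: b0 split: split_indicator)
    finally have le: "(\<integral>\<omega>. \<bar>Z \<omega>\<bar> * indicator A (Y \<omega>) \<partial>M) \<le> (\<integral>y. indicator A y * b y \<partial>Q)"
      by (subst (asm) ennreal_le_iff) (auto intro!: Bochner_Integration.integral_nonneg simp: b0)
    have "(\<integral>y. indicator A y * (\<sigma> * \<phi> y) \<partial>Q) = \<sigma> * (\<integral>\<omega>. indicator A (Y \<omega>) * Z \<omega> \<partial>M)"
      using ce(2) by (simp add: mult.left_commute)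
    also have "\<dots> \<le> \<bar>\<integral>\<omega>. indicator A (Y \<omega>) * Z \<omega> \<partial>M\<bar>"
      using abs_ge_self[of "\<sigma> * (\<integral>\<omega>. indicator A (Y \<omega>) * Z \<omega> \<partial>M)"] by (simp add: abs_mult s)
    also have "\<dots> \<le> (\<integral>\<omega>. \<bar>Z \<omega>\<bar> * indicator A (Y \<omega>) \<partial>M)"
      using integral_abs_bound[of M "\<lambda>\<omega>. indicator A (Y \<omega>) * Z \<omega>"] by (simp add: abs_mult mult.commute)
    finally have le2: "(\<integral>y. indicator A y * (\<sigma> * \<phi> y) \<partial>Q) \<le> (\<integral>y. indicator A y * b y \<partial>Q)" using le by simp
    have int3: "integrable Q (\<lambda>y. indicator A y * (\<sigma> * \<phi> y) - indicator A y * b y)"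
      using phi_int b_int by (auto simp: mult.left_commute)
    have nn: "AE y in Q. 0 \<le> indicator A y * (\<sigma> * \<phi> y) - indicator A y * b y"
      by (intro AE_I2) (auto simp: A_def split: split_indicator)
    have "(\<integral>y. indicator A y * (\<sigma> * \<phi> y) - indicator A y * b y \<partial>Q) = 0"
      using le2 phi_int b_int integral_nonneg_AE[OF nn] by (simp add: mult.left_commute)
    then have "AE y in Q. indicator A y * (\<sigma> * \<phi> y) - indicator A y * b y = 0"
      using integral_nonneg_eq_0_iff_AE[OF int3 nn] by simp
    then show ?thesis
      using AE_space
    proof eventually_elim
      case (elim y)
      then show ?case using sets_eq_imp_space_eq[OF sets_Q] by (auto simp: A_def indicator_def split: if_splits)
    qed
  qed
  have "AE y in Q. \<phi> y \<le> b y" "AE y in Q. - \<phi> y \<le> b y"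
    using one_sided[of 1] one_sided[of "-1"] by auto
  then show ?thesis by eventually_elim linarith
qed

context prob_space
begin

lemma indep_set_imp_indep_var:
  assumes ind: "indep_set (sets F1) (sets F2)" and sp: "space F1 = space M" "space F2 = space M"
    and U: "U \<in> measurable F1 N1" and V: "V \<in> measurable F2 N2"
  shows "indep_var N1 U N2 V"
proof -
  have ev: "sets F1 \<subseteq> events" "sets F2 \<subseteq> events" using ind by (auto simp: indep_sets2_eq)
  have UM: "U \<in> measurable M N1" using U ev sp by (auto simp: measurable_def)
  have VM: "V \<in> measurable M N2" using V ev sp by (auto simp: measurable_def)
  have "{U -` A \<inter> space F1 | A. A \<in> sets N1} \<subseteq> sets F1" using measurable_sets[OF U] by auto
  note 1 = sets.sigma_sets_subset[OF this, unfolded sp]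
  have "{V -` A \<inter> space F2 | A. A \<in> sets N2} \<subseteq> sets F2" using measurable_sets[OF V] by auto
  note 2 = sets.sigma_sets_subset[OF this, unfolded sp]
  have "indep_set (sigma_sets (space M) {U -` A \<inter> space M | A. A \<in> sets N1})
      (sigma_sets (space M) {V -` A \<inter> space M | A. A \<in> sets N2})"
    using ind 1 2 unfolding indep_sets2_eq by blast
  then show ?thesis unfolding indep_var_eq using UM VM by simp
qed

lemma indep_var_imp_indep_set:
  assumes ind: "indep_var N1 U N2 V"
  shows "indep_set (sets (vimage_algebra (space M) U N1)) (sets (vimage_algebra (space M) V N2))"
  using ind unfolding indep_var_eq sets_vimage_algebra by simp

lemma indep_var_nn_integral:
  fixes U V :: "'a \<Rightarrow> ennreal"
  assumes ind: "indep_var borel U borel V"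
  shows "(\<integral>\<^sup>+\<omega>. U \<omega> * V \<omega> \<partial>M) = (\<integral>\<^sup>+\<omega>. U \<omega> \<partial>M) * (\<integral>\<^sup>+\<omega>. V \<omega> \<partial>M)"
proof -
  have [measurable]: "U \<in> borel_measurable M" "V \<in> borel_measurable M"
    using ind by (auto dest: indep_var_rv1 indep_var_rv2)
  interpret D: prob_space "distr M borel U" by (rule prob_space_distr) simp
  interpret E: prob_space "distr M borel V" by (rule prob_space_distr) simp
  have "(\<integral>\<^sup>+\<omega>. U \<omega> * V \<omega> \<partial>M) = (\<integral>\<^sup>+p. fst p * snd p \<partial>distr M (borel \<Otimes>\<^sub>M borel) (\<lambda>\<omega>. (U \<omega>, V \<omega>)))"
    by (subst nn_integral_distr) auto
  also have "\<dots> = (\<integral>\<^sup>+p. fst p * snd p \<partial>(distr M borel U \<Otimes>\<^sub>M distr M borel V))"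
    using ind unfolding indep_var_distribution_eq by simp
  also have "\<dots> = (\<integral>\<^sup>+u. \<integral>\<^sup>+v. u * v \<partial>distr M borel V \<partial>distr M borel U)"
    by (subst E.nn_integral_fst[symmetric]) auto
  also have "\<dots> = (\<integral>\<^sup>+u. u * (\<integral>\<^sup>+v. v \<partial>distr M borel V) \<partial>distr M borel U)"
    by (intro nn_integral_cong nn_integral_cmult) auto
  also have "\<dots> = (\<integral>\<^sup>+u. u \<partial>distr M borel U) * (\<integral>\<^sup>+v. v \<partial>distr M borel V)"
    by (intro nn_integral_multc) auto
  also have "\<dots> = (\<integral>\<^sup>+\<omega>. U \<omega> \<partial>M) * (\<integral>\<^sup>+\<omega>. V \<omega> \<partial>M)"
    by (simp add: nn_integral_distr)
  finally show ?thesis .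
qed

end

section \<open>The cost of an i.i.d. path\<close>

locale cost_model = prob_space M + P: prob_space P0
  for M :: "'w measure" and P0 :: "'a measure" +
  fixes X :: "nat \<Rightarrow> 'w \<Rightarrow> 'a" and \<tau> :: "'w \<Rightarrow> nat" and h :: "'a list \<Rightarrow> real"
  assumes iid: "iid_sequence M P0 X" and random_time: "random_time M \<tau>"
    and measurable_cost: "measurable_cost P0 h"
begin

abbreviation "H \<equiv> path_cost h X \<tau>"

lemma X_measurable: "1 \<le> t \<Longrightarrow> X t \<in> measurable M P0"
  using iid unfolding iid_sequence_def indep_vars_def by auto

lemma X_distr: "1 \<le> t \<Longrightarrow> distr M P0 (X t) = P0"
  using iid unfolding iid_sequence_def by auto

lemma tau_measurable [measurable]: "\<tau> \<in> measurable M (count_space UNIV)"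
  using random_time by (simp add: random_time_def)

lemma tau_ge_1: "\<omega> \<in> space M \<Longrightarrow> 1 \<le> \<tau> \<omega>"
  using random_time by (simp add: random_time_def)

text \<open>The \<open>\<sigma>\<close>-algebra generated by the coordinates in \<open>J\<close>.  Independence is used in the form that
functions measurable for disjoint sets of coordinates are independent.\<close>
definition gen :: "nat set \<Rightarrow> 'w measure" where
  "gen J = vimage_algebra (space M) (\<lambda>\<omega>. \<lambda>t\<in>J. X t \<omega>) (PiM J (\<lambda>_. P0))"

lemma space_gen [simp]: "space (gen J) = space M" by (simp add: gen_def)

lemma restrict_gen_measurable:
  assumes "J \<subseteq> {1..}"
  shows "(\<lambda>\<omega>. \<lambda>t\<in>J. X t \<omega>) \<in> measurable (gen J) (PiM J (\<lambda>_. P0))"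
  unfolding gen_def
proof (rule measurable_vimage_algebra1)
  show "(\<lambda>\<omega>. \<lambda>t\<in>J. X t \<omega>) \<in> space M \<rightarrow> space (PiM J (\<lambda>_. P0))"
    using assms measurable_space[OF X_measurable] by (auto simp: space_PiM subset_eq)
qed

lemma X_gen:
  assumes "t \<in> J" "J \<subseteq> {1..}"
  shows "X t \<in> measurable (gen J) P0"
  using measurable_compose[OF restrict_gen_measurable[OF assms(2)] measurable_component_singleton[OF assms(1)]] assms
  by simp

lemma sets_gen_subset: "J \<subseteq> {1..} \<Longrightarrow> sets (gen J) \<subseteq> sets M"
  unfolding gen_def using X_measurable
  by (intro sets_image_in_sets measurable_restrict) (auto simp: subset_eq)

lemma gen_measurable: "f \<in> measurable (gen J) N \<Longrightarrow> J \<subseteq> {1..} \<Longrightarrow> f \<in> measurable M N"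
  using sets_gen_subset[of J] by (auto simp: measurable_def)

lemma gen_mono: "f \<in> measurable (gen J) N \<Longrightarrow> J \<subseteq> I \<Longrightarrow> I \<subseteq> {1..} \<Longrightarrow> f \<in> measurable (gen I) N"
proof -
  assume f: "f \<in> measurable (gen J) N" and JI: "J \<subseteq> I" "I \<subseteq> {1..}"
  have "sets (gen J) \<subseteq> sets (gen I)"
    unfolding gen_def[of J]
  proof (rule sets_image_in_sets)
    show "(\<lambda>\<omega>. \<lambda>t\<in>J. X t \<omega>) \<in> measurable (gen I) (PiM J (\<lambda>_. P0))"
      using JI by (intro measurable_restrict X_gen) auto
  qed simp
  then show ?thesis using f by (auto simp: measurable_def)
qed

lemma gen_indep_var:
  assumes "A \<inter> B = {}" "A \<subseteq> {1..}" "B \<subseteq> {1..}"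
    and U: "U \<in> measurable (gen A) N1" and V: "V \<in> measurable (gen B) N2"
  shows "indep_var N1 U N2 V"
proof (rule indep_set_imp_indep_var[OF _ _ _ U V])
  have "indep_vars (\<lambda>_. P0) X {1..}" using iid by (simp add: iid_sequence_def)
  from indep_var_restrict[OF this assms(1-3)]
  show "indep_set (sets (gen A)) (sets (gen B))"
    unfolding gen_def by (rule indep_var_imp_indep_set)
qed auto

lemma pair_distr:
  assumes "1 \<le> t" "1 \<le> s" "s \<noteq> t"
  shows "distr M (P0 \<Otimes>\<^sub>M P0) (\<lambda>\<omega>. (X t \<omega>, X s \<omega>)) = P0 \<Otimes>\<^sub>M P0"
proof -
  have "indep_var P0 (X t) P0 (X s)"
    using assms by (intro gen_indep_var[of "{t}" "{s}"] X_gen) auto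
  then show ?thesis unfolding indep_var_distribution_eq using X_distr assms by simp
qed

lemma pair_measurable:
  assumes "1 \<le> t" "1 \<le> s"
  shows "(\<lambda>\<omega>. (X t \<omega>, X s \<omega>)) \<in> measurable M (P0 \<Otimes>\<^sub>M P0)"
  using X_measurable assms by simp

lemma nn_integral_X:
  assumes "1 \<le> t" "f \<in> borel_measurable P0"
  shows "(\<integral>\<^sup>+\<omega>. f (X t \<omega>) \<partial>M) = (\<integral>\<^sup>+x. f x \<partial>P0)"
  using nn_integral_distr[OF X_measurable[OF assms(1)], of f] assms X_distr by simp

lemma nn_integral_pair:
  assumes "1 \<le> t" "1 \<le> s" "s \<noteq> t" "f \<in> borel_measurable (P0 \<Otimes>\<^sub>M P0)"
  shows "(\<integral>\<^sup>+\<omega>. f (X t \<omega>, X s \<omega>) \<partial>M) = (\<integral>\<^sup>+p. f p \<partial>(P0 \<Otimes>\<^sub>M P0))"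
  using nn_integral_distr[OF pair_measurable[OF assms(1,2)], of f] assms pair_distr[OF assms(1-3)] by simp

lemma path_cost_gen:
  assumes "1 \<le> n"
  shows "(\<lambda>\<omega>. h (map (\<lambda>t. X t \<omega>) [1..<Suc n])) \<in> borel_measurable (gen {1..n})"
proof -
  have m: "(\<lambda>x. h (map x [1..<Suc n])) \<in> borel_measurable (PiM {1..n} (\<lambda>_. P0))"
    using measurable_cost assms by (simp add: measurable_cost_def)
  have eq: "map (\<lambda>t\<in>{1..n}. X t \<omega>) [1..<Suc n] = map (\<lambda>t. X t \<omega>) [1..<Suc n]" for \<omega>
    by (intro map_cong) auto
  have "{1..n} \<subseteq> {1..}" by auto
  from measurable_compose[OF restrict_gen_measurable[OF this] m] show ?thesis unfolding eq .
qed

lemma H_eq: "H \<omega> = h (map (\<lambda>t. X t \<omega>) [1..<Suc (\<tau> \<omega>)])"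
  by (simp add: path_cost_def path_def)

lemma H_measurable [measurable]: "H \<in> borel_measurable M"
proof -
  have "(\<lambda>\<omega>. (\<lambda>n \<omega>. if n = 0 then 0 else h (map (\<lambda>t. X t \<omega>) [1..<Suc n])) (\<tau> \<omega>) \<omega>) \<in> borel_measurable M"
  proof (rule measurable_compose_countable[OF _ tau_measurable])
    fix n :: nat
    show "(\<lambda>\<omega>. if n = 0 then 0 else h (map (\<lambda>t. X t \<omega>) [1..<Suc n])) \<in> borel_measurable M"
      using gen_measurable[OF path_cost_gen[of n]] by (cases "n = 0") auto
  qed
  then show ?thesis
    by (rule measurable_cong[THEN iffD1, rotated]) (auto simp: H_eq dest: tau_ge_1)
qed

lemma nn_integral_prod:
  assumes "finite J" "J \<subseteq> {1..}" and f: "f \<in> borel_measurable P0"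
  shows "(\<lambda>\<omega>. \<Prod>u\<in>J. f (X u \<omega>) :: ennreal) \<in> borel_measurable (gen J)"
    and "(\<integral>\<^sup>+\<omega>. (\<Prod>u\<in>J. f (X u \<omega>) :: ennreal) \<partial>M) = (\<integral>\<^sup>+x. f x \<partial>P0) ^ card J"
proof -
  have meas: "(\<lambda>\<omega>. \<Prod>u\<in>J. f (X u \<omega>) :: ennreal) \<in> borel_measurable (gen J)" if "J \<subseteq> {1..}" for J
  proof -
    have "(\<lambda>\<omega>. f (X u \<omega>)) \<in> borel_measurable (gen J)" if "u \<in> J" for u
      by (rule measurable_compose[OF X_gen f]) (use that \<open>J \<subseteq> {1..}\<close> in auto)
    then show ?thesis by (rule borel_measurable_prod_ennreal)
  qed
  then show "(\<lambda>\<omega>. \<Prod>u\<in>J. f (X u \<omega>) :: ennreal) \<in> borel_measurable (gen J)" using assms by simp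
  show "(\<integral>\<^sup>+\<omega>. (\<Prod>u\<in>J. f (X u \<omega>) :: ennreal) \<partial>M) = (\<integral>\<^sup>+x. f x \<partial>P0) ^ card J"
    using assms(1,2)
  proof (induction J)
    case empty
    then show ?case by (simp add: emeasure_space_1)
  next
    case (insert j J)
    have "indep_var borel (\<lambda>\<omega>. f (X j \<omega>)) borel (\<lambda>\<omega>. \<Prod>u\<in>J. f (X u \<omega>))"
      using insert by (intro gen_indep_var[of "{j}" J] meas measurable_compose[OF X_gen f]) auto
    from indep_var_nn_integral[OF this] insert show ?case
      by (simp add: nn_integral_X[OF _ f])
  qed
qed

lemma nn_integral_prod_single:
  fixes f \<psi> :: "'a \<Rightarrow> ennreal"
  assumes I: "finite I" "I \<subseteq> {1..}" "t \<in> I" and f: "f \<in> borel_measurable P0" and psi: "\<psi> \<in> borel_measurable P0"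
  shows "(\<integral>\<^sup>+\<omega>. (\<Prod>u\<in>I. f (X u \<omega>)) * \<psi> (X t \<omega>) \<partial>M)
     = (\<integral>\<^sup>+x. f x \<partial>P0) ^ (card I - 1) * (\<integral>\<^sup>+x. f x * \<psi> x \<partial>P0)"
proof -
  note [measurable] = f psi
  have I': "1 \<le> t" "I - {t} \<subseteq> {1..}" using I by auto
  have [measurable]: "X t \<in> measurable (gen {t}) P0" using I by (auto intro!: X_gen)
  have "(\<lambda>\<omega>. f (X t \<omega>) * \<psi> (X t \<omega>)) \<in> borel_measurable (gen {t})" by measurable
  then have "indep_var borel (\<lambda>\<omega>. \<Prod>u\<in>I - {t}. f (X u \<omega>)) borel (\<lambda>\<omega>. f (X t \<omega>) * \<psi> (X t \<omega>))"
    using I by (intro gen_indep_var[of "I - {t}" "{t}"] nn_integral_prod f) auto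
  from indep_var_nn_integral[OF this]
  have "(\<integral>\<^sup>+\<omega>. (\<Prod>u\<in>I - {t}. f (X u \<omega>)) * (f (X t \<omega>) * \<psi> (X t \<omega>)) \<partial>M)
     = (\<integral>\<^sup>+x. f x \<partial>P0) ^ (card I - 1) * (\<integral>\<^sup>+x. f x * \<psi> x \<partial>P0)"
    using I(1,3) I' nn_integral_X[OF I'(1), of "\<lambda>x. f x * \<psi> x"] nn_integral_prod(2)[OF _ _ f, of "I - {t}"] by simp
  then show ?thesis
    using I by (subst prod.remove[of I t]) (auto simp: mult_ac)
qed

lemma nn_integral_prod_pair:
  fixes f :: "'a \<Rightarrow> ennreal" and \<psi> :: "'a \<times> 'a \<Rightarrow> ennreal"
  assumes I: "finite I" "I \<subseteq> {1..}" "t \<in> I" "s \<in> I" "s \<noteq> t" and f: "f \<in> borel_measurable P0"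
    and psi: "\<psi> \<in> borel_measurable (P0 \<Otimes>\<^sub>M P0)"
  shows "(\<integral>\<^sup>+\<omega>. (\<Prod>u\<in>I. f (X u \<omega>)) * \<psi> (X t \<omega>, X s \<omega>) \<partial>M)
     = (\<integral>\<^sup>+x. f x \<partial>P0) ^ (card I - 2) * (\<integral>\<^sup>+p. f (fst p) * f (snd p) * \<psi> p \<partial>(P0 \<Otimes>\<^sub>M P0))"
proof -
  note [measurable] = f psi
  have I': "1 \<le> t" "1 \<le> s" "I - {t, s} \<subseteq> {1..}" using I by auto
  have fp: "(\<lambda>p. f (fst p) * f (snd p) * \<psi> p) \<in> borel_measurable (P0 \<Otimes>\<^sub>M P0)" by measurable
  have [measurable]: "X t \<in> measurable (gen {t, s}) P0" "X s \<in> measurable (gen {t, s}) P0"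
    using I by (auto intro!: X_gen)
  have "(\<lambda>\<omega>. (X t \<omega>, X s \<omega>)) \<in> measurable (gen {t, s}) (P0 \<Otimes>\<^sub>M P0)" by measurable
  from measurable_compose[OF this fp]
  have "indep_var borel (\<lambda>\<omega>. \<Prod>u\<in>I - {t, s}. f (X u \<omega>)) borel (\<lambda>\<omega>. f (X t \<omega>) * f (X s \<omega>) * \<psi> (X t \<omega>, X s \<omega>))"
    using I by (intro gen_indep_var[of "I - {t, s}" "{t, s}"] nn_integral_prod f) auto
  from indep_var_nn_integral[OF this]
  have "(\<integral>\<^sup>+\<omega>. (\<Prod>u\<in>I - {t, s}. f (X u \<omega>)) * (f (X t \<omega>) * f (X s \<omega>) * \<psi> (X t \<omega>, X s \<omega>)) \<partial>M)
     = (\<integral>\<^sup>+x. f x \<partial>P0) ^ card (I - {t, s}) * (\<integral>\<^sup>+p. f (fst p) * f (snd p) * \<psi> p \<partial>(P0 \<Otimes>\<^sub>M P0))"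
    using I(1) I' nn_integral_pair[OF _ _ I(5) fp] nn_integral_prod(2)[OF _ _ f, of "I - {t, s}"] by simp
  moreover have "card (I - {t, s}) = card I - 2"
    using I by (subst card_Diff_subset) auto
  moreover have "(\<Prod>u\<in>I. f (X u \<omega>)) = f (X t \<omega>) * f (X s \<omega>) * (\<Prod>u\<in>I - {t, s}. f (X u \<omega>))" for \<omega>
  proof -
    have "I - {t, s} = I - {t} - {s}" by auto
    then show ?thesis
      using I by (simp add: prod.remove[of I t] prod.remove[of "I - {t}" s] mult.assoc)
  qed
  ultimately show ?thesis by (simp add: mult_ac)
qed

end

section \<open>Expansion of the likelihood ratio\<close>

text \<open>The elementary symmetric functions of degree one and two of \<open>y 1, ..., y n\<close>, and the sum of those
of degree at least three.  The recursion in \<open>n\<close> for the latter allows estimates without a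
summation over sets of coordinates.\<close>
primrec linear_part :: "(nat \<Rightarrow> real) \<Rightarrow> nat \<Rightarrow> real" where
  "linear_part y 0 = 0"
| "linear_part y (Suc n) = linear_part y n + y (Suc n)"

primrec quadratic_part :: "(nat \<Rightarrow> real) \<Rightarrow> nat \<Rightarrow> real" where
  "quadratic_part y 0 = 0"
| "quadratic_part y (Suc n) = quadratic_part y n + linear_part y n * y (Suc n)"

primrec higher_part :: "(nat \<Rightarrow> real) \<Rightarrow> nat \<Rightarrow> real" where
  "higher_part y 0 = 0"
| "higher_part y (Suc n) = higher_part y n * (1 + y (Suc n)) + quadratic_part y n * y (Suc n)"

lemma prod_one_plus_expansion:
  "(\<Prod>t=1..n. 1 + y t) = 1 + linear_part y n + quadratic_part y n + higher_part y n"
  by (induction n) (simp_all add: algebra_simps)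

lemma linear_part_eq_sum: "linear_part y n = (\<Sum>t<n. y (Suc t))"
  by (induction n) simp_all

lemma quadratic_part_eq_sum:
  "2 * quadratic_part y n = (\<Sum>t<n. \<Sum>s<n. if s = t then 0 else y (Suc t) * y (Suc s))"
proof (induction n)
  case (Suc n)
  have 1: "(\<Sum>s<n. if s = n then 0 else y (Suc n) * y (Suc s)) = y (Suc n) * linear_part y n"
    by (simp add: linear_part_eq_sum sum_distrib_left)
  have 2: "(\<Sum>t<n. if n = t then 0 else y (Suc t) * y (Suc n)) = y (Suc n) * linear_part y n"
    by (simp add: linear_part_eq_sum sum_distrib_left mult.commute)
  have "(\<Sum>t<Suc n. \<Sum>s<Suc n. if s = t then 0 else y (Suc t) * y (Suc s))
    = 2 * quadratic_part y n + 2 * (y (Suc n) * linear_part y n)"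
    using Suc 1 2 by (simp add: sum.distrib)
  then show ?case by (simp add: algebra_simps)
qed simp

section \<open>Double series\<close>

lemma summable_double_of_bounded:
  fixes w :: "nat \<Rightarrow> nat \<Rightarrow> real"
  assumes w0: "\<And>t s. 0 \<le> w t s" and bd: "\<And>N. (\<Sum>t<N. \<Sum>s<N. w t s) \<le> B"
  shows "summable (w t)" and "summable (\<lambda>t. \<Sum>s. w t s)" and "(\<Sum>t. \<Sum>s. w t s) \<le> B"
proof -
  have part: "(\<Sum>t<N. \<Sum>s<n. w t s) \<le> B" for N n
  proof -
    have "(\<Sum>t<N. \<Sum>s<n. w t s) \<le> (\<Sum>t<max N n. \<Sum>s<max N n. w t s)"
      by (intro order.trans[OF sum_mono[OF sum_mono2] sum_mono2]) (auto intro!: sum_nonneg w0)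
    then show ?thesis using bd[of "max N n"] by linarith
  qed
  have sm: "summable (w t)" for t
  proof (rule summableI_nonneg_bounded)
    fix n
    have "(\<Sum>s<n. w t s) \<le> (\<Sum>t<Suc t. \<Sum>s<n. w t s)"
      by (rule member_le_sum[of t "{..<Suc t}" "\<lambda>t. \<Sum>s<n. w t s"]) (auto intro!: sum_nonneg w0)
    then show "(\<Sum>s<n. w t s) \<le> B" using part[of n "Suc t"] by linarith
  qed (rule w0)
  then show "summable (w t)" .
  have le: "(\<Sum>t<N. \<Sum>s. w t s) \<le> B" for N
  proof -
    have "(\<Sum>t<N. \<Sum>s. w t s) = (\<Sum>s. \<Sum>t<N. w t s)" by (intro suminf_sum[symmetric] sm)
    also have "\<dots> \<le> B"
      using part[of _ N] by (intro suminf_le_const summable_sum sm) (subst sum.swap, auto)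
    finally show ?thesis .
  qed
  show sm2: "summable (\<lambda>t. \<Sum>s. w t s)"
    by (rule summableI_nonneg_bounded[OF _ le]) (intro suminf_nonneg sm w0)
  show "(\<Sum>t. \<Sum>s. w t s) \<le> B" by (rule suminf_le_const[OF sm2 le])
qed

text \<open>Iterated series are used, and not sums over pairs, because this is how the second order
kernel is summed.\<close>
lemma integral_double_suminf:
  fixes f :: "nat \<Rightarrow> nat \<Rightarrow> 'b \<Rightarrow> real"
  assumes int: "\<And>t s. integrable M (f t s)"
    and bd: "\<And>t s. (\<integral>x. \<bar>f t s x\<bar> \<partial>M) \<le> w t s"
    and w: "\<And>t. summable (w t)" "summable (\<lambda>t. \<Sum>s. w t s)"
    and ae: "AE x in M. (\<forall>t. summable (\<lambda>s. \<bar>f t s x\<bar>)) \<and> summable (\<lambda>t. \<Sum>s. \<bar>f t s x\<bar>)"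
  shows "integrable M (\<lambda>x. \<Sum>t. \<Sum>s. f t s x)"
    and "(\<integral>x. (\<Sum>t. \<Sum>s. f t s x) \<partial>M) = (\<Sum>t. \<Sum>s. \<integral>x. f t s x \<partial>M)"
proof -
  have i0: "0 \<le> (\<integral>x. \<bar>f t s x\<bar> \<partial>M)" for t s by (intro Bochner_Integration.integral_nonneg) simp
  have sm: "summable (\<lambda>s. \<integral>x. \<bar>f t s x\<bar> \<partial>M)" for t
    by (rule summable_comparison_test[OF _ w(1)[of t]]) (use bd i0 in auto)
  have ae1: "AE x in M. summable (\<lambda>s. \<bar>f t s x\<bar>)" for t using ae by eventually_elim auto
  have F: "integrable M (\<lambda>x. \<Sum>s. f t s x)" "(\<integral>x. (\<Sum>s. f t s x) \<partial>M) = (\<Sum>s. \<integral>x. f t s x \<partial>M)" for t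
    using integrable_suminf[OF int[of t]] integral_suminf[OF int[of t]] ae1[of t] sm[of t] by auto
  have A: "integrable M (\<lambda>x. \<Sum>s. \<bar>f t s x\<bar>)" "(\<integral>x. (\<Sum>s. \<bar>f t s x\<bar>) \<partial>M) = (\<Sum>s. \<integral>x. \<bar>f t s x\<bar> \<partial>M)" for t
    using integrable_suminf[OF integrable_abs[OF int[of t]]] integral_suminf[OF integrable_abs[OF int[of t]]]
      ae1[of t] sm[of t] by auto
  have ae2: "AE x in M. \<bar>\<Sum>s. f t s x\<bar> \<le> (\<Sum>s. \<bar>f t s x\<bar>)" for t
    using ae1[of t] by eventually_elim (rule summable_rabs)
  have "(\<integral>x. \<bar>\<Sum>s. f t s x\<bar> \<partial>M) \<le> (\<Sum>s. w t s)" for t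
  proof -
    have "(\<integral>x. \<bar>\<Sum>s. f t s x\<bar> \<partial>M) \<le> (\<integral>x. (\<Sum>s. \<bar>f t s x\<bar>) \<partial>M)"
      by (intro integral_mono_AE integrable_abs F A ae2)
    also have "\<dots> \<le> (\<Sum>s. w t s)" unfolding A(2) by (intro suminf_le bd sm w)
    finally show ?thesis .
  qed
  then have sm2: "summable (\<lambda>t. \<integral>x. \<bar>\<Sum>s. f t s x\<bar> \<partial>M)"
    by (intro summable_comparison_test[OF _ w(2)]) auto
  have ae3: "AE x in M. summable (\<lambda>t. \<bar>\<Sum>s. f t s x\<bar>)"
    using ae
  proof eventually_elim
    case (elim x)
    show ?case
      by (rule summable_comparison_test[of _ "\<lambda>t. \<Sum>s. \<bar>f t s x\<bar>"]) (use elim in \<open>auto intro!: summable_rabs\<close>)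
  qed
  show "integrable M (\<lambda>x. \<Sum>t. \<Sum>s. f t s x)"
    "(\<integral>x. (\<Sum>t. \<Sum>s. f t s x) \<partial>M) = (\<Sum>t. \<Sum>s. \<integral>x. f t s x \<partial>M)"
    using integrable_suminf[OF F(1)] integral_suminf[OF F(1)] ae3 sm2 F(2) by auto
qed

lemma nn_bound_imp_integrable:
  fixes f :: "'b \<Rightarrow> real"
  assumes [measurable]: "f \<in> borel_measurable M" and bd: "(\<integral>\<^sup>+x. ennreal \<bar>f x\<bar> \<partial>M) \<le> ennreal C" and "0 \<le> C"
  shows "integrable M f" and "(\<integral>x. \<bar>f x\<bar> \<partial>M) \<le> C"
proof -
  show int: "integrable M f"
    unfolding integrable_iff_bounded using bd by (auto simp: le_less_trans)
  have "ennreal (\<integral>x. \<bar>f x\<bar> \<partial>M) \<le> ennreal C"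
    using bd nn_integral_eq_integral[OF integrable_abs[OF int]] by simp
  then show "(\<integral>x. \<bar>f x\<bar> \<partial>M) \<le> C" using \<open>0 \<le> C\<close> by (simp add: ennreal_le_iff)
qed

section \<open>The first two terms of the expansion\<close>

text \<open>What the two sets of conditions on time and cost have in common.  The cost on \<open>t \<le> \<tau>\<close>, tested
against functions of \<open>X t\<close>, is dominated by the weight \<open>a\<close> with a constant \<open>w t t\<close>; likewise for
pairs of times, with constants \<open>w t s\<close> that are summable over all pairs.  The constant \<open>c\<close> serves
the kernels with the minimum of the two times, whose bounds do not decay.\<close>
locale dominated_cost = cost_model M P0 X \<tau> h
  for M :: "'w measure" and P0 :: "'a measure" and X \<tau> h +
  fixes a :: "'a \<Rightarrow> real" and w :: "nat \<Rightarrow> nat \<Rightarrow> real" and B c :: real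
  assumes a_measurable [measurable]: "a \<in> borel_measurable P0"
    and a_ge_1: "1 \<le> a x"
    and a_integrable: "integrable P0 a"
    and w_nonneg: "0 \<le> w t s"
    and w_sum: "(\<Sum>t<N. \<Sum>s<N. w (Suc t) (Suc s)) \<le> B"
    and c_nonneg: "0 \<le> c"
    and dominated_single: "\<lbrakk>1 \<le> t; \<psi> \<in> borel_measurable P0\<rbrakk> \<Longrightarrow>
      (\<integral>\<^sup>+\<omega>. ennreal \<bar>H \<omega>\<bar> * indicator {\<omega>. t \<le> \<tau> \<omega>} \<omega> * \<psi> (X t \<omega>) \<partial>M)
        \<le> ennreal (w t t) * (\<integral>\<^sup>+x. ennreal (a x) * \<psi> x \<partial>P0)"
    and dominated_pair: "\<lbrakk>1 \<le> t; 1 \<le> s; s \<noteq> t; \<Psi> \<in> borel_measurable (P0 \<Otimes>\<^sub>M P0)\<rbrakk> \<Longrightarrow>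
      (\<integral>\<^sup>+\<omega>. ennreal \<bar>H \<omega>\<bar> * indicator {\<omega>. max t s \<le> \<tau> \<omega>} \<omega> * \<Psi> (X t \<omega>, X s \<omega>) \<partial>M)
        \<le> ennreal (w t s) * (\<integral>\<^sup>+p. ennreal (a (fst p)) * ennreal (a (snd p)) * \<Psi> p \<partial>(P0 \<Otimes>\<^sub>M P0))"
    and dominated_any_pair: "\<lbrakk>1 \<le> t; 1 \<le> s; s \<noteq> t; \<Psi> \<in> borel_measurable (P0 \<Otimes>\<^sub>M P0)\<rbrakk> \<Longrightarrow>
      (\<integral>\<^sup>+\<omega>. ennreal \<bar>H \<omega>\<bar> * \<Psi> (X t \<omega>, X s \<omega>) \<partial>M)
        \<le> ennreal c * (\<integral>\<^sup>+p. ennreal (a (fst p)) * ennreal (a (snd p)) * \<Psi> p \<partial>(P0 \<Otimes>\<^sub>M P0))"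
begin

lemma a_nonneg: "0 \<le> a x" using a_ge_1[of x] by linarith

lemma tau_indicator_measurable [measurable]:
  "(\<lambda>\<omega>. indicator {\<omega>. t \<le> \<tau> \<omega>} \<omega> :: real) \<in> borel_measurable M"
  "(\<lambda>\<omega>. indicator {\<omega>. t \<le> \<tau> \<omega>} \<omega> :: ennreal) \<in> borel_measurable M"
proof -
  have "{\<omega> \<in> space M. \<omega> \<in> {\<omega>. t \<le> \<tau> \<omega>}} \<in> sets M" by measurable
  then show "(\<lambda>\<omega>. indicator {\<omega>. t \<le> \<tau> \<omega>} \<omega> :: real) \<in> borel_measurable M"
  "(\<lambda>\<omega>. indicator {\<omega>. t \<le> \<tau> \<omega>} \<omega> :: ennreal) \<in> borel_measurable M"
    by (intro borel_measurable_indicator'; simp)+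
qed

lemma single_term:
  assumes t: "1 \<le> t" and [measurable]: "u \<in> borel_measurable P0" and u: "integrable P0 (\<lambda>x. a x * \<bar>u x\<bar>)"
  shows "integrable M (\<lambda>\<omega>. u (X t \<omega>) * (H \<omega> * indicator {\<omega>. t \<le> \<tau> \<omega>} \<omega>))"
    and "(\<integral>\<omega>. \<bar>u (X t \<omega>) * (H \<omega> * indicator {\<omega>. t \<le> \<tau> \<omega>} \<omega>)\<bar> \<partial>M) \<le> w t t * (\<integral>x. a x * \<bar>u x\<bar> \<partial>P0)"
proof -
  note [measurable] = X_measurable[OF t]
  have nn: "0 \<le> (\<integral>x. a x * \<bar>u x\<bar> \<partial>P0)" using a_nonneg by (intro Bochner_Integration.integral_nonneg) auto
  have "(\<integral>\<^sup>+\<omega>. ennreal \<bar>u (X t \<omega>) * (H \<omega> * indicator {\<omega>. t \<le> \<tau> \<omega>} \<omega>)\<bar> \<partial>M)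
     = (\<integral>\<^sup>+\<omega>. ennreal \<bar>H \<omega>\<bar> * indicator {\<omega>. t \<le> \<tau> \<omega>} \<omega> * ennreal \<bar>u (X t \<omega>)\<bar> \<partial>M)"
    by (intro nn_integral_cong) (auto simp: abs_mult ennreal_mult' mult_ac split: split_indicator)
  also have "\<dots> \<le> ennreal (w t t) * (\<integral>\<^sup>+x. ennreal (a x) * ennreal \<bar>u x\<bar> \<partial>P0)"
    using dominated_single[OF t, of "\<lambda>x. ennreal \<bar>u x\<bar>"] by simp
  also have "(\<integral>\<^sup>+x. ennreal (a x) * ennreal \<bar>u x\<bar> \<partial>P0) = ennreal (\<integral>x. a x * \<bar>u x\<bar> \<partial>P0)"
    using nn_integral_eq_integral[OF u] a_nonneg by (simp add: ennreal_mult')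
  finally have le: "(\<integral>\<^sup>+\<omega>. ennreal \<bar>u (X t \<omega>) * (H \<omega> * indicator {\<omega>. t \<le> \<tau> \<omega>} \<omega>)\<bar> \<partial>M)
     \<le> ennreal (w t t * (\<integral>x. a x * \<bar>u x\<bar> \<partial>P0))" using w_nonneg by (simp add: ennreal_mult')
  show "integrable M (\<lambda>\<omega>. u (X t \<omega>) * (H \<omega> * indicator {\<omega>. t \<le> \<tau> \<omega>} \<omega>))"
    "(\<integral>\<omega>. \<bar>u (X t \<omega>) * (H \<omega> * indicator {\<omega>. t \<le> \<tau> \<omega>} \<omega>)\<bar> \<partial>M) \<le> w t t * (\<integral>x. a x * \<bar>u x\<bar> \<partial>P0)"
    by (rule nn_bound_imp_integrable[OF _ le]; use w_nonneg nn in simp)+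
qed

lemma H_integrable: "integrable M H"
proof -
  have "integrable M (\<lambda>\<omega>. 1 * (H \<omega> * indicator {\<omega>. 1 \<le> \<tau> \<omega>} \<omega>))"
    using single_term(1)[of 1 "\<lambda>_. 1"] a_integrable a_nonneg by simp
  then show ?thesis
    by (rule integrable_cong_AE_imp) (use tau_ge_1 in \<open>auto intro!: AE_I2\<close>)
qed

lemma H_indicator_integrable: "integrable M (\<lambda>\<omega>. H \<omega> * indicator {\<omega>. t \<le> \<tau> \<omega>} \<omega>)"
  by (rule Bochner_Integration.integrable_bound[OF H_integrable]) (auto split: split_indicator)

lemma pair_norm_integral:
  assumes [measurable]: "u \<in> borel_measurable P0" "v \<in> borel_measurable P0"
    and u: "integrable P0 (\<lambda>x. a x * \<bar>u x\<bar>)" and v: "integrable P0 (\<lambda>x. a x * \<bar>v x\<bar>)"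
  shows "(\<integral>\<^sup>+p. ennreal (a (fst p)) * ennreal (a (snd p)) * ennreal \<bar>u (fst p) * v (snd p)\<bar> \<partial>(P0 \<Otimes>\<^sub>M P0))
     = ennreal ((\<integral>x. a x * \<bar>u x\<bar> \<partial>P0) * (\<integral>x. a x * \<bar>v x\<bar> \<partial>P0))"
proof -
  note pp = integral_pair_product[OF P.prob_space_axioms u v]
  have "(\<integral>\<^sup>+p. ennreal (a (fst p)) * ennreal (a (snd p)) * ennreal \<bar>u (fst p) * v (snd p)\<bar> \<partial>(P0 \<Otimes>\<^sub>M P0))
    = (\<integral>\<^sup>+p. ennreal (case p of (x, y) \<Rightarrow> (a x * \<bar>u x\<bar>) * (a y * \<bar>v y\<bar>)) \<partial>(P0 \<Otimes>\<^sub>M P0))"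
    using a_nonneg by (intro nn_integral_cong) (auto simp: abs_mult ennreal_mult' mult_ac split_beta)
  also have "\<dots> = ennreal ((\<integral>x. a x * \<bar>u x\<bar> \<partial>P0) * (\<integral>x. a x * \<bar>v x\<bar> \<partial>P0))"
    using nn_integral_eq_integral[OF pp(1)] a_nonneg by (simp add: pp(2) split_beta)
  finally show ?thesis .
qed

lemma pair_term:
  assumes t: "1 \<le> t" "1 \<le> s" "s \<noteq> t" and [measurable]: "u \<in> borel_measurable P0" "v \<in> borel_measurable P0"
    and u: "integrable P0 (\<lambda>x. a x * \<bar>u x\<bar>)" and v: "integrable P0 (\<lambda>x. a x * \<bar>v x\<bar>)"
  shows "integrable M (\<lambda>\<omega>. u (X t \<omega>) * v (X s \<omega>) * (H \<omega> * indicator {\<omega>. max t s \<le> \<tau> \<omega>} \<omega>))"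
    and "(\<integral>\<omega>. \<bar>u (X t \<omega>) * v (X s \<omega>) * (H \<omega> * indicator {\<omega>. max t s \<le> \<tau> \<omega>} \<omega>)\<bar> \<partial>M)
      \<le> w t s * ((\<integral>x. a x * \<bar>u x\<bar> \<partial>P0) * (\<integral>x. a x * \<bar>v x\<bar> \<partial>P0))"
    and "integrable M (\<lambda>\<omega>. u (X t \<omega>) * v (X s \<omega>) * (H \<omega> * indicator {\<omega>. m \<le> \<tau> \<omega>} \<omega>))"
proof -
  note [measurable] = X_measurable[OF t(1)] X_measurable[OF t(2)]
  have nn: "0 \<le> (\<integral>x. a x * \<bar>u x\<bar> \<partial>P0) * (\<integral>x. a x * \<bar>v x\<bar> \<partial>P0)"
    using a_nonneg by (intro mult_nonneg_nonneg Bochner_Integration.integral_nonneg) auto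
  have "(\<integral>\<^sup>+\<omega>. ennreal \<bar>u (X t \<omega>) * v (X s \<omega>) * (H \<omega> * indicator {\<omega>. max t s \<le> \<tau> \<omega>} \<omega>)\<bar> \<partial>M)
     = (\<integral>\<^sup>+\<omega>. ennreal \<bar>H \<omega>\<bar> * indicator {\<omega>. max t s \<le> \<tau> \<omega>} \<omega> * ennreal \<bar>u (X t \<omega>) * v (X s \<omega>)\<bar> \<partial>M)"
    by (intro nn_integral_cong) (auto simp: abs_mult ennreal_mult' mult_ac split: split_indicator)
  also have "\<dots> \<le> ennreal (w t s * ((\<integral>x. a x * \<bar>u x\<bar> \<partial>P0) * (\<integral>x. a x * \<bar>v x\<bar> \<partial>P0)))"
    using dominated_pair[OF t, of "\<lambda>p. ennreal \<bar>u (fst p) * v (snd p)\<bar>"] w_nonneg[of t s]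
    by (simp add: pair_norm_integral[OF _ _ u v] ennreal_mult')
  finally have le: "(\<integral>\<^sup>+\<omega>. ennreal \<bar>u (X t \<omega>) * v (X s \<omega>) * (H \<omega> * indicator {\<omega>. max t s \<le> \<tau> \<omega>} \<omega>)\<bar> \<partial>M)
     \<le> ennreal (w t s * ((\<integral>x. a x * \<bar>u x\<bar> \<partial>P0) * (\<integral>x. a x * \<bar>v x\<bar> \<partial>P0)))" .
  show "integrable M (\<lambda>\<omega>. u (X t \<omega>) * v (X s \<omega>) * (H \<omega> * indicator {\<omega>. max t s \<le> \<tau> \<omega>} \<omega>))"
    "(\<integral>\<omega>. \<bar>u (X t \<omega>) * v (X s \<omega>) * (H \<omega> * indicator {\<omega>. max t s \<le> \<tau> \<omega>} \<omega>)\<bar> \<partial>M)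
      \<le> w t s * ((\<integral>x. a x * \<bar>u x\<bar> \<partial>P0) * (\<integral>x. a x * \<bar>v x\<bar> \<partial>P0))"
    by (rule nn_bound_imp_integrable[OF _ le]; use w_nonneg nn in simp)+
  have "(\<integral>\<^sup>+\<omega>. ennreal \<bar>u (X t \<omega>) * v (X s \<omega>) * (H \<omega> * indicator {\<omega>. m \<le> \<tau> \<omega>} \<omega>)\<bar> \<partial>M)
     \<le> (\<integral>\<^sup>+\<omega>. ennreal \<bar>H \<omega>\<bar> * ennreal \<bar>u (X t \<omega>) * v (X s \<omega>)\<bar> \<partial>M)"
    by (intro nn_integral_mono) (auto simp: abs_mult ennreal_mult' mult_ac split: split_indicator)
  also have "\<dots> \<le> ennreal (c * ((\<integral>x. a x * \<bar>u x\<bar> \<partial>P0) * (\<integral>x. a x * \<bar>v x\<bar> \<partial>P0)))"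
    using dominated_any_pair[OF t, of "\<lambda>p. ennreal \<bar>u (fst p) * v (snd p)\<bar>"] c_nonneg
    by (simp add: pair_norm_integral[OF _ _ u v] ennreal_mult')
  finally show "integrable M (\<lambda>\<omega>. u (X t \<omega>) * v (X s \<omega>) * (H \<omega> * indicator {\<omega>. m \<le> \<tau> \<omega>} \<omega>))"
    by (rule nn_bound_imp_integrable[rotated]) (use c_nonneg nn in simp_all)
qed

lemma w_summable:
  "summable (\<lambda>s. w (Suc t) (Suc s))" "summable (\<lambda>t. \<Sum>s. w (Suc t) (Suc s))"
  "(\<Sum>t. \<Sum>s. w (Suc t) (Suc s)) \<le> B"
  using summable_double_of_bounded[of "\<lambda>t s. w (Suc t) (Suc s)" B] w_nonneg w_sum by auto

lemma w_diagonal_summable: "summable (\<lambda>t. w (Suc t) (Suc t))" "(\<Sum>t. w (Suc t) (Suc t)) \<le> B"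
proof -
  have le: "w (Suc t) (Suc t) \<le> (\<Sum>s. w (Suc t) (Suc s))" for t
    using sum_le_suminf[OF w_summable(1)[of t], of "{t}"] w_nonneg by simp
  show sm: "summable (\<lambda>t. w (Suc t) (Suc t))"
    by (rule summable_comparison_test[OF _ w_summable(2)]) (use le w_nonneg in auto)
  show "(\<Sum>t. w (Suc t) (Suc t)) \<le> B"
    using suminf_le[OF le sm w_summable(2)] w_summable(3) by linarith
qed

lemma B_nonneg: "0 \<le> B" using w_sum[of 0] by simp

end

text \<open>An instance of Tannery's theorem.\<close>
lemma square_partial_sums_tendsto:
  fixes b w :: "nat \<Rightarrow> nat \<Rightarrow> real"
  assumes bd: "\<And>t s. \<bar>b t s\<bar> \<le> w t s"
    and w: "\<And>t. summable (w t)" "summable (\<lambda>t. \<Sum>s. w t s)"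
  shows "(\<lambda>N. \<Sum>t<N. \<Sum>s<N. b t s) \<longlonglongrightarrow> (\<Sum>t. \<Sum>s. b t s)"
proof -
  define A where "A = (\<lambda>k N. if k < N then \<Sum>s<N. b k s else 0)"
  have w0: "0 \<le> w t s" for t s using bd[of t s] by linarith
  have sm: "summable (b t)" for t
    by (rule summable_comparison_test[OF _ w(1)[of t]]) (use bd in auto)
  have lim: "(\<lambda>N. A k N) \<longlonglongrightarrow> (\<Sum>s. b k s)" for k
  proof (rule Lim_transform_eventually)
    show "(\<lambda>N. \<Sum>s<N. b k s) \<longlonglongrightarrow> (\<Sum>s. b k s)" using sm by (rule summable_LIMSEQ)
    show "\<forall>\<^sub>F N in sequentially. (\<Sum>s<N. b k s) = A k N"
      using eventually_gt_at_top[of k] by eventually_elim (simp add: A_def)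
  qed
  have Abd: "norm (A k N) \<le> (\<Sum>s. w k s)" for k N
  proof -
    have "\<bar>\<Sum>s<N. b k s\<bar> \<le> (\<Sum>s<N. w k s)" by (intro order.trans[OF sum_abs] sum_mono bd)
    also have "\<dots> \<le> (\<Sum>s. w k s)" by (intro sum_le_suminf w) (auto intro: w0)
    finally show ?thesis using suminf_nonneg[OF w(1) w0] by (auto simp: A_def)
  qed
  have "(\<lambda>N. \<Sum>k. A k N) \<longlonglongrightarrow> (\<Sum>k. \<Sum>s. b k s)"
    using tannerys_theorem[of A "\<lambda>k. \<Sum>s. b k s" sequentially "\<lambda>k. \<Sum>s. w k s", OF lim _ w(2)] Abd
    by (auto simp: case_prod_unfold)
  moreover have "(\<Sum>k. A k N) = (\<Sum>t<N. \<Sum>s<N. b t s)" for N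
    by (subst suminf_finite[of "{..<N}"]) (auto simp: A_def)
  ultimately show ?thesis by simp
qed

locale expanded_cost = dominated_cost M P0 X \<tau> h a w B c
  for M :: "'w measure" and P0 :: "'a measure" and X \<tau> h a w B c +
  fixes g :: "nat \<Rightarrow> 'a \<Rightarrow> real" and G :: "nat \<Rightarrow> nat \<Rightarrow> 'a \<Rightarrow> 'a \<Rightarrow> real"
  assumes first_order: "first_order_kernel M P0 X \<tau> h g"
    and second_order: "second_order_kernel max M P0 X \<tau> h G"
begin

lemma g_version: "1 \<le> t \<Longrightarrow>
   cond_exp_version M (\<lambda>\<omega>. H \<omega> * indicator {\<omega>. t \<le> \<tau> \<omega>} \<omega>) P0 (X t) (g t)"
  using first_order by (simp add: first_order_kernel_def)

lemma G_version: "\<lbrakk>1 \<le> t; 1 \<le> s; s \<noteq> t\<rbrakk> \<Longrightarrow>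
   cond_exp_version M (\<lambda>\<omega>. H \<omega> * indicator {\<omega>. max t s \<le> \<tau> \<omega>} \<omega>) (P0 \<Otimes>\<^sub>M P0)
     (\<lambda>\<omega>. (X t \<omega>, X s \<omega>)) (\<lambda>(x, y). G t s x y)"
  using second_order by (simp add: second_order_kernel_def)

lemma g_measurable: "1 \<le> t \<Longrightarrow> g t \<in> borel_measurable P0"
  using g_version[of t] by (simp add: cond_exp_version_def)

lemma G_measurable: "\<lbrakk>1 \<le> t; 1 \<le> s; s \<noteq> t\<rbrakk> \<Longrightarrow> (\<lambda>(x, y). G t s x y) \<in> borel_measurable (P0 \<Otimes>\<^sub>M P0)"
  using G_version[of t s] by (simp add: cond_exp_version_def)

lemma g_bound:
  assumes t: "1 \<le> t"
  shows "AE x in P0. \<bar>g t x\<bar> \<le> w t t * a x"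
proof (rule cond_exp_version_bound[OF prob_space_axioms X_measurable[OF t] X_distr[OF t] H_indicator_integrable g_version[OF t]])
  show "integrable P0 (\<lambda>x. w t t * a x)" using a_integrable by simp
  show "0 \<le> w t t * a x" for x using w_nonneg a_nonneg by simp
  fix A assume [measurable]: "A \<in> sets P0"
  have "(\<integral>\<^sup>+\<omega>. ennreal \<bar>H \<omega> * indicator {\<omega>. t \<le> \<tau> \<omega>} \<omega>\<bar> * indicator A (X t \<omega>) \<partial>M)
    = (\<integral>\<^sup>+\<omega>. ennreal \<bar>H \<omega>\<bar> * indicator {\<omega>. t \<le> \<tau> \<omega>} \<omega> * indicator A (X t \<omega>) \<partial>M)"
    by (intro nn_integral_cong) (auto split: split_indicator)
  also have "\<dots> \<le> ennreal (w t t) * (\<integral>\<^sup>+x. ennreal (a x) * indicator A x \<partial>P0)"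
    by (rule dominated_single[OF t]) simp
  also have "\<dots> = (\<integral>\<^sup>+x. ennreal (w t t * a x) * indicator A x \<partial>P0)"
    using w_nonneg a_nonneg by (simp add: nn_integral_cmult[symmetric] ennreal_mult' mult.assoc)
  finally show "(\<integral>\<^sup>+\<omega>. ennreal \<bar>H \<omega> * indicator {\<omega>. t \<le> \<tau> \<omega>} \<omega>\<bar> * indicator A (X t \<omega>) \<partial>M)
    \<le> (\<integral>\<^sup>+x. ennreal (w t t * a x) * indicator A x \<partial>P0)" .
qed

lemma G_bound:
  assumes t: "1 \<le> t" "1 \<le> s" "s \<noteq> t"
  shows "AE p in P0 \<Otimes>\<^sub>M P0. \<bar>case p of (x, y) \<Rightarrow> G t s x y\<bar> \<le> w t s * (a (fst p) * a (snd p))"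
proof (rule cond_exp_version_bound[OF prob_space_axioms pair_measurable[OF t(1,2)] pair_distr[OF t] H_indicator_integrable G_version[OF t]])
  show "integrable (P0 \<Otimes>\<^sub>M P0) (\<lambda>p. w t s * (a (fst p) * a (snd p)))"
    using integral_pair_product(1)[OF P.prob_space_axioms a_integrable a_integrable] by (simp add: case_prod_unfold)
  show "0 \<le> w t s * (a (fst p) * a (snd p))" for p using w_nonneg a_nonneg by simp
  fix A assume [measurable]: "A \<in> sets (P0 \<Otimes>\<^sub>M P0)"
  have "(\<integral>\<^sup>+\<omega>. ennreal \<bar>H \<omega> * indicator {\<omega>. max t s \<le> \<tau> \<omega>} \<omega>\<bar> * indicator A (X t \<omega>, X s \<omega>) \<partial>M)
    = (\<integral>\<^sup>+\<omega>. ennreal \<bar>H \<omega>\<bar> * indicator {\<omega>. max t s \<le> \<tau> \<omega>} \<omega> * indicator A (X t \<omega>, X s \<omega>) \<partial>M)"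
    by (intro nn_integral_cong) (auto split: split_indicator)
  also have "\<dots> \<le> ennreal (w t s) * (\<integral>\<^sup>+p. ennreal (a (fst p)) * ennreal (a (snd p)) * indicator A p \<partial>(P0 \<Otimes>\<^sub>M P0))"
    by (rule dominated_pair[OF t]) simp
  also have "\<dots> = (\<integral>\<^sup>+p. ennreal (w t s * (a (fst p) * a (snd p))) * indicator A p \<partial>(P0 \<Otimes>\<^sub>M P0))"
    using w_nonneg a_nonneg by (simp add: nn_integral_cmult[symmetric] ennreal_mult' mult.assoc)
  finally show "(\<integral>\<^sup>+\<omega>. ennreal \<bar>H \<omega> * indicator {\<omega>. max t s \<le> \<tau> \<omega>} \<omega>\<bar> * indicator A (X t \<omega>, X s \<omega>) \<partial>M)
    \<le> (\<integral>\<^sup>+p. ennreal (w t s * (a (fst p) * a (snd p))) * indicator A p \<partial>(P0 \<Otimes>\<^sub>M P0))" .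
qed

lemma g_sum_measurable [measurable]: "g_sum g \<in> borel_measurable P0"
proof -
  have [measurable]: "g (Suc t) \<in> borel_measurable P0" for t by (rule g_measurable) simp
  show ?thesis unfolding g_sum_def[abs_def] by measurable
qed

lemma G_term_measurable [measurable]:
  "(\<lambda>p. if s = t then 0 else G (Suc t) (Suc s) (fst p) (snd p)) \<in> borel_measurable (P0 \<Otimes>\<^sub>M P0)"
  using G_measurable[of "Suc t" "Suc s"] by (cases "s = t") (auto simp: case_prod_unfold)

lemma G_sum_measurable: "(\<lambda>(x, y). G_sum G x y) \<in> borel_measurable (P0 \<Otimes>\<^sub>M P0)"
  unfolding G_sum_def case_prod_unfold by measurable

lemma g_bound_all: "AE x in P0. \<forall>t. \<bar>g (Suc t) x\<bar> \<le> w (Suc t) (Suc t) * a x"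
  unfolding AE_all_countable by (intro allI g_bound) simp

lemma G_bound_all:
  "AE p in P0 \<Otimes>\<^sub>M P0. \<forall>t s. \<bar>if s = t then 0 else G (Suc t) (Suc s) (fst p) (snd p)\<bar>
     \<le> w (Suc t) (Suc s) * (a (fst p) * a (snd p))"
  unfolding AE_all_countable
proof (intro allI)
  fix t s
  show "AE p in P0 \<Otimes>\<^sub>M P0. \<bar>if s = t then 0 else G (Suc t) (Suc s) (fst p) (snd p)\<bar>
     \<le> w (Suc t) (Suc s) * (a (fst p) * a (snd p))"
    using G_bound[of "Suc t" "Suc s"] w_nonneg a_nonneg by (cases "s = t") (auto simp: case_prod_unfold)
qed

lemma g_sum_bound: "AE x in P0. \<bar>g_sum g x\<bar> \<le> B * a x"
  using g_bound_all
proof eventually_elim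
  case (elim x)
  have sm: "summable (\<lambda>t. w (Suc t) (Suc t) * a x)" using w_diagonal_summable by (intro summable_mult2)
  have sg: "summable (\<lambda>t. \<bar>g (Suc t) x\<bar>)"
    by (rule summable_comparison_test[OF _ sm]) (use elim in auto)
  have "\<bar>g_sum g x\<bar> \<le> (\<Sum>t. \<bar>g (Suc t) x\<bar>)" unfolding g_sum_def by (rule summable_rabs[OF sg])
  also have "\<dots> \<le> (\<Sum>t. w (Suc t) (Suc t) * a x)" by (intro suminf_le sg sm) (use elim in auto)
  also have "\<dots> = (\<Sum>t. w (Suc t) (Suc t)) * a x" by (intro suminf_mult2[symmetric] w_diagonal_summable)
  also have "\<dots> \<le> B * a x" using w_diagonal_summable a_nonneg by (intro mult_right_mono)
  finally show ?case .
qed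

lemma G_sum_bound: "AE p in P0 \<Otimes>\<^sub>M P0. \<bar>case p of (x, y) \<Rightarrow> G_sum G x y\<bar> \<le> B * (a (fst p) * a (snd p))"
  using G_bound_all
proof eventually_elim
  case (elim p)
  let ?G = "\<lambda>t s. if s = t then 0 else G (Suc t) (Suc s) (fst p) (snd p)"
  define aa where "aa = a (fst p) * a (snd p)"
  have aa: "0 \<le> aa" unfolding aa_def using a_nonneg by simp
  have le: "\<bar>?G t s\<bar> \<le> w (Suc t) (Suc s) * aa" for t s using elim unfolding aa_def by blast
  have sw: "summable (\<lambda>s. w (Suc t) (Suc s) * aa)" for t using w_summable(1) by (intro summable_mult2)
  have ww: "(\<Sum>s. w (Suc t) (Suc s) * aa) = (\<Sum>s. w (Suc t) (Suc s)) * aa" for t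
    by (intro suminf_mult2[symmetric] w_summable)
  have sG: "summable (\<lambda>s. \<bar>?G t s\<bar>)" for t
    by (rule summable_comparison_test[OF _ sw[of t]]) (use le[of _ t] in auto)
  have inner: "\<bar>\<Sum>s. ?G t s\<bar> \<le> (\<Sum>s. w (Suc t) (Suc s)) * aa" for t
    unfolding ww[symmetric]
    by (rule order.trans[OF summable_rabs[OF sG] suminf_le[OF le sG sw]])
  have sm: "summable (\<lambda>t. (\<Sum>s. w (Suc t) (Suc s)) * aa)" using w_summable(2) by (intro summable_mult2)
  have so: "summable (\<lambda>t. \<bar>\<Sum>s. ?G t s\<bar>)"
    by (rule summable_comparison_test[OF _ sm]) (use inner in auto)
  have "\<bar>\<Sum>t. \<Sum>s. ?G t s\<bar> \<le> (\<Sum>t. (\<Sum>s. w (Suc t) (Suc s)) * aa)"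
    by (rule order.trans[OF summable_rabs[OF so] suminf_le[OF inner so sm]])
  also have "\<dots> = (\<Sum>t. \<Sum>s. w (Suc t) (Suc s)) * aa" by (intro suminf_mult2[symmetric] w_summable)
  also have "\<dots> \<le> B * aa" using w_summable(3) aa by (intro mult_right_mono)
  finally show ?case unfolding aa_def G_sum_def by (simp add: case_prod_unfold)
qed

context
  fixes u :: "'a \<Rightarrow> real"
  assumes u_meas [measurable]: "u \<in> borel_measurable P0" and u: "integrable P0 (\<lambda>x. a x * \<bar>u x\<bar>)"
begin

text \<open>Both sides are sums over \<open>t\<close> of the same terms, by the defining property of the conditional
expectation; the domination justifies the interchange of sum and integral on both sides.\<close>
lemma first_order_term:
  shows "integrable P0 (\<lambda>x. g_sum g x * u x)"
    and "integrable M (\<lambda>\<omega>. H \<omega> * linear_part (\<lambda>t. u (X t \<omega>)) (\<tau> \<omega>))"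
    and "(\<integral>\<omega>. H \<omega> * linear_part (\<lambda>t. u (X t \<omega>)) (\<tau> \<omega>) \<partial>M) = (\<integral>x. g_sum g x * u x \<partial>P0)"
proof -
  define U where "U = (\<integral>x. a x * \<bar>u x\<bar> \<partial>P0)"
  have U0: "0 \<le> U" unfolding U_def using a_nonneg by (intro Bochner_Integration.integral_nonneg) auto
  let ?f = "\<lambda>t \<omega>. u (X (Suc t) \<omega>) * (H \<omega> * indicator {\<omega>. Suc t \<le> \<tau> \<omega>} \<omega>)"
  let ?g = "\<lambda>t x. u x * g (Suc t) x"
  have [measurable]: "g (Suc t) \<in> borel_measurable P0" for t by (rule g_measurable) simp
  have f: "integrable M (?f t)" "(\<integral>\<omega>. \<bar>?f t \<omega>\<bar> \<partial>M) \<le> w (Suc t) (Suc t) * U" for t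
    unfolding U_def using single_term[of "Suc t" u] u by auto
  have g: "integrable P0 (?g t)" "(\<integral>x. ?g t x \<partial>P0) = (\<integral>\<omega>. ?f t \<omega> \<partial>M)" for t
    using cond_exp_version_integral[OF prob_space_axioms X_measurable X_distr _ g_version, of "Suc t" u] f(1)[of t]
    by auto
  have sU: "summable (\<lambda>t. w (Suc t) (Suc t) * U)" using w_diagonal_summable by (intro summable_mult2)
  have gle: "(\<integral>x. \<bar>?g t x\<bar> \<partial>P0) \<le> w (Suc t) (Suc t) * U" for t
  proof -
    have "(\<integral>x. \<bar>?g t x\<bar> \<partial>P0) \<le> (\<integral>x. w (Suc t) (Suc t) * (a x * \<bar>u x\<bar>) \<partial>P0)"
    proof (rule integral_mono_AE)
      show "AE x in P0. \<bar>?g t x\<bar> \<le> w (Suc t) (Suc t) * (a x * \<bar>u x\<bar>)"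
        using g_bound_all
      proof eventually_elim
        case (elim x)
        have "\<bar>u x\<bar> * \<bar>g (Suc t) x\<bar> \<le> \<bar>u x\<bar> * (w (Suc t) (Suc t) * a x)"
          using elim by (intro mult_left_mono) auto
        then show ?case by (simp add: abs_mult mult_ac)
      qed
    qed (use g u in auto)
    then show ?thesis by (simp add: U_def)
  qed
  have sf: "summable (\<lambda>t. \<integral>\<omega>. norm (?f t \<omega>) \<partial>M)"
    by (rule summable_comparison_test[OF _ sU])
      (use f(2) in \<open>auto simp: Bochner_Integration.integral_nonneg\<close>)
  have sg: "summable (\<lambda>t. \<integral>x. norm (?g t x) \<partial>P0)"
    by (rule summable_comparison_test[OF _ sU])
      (use gle in \<open>auto simp: Bochner_Integration.integral_nonneg\<close>)
  have fin: "?f t \<omega> = 0" if "t \<notin> {..<\<tau> \<omega>}" for t \<omega> using that by auto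
  have aef: "AE \<omega> in M. summable (\<lambda>t. norm (?f t \<omega>))"
  proof (intro AE_I2 summable_finite[of "{..<\<tau> _}"])
    show "norm (?f t \<omega>) = 0" if "t \<notin> {..<\<tau> \<omega>}" for t \<omega> using fin[OF that] by simp
  qed simp
  have aeg: "AE x in P0. summable (\<lambda>t. norm (?g t x))"
    using g_bound_all
  proof eventually_elim
    case (elim x)
    have "summable (\<lambda>t. w (Suc t) (Suc t) * (a x * \<bar>u x\<bar>))" using w_diagonal_summable by (intro summable_mult2)
    then show ?case
    proof (rule summable_comparison_test[rotated], intro exI allI impI)
      fix t
      have "\<bar>u x\<bar> * \<bar>g (Suc t) x\<bar> \<le> \<bar>u x\<bar> * (w (Suc t) (Suc t) * a x)"
        using elim by (intro mult_left_mono) auto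
      then show "norm (norm (?g t x)) \<le> w (Suc t) (Suc t) * (a x * \<bar>u x\<bar>)" by (simp add: abs_mult mult_ac)
    qed
  qed
  have feq: "(\<Sum>t. ?f t \<omega>) = H \<omega> * linear_part (\<lambda>t. u (X t \<omega>)) (\<tau> \<omega>)" for \<omega>
  proof -
    have "(\<Sum>t. ?f t \<omega>) = (\<Sum>t<\<tau> \<omega>. ?f t \<omega>)" using fin by (intro suminf_finite) auto
    also have "\<dots> = (\<Sum>t<\<tau> \<omega>. H \<omega> * u (X (Suc t) \<omega>))" by (intro sum.cong) auto
    finally show ?thesis by (simp add: linear_part_eq_sum sum_distrib_left)
  qed
  have geq: "AE x in P0. (\<Sum>t. ?g t x) = g_sum g x * u x"
    using g_bound_all
  proof eventually_elim
    case (elim x)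
    have "summable (\<lambda>t. w (Suc t) (Suc t) * a x)" using w_diagonal_summable by (intro summable_mult2)
    then have "summable (\<lambda>t. g (Suc t) x)"
      by (rule summable_comparison_test[rotated]) (use elim in auto)
    from suminf_mult[OF this, of "u x"] show ?case by (simp add: g_sum_def mult.commute)
  qed
  have Sg: "integrable P0 (\<lambda>x. \<Sum>t. ?g t x)" "(\<integral>x. (\<Sum>t. ?g t x) \<partial>P0) = (\<Sum>t. \<integral>x. ?g t x \<partial>P0)"
    by (rule integrable_suminf[OF g(1) aeg sg], rule integral_suminf[OF g(1) aeg sg])
  show "integrable P0 (\<lambda>x. g_sum g x * u x)"
    by (rule integrable_cong_AE_imp[OF Sg(1) _ geq]) simp
  show "integrable M (\<lambda>\<omega>. H \<omega> * linear_part (\<lambda>t. u (X t \<omega>)) (\<tau> \<omega>))"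
    using integrable_suminf[OF f(1) aef sf] unfolding feq .
  have "(\<integral>\<omega>. H \<omega> * linear_part (\<lambda>t. u (X t \<omega>)) (\<tau> \<omega>) \<partial>M) = (\<Sum>t. \<integral>\<omega>. ?f t \<omega> \<partial>M)"
    using integral_suminf[OF f(1) aef sf] unfolding feq .
  also have "\<dots> = (\<integral>x. (\<Sum>t. ?g t x) \<partial>P0)" unfolding Sg(2) g(2) ..
  also have "\<dots> = (\<integral>x. g_sum g x * u x \<partial>P0)"
    by (rule integral_cong_AE[OF _ _ geq]) simp_all
  finally show "(\<integral>\<omega>. H \<omega> * linear_part (\<lambda>t. u (X t \<omega>)) (\<tau> \<omega>) \<partial>M) = (\<integral>x. g_sum g x * u x \<partial>P0)" .
qed

text \<open>The arguments count from \<open>0\<close>, as those of the series do.\<close>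
definition pair_expectation :: "nat \<Rightarrow> nat \<Rightarrow> real" where
  "pair_expectation t s = (if s = t then 0 else
     \<integral>\<omega>. u (X (Suc t) \<omega>) * u (X (Suc s) \<omega>) * (H \<omega> * indicator {\<omega>. max (Suc t) (Suc s) \<le> \<tau> \<omega>} \<omega>) \<partial>M)"

text \<open>Every unordered pair of times occurs twice in the double series, whence the factor \<open>1 / 2\<close>.\<close>
lemma second_order_term:
  shows "integrable M (\<lambda>\<omega>. H \<omega> * quadratic_part (\<lambda>t. u (X t \<omega>)) (\<tau> \<omega>))"
    and "(\<integral>\<omega>. H \<omega> * quadratic_part (\<lambda>t. u (X t \<omega>)) (\<tau> \<omega>) \<partial>M) = bilinear_form P0 (G_sum G) u u / 2"
    and "bilinear_form P0 (G_sum G) u u = (\<Sum>t. \<Sum>s. pair_expectation t s)"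
    and "(\<lambda>N. \<Sum>t<N. \<Sum>s<N. pair_expectation t s) \<longlonglongrightarrow> bilinear_form P0 (G_sum G) u u"
proof -
  define U where "U = (\<integral>x. a x * \<bar>u x\<bar> \<partial>P0)"
  have U0: "0 \<le> U" unfolding U_def using a_nonneg by (intro Bochner_Integration.integral_nonneg) auto
  define W where "W = (\<lambda>t s. w (Suc t) (Suc s) * (U * U))"
  define f where "f = (\<lambda>t s \<omega>. if s = t then 0 else
    u (X (Suc t) \<omega>) * u (X (Suc s) \<omega>) * (H \<omega> * indicator {\<omega>. max (Suc t) (Suc s) \<le> \<tau> \<omega>} \<omega>))"
  define k where "k = (\<lambda>t s p. u (fst p) * u (snd p) * (if s = t then 0 else G (Suc t) (Suc s) (fst p) (snd p)))"
  have Wsum: "summable (W t)" "summable (\<lambda>t. \<Sum>s. W t s)" for t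
    unfolding W_def using w_summable by (auto simp: suminf_mult2[symmetric] intro!: summable_mult2)
  have W0: "0 \<le> W t s" for t s unfolding W_def using w_nonneg U0 by simp
  have f: "integrable M (f t s)" "(\<integral>\<omega>. \<bar>f t s \<omega>\<bar> \<partial>M) \<le> W t s" for t s
  proof (atomize(full), cases "s = t")
    case False
    then show "integrable M (f t s) \<and> (\<integral>\<omega>. \<bar>f t s \<omega>\<bar> \<partial>M) \<le> W t s"
      using pair_term(1,2)[of "Suc t" "Suc s" u u] u by (simp add: f_def W_def U_def del: max_Suc_Suc)
  qed (use W0[of t t] in \<open>simp add: f_def\<close>)
  have k: "integrable (P0 \<Otimes>\<^sub>M P0) (k t s)" "(\<integral>p. k t s p \<partial>(P0 \<Otimes>\<^sub>M P0)) = pair_expectation t s" for t s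
  proof (atomize(full), cases "s = t")
    case False
    then show "integrable (P0 \<Otimes>\<^sub>M P0) (k t s) \<and> (\<integral>p. k t s p \<partial>(P0 \<Otimes>\<^sub>M P0)) = pair_expectation t s"
      using cond_exp_version_integral[OF prob_space_axioms pair_measurable pair_distr _ G_version,
        of "Suc t" "Suc s" "\<lambda>p. u (fst p) * u (snd p)"] f(1)[of t s]
      by (simp add: f_def k_def[abs_def] pair_expectation_def case_prod_unfold del: max_Suc_Suc)
  qed (simp add: k_def pair_expectation_def)
  note pu = integral_pair_product[OF P.prob_space_axioms u u, folded U_def]
  have kle: "AE p in P0 \<Otimes>\<^sub>M P0. \<forall>t s. \<bar>k t s p\<bar> \<le> w (Suc t) (Suc s) * ((a (fst p) * \<bar>u (fst p)\<bar>) * (a (snd p) * \<bar>u (snd p)\<bar>))"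
    using G_bound_all
  proof (eventually_elim, intro allI)
    fix p t s
    assume *: "\<forall>t s. \<bar>if s = t then 0 else G (Suc t) (Suc s) (fst p) (snd p)\<bar> \<le> w (Suc t) (Suc s) * (a (fst p) * a (snd p))"
    have "\<bar>k t s p\<bar> \<le> \<bar>u (fst p) * u (snd p)\<bar> * (w (Suc t) (Suc s) * (a (fst p) * a (snd p)))"
      unfolding k_def abs_mult[of "u (fst p) * u (snd p)"] using *[rule_format, of s t] by (intro mult_left_mono) auto
    then show "\<bar>k t s p\<bar> \<le> w (Suc t) (Suc s) * ((a (fst p) * \<bar>u (fst p)\<bar>) * (a (snd p) * \<bar>u (snd p)\<bar>))"
      by (simp add: abs_mult mult_ac)
  qed
  have kW: "(\<integral>p. \<bar>k t s p\<bar> \<partial>(P0 \<Otimes>\<^sub>M P0)) \<le> W t s" for t s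
  proof -
    have "(\<integral>p. \<bar>k t s p\<bar> \<partial>(P0 \<Otimes>\<^sub>M P0)) \<le> (\<integral>p. w (Suc t) (Suc s) * ((a (fst p) * \<bar>u (fst p)\<bar>) * (a (snd p) * \<bar>u (snd p)\<bar>)) \<partial>(P0 \<Otimes>\<^sub>M P0))"
      using k(1) pu(1) kle by (intro integral_mono_AE) (auto simp: case_prod_unfold)
    also have "\<dots> = W t s" using pu by (simp add: W_def case_prod_unfold)
    finally show ?thesis .
  qed
  have fin1: "f t s \<omega> = 0" if "\<not> s < \<tau> \<omega>" for t s \<omega> using that by (auto simp: f_def)
  have fin2: "f t s \<omega> = 0" if "\<not> t < \<tau> \<omega>" for t s \<omega> using that by (auto simp: f_def)
  have fs: "(\<Sum>s. f t s \<omega>) = (\<Sum>s<\<tau> \<omega>. f t s \<omega>)" "(\<Sum>s. \<bar>f t s \<omega>\<bar>) = (\<Sum>s<\<tau> \<omega>. \<bar>f t s \<omega>\<bar>)" for t \<omega>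
    by (rule suminf_finite; simp add: fin1)+
  have aef: "AE \<omega> in M. (\<forall>t. summable (\<lambda>s. \<bar>f t s \<omega>\<bar>)) \<and> summable (\<lambda>t. \<Sum>s. \<bar>f t s \<omega>\<bar>)"
  proof (intro AE_I2 conjI allI)
    fix \<omega> t
    show "summable (\<lambda>s. \<bar>f t s \<omega>\<bar>)" by (rule summable_finite[of "{..<\<tau> \<omega>}"]; simp add: fin1)
    show "summable (\<lambda>t. \<Sum>s. \<bar>f t s \<omega>\<bar>)" unfolding fs by (rule summable_finite[of "{..<\<tau> \<omega>}"]; simp add: fin2)
  qed
  have aek: "AE p in P0 \<Otimes>\<^sub>M P0. (\<forall>t. summable (\<lambda>s. \<bar>k t s p\<bar>)) \<and> summable (\<lambda>t. \<Sum>s. \<bar>k t s p\<bar>)"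
    using kle
  proof eventually_elim
    case (elim p)
    define q where "q = (a (fst p) * \<bar>u (fst p)\<bar>) * (a (snd p) * \<bar>u (snd p)\<bar>)"
    have le: "\<bar>k t s p\<bar> \<le> w (Suc t) (Suc s) * q" for t s using elim unfolding q_def by blast
    have sw: "summable (\<lambda>s. w (Suc t) (Suc s) * q)" for t using w_summable(1) by (intro summable_mult2)
    have sk: "summable (\<lambda>s. \<bar>k t s p\<bar>)" for t
      by (rule summable_comparison_test[OF _ sw[of t]]) (use le[of t] in auto)
    have inner: "norm (\<Sum>s. \<bar>k t s p\<bar>) \<le> (\<Sum>s. w (Suc t) (Suc s)) * q" for t
    proof -
      have "0 \<le> (\<Sum>s. \<bar>k t s p\<bar>)" by (rule suminf_nonneg[OF sk]) simp
      moreover have "(\<Sum>s. \<bar>k t s p\<bar>) \<le> (\<Sum>s. w (Suc t) (Suc s) * q)" by (rule suminf_le[OF le sk sw])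
      ultimately show ?thesis using suminf_mult2[OF w_summable(1), of t q] by simp
    qed
    have "summable (\<lambda>t. (\<Sum>s. w (Suc t) (Suc s)) * q)" using w_summable(2) by (intro summable_mult2)
    then have "summable (\<lambda>t. \<Sum>s. \<bar>k t s p\<bar>)"
      by (rule summable_comparison_test[rotated]) (use inner in blast)
    with sk show ?case by blast
  qed
  note F = integral_double_suminf[OF f Wsum aef]
  note K = integral_double_suminf[OF k(1) kW Wsum aek]
  have feq: "(\<Sum>t. \<Sum>s. f t s \<omega>) = 2 * (H \<omega> * quadratic_part (\<lambda>t. u (X t \<omega>)) (\<tau> \<omega>))" for \<omega>
  proof -
    have "(\<Sum>t. \<Sum>s. f t s \<omega>) = (\<Sum>t<\<tau> \<omega>. \<Sum>s<\<tau> \<omega>. f t s \<omega>)"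
      unfolding fs by (rule suminf_finite; simp add: fin2)
    also have "\<dots> = (\<Sum>t<\<tau> \<omega>. \<Sum>s<\<tau> \<omega>. H \<omega> * (if s = t then 0 else u (X (Suc t) \<omega>) * u (X (Suc s) \<omega>)))"
      by (intro sum.cong) (auto simp: f_def)
    also have "\<dots> = H \<omega> * (2 * quadratic_part (\<lambda>t. u (X t \<omega>)) (\<tau> \<omega>))"
      unfolding quadratic_part_eq_sum by (simp add: sum_distrib_left)
    finally show ?thesis by simp
  qed
  show "integrable M (\<lambda>\<omega>. H \<omega> * quadratic_part (\<lambda>t. u (X t \<omega>)) (\<tau> \<omega>))"
    using F(1) unfolding feq by simp
  have pe: "(\<integral>\<omega>. f t s \<omega> \<partial>M) = pair_expectation t s" for t s
    by (auto simp: f_def pair_expectation_def)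
  have keq: "AE p in P0 \<Otimes>\<^sub>M P0. (\<Sum>t. \<Sum>s. k t s p) = (case p of (x, y) \<Rightarrow> G_sum G x y * u x * u y)"
    using G_bound_all
  proof eventually_elim
    case (elim p)
    let ?G = "\<lambda>t s. if s = t then 0 else G (Suc t) (Suc s) (fst p) (snd p)"
    define q where "q = a (fst p) * a (snd p)"
    have le: "\<bar>?G t s\<bar> \<le> w (Suc t) (Suc s) * q" for t s using elim unfolding q_def by blast
    have sw: "summable (\<lambda>s. w (Suc t) (Suc s) * q)" for t using w_summable(1) by (intro summable_mult2)
    have sG: "summable (\<lambda>s. \<bar>?G t s\<bar>)" for t
      by (rule summable_comparison_test[OF _ sw[of t]]) (use le[of _ t] in auto)
    have in1: "\<bar>\<Sum>s. ?G t s\<bar> \<le> (\<Sum>s. w (Suc t) (Suc s)) * q" for t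
      using order.trans[OF summable_rabs[OF sG] suminf_le[OF le sG sw], of t] suminf_mult2[OF w_summable(1), of t q] by simp
    have "summable (\<lambda>t. (\<Sum>s. w (Suc t) (Suc s)) * q)" using w_summable(2) by (intro summable_mult2)
    then have so: "summable (\<lambda>t. \<Sum>s. ?G t s)"
      by (rule summable_comparison_test[rotated]) (use in1 in auto)
    have "(\<Sum>t. \<Sum>s. k t s p) = u (fst p) * u (snd p) * (\<Sum>t. \<Sum>s. ?G t s)"
      unfolding k_def by (simp only: suminf_mult[OF summable_rabs_cancel[OF sG]] suminf_mult[OF so])
    then show ?case by (simp add: G_sum_def case_prod_unfold mult_ac)
  qed
  have [measurable]: "(\<lambda>p. G_sum G (fst p) (snd p)) \<in> borel_measurable (P0 \<Otimes>\<^sub>M P0)"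
    using G_sum_measurable by (simp add: case_prod_unfold)
  have "bilinear_form P0 (G_sum G) u u = (\<integral>p. (\<Sum>t. \<Sum>s. k t s p) \<partial>(P0 \<Otimes>\<^sub>M P0))"
    unfolding bilinear_form_def
    by (rule integral_cong_AE) (use K(1) keq in \<open>auto simp: case_prod_unfold\<close>)
  then show bil: "bilinear_form P0 (G_sum G) u u = (\<Sum>t. \<Sum>s. pair_expectation t s)"
    using K(2) by (simp add: k(2))
  show "(\<integral>\<omega>. H \<omega> * quadratic_part (\<lambda>t. u (X t \<omega>)) (\<tau> \<omega>) \<partial>M) = bilinear_form P0 (G_sum G) u u / 2"
    using F(2) unfolding feq pe bil by simp
  show "(\<lambda>N. \<Sum>t<N. \<Sum>s<N. pair_expectation t s) \<longlonglongrightarrow> bilinear_form P0 (G_sum G) u u"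
    unfolding bil
  proof (rule square_partial_sums_tendsto[OF _ Wsum])
    show "\<bar>pair_expectation t s\<bar> \<le> W t s" for t s
      unfolding pe[symmetric] by (rule order.trans[OF integral_abs_bound f(2)])
  qed
qed

end

end

section \<open>Bounded times and costs with exponential moments\<close>

lemma parts_abs_le:
  fixes y :: "nat \<Rightarrow> real"
  shows "\<bar>linear_part y n\<bar> \<le> linear_part (\<lambda>t. \<bar>y t\<bar>) n"
    and "\<bar>quadratic_part y n\<bar> \<le> quadratic_part (\<lambda>t. \<bar>y t\<bar>) n"
    and "\<bar>higher_part y n\<bar> \<le> higher_part (\<lambda>t. \<bar>y t\<bar>) n"
proof -
  show l: "\<bar>linear_part y n\<bar> \<le> linear_part (\<lambda>t. \<bar>y t\<bar>) n" for n
    by (induction n) auto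
  show q: "\<bar>quadratic_part y n\<bar> \<le> quadratic_part (\<lambda>t. \<bar>y t\<bar>) n" for n
  proof (induction n)
    case (Suc n)
    have "\<bar>linear_part y n * y (Suc n)\<bar> \<le> linear_part (\<lambda>t. \<bar>y t\<bar>) n * \<bar>y (Suc n)\<bar>"
      unfolding abs_mult by (intro mult_right_mono l) simp
    with Suc show ?case by simp
  qed simp
  show "\<bar>higher_part y n\<bar> \<le> higher_part (\<lambda>t. \<bar>y t\<bar>) n"
  proof (induction n)
    case (Suc n)
    have "\<bar>quadratic_part y n * y (Suc n)\<bar> \<le> quadratic_part (\<lambda>t. \<bar>y t\<bar>) n * \<bar>y (Suc n)\<bar>"
      unfolding abs_mult by (intro mult_right_mono q) simp
    moreover have "\<bar>higher_part y n * (1 + y (Suc n))\<bar> \<le> higher_part (\<lambda>t. \<bar>y t\<bar>) n * (1 + \<bar>y (Suc n)\<bar>)"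
      unfolding abs_mult using Suc by (intro mult_mono) auto
    ultimately show ?case by simp
  qed simp
qed

lemma parts_nonneg:
  fixes y :: "nat \<Rightarrow> real"
  assumes "\<And>t. 0 \<le> y t"
  shows "0 \<le> linear_part y n" "0 \<le> quadratic_part y n" "0 \<le> higher_part y n"
proof -
  have eq: "(\<lambda>t. \<bar>y t\<bar>) = y" using assms by auto
  show "0 \<le> linear_part y n" "0 \<le> quadratic_part y n" "0 \<le> higher_part y n"
    using order.trans[OF abs_ge_zero parts_abs_le(1), of y n] order.trans[OF abs_ge_zero parts_abs_le(2), of y n]
      order.trans[OF abs_ge_zero parts_abs_le(3), of y n] unfolding eq by auto
qed

lemma higher_part_mono:
  fixes y :: "nat \<Rightarrow> real"
  assumes "\<And>t. 0 \<le> y t" "n \<le> m"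
  shows "higher_part y n \<le> higher_part y m"
  using assms(2)
proof (induction rule: dec_induct)
  case (step k)
  have "higher_part y k \<le> higher_part y k * (1 + y (Suc k))"
    using assms(1) parts_nonneg(3)[OF assms(1)] by (simp add: distrib_left)
  moreover have "0 \<le> quadratic_part y k * y (Suc k)" using assms(1) parts_nonneg(2)[OF assms(1)] by simp
  ultimately show ?case using step by simp
qed simp

lemma one_plus_sum_le_prod:
  fixes b :: "nat \<Rightarrow> real"
  assumes "finite S" "\<And>t. t \<in> S \<Longrightarrow> 0 \<le> b t"
  shows "1 + (\<Sum>t\<in>S. b t) \<le> (\<Prod>t\<in>S. 1 + b t)"
  using assms
proof (induction S)
  case (insert t S)
  have "(1 + b t) * (1 + (\<Sum>t\<in>S. b t)) \<le> (1 + b t) * (\<Prod>t\<in>S. 1 + b t)"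
    using insert by (intro mult_left_mono) auto
  moreover have "0 \<le> b t * (\<Sum>t\<in>S. b t)" using insert by (intro mult_nonneg_nonneg sum_nonneg) auto
  ultimately show ?case using insert by (simp add: algebra_simps)
qed simp

lemma sum_cutoff_le: "(\<Sum>s<N. if s < T then e else 0) = real (min N T) * e" for e :: real
  by (induction N) (auto simp: min_def distrib_right)

text \<open>One of the summands is at least the average, so that the exponential of the sum is at most the
sum of the exponentials of \<open>T\<close> times the summands.\<close>
lemma exp_moment_of_sum:
  fixes \<Lambda> :: "nat \<Rightarrow> 'a \<Rightarrow> real"
  assumes "prob_space P"
    and meas: "\<And>t. t \<in> {1..T} \<Longrightarrow> \<Lambda> t \<in> borel_measurable P"
    and mgf: "\<And>t. t \<in> {1..T} \<Longrightarrow> \<forall>\<^sub>F \<theta> in nhds (0::real). integrable P (\<lambda>x. exp (\<theta> * \<Lambda> t x))"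
  shows "\<exists>\<theta>>0. integrable P (\<lambda>x. exp (\<theta> * (1 + (\<Sum>t\<in>{1..T}. \<bar>\<Lambda> t x\<bar>))))"
proof -
  interpret prob_space P by fact
  have "\<forall>\<^sub>F \<theta> in nhds (0::real). \<forall>t\<in>{1..T}. integrable P (\<lambda>x. exp (\<theta> * \<Lambda> t x))"
    using mgf by (intro eventually_ball_finite) auto
  then obtain d where d: "0 < d" "\<And>\<theta>. dist \<theta> 0 < d \<Longrightarrow> \<forall>t\<in>{1..T}. integrable P (\<lambda>x. exp (\<theta> * \<Lambda> t x))"
    unfolding eventually_nhds_metric by blast
  define \<theta>1 where "\<theta>1 = d / 2"
  have th1: "0 < \<theta>1" using d by (simp add: \<theta>1_def)
  have int: "integrable P (\<lambda>x. exp (\<theta>1 * \<Lambda> t x) + exp (- \<theta>1 * \<Lambda> t x))" if "t \<in> {1..T}" for t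
    using d(2)[of \<theta>1] d(2)[of "- \<theta>1"] that d(1) by (intro Bochner_Integration.integrable_add) (auto simp: \<theta>1_def)
  define \<theta> where "\<theta> = \<theta>1 / (real T + 1)"
  have th: "0 < \<theta>" using th1 by (simp add: \<theta>_def)
  let ?R = "\<lambda>x. exp \<theta> * (1 + (\<Sum>t\<in>{1..T}. exp (\<theta>1 * \<Lambda> t x) + exp (- \<theta>1 * \<Lambda> t x)))"
  have "integrable P (\<lambda>x. \<Sum>t\<in>{1..T}. exp (\<theta>1 * \<Lambda> t x) + exp (- \<theta>1 * \<Lambda> t x))"
    by (rule Bochner_Integration.integrable_sum[OF int])
  then have Rint: "integrable P ?R"
    by (intro integrable_mult_right Bochner_Integration.integrable_add) auto
  have pt: "exp (\<theta> * (1 + (\<Sum>t\<in>{1..T}. \<bar>\<Lambda> t x\<bar>))) \<le> ?R x" for x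
  proof -
    define S where "S = (\<Sum>t\<in>{1..T}. \<bar>\<Lambda> t x\<bar>)"
    have "exp (\<theta> * S) \<le> 1 + (\<Sum>t\<in>{1..T}. exp (\<theta>1 * \<Lambda> t x) + exp (- \<theta>1 * \<Lambda> t x))"
    proof (cases "T = 0")
      case True
      then show ?thesis by (simp add: S_def)
    next
      case False
      have "\<exists>t\<in>{1..T}. S / T \<le> \<bar>\<Lambda> t x\<bar>"
      proof (rule ccontr)
        assume "\<not> ?thesis"
        then have "S < real (card {1..T}) * (S / T)"
          unfolding S_def using False by (intro sum_bounded_above_strict) (auto simp: not_le)
        then show False using False by simp
      qed
      then obtain t where t: "t \<in> {1..T}" "S / T \<le> \<bar>\<Lambda> t x\<bar>" by blast
      have S0: "0 \<le> S" by (simp add: S_def sum_nonneg)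
      have "\<theta> * S \<le> \<theta>1 / real T * S"
        unfolding \<theta>_def using False th1 S0 by (intro mult_right_mono divide_left_mono) auto
      also have "\<dots> \<le> \<theta>1 * \<bar>\<Lambda> t x\<bar>" using mult_left_mono[OF t(2), of \<theta>1] th1 by simp
      finally have "exp (\<theta> * S) \<le> exp (\<theta>1 * \<bar>\<Lambda> t x\<bar>)" by simp
      also have "\<dots> \<le> exp (\<theta>1 * \<Lambda> t x) + exp (- \<theta>1 * \<Lambda> t x)" by (cases "0 \<le> \<Lambda> t x") auto
      also have "\<dots> \<le> (\<Sum>t\<in>{1..T}. exp (\<theta>1 * \<Lambda> t x) + exp (- \<theta>1 * \<Lambda> t x))"
        by (rule member_le_sum[OF t(1)]) (auto intro: add_nonneg_nonneg)
      finally show ?thesis by simp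
    qed
    from mult_left_mono[OF this, of "exp \<theta>"] show ?thesis
      unfolding S_def[symmetric] by (simp only: distrib_left[of \<theta>] mult_1_right exp_add) simp
  qed
  have [measurable]: "(\<lambda>x. \<Sum>t\<in>{1..T}. \<bar>\<Lambda> t x\<bar>) \<in> borel_measurable P"
    by (intro borel_measurable_sum borel_measurable_abs meas)
  have "integrable P (\<lambda>x. exp (\<theta> * (1 + (\<Sum>t\<in>{1..T}. \<bar>\<Lambda> t x\<bar>))))"
  proof (rule Bochner_Integration.integrable_bound[OF Rint])
    show "AE x in P. norm (exp (\<theta> * (1 + (\<Sum>t\<in>{1..T}. \<bar>\<Lambda> t x\<bar>)))) \<le> norm (?R x)"
    proof (intro AE_I2)
      fix x show "norm (exp (\<theta> * (1 + (\<Sum>t\<in>{1..T}. \<bar>\<Lambda> t x\<bar>)))) \<le> norm (?R x)"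
        using order.trans[OF pt[of x] abs_ge_self] by (simp only: real_norm_def abs_exp_cancel)
    qed
  qed measurable
  with th show ?thesis by blast
qed

context cost_model
begin

lemma gen_next_nn_integral:
  fixes U :: "'w \<Rightarrow> ennreal"
  assumes U: "U \<in> borel_measurable (gen {1..n})" and f: "f \<in> borel_measurable P0"
  shows "(\<integral>\<^sup>+\<omega>. U \<omega> * f (X (Suc n) \<omega>) \<partial>M) = (\<integral>\<^sup>+\<omega>. U \<omega> \<partial>M) * (\<integral>\<^sup>+x. f x \<partial>P0)"
proof -
  have "(\<lambda>\<omega>. f (X (Suc n) \<omega>)) \<in> borel_measurable (gen {Suc n})"
    by (rule measurable_compose[OF X_gen f]) auto
  then have "indep_var borel U borel (\<lambda>\<omega>. f (X (Suc n) \<omega>))"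
    by (intro gen_indep_var[OF _ _ _ U]) auto
  from indep_var_nn_integral[OF this] show ?thesis using nn_integral_X[OF _ f, of "Suc n"] by simp
qed

lemma parts_gen:
  assumes J: "{1..n} \<subseteq> J" "J \<subseteq> {1..}" and u: "u \<in> borel_measurable P0"
  shows "(\<lambda>\<omega>. linear_part (\<lambda>t. u (X t \<omega>)) n) \<in> borel_measurable (gen J)"
    and "(\<lambda>\<omega>. quadratic_part (\<lambda>t. u (X t \<omega>)) n) \<in> borel_measurable (gen J)"
    and "(\<lambda>\<omega>. higher_part (\<lambda>t. u (X t \<omega>)) n) \<in> borel_measurable (gen J)"
proof -
  have X: "(\<lambda>\<omega>. u (X t \<omega>)) \<in> borel_measurable (gen J)" if "t \<in> J" for t
    by (rule measurable_compose[OF X_gen u]) (use that J in auto)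
  have "(\<lambda>\<omega>. linear_part (\<lambda>t. u (X t \<omega>)) n) \<in> borel_measurable (gen J) \<and>
    (\<lambda>\<omega>. quadratic_part (\<lambda>t. u (X t \<omega>)) n) \<in> borel_measurable (gen J) \<and>
    (\<lambda>\<omega>. higher_part (\<lambda>t. u (X t \<omega>)) n) \<in> borel_measurable (gen J)"
    using J(1)
  proof (induction n)
    case (Suc n)
    then have [measurable]: "(\<lambda>\<omega>. linear_part (\<lambda>t. u (X t \<omega>)) n) \<in> borel_measurable (gen J)"
      "(\<lambda>\<omega>. quadratic_part (\<lambda>t. u (X t \<omega>)) n) \<in> borel_measurable (gen J)"
      "(\<lambda>\<omega>. higher_part (\<lambda>t. u (X t \<omega>)) n) \<in> borel_measurable (gen J)"
      "(\<lambda>\<omega>. u (X (Suc n) \<omega>)) \<in> borel_measurable (gen J)"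
      using X[of "Suc n"] by (auto simp: subset_eq)
    show ?case unfolding linear_part.simps quadratic_part.simps higher_part.simps by (intro conjI; measurable)
  qed simp
  then show "(\<lambda>\<omega>. linear_part (\<lambda>t. u (X t \<omega>)) n) \<in> borel_measurable (gen J)"
    "(\<lambda>\<omega>. quadratic_part (\<lambda>t. u (X t \<omega>)) n) \<in> borel_measurable (gen J)"
    "(\<lambda>\<omega>. higher_part (\<lambda>t. u (X t \<omega>)) n) \<in> borel_measurable (gen J)" by auto
qed

text \<open>The part of order at least three consists of products of three or more distinct
  coordinates.  Each of these coordinates contributes one factor \<open>r\<close>, the size of
  the weighted norm.\<close>

lemma weighted_parts_bound:
  assumes a: "a \<in> borel_measurable P0" "\<And>x. 0 \<le> a x" and A: "(\<integral>\<^sup>+x. ennreal (a x) \<partial>P0) \<le> ennreal A" "0 \<le> A"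
  shows "\<exists>C\<ge>0. \<forall>v r. v \<in> borel_measurable P0 \<longrightarrow> (\<forall>x. 0 \<le> v x) \<longrightarrow> 0 \<le> r \<longrightarrow> r \<le> 1 \<longrightarrow>
     (\<integral>\<^sup>+x. ennreal (a x * v x) \<partial>P0) \<le> ennreal r \<longrightarrow>
     (\<integral>\<^sup>+\<omega>. ennreal ((\<Prod>u=1..n. a (X u \<omega>)) * linear_part (\<lambda>t. v (X t \<omega>)) n) \<partial>M) \<le> ennreal (C * r) \<and>
     (\<integral>\<^sup>+\<omega>. ennreal ((\<Prod>u=1..n. a (X u \<omega>)) * quadratic_part (\<lambda>t. v (X t \<omega>)) n) \<partial>M) \<le> ennreal (C * r ^ 2) \<and>
     (\<integral>\<^sup>+\<omega>. ennreal ((\<Prod>u=1..n. a (X u \<omega>)) * higher_part (\<lambda>t. v (X t \<omega>)) n) \<partial>M) \<le> ennreal (C * r ^ 3)"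
proof (induction n)
  case 0
  then show ?case by (intro exI[of _ 0]) simp
next
  case (Suc n)
  then obtain C where C: "0 \<le> C" and IH: "\<And>v r. v \<in> borel_measurable P0 \<Longrightarrow> (\<forall>x. 0 \<le> v x) \<Longrightarrow> 0 \<le> r \<Longrightarrow> r \<le> 1 \<Longrightarrow>
     (\<integral>\<^sup>+x. ennreal (a x * v x) \<partial>P0) \<le> ennreal r \<Longrightarrow>
     (\<integral>\<^sup>+\<omega>. ennreal ((\<Prod>u=1..n. a (X u \<omega>)) * linear_part (\<lambda>t. v (X t \<omega>)) n) \<partial>M) \<le> ennreal (C * r) \<and>
     (\<integral>\<^sup>+\<omega>. ennreal ((\<Prod>u=1..n. a (X u \<omega>)) * quadratic_part (\<lambda>t. v (X t \<omega>)) n) \<partial>M) \<le> ennreal (C * r ^ 2) \<and>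
     (\<integral>\<^sup>+\<omega>. ennreal ((\<Prod>u=1..n. a (X u \<omega>)) * higher_part (\<lambda>t. v (X t \<omega>)) n) \<partial>M) \<le> ennreal (C * r ^ 3)"
    by blast
  define C' where "C' = C * (A + 2) + A ^ n"
  have C': "0 \<le> C'" using C A by (simp add: C'_def)
  show ?case
  proof (intro exI[of _ C'] conjI C' allI impI)
    fix v :: "'a \<Rightarrow> real" and r :: real
    assume v [measurable]: "v \<in> borel_measurable P0" and v0: "\<forall>x. 0 \<le> v x" and r: "0 \<le> r" "r \<le> 1"
      and av: "(\<integral>\<^sup>+x. ennreal (a x * v x) \<partial>P0) \<le> ennreal r"
    note [measurable] = a(1)
    note ih = IH[OF v v0 r av]
    define p where "p = (\<lambda>n \<omega>. \<Prod>u=1..n. a (X u \<omega>))"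
    define l where "l = (\<lambda>n \<omega>. linear_part (\<lambda>t. v (X t \<omega>)) n)"
    define q where "q = (\<lambda>n \<omega>. quadratic_part (\<lambda>t. v (X t \<omega>)) n)"
    define k where "k = (\<lambda>n \<omega>. higher_part (\<lambda>t. v (X t \<omega>)) n)"
    have p0: "0 \<le> p n \<omega>" for n \<omega> unfolding p_def using a(2) by (intro prod_nonneg) auto
    have l0: "0 \<le> l n \<omega>" "0 \<le> q n \<omega>" "0 \<le> k n \<omega>" for n \<omega>
      unfolding l_def q_def k_def using v0 by (auto intro!: parts_nonneg)
    have [measurable]: "X u \<in> measurable (gen {1..n}) P0" if "u \<in> {1..n}" for u
      using that by (intro X_gen) auto
    have pm: "p n \<in> borel_measurable (gen {1..n})" unfolding p_def by (intro borel_measurable_prod) measurable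
    have lm: "l n \<in> borel_measurable (gen {1..n})" "q n \<in> borel_measurable (gen {1..n})" "k n \<in> borel_measurable (gen {1..n})"
      unfolding l_def q_def k_def by (auto intro!: parts_gen v)
    have pM: "p n \<in> borel_measurable M" "l n \<in> borel_measurable M" "q n \<in> borel_measurable M" "k n \<in> borel_measurable M"
      using pm lm by (auto intro!: gen_measurable[of _ "{1..n}"])
    note [measurable] = pm lm
    have XM [measurable]: "X (Suc n) \<in> measurable M P0" by (rule X_measurable) simp
    note [measurable] = pM
    have step: "(\<integral>\<^sup>+\<omega>. ennreal (U \<omega>) * ennreal (f (X (Suc n) \<omega>)) \<partial>M) \<le> ennreal (b * e)"
      if "U \<in> borel_measurable (gen {1..n})" "f \<in> borel_measurable P0"
        "(\<integral>\<^sup>+\<omega>. ennreal (U \<omega>) \<partial>M) \<le> ennreal b" "(\<integral>\<^sup>+x. ennreal (f x) \<partial>P0) \<le> ennreal e" "0 \<le> b" "0 \<le> e"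
      for U f b e
    proof -
      have "(\<integral>\<^sup>+\<omega>. ennreal (U \<omega>) * ennreal (f (X (Suc n) \<omega>)) \<partial>M) = (\<integral>\<^sup>+\<omega>. ennreal (U \<omega>) \<partial>M) * (\<integral>\<^sup>+x. ennreal (f x) \<partial>P0)"
        using that(1,2) by (intro gen_next_nn_integral) auto
      also have "\<dots> \<le> ennreal b * ennreal e" using that by (intro mult_mono) auto
      finally show ?thesis using that by (simp add: ennreal_mult)
    qed
    have ih1: "(\<integral>\<^sup>+\<omega>. ennreal (p n \<omega> * l n \<omega>) \<partial>M) \<le> ennreal (C * r)"
      "(\<integral>\<^sup>+\<omega>. ennreal (p n \<omega> * q n \<omega>) \<partial>M) \<le> ennreal (C * r ^ 2)"
      "(\<integral>\<^sup>+\<omega>. ennreal (p n \<omega> * k n \<omega>) \<partial>M) \<le> ennreal (C * r ^ 3)"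
      using ih unfolding p_def l_def q_def k_def by auto
    have pA: "(\<integral>\<^sup>+\<omega>. ennreal (p n \<omega>) \<partial>M) \<le> ennreal (A ^ n)"
    proof -
      have "(\<integral>\<^sup>+\<omega>. ennreal (p n \<omega>) \<partial>M) = (\<integral>\<^sup>+x. ennreal (a x) \<partial>P0) ^ card {1..n}"
        unfolding p_def using nn_integral_prod(2)[of "{1..n}" "\<lambda>x. ennreal (a x)"] a(2)
        by (simp add: prod_ennreal[symmetric])
      also have "\<dots> \<le> ennreal A ^ n" using A by (simp add: power_mono)
      finally show ?thesis using A by (simp add: ennreal_power)
    qed
    have aA: "(\<integral>\<^sup>+x. ennreal (a x * (1 + v x)) \<partial>P0) \<le> ennreal (A + 1)"
    proof -
      have "(\<integral>\<^sup>+x. ennreal (a x * (1 + v x)) \<partial>P0) = (\<integral>\<^sup>+x. ennreal (a x) + ennreal (a x * v x) \<partial>P0)"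
        using a(2) v0 by (intro nn_integral_cong) (simp add: distrib_left)
      also have "\<dots> = (\<integral>\<^sup>+x. ennreal (a x) \<partial>P0) + (\<integral>\<^sup>+x. ennreal (a x * v x) \<partial>P0)"
        by (intro nn_integral_add) auto
      also have "\<dots> \<le> ennreal A + ennreal r" by (intro add_mono A av)
      also have "\<dots> \<le> ennreal (A + 1)" using A r by (simp flip: ennreal_plus add: ennreal_leI)
      finally show ?thesis .
    qed
    have sumI: "(\<integral>\<^sup>+\<omega>. ennreal (F \<omega>) \<partial>M) \<le> ennreal z"
      if "\<And>\<omega>. F \<omega> = U1 \<omega> * f1 (X (Suc n) \<omega>) + U2 \<omega> * f2 (X (Suc n) \<omega>)" "\<And>\<omega>. 0 \<le> U1 \<omega>" "\<And>\<omega>. 0 \<le> U2 \<omega>" "\<And>x. 0 \<le> f1 x" "\<And>x. 0 \<le> f2 x"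
        and m: "U1 \<in> borel_measurable (gen {1..n})" "f1 \<in> borel_measurable P0" "U2 \<in> borel_measurable (gen {1..n})" "f2 \<in> borel_measurable P0"
        and i: "(\<integral>\<^sup>+\<omega>. ennreal (U1 \<omega>) \<partial>M) \<le> ennreal b1" "(\<integral>\<^sup>+x. ennreal (f1 x) \<partial>P0) \<le> ennreal e1" "0 \<le> b1" "0 \<le> e1"
          "(\<integral>\<^sup>+\<omega>. ennreal (U2 \<omega>) \<partial>M) \<le> ennreal b2" "(\<integral>\<^sup>+x. ennreal (f2 x) \<partial>P0) \<le> ennreal e2" "0 \<le> b2" "0 \<le> e2"
        and z: "b1 * e1 + b2 * e2 \<le> z"
      for F U1 U2 f1 f2 b1 b2 e1 e2 z
    proof -
      have [measurable]: "U1 \<in> borel_measurable M" "U2 \<in> borel_measurable M" "f1 \<in> borel_measurable P0" "f2 \<in> borel_measurable P0"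
        using m by (auto intro!: gen_measurable[of _ "{1..n}"])
      have "(\<integral>\<^sup>+\<omega>. ennreal (F \<omega>) \<partial>M) = (\<integral>\<^sup>+\<omega>. ennreal (U1 \<omega>) * ennreal (f1 (X (Suc n) \<omega>)) + ennreal (U2 \<omega>) * ennreal (f2 (X (Suc n) \<omega>)) \<partial>M)"
        using that(1-5) by (intro nn_integral_cong) (simp add: ennreal_mult)
      also have "\<dots> = (\<integral>\<^sup>+\<omega>. ennreal (U1 \<omega>) * ennreal (f1 (X (Suc n) \<omega>)) \<partial>M) + (\<integral>\<^sup>+\<omega>. ennreal (U2 \<omega>) * ennreal (f2 (X (Suc n) \<omega>)) \<partial>M)"
        by (intro nn_integral_add) auto
      also have "\<dots> \<le> ennreal (b1 * e1) + ennreal (b2 * e2)" by (intro add_mono step m i)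
      also have "\<dots> \<le> ennreal z" using z i by (simp flip: ennreal_plus add: ennreal_leI)
      finally show ?thesis .
    qed
    have pS: "p (Suc n) \<omega> = p n \<omega> * a (X (Suc n) \<omega>)" for \<omega> by (simp add: p_def)
    show "(\<integral>\<^sup>+\<omega>. ennreal ((\<Prod>u=1..Suc n. a (X u \<omega>)) * linear_part (\<lambda>t. v (X t \<omega>)) (Suc n)) \<partial>M) \<le> ennreal (C' * r)"
    proof -
      have "(\<integral>\<^sup>+\<omega>. ennreal (p (Suc n) \<omega> * l (Suc n) \<omega>) \<partial>M) \<le> ennreal (C' * r)"
      proof (rule sumI[of _ "\<lambda>\<omega>. p n \<omega> * l n \<omega>" a "p n" "\<lambda>x. a x * v x" "C * r" A "A ^ n" r])
        show "C * r * A + A ^ n * r \<le> C' * r" using C r by (simp add: C'_def algebra_simps)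
        show "p (Suc n) \<omega> * l (Suc n) \<omega> = p n \<omega> * l n \<omega> * a (X (Suc n) \<omega>) + p n \<omega> * (a (X (Suc n) \<omega>) * v (X (Suc n) \<omega>))" for \<omega>
          by (simp add: pS l_def algebra_simps)
      qed (use p0 l0 a v0 pm lm ih1 pA A av r C in auto)
      then show ?thesis by (simp only: p_def l_def)
    qed
    show "(\<integral>\<^sup>+\<omega>. ennreal ((\<Prod>u=1..Suc n. a (X u \<omega>)) * quadratic_part (\<lambda>t. v (X t \<omega>)) (Suc n)) \<partial>M) \<le> ennreal (C' * r ^ 2)"
    proof -
      have "(\<integral>\<^sup>+\<omega>. ennreal (p (Suc n) \<omega> * q (Suc n) \<omega>) \<partial>M) \<le> ennreal (C' * r ^ 2)"
      proof (rule sumI[of _ "\<lambda>\<omega>. p n \<omega> * q n \<omega>" a "\<lambda>\<omega>. p n \<omega> * l n \<omega>" "\<lambda>x. a x * v x" "C * r ^ 2" A "C * r" r])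
        show "C * r ^ 2 * A + C * r * r \<le> C' * r ^ 2" using C A r by (simp add: C'_def algebra_simps power2_eq_square)
        show "p (Suc n) \<omega> * q (Suc n) \<omega> = p n \<omega> * q n \<omega> * a (X (Suc n) \<omega>) + p n \<omega> * l n \<omega> * (a (X (Suc n) \<omega>) * v (X (Suc n) \<omega>))" for \<omega>
          by (simp add: pS l_def q_def algebra_simps)
      qed (use p0 l0 a v0 pm lm ih1 pA A av r C in auto)
      then show ?thesis by (simp only: p_def q_def)
    qed
    show "(\<integral>\<^sup>+\<omega>. ennreal ((\<Prod>u=1..Suc n. a (X u \<omega>)) * higher_part (\<lambda>t. v (X t \<omega>)) (Suc n)) \<partial>M) \<le> ennreal (C' * r ^ 3)"
    proof -
      have "(\<integral>\<^sup>+\<omega>. ennreal (p (Suc n) \<omega> * k (Suc n) \<omega>) \<partial>M) \<le> ennreal (C' * r ^ 3)"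
      proof (rule sumI[of _ "\<lambda>\<omega>. p n \<omega> * k n \<omega>" "\<lambda>x. a x * (1 + v x)" "\<lambda>\<omega>. p n \<omega> * q n \<omega>" "\<lambda>x. a x * v x" "C * r ^ 3" "A + 1" "C * r ^ 2" r])
        show "C * r ^ 3 * (A + 1) + C * r ^ 2 * r \<le> C' * r ^ 3" using C A r by (simp add: C'_def algebra_simps eval_nat_numeral)
        show "p (Suc n) \<omega> * k (Suc n) \<omega> = p n \<omega> * k n \<omega> * (a (X (Suc n) \<omega>) * (1 + v (X (Suc n) \<omega>))) + p n \<omega> * q n \<omega> * (a (X (Suc n) \<omega>) * v (X (Suc n) \<omega>))" for \<omega>
          by (simp add: pS k_def q_def algebra_simps)
      qed (use p0 l0 a v0 pm lm ih1 aA A av r C in auto)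
      then show ?thesis by (simp only: p_def k_def)
    qed
  qed
qed

text \<open>The cost is dominated by the product over \<open>t \<le> T\<close> of the weight \<open>1 + (\<Sum>t=1..T. \<bar>\<Lambda> t x\<bar>)\<close> at \<open>X t\<close>.
Such a product factorizes against every function of a few coordinates.\<close>
theorem bounded_time_domination:
  assumes "cond_A M P0 X \<tau> h F"
  shows "\<exists>a w B c \<theta>. dominated_cost M P0 X \<tau> h a w B c \<and> 0 < \<theta> \<and> integrable P0 (\<lambda>x. exp (\<theta> * a x)) \<and>
    (\<exists>C\<ge>0. \<forall>\<^sub>F r in at_right 0. \<forall>L. entropy_ball_density P0 (r\<^sup>2) L \<longrightarrow>
      (\<integral>\<^sup>+\<omega>. ennreal \<bar>H \<omega> * higher_part (\<lambda>t. L (X t \<omega>) - 1) (\<tau> \<omega>)\<bar> \<partial>M) \<le> ennreal (C * r ^ 3))"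
proof -
  obtain T \<Lambda> where T: "AE \<omega> in M. \<tau> \<omega> \<le> T"
    and Lam: "\<And>t. t \<in> {1..T} \<Longrightarrow> \<Lambda> t \<in> borel_measurable P0"
      "\<And>t. t \<in> {1..T} \<Longrightarrow> \<forall>\<^sub>F \<theta> in nhds (0::real). integrable P0 (\<lambda>x. exp (\<theta> * \<Lambda> t x))"
    and HL: "AE \<omega> in M. \<bar>H \<omega>\<bar> \<le> (\<Sum>t=1..T. \<Lambda> t (X t \<omega>))"
    using assms unfolding cond_A_def by blast
  define a where "a = (\<lambda>x. 1 + (\<Sum>t\<in>{1..T}. \<bar>\<Lambda> t x\<bar>))"
  have a_m [measurable]: "a \<in> borel_measurable P0"
    unfolding a_def using Lam(1) by (intro borel_measurable_add borel_measurable_sum borel_measurable_abs) auto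
  have a1: "1 \<le> a x" for x by (simp add: a_def sum_nonneg)
  have a0: "0 \<le> a x" for x using a1[of x] by linarith
  obtain \<theta> where th: "0 < \<theta>" "integrable P0 (\<lambda>x. exp (\<theta> * a x))"
    using exp_moment_of_sum[where T = T and \<Lambda> = \<Lambda>, OF P.prob_space_axioms Lam] unfolding a_def by blast
  have a_int: "integrable P0 a"
  proof (rule Bochner_Integration.integrable_bound)
    show "integrable P0 (\<lambda>x. exp (\<theta> * a x) / \<theta>)" using th by simp
    show "AE x in P0. norm (a x) \<le> norm (exp (\<theta> * a x) / \<theta>)"
    proof (intro AE_I2)
      fix x
      have "\<theta> * a x \<le> exp (\<theta> * a x)" using exp_ge_add_one_self[of "\<theta> * a x"] by linarith
      then show "norm (a x) \<le> norm (exp (\<theta> * a x) / \<theta>)" using th(1) a0[of x] by (simp add: field_simps)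
    qed
  qed measurable
  define A where "A = (\<integral>x. a x \<partial>P0)"
  have A1: "1 \<le> A"
    unfolding A_def using integral_mono[of P0 "\<lambda>_. 1" a] a1 a_int by (simp add: P.prob_space)
  have Ae: "(\<integral>\<^sup>+x. ennreal (a x) \<partial>P0) = ennreal A"
    unfolding A_def using a_int a0 by (intro nn_integral_eq_integral) auto
  have Apow: "(\<integral>\<^sup>+x. ennreal (a x) \<partial>P0) ^ k \<le> ennreal (A ^ T)" if "k \<le> T" for k
    unfolding Ae using A1 that by (simp add: ennreal_power ennreal_leI power_increasing)
  have HP: "AE \<omega> in M. \<bar>H \<omega>\<bar> \<le> (\<Prod>u=1..T. a (X u \<omega>))"
    using HL
  proof eventually_elim
    case (elim \<omega>)
    have "(\<Sum>t=1..T. \<Lambda> t (X t \<omega>)) \<le> 1 + (\<Sum>t\<in>{1..T}. \<bar>\<Lambda> t (X t \<omega>)\<bar>)"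
      by (rule order.trans[OF sum_mono[of _ _ "\<lambda>t. \<bar>\<Lambda> t (X t \<omega>)\<bar>"]]) auto
    also have "\<dots> \<le> (\<Prod>t\<in>{1..T}. 1 + \<bar>\<Lambda> t (X t \<omega>)\<bar>)" by (rule one_plus_sum_le_prod) auto
    also have "\<dots> \<le> (\<Prod>t\<in>{1..T}. a (X t \<omega>))"
    proof (intro prod_mono conjI)
      fix t assume "t \<in> {1..T}"
      then show "1 + \<bar>\<Lambda> t (X t \<omega>)\<bar> \<le> a (X t \<omega>)"
        unfolding a_def by (intro add_left_mono member_le_sum[of t "{1..T}" "\<lambda>s. \<bar>\<Lambda> s (X t \<omega>)\<bar>"]) auto
    qed auto
    finally show ?case using elim by linarith
  qed
  have HI: "AE \<omega> in M. ennreal \<bar>H \<omega>\<bar> \<le> (\<Prod>u\<in>I. ennreal (a (X u \<omega>)))" if "finite I" "{1..T} \<subseteq> I" for I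
    using HP
  proof eventually_elim
    case (elim \<omega>)
    have "(\<Prod>u=1..T. a (X u \<omega>)) \<le> (\<Prod>u\<in>I. a (X u \<omega>))"
      by (rule prod_mono2) (use that a1 a0 in auto)
    with elim have "ennreal \<bar>H \<omega>\<bar> \<le> ennreal (\<Prod>u\<in>I. a (X u \<omega>))" by (intro ennreal_leI) linarith
    then show ?case by (subst prod_ennreal) (use a0 in auto)
  qed
  have single: "(\<integral>\<^sup>+\<omega>. ennreal \<bar>H \<omega>\<bar> * \<psi> (X t \<omega>) \<partial>M) \<le> ennreal (A ^ T) * (\<integral>\<^sup>+x. ennreal (a x) * \<psi> x \<partial>P0)"
    if t: "1 \<le> t" "t \<le> T" and psi: "\<psi> \<in> borel_measurable P0" for t \<psi>
  proof -
    have "(\<integral>\<^sup>+\<omega>. ennreal \<bar>H \<omega>\<bar> * \<psi> (X t \<omega>) \<partial>M) \<le> (\<integral>\<^sup>+\<omega>. (\<Prod>u\<in>{1..T}. ennreal (a (X u \<omega>))) * \<psi> (X t \<omega>) \<partial>M)"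
      using HI[of "{1..T}"] by (intro nn_integral_mono_AE) (auto elim!: eventually_mono intro!: mult_right_mono)
    also have "\<dots> = (\<integral>\<^sup>+x. ennreal (a x) \<partial>P0) ^ (card {1..T} - 1) * (\<integral>\<^sup>+x. ennreal (a x) * \<psi> x \<partial>P0)"
      using t psi by (intro nn_integral_prod_single) auto
    also have "\<dots> \<le> ennreal (A ^ T) * (\<integral>\<^sup>+x. ennreal (a x) * \<psi> x \<partial>P0)"
      by (intro mult_right_mono Apow) auto
    finally show ?thesis .
  qed
  have pair: "(\<integral>\<^sup>+\<omega>. ennreal \<bar>H \<omega>\<bar> * \<Psi> (X t \<omega>, X s \<omega>) \<partial>M)
      \<le> ennreal (A ^ T) * (\<integral>\<^sup>+p. ennreal (a (fst p)) * ennreal (a (snd p)) * \<Psi> p \<partial>(P0 \<Otimes>\<^sub>M P0))"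
    if t: "1 \<le> t" "1 \<le> s" "s \<noteq> t" and psi: "\<Psi> \<in> borel_measurable (P0 \<Otimes>\<^sub>M P0)" for t s \<Psi>
  proof -
    (* The times t and s may exceed T.  Extending the product to them is harmless because the
       weight is at least 1. *)
    define I where "I = {1..T} \<union> {t, s}"
    have card: "card I - 2 \<le> T"
    proof -
      have "card I \<le> card {1..T} + card {t, s}" unfolding I_def by (rule card_Un_le)
      then show ?thesis using t by simp
    qed
    have "(\<integral>\<^sup>+\<omega>. ennreal \<bar>H \<omega>\<bar> * \<Psi> (X t \<omega>, X s \<omega>) \<partial>M) \<le> (\<integral>\<^sup>+\<omega>. (\<Prod>u\<in>I. ennreal (a (X u \<omega>))) * \<Psi> (X t \<omega>, X s \<omega>) \<partial>M)"
    proof (rule nn_integral_mono_AE)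
      have "finite I" "{1..T} \<subseteq> I" by (auto simp: I_def)
      from HI[OF this] show "AE \<omega> in M. ennreal \<bar>H \<omega>\<bar> * \<Psi> (X t \<omega>, X s \<omega>) \<le> (\<Prod>u\<in>I. ennreal (a (X u \<omega>))) * \<Psi> (X t \<omega>, X s \<omega>)"
        by eventually_elim (intro mult_right_mono, auto)
    qed
    also have "\<dots> = (\<integral>\<^sup>+x. ennreal (a x) \<partial>P0) ^ (card I - 2)
        * (\<integral>\<^sup>+p. ennreal (a (fst p)) * ennreal (a (snd p)) * \<Psi> p \<partial>(P0 \<Otimes>\<^sub>M P0))"
      using t psi by (intro nn_integral_prod_pair) (auto simp: I_def)
    also have "\<dots> \<le> ennreal (A ^ T) * (\<integral>\<^sup>+p. ennreal (a (fst p)) * ennreal (a (snd p)) * \<Psi> p \<partial>(P0 \<Otimes>\<^sub>M P0))"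
      by (intro mult_right_mono Apow card) auto
    finally show ?thesis .
  qed
  define w where "w = (\<lambda>t s. if t \<le> T then if s \<le> T then A ^ T else 0 else 0 :: real)"
  have late: "(\<integral>\<^sup>+\<omega>. ennreal \<bar>H \<omega>\<bar> * indicator {\<omega>. m \<le> \<tau> \<omega>} \<omega> * f \<omega> \<partial>M) = 0" if "T < m" for m f
  proof -
    have "AE \<omega> in M. ennreal \<bar>H \<omega>\<bar> * indicator {\<omega>. m \<le> \<tau> \<omega>} \<omega> * f \<omega> = 0"
      using T that by (auto elim!: eventually_mono split: split_indicator)
    then have "(\<integral>\<^sup>+\<omega>. ennreal \<bar>H \<omega>\<bar> * indicator {\<omega>. m \<le> \<tau> \<omega>} \<omega> * f \<omega> \<partial>M) = (\<integral>\<^sup>+\<omega>. 0 \<partial>M)"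
      by (rule nn_integral_cong_AE)
    then show ?thesis by simp
  qed
  have drop: "(\<integral>\<^sup>+\<omega>. ennreal \<bar>H \<omega>\<bar> * indicator {\<omega>. m \<le> \<tau> \<omega>} \<omega> * f \<omega> \<partial>M) \<le> (\<integral>\<^sup>+\<omega>. ennreal \<bar>H \<omega>\<bar> * f \<omega> \<partial>M)" for m f
    by (intro nn_integral_mono) (auto split: split_indicator)
  have dom: "dominated_cost M P0 X \<tau> h a w (real T * (real T * A ^ T)) (A ^ T)"
  proof (intro dominated_cost.intro dominated_cost_axioms.intro)
    show "cost_model M P0 X \<tau> h" by (rule cost_model_axioms)
    show "0 \<le> w t s" for t s using A1 by (simp add: w_def)
    show "0 \<le> A ^ T" using A1 by simp
    show "(\<Sum>t<N. \<Sum>s<N. w (Suc t) (Suc s)) \<le> real T * (real T * A ^ T)" for N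
    proof -
      have "(\<Sum>s<N. w (Suc t) (Suc s)) = (if t < T then real (min N T) * A ^ T else 0)" for t
        using sum_cutoff_le[where N = N and T = T and e = "A ^ T"] by (simp add: w_def Suc_le_eq)
      then have "(\<Sum>t<N. \<Sum>s<N. w (Suc t) (Suc s)) = real (min N T) * (real (min N T) * A ^ T)"
        by (simp only: sum_cutoff_le)
      also have "\<dots> \<le> real T * (real T * A ^ T)"
        using A1 by (intro mult_mono) auto
      finally show ?thesis .
    qed
    show "(\<integral>\<^sup>+\<omega>. ennreal \<bar>H \<omega>\<bar> * indicator {\<omega>. t \<le> \<tau> \<omega>} \<omega> * \<psi> (X t \<omega>) \<partial>M)
        \<le> ennreal (w t t) * (\<integral>\<^sup>+x. ennreal (a x) * \<psi> x \<partial>P0)"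
      if "1 \<le> t" "\<psi> \<in> borel_measurable P0" for t \<psi>
      using order.trans[OF drop[of t "\<lambda>\<omega>. \<psi> (X t \<omega>)"] single[OF that(1) _ that(2)]] late[of t "\<lambda>\<omega>. \<psi> (X t \<omega>)"]
      by (cases "t \<le> T") (auto simp: w_def)
    show "(\<integral>\<^sup>+\<omega>. ennreal \<bar>H \<omega>\<bar> * indicator {\<omega>. max t s \<le> \<tau> \<omega>} \<omega> * \<Psi> (X t \<omega>, X s \<omega>) \<partial>M)
        \<le> ennreal (w t s) * (\<integral>\<^sup>+p. ennreal (a (fst p)) * ennreal (a (snd p)) * \<Psi> p \<partial>(P0 \<Otimes>\<^sub>M P0))"
      if "1 \<le> t" "1 \<le> s" "s \<noteq> t" "\<Psi> \<in> borel_measurable (P0 \<Otimes>\<^sub>M P0)" for t s \<Psi>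
    proof (cases "t \<le> T \<and> s \<le> T")
      case True
      then show ?thesis
        using order.trans[OF drop[of "max t s" "\<lambda>\<omega>. \<Psi> (X t \<omega>, X s \<omega>)"] pair[OF that]] by (simp add: w_def)
    next
      case False
      then have "T < max t s" by auto
      from late[OF this, of "\<lambda>\<omega>. \<Psi> (X t \<omega>, X s \<omega>)"] show ?thesis by simp
    qed
    show "(\<integral>\<^sup>+\<omega>. ennreal \<bar>H \<omega>\<bar> * \<Psi> (X t \<omega>, X s \<omega>) \<partial>M)
        \<le> ennreal (A ^ T) * (\<integral>\<^sup>+p. ennreal (a (fst p)) * ennreal (a (snd p)) * \<Psi> p \<partial>(P0 \<Otimes>\<^sub>M P0))"
      if "1 \<le> t" "1 \<le> s" "s \<noteq> t" "\<Psi> \<in> borel_measurable (P0 \<Otimes>\<^sub>M P0)" for t s \<Psi>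
      by (rule pair[OF that])
  qed (fact a_m a1 a_int)+
  obtain C where C: "0 \<le> C" and CI: "\<And>v r. v \<in> borel_measurable P0 \<Longrightarrow> (\<forall>x. 0 \<le> v x) \<Longrightarrow> 0 \<le> r \<Longrightarrow> r \<le> 1 \<Longrightarrow>
     (\<integral>\<^sup>+x. ennreal (a x * v x) \<partial>P0) \<le> ennreal r \<Longrightarrow>
     (\<integral>\<^sup>+\<omega>. ennreal ((\<Prod>u=1..T. a (X u \<omega>)) * higher_part (\<lambda>t. v (X t \<omega>)) T) \<partial>M) \<le> ennreal (C * r ^ 3)"
    using weighted_parts_bound[of a A T] a0 Ae A1 by auto
  define e where "e = 1 + 4 / \<theta>\<^sup>2 * (\<integral>x. exp (\<theta> * a x) \<partial>P0)"
  have e0: "0 \<le> e" unfolding e_def by (intro add_nonneg_nonneg mult_nonneg_nonneg Bochner_Integration.integral_nonneg) auto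
  have "\<forall>\<^sub>F r in at_right 0. \<forall>L. entropy_ball_density P0 (r\<^sup>2) L \<longrightarrow>
      (\<integral>\<^sup>+\<omega>. ennreal \<bar>H \<omega> * higher_part (\<lambda>t. L (X t \<omega>) - 1) (\<tau> \<omega>)\<bar> \<partial>M) \<le> ennreal (C * e ^ 3 * r ^ 3)"
    using eventually_pos eventually_id_le[OF half_gt_zero[OF th(1)]] eventually_linear_le[OF zero_less_one, of e]
  proof (eventually_elim, intro allI impI)
    case (elim r)
    fix L assume L: "entropy_ball_density P0 (r\<^sup>2) L"
    have Lm: "L \<in> borel_measurable P0" using L by (simp add: entropy_ball_density_def)
    define v where "v = (\<lambda>x. \<bar>L x - 1\<bar>)"
    have vm [measurable]: "v \<in> borel_measurable P0" unfolding v_def using Lm by measurable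
    note dist = entropy_ball_distance[OF P.prob_space_axioms L a_m a0 th(2)]
    have "integrable P0 (\<lambda>x. a x * v x)" "(\<integral>x. a x * v x \<partial>P0) \<le> e * r"
      using dist elim by (auto simp: v_def e_def)
    then have av: "(\<integral>\<^sup>+x. ennreal (a x * v x) \<partial>P0) \<le> ennreal (e * r)"
      by (subst nn_integral_eq_integral) (auto simp: a0 v_def ennreal_leI)
    have "(\<integral>\<^sup>+\<omega>. ennreal \<bar>H \<omega> * higher_part (\<lambda>t. L (X t \<omega>) - 1) (\<tau> \<omega>)\<bar> \<partial>M)
      \<le> (\<integral>\<^sup>+\<omega>. ennreal ((\<Prod>u=1..T. a (X u \<omega>)) * higher_part (\<lambda>t. v (X t \<omega>)) T) \<partial>M)"
    proof (rule nn_integral_mono_AE)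
      show "AE \<omega> in M. ennreal \<bar>H \<omega> * higher_part (\<lambda>t. L (X t \<omega>) - 1) (\<tau> \<omega>)\<bar>
         \<le> ennreal ((\<Prod>u=1..T. a (X u \<omega>)) * higher_part (\<lambda>t. v (X t \<omega>)) T)"
        using HP T
      proof eventually_elim
        case (elim \<omega>)
        have "\<bar>higher_part (\<lambda>t. L (X t \<omega>) - 1) (\<tau> \<omega>)\<bar> \<le> higher_part (\<lambda>t. v (X t \<omega>)) (\<tau> \<omega>)"
          unfolding v_def by (rule parts_abs_le)
        also have "\<dots> \<le> higher_part (\<lambda>t. v (X t \<omega>)) T" using elim(2) by (intro higher_part_mono) (auto simp: v_def)
        finally show ?case
          unfolding abs_mult using elim(1) a0 by (intro ennreal_leI mult_mono) (auto intro!: prod_nonneg)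
      qed
    qed
    also have "\<dots> \<le> ennreal (C * (e * r) ^ 3)"
      using elim e0 av by (intro CI vm) (auto simp: v_def)
    finally show "(\<integral>\<^sup>+\<omega>. ennreal \<bar>H \<omega> * higher_part (\<lambda>t. L (X t \<omega>) - 1) (\<tau> \<omega>)\<bar> \<partial>M) \<le> ennreal (C * e ^ 3 * r ^ 3)"
      by (simp add: power_mult_distrib mult.assoc)
  qed
  moreover have "0 \<le> C * e ^ 3" using C e0 by simp
  ultimately show ?thesis using dom th by blast
qed

end

section \<open>Independent times and bounded costs\<close>

text \<open>A density in the entropy ball need not be square integrable.  It splits into a bounded centred
part whose mean square is of the order of the entropy, and a part whose mean is of the order of the
entropy.  The reason is that \<open>t ln t - t + 1\<close> grows quadratically near \<open>1\<close> and at least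
linearly far from \<open>1\<close>.\<close>

lemma entropy_ball_truncation:
  assumes "prob_space P" and L: "entropy_ball_density P (r\<^sup>2) L" and r: "0 < r" "r \<le> 1"
  shows "\<exists>d q. d \<in> borel_measurable P \<and> q \<in> borel_measurable P \<and> (\<forall>x. L x - 1 = d x + q x) \<and> (\<forall>x. \<bar>d x\<bar> \<le> 2) \<and>
     (\<integral>x. d x \<partial>P) = 0 \<and> (\<integral>x. (d x)\<^sup>2 \<partial>P) \<le> (2 * r)\<^sup>2 \<and> integrable P q \<and> (\<integral>x. \<bar>q x\<bar> \<partial>P) \<le> 8 * r\<^sup>2 \<and>
     integrable P (\<lambda>x. \<bar>L x - 1\<bar>) \<and> (\<integral>x. \<bar>L x - 1\<bar> \<partial>P) \<le> 8 * r"
proof -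
  interpret prob_space P by fact
  have L': "integrable P L" "\<And>x. 0 \<le> L x" "integrable P (\<lambda>x. L x * ln (L x))"
    "(\<integral>x. L x \<partial>P) = 1" "(\<integral>x. L x * ln (L x) \<partial>P) \<le> r\<^sup>2"
    using L by (auto simp: entropy_ball_density_def)
  have [measurable]: "L \<in> borel_measurable P" using L' by auto
  define \<phi> where "\<phi> = (\<lambda>x. L x * ln (L x) - L x + 1)"
  have phi: "integrable P \<phi>" "(\<integral>x. \<phi> x \<partial>P) \<le> r\<^sup>2" unfolding \<phi>_def using L' by (auto simp: prob_space)
  have young: "s * (L x - 1) - (exp s - 1 - s) \<le> \<phi> x" for s x
    unfolding \<phi>_def by (rule entropy_young[OF L'(2)])
  have phi0: "0 \<le> \<phi> x" for x using young[of 0 x] by simp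
  have e_half: "exp s - 1 - s \<le> s\<^sup>2" if "\<bar>s\<bar> \<le> 1 / 2" for s :: real
  proof -
    have "exp \<bar>s\<bar> \<le> exp (1 / 2)" using that by simp
    also have "\<dots> \<le> 1 + 1 / 2 + (1 / 2)\<^sup>2" by (rule exp_bound) auto
    finally have "exp \<bar>s\<bar> \<le> 2" by (simp add: power2_eq_square)
    then have "s\<^sup>2 * exp \<bar>s\<bar> / 2 \<le> s\<^sup>2 * 2 / 2" by (intro divide_right_mono mult_left_mono) auto
    then show ?thesis using exp_minus_linear_le[of s] by linarith
  qed
  define c where "c = (\<lambda>x. if \<bar>L x - 1\<bar> \<le> 1 then L x - 1 else 0)"
  define b where "b = (\<lambda>x. if \<bar>L x - 1\<bar> \<le> 1 then 0 else L x - 1)"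
  have [measurable]: "c \<in> borel_measurable P" "b \<in> borel_measurable P" unfolding c_def b_def by measurable
  have cb: "L x - 1 = c x + b x" for x by (simp add: c_def b_def)
  have c1: "\<bar>c x\<bar> \<le> 1" for x by (simp add: c_def)
  have c2: "(c x)\<^sup>2 \<le> 4 * \<phi> x" for x
  proof (cases "\<bar>L x - 1\<bar> \<le> 1")
    case True
    then have "(L x - 1) / 2 * (L x - 1) - ((L x - 1) / 2)\<^sup>2 \<le> \<phi> x"
      using young[of "(L x - 1) / 2" x] e_half[of "(L x - 1) / 2"] by simp
    then show ?thesis using True by (simp add: c_def power2_eq_square)
  qed (simp add: c_def phi0)
  have b4: "\<bar>b x\<bar> \<le> 4 * \<phi> x" for x
  proof (cases "\<bar>L x - 1\<bar> \<le> 1")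
    case False
    then have "1 < L x - 1" using L'(2)[of x] by linarith
    moreover have "exp (1/2) - 1 - 1/2 \<le> (1/2 :: real)\<^sup>2" by (rule e_half) simp
    then have "1 / 2 * (L x - 1) - 1 / 4 \<le> \<phi> x"
      using young[of "1/2" x] by (simp add: power2_eq_square)
    moreover have "4 * (1 / 2 * (L x - 1) - 1 / 4) = 2 * L x - 3" by (simp add: field_simps)
    ultimately have "L x - 1 \<le> 4 * \<phi> x" using mult_left_mono[of "1 / 2 * (L x - 1) - 1 / 4" "\<phi> x" 4] by linarith
    then show ?thesis using False \<open>1 < L x - 1\<close> by (simp add: b_def)
  qed (simp add: b_def phi0)
  have c_int: "integrable P c" by (rule integrable_const_bound[of _ 1]) (auto simp: c1)
  have csq: "integrable P (\<lambda>x. (c x)\<^sup>2)"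
  proof (rule integrable_const_bound[of _ 1])
    have "(c x)\<^sup>2 \<le> 1" for x using power_mono[OF c1[of x], where n = 2] by simp
    then show "AE x in P. norm ((c x)\<^sup>2) \<le> 1" by simp
  qed measurable
  have "b = (\<lambda>x. L x - 1 - c x)" using cb by (auto simp: fun_eq_iff)
  then have b_int: "integrable P b" using L'(1) c_int by simp
  define m where "m = (\<integral>x. c x \<partial>P)"
  have mb: "m = - (\<integral>x. b x \<partial>P)"
  proof -
    have "(\<integral>x. L x - 1 \<partial>P) = m + (\<integral>x. b x \<partial>P)" unfolding cb m_def using c_int b_int by simp
    then show ?thesis using L' by (simp add: prob_space)
  qed
  have bI: "(\<integral>x. \<bar>b x\<bar> \<partial>P) \<le> 4 * r\<^sup>2"
  proof -
    have "(\<integral>x. \<bar>b x\<bar> \<partial>P) \<le> (\<integral>x. 4 * \<phi> x \<partial>P)" using b_int phi b4 by (intro integral_mono) auto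
    then show ?thesis using phi by simp
  qed
  have cI: "(\<integral>x. (c x)\<^sup>2 \<partial>P) \<le> 4 * r\<^sup>2"
  proof -
    have "(\<integral>x. (c x)\<^sup>2 \<partial>P) \<le> (\<integral>x. 4 * \<phi> x \<partial>P)" using csq phi c2 by (intro integral_mono) auto
    then show ?thesis using phi by simp
  qed
  have m4: "\<bar>m\<bar> \<le> 4 * r\<^sup>2" using integral_abs_bound[of P b] bI unfolding mb by linarith
  have m1: "\<bar>m\<bar> \<le> 1"
  proof -
    have "(\<integral>x. \<bar>c x\<bar> \<partial>P) \<le> (\<integral>x. 1 \<partial>P)" using c_int c1 by (intro integral_mono) auto
    also have "\<dots> = 1" by (simp add: prob_space)
    finally show ?thesis using integral_abs_bound[of P c] unfolding m_def by linarith
  qed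
  define d where "d = (\<lambda>x. c x - m)"
  define q where "q = (\<lambda>x. b x + m)"
  have "(\<integral>x. (d x)\<^sup>2 \<partial>P) = (\<integral>x. (c x)\<^sup>2 - 2 * m * c x + m\<^sup>2 \<partial>P)"
    unfolding d_def by (intro Bochner_Integration.integral_cong) (auto simp: power2_diff)
  also have "\<dots> = (\<integral>x. (c x)\<^sup>2 \<partial>P) - m\<^sup>2"
    using csq c_int by (simp add: prob_space m_def[symmetric] power2_eq_square)
  finally have "(\<integral>x. (d x)\<^sup>2 \<partial>P) = (\<integral>x. (c x)\<^sup>2 \<partial>P) - m\<^sup>2" .
  then have d2: "(\<integral>x. (d x)\<^sup>2 \<partial>P) \<le> (2 * r)\<^sup>2" 
  proof -
    have "(2 * r)\<^sup>2 = 4 * r\<^sup>2" by (simp add: power_mult_distrib)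
    moreover have "0 \<le> m\<^sup>2" by simp
    ultimately show ?thesis using cI \<open>(\<integral>x. (d x)\<^sup>2 \<partial>P) = (\<integral>x. (c x)\<^sup>2 \<partial>P) - m\<^sup>2\<close> by argo
  qed
  have qI: "(\<integral>x. \<bar>q x\<bar> \<partial>P) \<le> 8 * r\<^sup>2"
  proof -
    have "(\<integral>x. \<bar>q x\<bar> \<partial>P) \<le> (\<integral>x. \<bar>b x\<bar> + \<bar>m\<bar> \<partial>P)" unfolding q_def using b_int by (intro integral_mono) auto
    also have "\<dots> = (\<integral>x. \<bar>b x\<bar> \<partial>P) + \<bar>m\<bar>" using b_int by (simp add: prob_space)
    finally show ?thesis using bI m4 by linarith
  qed
  have L1: "(\<integral>x. \<bar>L x - 1\<bar> \<partial>P) \<le> 8 * r"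
  proof -
    have "\<bar>L x - 1\<bar> \<le> (c x)\<^sup>2 / (2 * r) + r / 2 + \<bar>b x\<bar>" for x
    proof -
      have "0 \<le> (\<bar>c x\<bar> - r)\<^sup>2 / (2 * r)" using r by simp
      also have "(\<bar>c x\<bar> - r)\<^sup>2 / (2 * r) = (c x)\<^sup>2 / (2 * r) - \<bar>c x\<bar> + r / 2"
        using r by (simp add: power2_diff field_simps power2_eq_square)
      finally show ?thesis unfolding cb by linarith
    qed
    then have "(\<integral>x. \<bar>L x - 1\<bar> \<partial>P) \<le> (\<integral>x. (c x)\<^sup>2 / (2 * r) + r / 2 + \<bar>b x\<bar> \<partial>P)"
      using L'(1) csq b_int by (intro integral_mono) auto
    also have "\<dots> = (\<integral>x. (c x)\<^sup>2 \<partial>P) / (2 * r) + r / 2 + (\<integral>x. \<bar>b x\<bar> \<partial>P)"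
      using csq b_int by (simp add: prob_space)
    also have "\<dots> \<le> 4 * r\<^sup>2 / (2 * r) + r / 2 + 4 * r\<^sup>2"
      using cI bI r by (intro add_mono divide_right_mono) auto
    also have "\<dots> \<le> 4 * r\<^sup>2 / (2 * r) + r / 2 + 4 * r"
      using r by (simp add: power2_eq_square mult_left_le)
    also have "\<dots> \<le> 8 * r" using r by (simp add: power2_eq_square)
    finally show ?thesis .
  qed
  have "\<bar>d x\<bar> \<le> 2" for x using c1[of x] m1 by (simp add: d_def)
  moreover have "L x - 1 = d x + q x" for x by (simp add: cb d_def q_def)
  moreover have "(\<integral>x. d x \<partial>P) = 0" unfolding d_def using c_int by (simp add: m_def prob_space)
  moreover have "integrable P q" unfolding q_def using b_int by simp
  moreover have "d \<in> borel_measurable P" "q \<in> borel_measurable P" unfolding d_def q_def by measurable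
  moreover have "integrable P (\<lambda>x. \<bar>L x - 1\<bar>)" using L'(1) by simp
  ultimately show ?thesis using d2 qI L1 by blast
qed

lemma parts_bounded:
  fixes y :: "nat \<Rightarrow> real"
  assumes "\<And>t. \<bar>y t\<bar> \<le> D"
  shows "\<bar>linear_part y n\<bar> \<le> real n * D" and "\<bar>quadratic_part y n\<bar> \<le> (real n * D)\<^sup>2"
proof -
  have D: "0 \<le> D" using order.trans[OF abs_ge_zero assms] .
  show l: "\<bar>linear_part y n\<bar> \<le> real n * D" for n
  proof (induction n)
    case (Suc n)
    have "\<bar>linear_part y (Suc n)\<bar> \<le> \<bar>linear_part y n\<bar> + \<bar>y (Suc n)\<bar>" by simp
    also have "\<dots> \<le> real n * D + D" by (intro add_mono Suc assms)
    finally show ?case by (simp add: distrib_right add.commute)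
  qed simp
  show "\<bar>quadratic_part y n\<bar> \<le> (real n * D)\<^sup>2"
  proof (induction n)
    case (Suc n)
    have "\<bar>linear_part y n * y (Suc n)\<bar> \<le> real n * D * D"
      unfolding abs_mult using D by (intro mult_mono l assms) auto
    with Suc have "\<bar>quadratic_part y (Suc n)\<bar> \<le> (real n * D)\<^sup>2 + real n * D * D" by simp
    also have "\<dots> \<le> (real (Suc n) * D)\<^sup>2" using D by (simp add: power2_eq_square algebra_simps)
    finally show ?case .
  qed simp
qed

text \<open>In the mixed terms the coordinates of \<open>d\<close> are collected over all other times, earlier and later.
If they are centred and independent, each of these sums is of order \<open>sqrt n\<close>, and all the mixed
terms together are of order \<open>n * sqrt n\<close> instead of \<open>n\<^sup>2\<close>.\<close>
lemma quadratic_part_add: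
  "quadratic_part (\<lambda>t. d t + q t) n = quadratic_part d n + quadratic_part q n
     + (\<Sum>t=1..n. q t * (\<Sum>s\<in>{1..n} - {t}. d s))"
proof -
  have lin: "linear_part y n = (\<Sum>t=1..n. y t)" for y n
    by (induction n) (simp_all add: add.commute)
  have "quadratic_part (\<lambda>t. d t + q t) n = quadratic_part d n + quadratic_part q n
     + (linear_part q n * linear_part d n - (\<Sum>t=1..n. q t * d t))"
  proof (induction n)
    case (Suc n)
    have "linear_part (\<lambda>t. d t + q t) n = linear_part d n + linear_part q n"
      unfolding lin by (simp add: sum.distrib)
    with Suc show ?case by (simp add: algebra_simps)
  qed simp
  also have "linear_part q n * linear_part d n - (\<Sum>t=1..n. q t * d t) = (\<Sum>t=1..n. q t * (linear_part d n - d t))"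
    unfolding lin[of q] by (simp add: sum_distrib_right right_diff_distrib sum_subtractf)
  also have "\<dots> = (\<Sum>t=1..n. q t * (\<Sum>s\<in>{1..n} - {t}. d s))"
    unfolding lin by (intro sum.cong) (auto simp: sum_diff1)
  finally show ?thesis .
qed

lemma (in prob_space) L1_bound_of_L2:
  fixes U :: "'a \<Rightarrow> real"
  assumes [measurable]: "U \<in> borel_measurable M" and int: "integrable M (\<lambda>\<omega>. (U \<omega>)\<^sup>2)"
    and bd: "(\<integral>\<omega>. (U \<omega>)\<^sup>2 \<partial>M) \<le> k\<^sup>2" and k: "0 < k"
  shows "(\<integral>\<^sup>+\<omega>. ennreal \<bar>U \<omega>\<bar> \<partial>M) \<le> ennreal k"
proof -
  have pt: "\<bar>U \<omega>\<bar> \<le> (U \<omega>)\<^sup>2 / (2 * k) + k / 2" for \<omega>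
  proof -
    have "0 \<le> (\<bar>U \<omega>\<bar> - k)\<^sup>2 / (2 * k)" using k by simp
    also have "\<dots> = (U \<omega>)\<^sup>2 / (2 * k) - \<bar>U \<omega>\<bar> + k / 2"
      using k by (simp add: power2_diff field_simps power2_eq_square)
    finally show ?thesis by linarith
  qed
  have "(\<integral>\<^sup>+\<omega>. ennreal \<bar>U \<omega>\<bar> \<partial>M) \<le> (\<integral>\<^sup>+\<omega>. ennreal ((U \<omega>)\<^sup>2 / (2 * k) + k / 2) \<partial>M)"
    by (intro nn_integral_mono ennreal_leI pt)
  also have "\<dots> = ennreal (\<integral>\<omega>. (U \<omega>)\<^sup>2 / (2 * k) + k / 2 \<partial>M)"
    using int k by (intro nn_integral_eq_integral) auto
  also have "(\<integral>\<omega>. (U \<omega>)\<^sup>2 / (2 * k) + k / 2 \<partial>M) = (\<integral>\<omega>. (U \<omega>)\<^sup>2 \<partial>M) / (2 * k) + k / 2"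
    using int by (simp add: prob_space)
  also have "ennreal \<dots> \<le> ennreal (k\<^sup>2 / (2 * k) + k / 2)"
    using bd k by (intro ennreal_leI add_right_mono divide_right_mono) auto
  also have "k\<^sup>2 / (2 * k) + k / 2 = k" using k by (simp add: power2_eq_square)
  finally show ?thesis .
qed

lemma nn_integral_abs_add:
  fixes U V :: "'b \<Rightarrow> real"
  assumes [measurable]: "U \<in> borel_measurable M" "V \<in> borel_measurable M"
    and "(\<integral>\<^sup>+\<omega>. ennreal \<bar>U \<omega>\<bar> \<partial>M) \<le> ennreal p" "(\<integral>\<^sup>+\<omega>. ennreal \<bar>V \<omega>\<bar> \<partial>M) \<le> ennreal q" "0 \<le> p" "0 \<le> q"
  shows "(\<integral>\<^sup>+\<omega>. ennreal \<bar>U \<omega> + V \<omega>\<bar> \<partial>M) \<le> ennreal (p + q)"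
proof -
  have "(\<integral>\<^sup>+\<omega>. ennreal \<bar>U \<omega> + V \<omega>\<bar> \<partial>M) \<le> (\<integral>\<^sup>+\<omega>. ennreal \<bar>U \<omega>\<bar> + ennreal \<bar>V \<omega>\<bar> \<partial>M)"
    by (intro nn_integral_mono) (simp flip: ennreal_plus add: ennreal_leI)
  also have "\<dots> = (\<integral>\<^sup>+\<omega>. ennreal \<bar>U \<omega>\<bar> \<partial>M) + (\<integral>\<^sup>+\<omega>. ennreal \<bar>V \<omega>\<bar> \<partial>M)" by (intro nn_integral_add) auto
  also have "\<dots> \<le> ennreal p + ennreal q" using assms by (intro add_mono)
  finally show ?thesis using assms by (simp add: ennreal_plus)
qed

lemma nn_integral_abs_sum:
  fixes U :: "nat \<Rightarrow> 'b \<Rightarrow> real"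
  assumes "finite S" "\<And>t. t \<in> S \<Longrightarrow> U t \<in> borel_measurable M"
    "\<And>t. t \<in> S \<Longrightarrow> (\<integral>\<^sup>+\<omega>. ennreal \<bar>U t \<omega>\<bar> \<partial>M) \<le> ennreal p" "0 \<le> p"
  shows "(\<integral>\<^sup>+\<omega>. ennreal \<bar>\<Sum>t\<in>S. U t \<omega>\<bar> \<partial>M) \<le> ennreal (real (card S) * p)"
  using assms
proof (induction S)
  case (insert t S)
  have "(\<integral>\<^sup>+\<omega>. ennreal \<bar>U t \<omega> + (\<Sum>t\<in>S. U t \<omega>)\<bar> \<partial>M) \<le> ennreal (p + real (card S) * p)"
    using insert by (intro nn_integral_abs_add borel_measurable_sum) auto
  then show ?case using insert by (simp add: algebra_simps)
qed simp

context cost_model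
begin

lemma integral_X:
  fixes f :: "'a \<Rightarrow> real"
  assumes "1 \<le> t" "f \<in> borel_measurable P0"
  shows "(\<integral>\<omega>. f (X t \<omega>) \<partial>M) = (\<integral>x. f x \<partial>P0)" "integrable M (\<lambda>\<omega>. f (X t \<omega>)) \<longleftrightarrow> integrable P0 f"
  using integral_distr[OF X_measurable[OF assms(1)], of f] integrable_distr_eq[OF X_measurable[OF assms(1)], of f]
    X_distr[OF assms(1)] assms(2) by auto

lemma gen_indep_integral:
  fixes U :: "'w \<Rightarrow> real"
  assumes J: "J \<subseteq> {1..}" "t \<notin> J" "1 \<le> t" and U: "U \<in> borel_measurable (gen J)" "integrable M U"
    and f: "f \<in> borel_measurable P0" "integrable P0 f"
  shows "(\<integral>\<omega>. U \<omega> * f (X t \<omega>) \<partial>M) = (\<integral>\<omega>. U \<omega> \<partial>M) * (\<integral>x. f x \<partial>P0)"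
proof -
  have "(\<lambda>\<omega>. f (X t \<omega>)) \<in> borel_measurable (gen {t})"
    by (rule measurable_compose[OF X_gen f(1)]) (use J in auto)
  then have "indep_var borel U borel (\<lambda>\<omega>. f (X t \<omega>))"
    using J by (intro gen_indep_var[OF _ _ _ U(1)]) auto
  from indep_var_lebesgue_integral[OF this U(2)] show ?thesis
    using integral_X[OF J(3) f(1)] f(2) by simp
qed

lemma gen_indep_nn_integral_abs:
  fixes U :: "'w \<Rightarrow> real"
  assumes J: "J \<subseteq> {1..}" "t \<notin> J" "1 \<le> t" and U: "U \<in> borel_measurable (gen J)"
    and f: "f \<in> borel_measurable P0"
    and bd: "(\<integral>\<^sup>+\<omega>. ennreal \<bar>U \<omega>\<bar> \<partial>M) \<le> ennreal b" "(\<integral>\<^sup>+x. ennreal \<bar>f x\<bar> \<partial>P0) \<le> ennreal e" "0 \<le> b" "0 \<le> e"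
  shows "(\<integral>\<^sup>+\<omega>. ennreal \<bar>U \<omega> * f (X t \<omega>)\<bar> \<partial>M) \<le> ennreal (b * e)"
proof -
  have 1: "(\<lambda>\<omega>. f (X t \<omega>)) \<in> borel_measurable (gen {t})"
    by (rule measurable_compose[OF X_gen f(1)]) (use J in auto)
  have "indep_var borel (\<lambda>\<omega>. ennreal \<bar>U \<omega>\<bar>) borel (\<lambda>\<omega>. ennreal \<bar>f (X t \<omega>)\<bar>)"
    by (rule gen_indep_var[of J "{t}"]) (use J U 1 in auto)
  from indep_var_nn_integral[OF this]
  have "(\<integral>\<^sup>+\<omega>. ennreal \<bar>U \<omega> * f (X t \<omega>)\<bar> \<partial>M) = (\<integral>\<^sup>+\<omega>. ennreal \<bar>U \<omega>\<bar> \<partial>M) * (\<integral>\<^sup>+x. ennreal \<bar>f x\<bar> \<partial>P0)"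
    using nn_integral_X[OF J(3), of "\<lambda>x. ennreal \<bar>f x\<bar>"] f by (simp add: abs_mult ennreal_mult)
  also have "\<dots> \<le> ennreal b * ennreal e" using bd by (intro mult_mono) auto
  finally show ?thesis using bd by (simp add: ennreal_mult)
qed

context
  fixes d q :: "'a \<Rightarrow> real" and D s e :: real
  assumes d [measurable]: "d \<in> borel_measurable P0" and d_bd: "\<And>x. \<bar>d x\<bar> \<le> D"
    and d0: "(\<integral>x. d x \<partial>P0) = 0" and d2: "(\<integral>x. (d x)\<^sup>2 \<partial>P0) \<le> s\<^sup>2" and s: "0 < s"
    and q [measurable]: "q \<in> borel_measurable P0" and qe: "(\<integral>\<^sup>+x. ennreal \<bar>q x\<bar> \<partial>P0) \<le> ennreal e" and e: "0 \<le> e"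
begin

lemma d_integrable: "integrable P0 d" "integrable P0 (\<lambda>x. (d x)\<^sup>2)"
proof -
  show "integrable P0 d" by (rule P.integrable_const_bound[of _ D]) (auto simp: d_bd)
  have "(d x)\<^sup>2 \<le> D\<^sup>2" for x using power_mono[OF d_bd[of x], of 2] by simp
  then show "integrable P0 (\<lambda>x. (d x)\<^sup>2)" by (intro P.integrable_const_bound[of _ "D\<^sup>2"]) auto
qed

lemma d_X_gen: "t \<in> J \<Longrightarrow> J \<subseteq> {1..} \<Longrightarrow> (\<lambda>\<omega>. d (X t \<omega>)) \<in> borel_measurable (gen J)"
  by (rule measurable_compose[OF X_gen d])

lemma bounded_integrable:
  fixes U :: "'w \<Rightarrow> real"
  shows "U \<in> borel_measurable M \<Longrightarrow> (\<And>\<omega>. \<bar>U \<omega>\<bar> \<le> K) \<Longrightarrow> integrable M U"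
  by (rule integrable_const_bound[of _ K]) auto

lemma sum_L2:
  assumes "finite S" "S \<subseteq> {1..}"
  shows "(\<integral>\<omega>. (\<Sum>t\<in>S. d (X t \<omega>))\<^sup>2 \<partial>M) = real (card S) * (\<integral>x. (d x)\<^sup>2 \<partial>P0)"
  using assms
proof (induction S)
  case (insert j S)
  define A where "A = (\<lambda>\<omega>. \<Sum>t\<in>S. d (X t \<omega>))"
  have Ag: "A \<in> borel_measurable (gen S)" unfolding A_def using insert by (intro borel_measurable_sum d_X_gen) auto
  then have [measurable]: "A \<in> borel_measurable M" using insert by (intro gen_measurable) auto
  have j: "1 \<le> j" using insert by auto
  note [measurable] = X_measurable[OF j]
  have Ab: "\<bar>A \<omega>\<bar> \<le> real (card S) * D" for \<omega>
    unfolding A_def by (rule order.trans[OF sum_abs]) (use sum_bounded_above[of S "\<lambda>t. \<bar>d (X t \<omega>)\<bar>" D] d_bd in auto)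
  have iA: "integrable M A" by (rule bounded_integrable[OF _ Ab]) simp
  have "\<bar>(A \<omega>)\<^sup>2\<bar> \<le> (real (card S) * D)\<^sup>2" for \<omega> using power_mono[OF Ab[of \<omega>], of 2] by simp
  then have iA2: "integrable M (\<lambda>\<omega>. (A \<omega>)\<^sup>2)" by (intro bounded_integrable) auto
  have "D \<ge> 0" using order.trans[OF abs_ge_zero d_bd] .
  then have "\<bar>A \<omega> * d (X j \<omega>)\<bar> \<le> real (card S) * D * D" for \<omega>
    unfolding abs_mult by (intro mult_mono Ab d_bd) auto
  then have iAd: "integrable M (\<lambda>\<omega>. A \<omega> * d (X j \<omega>))" by (intro bounded_integrable) auto
  have "(\<integral>\<omega>. (\<Sum>t\<in>insert j S. d (X t \<omega>))\<^sup>2 \<partial>M) = (\<integral>\<omega>. (d (X j \<omega>))\<^sup>2 + (2 * (A \<omega> * d (X j \<omega>)) + (A \<omega>)\<^sup>2) \<partial>M)"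
    using insert by (intro Bochner_Integration.integral_cong) (auto simp: A_def power2_eq_square algebra_simps)
  also have "\<dots> = (\<integral>\<omega>. (d (X j \<omega>))\<^sup>2 \<partial>M) + (2 * (\<integral>\<omega>. A \<omega> * d (X j \<omega>) \<partial>M) + (\<integral>\<omega>. (A \<omega>)\<^sup>2 \<partial>M))"
    using iA2 iAd integral_X(2)[OF j, of "\<lambda>x. (d x)\<^sup>2"] d_integrable by simp
  also have "(\<integral>\<omega>. A \<omega> * d (X j \<omega>) \<partial>M) = 0"
    using gen_indep_integral[OF _ _ j Ag iA d d_integrable(1)] insert d0 by simp
  also have "(\<integral>\<omega>. (d (X j \<omega>))\<^sup>2 \<partial>M) = (\<integral>x. (d x)\<^sup>2 \<partial>P0)" using integral_X(1)[OF j, of "\<lambda>x. (d x)\<^sup>2"] by simp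
  finally show ?case using insert by (simp add: A_def algebra_simps)
qed simp

lemma sum_L1:
  assumes S: "finite S" "S \<subseteq> {1..}"
  shows "(\<integral>\<^sup>+\<omega>. ennreal \<bar>\<Sum>t\<in>S. d (X t \<omega>)\<bar> \<partial>M) \<le> ennreal (sqrt (real (card S)) * s)"
proof (cases "S = {}")
  case False
  have [measurable]: "(\<lambda>\<omega>. \<Sum>t\<in>S. d (X t \<omega>)) \<in> borel_measurable M"
    using S X_measurable by (intro borel_measurable_sum measurable_compose[OF _ d]) auto
  have sb: "\<bar>\<Sum>t\<in>S. d (X t \<omega>)\<bar> \<le> real (card S) * D" for \<omega>
    by (rule order.trans[OF sum_abs]) (use sum_bounded_above[of S "\<lambda>t. \<bar>d (X t \<omega>)\<bar>" D] d_bd in auto)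
  have "\<bar>(\<Sum>t\<in>S. d (X t \<omega>))\<^sup>2\<bar> \<le> (real (card S) * D)\<^sup>2" for \<omega>
    using power_mono[OF sb[of \<omega>], where n = 2] by simp
  then have "integrable M (\<lambda>\<omega>. (\<Sum>t\<in>S. d (X t \<omega>))\<^sup>2)" by (intro bounded_integrable) auto
  moreover have "(\<integral>\<omega>. (\<Sum>t\<in>S. d (X t \<omega>))\<^sup>2 \<partial>M) \<le> (sqrt (real (card S)) * s)\<^sup>2"
    unfolding sum_L2[OF S] using d2 by (simp add: power_mult_distrib mult_left_mono)
  moreover have "0 < sqrt (real (card S)) * s" using s S False by (simp add: card_gt_0_iff)
  ultimately show ?thesis by (intro L1_bound_of_L2) auto
qed simp

lemma linear_part_sum: "linear_part y n = (\<Sum>t\<in>{1..n}. y t)"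
  by (induction n) (simp_all add: add.commute)

text \<open>The increments of the quadratic part are orthogonal to its past, so that their mean squares add up.\<close>
lemma quadratic_L2: "(\<integral>\<omega>. (quadratic_part (\<lambda>t. d (X t \<omega>)) n)\<^sup>2 \<partial>M) \<le> (real n * s\<^sup>2)\<^sup>2"
proof (induction n)
  case (Suc n)
  define l where "l = (\<lambda>\<omega>. linear_part (\<lambda>t. d (X t \<omega>)) n)"
  define k where "k = (\<lambda>\<omega>. quadratic_part (\<lambda>t. d (X t \<omega>)) n)"
  have lg: "l \<in> borel_measurable (gen {1..n})" "k \<in> borel_measurable (gen {1..n})"
    unfolding l_def k_def by (auto intro!: parts_gen d)
  have [measurable]: "l \<in> borel_measurable M" "k \<in> borel_measurable M" using lg by (auto intro!: gen_measurable[of _ "{1..n}"])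
  have [measurable]: "X (Suc n) \<in> measurable M P0" by (rule X_measurable) simp
  have D: "D \<ge> 0" using order.trans[OF abs_ge_zero d_bd] .
  have lb: "\<bar>l \<omega>\<bar> \<le> real n * D" "\<bar>k \<omega>\<bar> \<le> (real n * D)\<^sup>2" for \<omega>
    unfolding l_def k_def by (rule parts_bounded; rule d_bd)+
  have lb2: "\<bar>(l \<omega>)\<^sup>2\<bar> \<le> (real n * D)\<^sup>2" for \<omega> using power_mono[OF lb(1)[of \<omega>], of 2] by simp
  have kb2: "\<bar>(k \<omega>)\<^sup>2\<bar> \<le> ((real n * D)\<^sup>2)\<^sup>2" for \<omega> using power_mono[OF lb(2)[of \<omega>], of 2] by simp
  have klb: "\<bar>k \<omega> * l \<omega>\<bar> \<le> (real n * D)\<^sup>2 * (real n * D)" for \<omega> unfolding abs_mult using D by (intro mult_mono lb) auto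
  have db2: "(d x)\<^sup>2 \<le> D\<^sup>2" for x using power_mono[OF d_bd[of x], of 2] by simp
  have i: "integrable M (\<lambda>\<omega>. (l \<omega>)\<^sup>2)" "integrable M (\<lambda>\<omega>. (k \<omega>)\<^sup>2)" "integrable M (\<lambda>\<omega>. k \<omega> * l \<omega>)"
    by (rule bounded_integrable[OF _ lb2] bounded_integrable[OF _ kb2] bounded_integrable[OF _ klb]; simp)+
  have "\<bar>k \<omega> * l \<omega> * d (X (Suc n) \<omega>)\<bar> \<le> (real n * D)\<^sup>2 * (real n * D) * D" for \<omega>
    unfolding abs_mult[of "k \<omega> * l \<omega>"] using D by (intro mult_mono klb d_bd) auto
  then have i2: "integrable M (\<lambda>\<omega>. k \<omega> * l \<omega> * d (X (Suc n) \<omega>))" by (intro bounded_integrable) auto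
  have "\<bar>(l \<omega>)\<^sup>2 * (d (X (Suc n) \<omega>))\<^sup>2\<bar> \<le> (real n * D)\<^sup>2 * D\<^sup>2" for \<omega>
    unfolding abs_mult using D db2 lb2[of \<omega>] by (intro mult_mono) auto
  then have i3: "integrable M (\<lambda>\<omega>. (l \<omega>)\<^sup>2 * (d (X (Suc n) \<omega>))\<^sup>2)" by (intro bounded_integrable) auto
  have "(\<integral>\<omega>. (quadratic_part (\<lambda>t. d (X t \<omega>)) (Suc n))\<^sup>2 \<partial>M)
    = (\<integral>\<omega>. (k \<omega>)\<^sup>2 + (2 * (k \<omega> * l \<omega> * d (X (Suc n) \<omega>)) + (l \<omega>)\<^sup>2 * (d (X (Suc n) \<omega>))\<^sup>2) \<partial>M)"
    by (intro Bochner_Integration.integral_cong) (auto simp: k_def l_def power2_eq_square algebra_simps)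
  also have "\<dots> = (\<integral>\<omega>. (k \<omega>)\<^sup>2 \<partial>M) + (2 * (\<integral>\<omega>. k \<omega> * l \<omega> * d (X (Suc n) \<omega>) \<partial>M) + (\<integral>\<omega>. (l \<omega>)\<^sup>2 * (d (X (Suc n) \<omega>))\<^sup>2 \<partial>M))"
    using i i2 i3 by simp
  also have "(\<integral>\<omega>. k \<omega> * l \<omega> * d (X (Suc n) \<omega>) \<partial>M) = 0"
    using gen_indep_integral[of "{1..n}" "Suc n" "\<lambda>\<omega>. k \<omega> * l \<omega>" d] lg i(3) d_integrable d0 by auto
  also have "(\<integral>\<omega>. (l \<omega>)\<^sup>2 * (d (X (Suc n) \<omega>))\<^sup>2 \<partial>M) = (\<integral>\<omega>. (l \<omega>)\<^sup>2 \<partial>M) * (\<integral>x. (d x)\<^sup>2 \<partial>P0)"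
    using lg i(1) d_integrable by (intro gen_indep_integral[of "{1..n}"]) auto
  also have "(\<integral>\<omega>. (l \<omega>)\<^sup>2 \<partial>M) = real n * (\<integral>x. (d x)\<^sup>2 \<partial>P0)"
    unfolding l_def linear_part_sum using sum_L2[of "{1..n}"] by auto
  also have "(\<integral>\<omega>. (k \<omega>)\<^sup>2 \<partial>M) + (2 * 0 + real n * (\<integral>x. (d x)\<^sup>2 \<partial>P0) * (\<integral>x. (d x)\<^sup>2 \<partial>P0))
     \<le> (real n * s\<^sup>2)\<^sup>2 + real n * s\<^sup>2 * s\<^sup>2"
  proof -
    have "0 \<le> (\<integral>x. (d x)\<^sup>2 \<partial>P0)" by (intro Bochner_Integration.integral_nonneg) simp
    then have "real n * (\<integral>x. (d x)\<^sup>2 \<partial>P0) * (\<integral>x. (d x)\<^sup>2 \<partial>P0) \<le> real n * s\<^sup>2 * s\<^sup>2"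
      using d2 by (intro mult_mono) auto
    then show ?thesis using Suc unfolding k_def by linarith
  qed
  also have "\<dots> \<le> (real (Suc n) * s\<^sup>2)\<^sup>2"
  proof -
    have "(real (Suc n) * s\<^sup>2)\<^sup>2 = (real n * s\<^sup>2)\<^sup>2 + real n * s\<^sup>2 * s\<^sup>2 + (real n * s\<^sup>2 * s\<^sup>2 + s\<^sup>2 * s\<^sup>2)"
      by (simp add: power2_eq_square algebra_simps)
    moreover have "0 \<le> real n * s\<^sup>2 * s\<^sup>2" "0 \<le> s\<^sup>2 * s\<^sup>2" by simp_all
    ultimately show ?thesis by linarith
  qed
  finally show ?case .
qed simp

lemma quadratic_d_L1: "(\<integral>\<^sup>+\<omega>. ennreal \<bar>quadratic_part (\<lambda>t. d (X t \<omega>)) n\<bar> \<partial>M) \<le> ennreal (real n * s\<^sup>2)"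
proof (cases "n = 0")
  case False
  have [measurable]: "(\<lambda>\<omega>. quadratic_part (\<lambda>t. d (X t \<omega>)) n) \<in> borel_measurable M"
    by (rule gen_measurable[OF parts_gen(2)[of n "{1..n}", OF _ _ d]]) auto
  have "\<bar>quadratic_part (\<lambda>t. d (X t \<omega>)) n\<bar> \<le> (real n * D)\<^sup>2" for \<omega> by (rule parts_bounded; rule d_bd)
  from power_mono[OF this, where n = 2] have "\<bar>(quadratic_part (\<lambda>t. d (X t \<omega>)) n)\<^sup>2\<bar> \<le> ((real n * D)\<^sup>2)\<^sup>2" for \<omega> by simp
  then have "integrable M (\<lambda>\<omega>. (quadratic_part (\<lambda>t. d (X t \<omega>)) n)\<^sup>2)" by (intro bounded_integrable) auto
  then show ?thesis using quadratic_L2[of n] s False by (intro L1_bound_of_L2) auto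
qed simp

lemma linear_q_L1: "(\<integral>\<^sup>+\<omega>. ennreal \<bar>linear_part (\<lambda>t. q (X t \<omega>)) n\<bar> \<partial>M) \<le> ennreal (real n * e)"
proof -
  have "(\<integral>\<^sup>+\<omega>. ennreal \<bar>\<Sum>t\<in>{1..n}. q (X t \<omega>)\<bar> \<partial>M) \<le> ennreal (real (card {1..n}) * e)"
    using e qe X_measurable nn_integral_X[of _ "\<lambda>x. ennreal \<bar>q x\<bar>"]
    by (intro nn_integral_abs_sum measurable_compose[OF _ q]) auto
  then show ?thesis by (simp add: linear_part_sum)
qed

lemma quadratic_q_L1: "(\<integral>\<^sup>+\<omega>. ennreal \<bar>quadratic_part (\<lambda>t. q (X t \<omega>)) n\<bar> \<partial>M) \<le> ennreal ((real n * e)\<^sup>2)"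
proof (induction n)
  case (Suc n)
  have g: "(\<lambda>\<omega>. linear_part (\<lambda>t. q (X t \<omega>)) n) \<in> borel_measurable (gen {1..n})"
    "(\<lambda>\<omega>. quadratic_part (\<lambda>t. q (X t \<omega>)) n) \<in> borel_measurable (gen {1..n})"
    by (auto intro!: parts_gen q)
  have [measurable]: "(\<lambda>\<omega>. linear_part (\<lambda>t. q (X t \<omega>)) n) \<in> borel_measurable M"
    "(\<lambda>\<omega>. quadratic_part (\<lambda>t. q (X t \<omega>)) n) \<in> borel_measurable M"
    using g by (auto intro!: gen_measurable[of _ "{1..n}"])
  have [measurable]: "X (Suc n) \<in> measurable M P0" by (rule X_measurable) simp
  have "(\<integral>\<^sup>+\<omega>. ennreal \<bar>linear_part (\<lambda>t. q (X t \<omega>)) n * q (X (Suc n) \<omega>)\<bar> \<partial>M) \<le> ennreal (real n * e * e)"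
    using linear_q_L1[of n] qe e by (intro gen_indep_nn_integral_abs[OF _ _ _ g(1)]) auto
  from nn_integral_abs_add[OF _ _ Suc.IH this] e
  have "(\<integral>\<^sup>+\<omega>. ennreal \<bar>quadratic_part (\<lambda>t. q (X t \<omega>)) (Suc n)\<bar> \<partial>M) \<le> ennreal ((real n * e)\<^sup>2 + real n * e * e)"
    by simp
  also have "\<dots> \<le> ennreal ((real (Suc n) * e)\<^sup>2)"
    using e by (intro ennreal_leI) (simp add: power2_eq_square algebra_simps)
  finally show ?case .
qed simp

lemma cross_L1:
  "(\<integral>\<^sup>+\<omega>. ennreal \<bar>\<Sum>t=1..n. q (X t \<omega>) * (\<Sum>u\<in>{1..n} - {t}. d (X u \<omega>))\<bar> \<partial>M) \<le> ennreal (real n * (sqrt (real n) * s * e))"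
proof -
  have "(\<integral>\<^sup>+\<omega>. ennreal \<bar>\<Sum>t\<in>{1..n}. q (X t \<omega>) * (\<Sum>u\<in>{1..n} - {t}. d (X u \<omega>))\<bar> \<partial>M) \<le> ennreal (real (card {1..n}) * (sqrt (real n) * s * e))"
  proof (rule nn_integral_abs_sum)
    fix t assume t: "t \<in> {1..n}"
    have sub: "{1..n} - {t} \<subseteq> {1..}" by auto
    have g: "(\<lambda>\<omega>. \<Sum>u\<in>{1..n} - {t}. d (X u \<omega>)) \<in> borel_measurable (gen ({1..n} - {t}))"
      by (intro borel_measurable_sum d_X_gen) auto
    have [measurable]: "X t \<in> measurable M P0" using t by (intro X_measurable) auto
    have [measurable]: "(\<lambda>\<omega>. \<Sum>u\<in>{1..n} - {t}. d (X u \<omega>)) \<in> borel_measurable M" by (rule gen_measurable[OF g sub])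
    show "(\<lambda>\<omega>. q (X t \<omega>) * (\<Sum>u\<in>{1..n} - {t}. d (X u \<omega>))) \<in> borel_measurable M" by measurable
    have "(\<integral>\<^sup>+\<omega>. ennreal \<bar>\<Sum>u\<in>{1..n} - {t}. d (X u \<omega>)\<bar> \<partial>M) \<le> ennreal (sqrt (real (card ({1..n} - {t}))) * s)"
      by (rule sum_L1) auto
    also have "\<dots> \<le> ennreal (sqrt (real n) * s)"
      using s by (intro ennreal_leI mult_right_mono) (auto simp: card_Diff_singleton_if)
    finally have "(\<integral>\<^sup>+\<omega>. ennreal \<bar>(\<Sum>u\<in>{1..n} - {t}. d (X u \<omega>)) * q (X t \<omega>)\<bar> \<partial>M) \<le> ennreal (sqrt (real n) * s * e)"
      using t qe e s by (intro gen_indep_nn_integral_abs[OF sub _ _ g]) auto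
    then show "(\<integral>\<^sup>+\<omega>. ennreal \<bar>q (X t \<omega>) * (\<Sum>u\<in>{1..n} - {t}. d (X u \<omega>))\<bar> \<partial>M) \<le> ennreal (sqrt (real n) * s * e)"
      by (simp add: mult.commute)
  qed (use s e in auto)
  then show ?thesis by simp
qed

text \<open>If \<open>s\<^sup>2\<close> and \<open>e\<close> are of the order of the entropy, the quadratic part is of order \<open>n\<close> times the
entropy as long as \<open>n\<close> is at most the inverse of the entropy; a bound of order \<open>n\<^sup>2\<close> would only
suit times with a third moment.\<close>

lemma quadratic_L1:
  "(\<integral>\<^sup>+\<omega>. ennreal \<bar>quadratic_part (\<lambda>t. d (X t \<omega>) + q (X t \<omega>)) n\<bar> \<partial>M) \<le> ennreal (2 * (real n * s\<^sup>2 + (real n * e)\<^sup>2))"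
proof -
  have sub: "{1..n} \<subseteq> {1..}" by auto
  have [measurable]: "(\<lambda>\<omega>. quadratic_part (\<lambda>t. d (X t \<omega>)) n) \<in> borel_measurable M"
    "(\<lambda>\<omega>. quadratic_part (\<lambda>t. q (X t \<omega>)) n) \<in> borel_measurable M"
    by (rule gen_measurable[OF parts_gen(2)[OF order.refl sub] sub]; fact)+
  have m [measurable]: "(\<lambda>\<omega>. \<Sum>t=1..n. q (X t \<omega>) * (\<Sum>u\<in>{1..n} - {t}. d (X u \<omega>))) \<in> borel_measurable M"
    by (intro borel_measurable_sum borel_measurable_times measurable_compose[OF X_measurable q] measurable_compose[OF X_measurable d]) auto
  have "(\<integral>\<^sup>+\<omega>. ennreal \<bar>quadratic_part (\<lambda>t. d (X t \<omega>) + q (X t \<omega>)) n\<bar> \<partial>M)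
    \<le> ennreal (real n * s\<^sup>2 + (real n * e)\<^sup>2 + real n * (sqrt (real n) * s * e))"
    unfolding quadratic_part_add using e s
    by (intro nn_integral_abs_add quadratic_d_L1 quadratic_q_L1 cross_L1 m) auto
  also have "\<dots> \<le> ennreal (2 * (real n * s\<^sup>2 + (real n * e)\<^sup>2))"
  proof (intro ennreal_leI)
    have "0 \<le> (sqrt (real n) * s - real n * e)\<^sup>2" by simp
    also have "\<dots> = real n * s\<^sup>2 + (real n * e)\<^sup>2 - 2 * (real n * (sqrt (real n) * s * e))"
      by (simp add: power2_diff power_mult_distrib)
    finally have *: "0 \<le> real n * s\<^sup>2 + (real n * e)\<^sup>2 - 2 * (real n * (sqrt (real n) * s * e))" .
    show "real n * s\<^sup>2 + (real n * e)\<^sup>2 + real n * (sqrt (real n) * s * e) \<le> 2 * (real n * s\<^sup>2 + (real n * e)\<^sup>2)"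
    proof -
      have "A + B + z \<le> 2 * (A + B)" if "0 \<le> A + B - 2 * z" "0 \<le> A" "0 \<le> B" for A B z :: real
        using that by argo
      from this[OF *] show ?thesis by simp
    qed
  qed
  finally show ?thesis .
qed

lemma linear_L1:
  "(\<integral>\<^sup>+\<omega>. ennreal \<bar>linear_part (\<lambda>t. d (X t \<omega>) + q (X t \<omega>)) n\<bar> \<partial>M) \<le> ennreal (sqrt (real n) * s + real n * e)"
proof -
  have sub: "{1..n} \<subseteq> {1..}" by auto
  have eq: "linear_part (\<lambda>t. d (X t \<omega>) + q (X t \<omega>)) n = (\<Sum>t\<in>{1..n}. d (X t \<omega>)) + linear_part (\<lambda>t. q (X t \<omega>)) n" for \<omega>
    unfolding linear_part_sum by (simp add: sum.distrib)
  have [measurable]: "(\<lambda>\<omega>. linear_part (\<lambda>t. q (X t \<omega>)) n) \<in> borel_measurable M"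
    by (rule gen_measurable[OF parts_gen(1)[OF order.refl sub] sub]; fact)
  have m [measurable]: "(\<lambda>\<omega>. \<Sum>t\<in>{1..n}. d (X t \<omega>)) \<in> borel_measurable M"
    by (intro borel_measurable_sum measurable_compose[OF X_measurable d]) auto
  show ?thesis unfolding eq using sum_L1[of "{1..n}"] sub s e
    by (intro nn_integral_abs_add linear_q_L1 m) auto
qed

end

end

context cost_model
begin

text \<open>The growth in \<open>n\<close> is quadratic and not cubic; for this reason a second moment of an independent
time is enough.  The constant is \<open>64 + 1024\<close>, from the bound in the case of short times.\<close>
lemma higher_part_L1:
  assumes L: "entropy_ball_density P0 (r\<^sup>2) L" and r: "0 < r" "r \<le> 1"
  shows "(\<integral>\<^sup>+\<omega>. ennreal \<bar>higher_part (\<lambda>t. L (X t \<omega>) - 1) n\<bar> \<partial>M) \<le> ennreal (1088 * (real n)\<^sup>2 * r ^ 3)"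
proof -
  obtain d q where d [measurable]: "d \<in> borel_measurable P0" and q [measurable]: "q \<in> borel_measurable P0"
    and dq: "\<And>x. L x - 1 = d x + q x" and d2: "\<And>x. \<bar>d x\<bar> \<le> 2" "(\<integral>x. d x \<partial>P0) = 0" "(\<integral>x. (d x)\<^sup>2 \<partial>P0) \<le> (2 * r)\<^sup>2"
    and qi: "integrable P0 q" "(\<integral>x. \<bar>q x\<bar> \<partial>P0) \<le> 8 * r\<^sup>2"
    and Li: "integrable P0 (\<lambda>x. \<bar>L x - 1\<bar>)" "(\<integral>x. \<bar>L x - 1\<bar> \<partial>P0) \<le> 8 * r"
    using entropy_ball_truncation[OF P.prob_space_axioms L r] by blast
  have L': "L \<in> borel_measurable P0" "\<And>x. 0 \<le> L x" "integrable P0 L" "(\<integral>x. L x \<partial>P0) = 1"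
    using L by (auto simp: entropy_ball_density_def)
  note [measurable] = L'(1)
  define v where "v = (\<lambda>x. L x - 1)"
  have v [measurable]: "v \<in> borel_measurable P0" unfolding v_def by measurable
  have qe: "(\<integral>\<^sup>+x. ennreal \<bar>q x\<bar> \<partial>P0) \<le> ennreal (8 * r\<^sup>2)"
    using nn_integral_eq_integral[OF integrable_abs[OF qi(1)]] qi(2) by (simp add: ennreal_leI)
  have ve: "(\<integral>\<^sup>+x. ennreal \<bar>v x\<bar> \<partial>P0) \<le> ennreal (8 * r)"
    using nn_integral_eq_integral[OF Li(1)] Li(2) by (simp add: v_def ennreal_leI)
  have Le: "(\<integral>\<^sup>+x. ennreal \<bar>L x\<bar> \<partial>P0) \<le> ennreal 1"
    using nn_integral_eq_integral[OF L'(3)] L' by simp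
  have r0: "0 < 2 * r" "0 \<le> 8 * r\<^sup>2" using r by auto
  have vdq: "v x = d x + q x" for x by (simp add: v_def dq)
  note quad = quadratic_L1[OF d d2 r0(1) q qe r0(2), folded vdq]
  note lin = linear_L1[OF d d2 r0(1) q qe r0(2), folded vdq]
  have veq: "(\<lambda>t. L (X t \<omega>) - 1) = (\<lambda>t. v (X t \<omega>))" for \<omega> by (simp add: v_def)
  have gen: "(\<lambda>\<omega>. linear_part (\<lambda>t. v (X t \<omega>)) n) \<in> borel_measurable (gen {1..n})"
    "(\<lambda>\<omega>. quadratic_part (\<lambda>t. v (X t \<omega>)) n) \<in> borel_measurable (gen {1..n})"
    "(\<lambda>\<omega>. higher_part (\<lambda>t. v (X t \<omega>)) n) \<in> borel_measurable (gen {1..n})" for n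
    by (auto intro!: parts_gen v)
  have M [measurable]: "(\<lambda>\<omega>. linear_part (\<lambda>t. v (X t \<omega>)) n) \<in> borel_measurable M"
    "(\<lambda>\<omega>. quadratic_part (\<lambda>t. v (X t \<omega>)) n) \<in> borel_measurable M"
    "(\<lambda>\<omega>. higher_part (\<lambda>t. v (X t \<omega>)) n) \<in> borel_measurable M" for n
    using gen[of n] by (auto intro!: gen_measurable[of _ "{1..n}"])
  define b where "b = (\<lambda>n::nat. 64 * (real n)\<^sup>2 * r ^ 3 + 1024 * real n ^ 3 * r ^ 5)"
  have b0: "0 \<le> b n" for n unfolding b_def using r by simp
  have q0: "0 \<le> 2 * (real n * (2 * r)\<^sup>2 + (real n * (8 * r\<^sup>2))\<^sup>2)" for n by simp
  (* Short times: the defining recursion, each step of which costs the mean of the quadratic part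
     times the mean of one coordinate. *)
  have rec: "(\<integral>\<^sup>+\<omega>. ennreal \<bar>higher_part (\<lambda>t. v (X t \<omega>)) n\<bar> \<partial>M) \<le> ennreal (b n)" for n
  proof (induction n)
    case (Suc n)
    have [measurable]: "X (Suc n) \<in> measurable M P0" by (rule X_measurable) simp
    have 1: "(\<integral>\<^sup>+\<omega>. ennreal \<bar>higher_part (\<lambda>t. v (X t \<omega>)) n * L (X (Suc n) \<omega>)\<bar> \<partial>M) \<le> ennreal (b n * 1)"
      using Suc.IH Le b0 by (intro gen_indep_nn_integral_abs[OF _ _ _ gen(3)[of n]]) auto
    have 2: "(\<integral>\<^sup>+\<omega>. ennreal \<bar>quadratic_part (\<lambda>t. v (X t \<omega>)) n * v (X (Suc n) \<omega>)\<bar> \<partial>M)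
       \<le> ennreal (2 * (real n * (2 * r)\<^sup>2 + (real n * (8 * r\<^sup>2))\<^sup>2) * (8 * r))"
      using quad ve r by (intro gen_indep_nn_integral_abs[OF _ _ _ gen(2)[of n]]) auto
    have "(\<integral>\<^sup>+\<omega>. ennreal \<bar>higher_part (\<lambda>t. v (X t \<omega>)) (Suc n)\<bar> \<partial>M)
      = (\<integral>\<^sup>+\<omega>. ennreal \<bar>higher_part (\<lambda>t. v (X t \<omega>)) n * L (X (Suc n) \<omega>) + quadratic_part (\<lambda>t. v (X t \<omega>)) n * v (X (Suc n) \<omega>)\<bar> \<partial>M)"
      by (simp add: v_def)
    also have "\<dots> \<le> ennreal (b n * 1 + 2 * (real n * (2 * r)\<^sup>2 + (real n * (8 * r\<^sup>2))\<^sup>2) * (8 * r))"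
      using b0 q0[of n] r by (intro nn_integral_abs_add 1 2) (auto intro!: mult_nonneg_nonneg)
    also have "\<dots> \<le> ennreal (b (Suc n))"
    proof (intro ennreal_leI)
      have "b (Suc n) = b n * 1 + 2 * (real n * (2 * r)\<^sup>2 + (real n * (8 * r\<^sup>2))\<^sup>2) * (8 * r)
         + (64 * real n * r ^ 3 + 64 * r ^ 3 + 2048 * (real n)\<^sup>2 * r ^ 5 + 3072 * real n * r ^ 5 + 1024 * r ^ 5)"
        unfolding b_def by (simp add: eval_nat_numeral algebra_simps)
      moreover have "0 \<le> 64 * real n * r ^ 3 + 64 * r ^ 3 + 2048 * (real n)\<^sup>2 * r ^ 5 + 3072 * real n * r ^ 5 + 1024 * r ^ 5"
        using r by (intro add_nonneg_nonneg mult_nonneg_nonneg) auto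
      ultimately show "b n * 1 + 2 * (real n * (2 * r)\<^sup>2 + (real n * (8 * r\<^sup>2))\<^sup>2) * (8 * r) \<le> b (Suc n)" by argo
    qed
    finally show ?case .
  qed (simp add: b_def)
  show ?thesis
  proof (cases "real n * r\<^sup>2 \<le> 1")
    case True
    have "1024 * (real n)\<^sup>2 * r ^ 3 * (real n * r\<^sup>2) \<le> 1024 * (real n)\<^sup>2 * r ^ 3 * 1"
      using True r by (intro mult_left_mono) auto
    moreover have "1024 * (real n)\<^sup>2 * r ^ 3 * (real n * r\<^sup>2) = 1024 * real n ^ 3 * r ^ 5"
      by (simp add: eval_nat_numeral)
    ultimately have "b n \<le> 1088 * (real n)\<^sup>2 * r ^ 3" unfolding b_def by argo
    then show ?thesis using order.trans[OF rec ennreal_leI] unfolding veq by blast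
  next
    case False
    (* Long times: z, the product of n and the entropy, exceeds 1, and each part of the expansion is
       at most a multiple of its square. *)
    define z where "z = real n * r\<^sup>2"
    have z: "1 < z" using False by (simp add: z_def)
    define p where "p = (\<lambda>\<omega>. \<Prod>t=1..n. L (X t \<omega>))"
    have pm [measurable]: "p \<in> borel_measurable M"
      unfolding p_def by (intro borel_measurable_prod measurable_compose[OF X_measurable L'(1)]) auto
    have pI: "(\<integral>\<^sup>+\<omega>. ennreal \<bar>p \<omega>\<bar> \<partial>M) \<le> ennreal 1"
    proof -
      have "(\<integral>\<^sup>+\<omega>. ennreal \<bar>p \<omega>\<bar> \<partial>M) = (\<integral>\<^sup>+\<omega>. (\<Prod>t\<in>{1..n}. ennreal (L (X t \<omega>))) \<partial>M)"
        unfolding p_def using L'(2) by (intro nn_integral_cong) (simp add: prod_ennreal prod_nonneg)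
      also have "\<dots> = (\<integral>\<^sup>+x. ennreal (L x) \<partial>P0) ^ card {1..n}" by (intro nn_integral_prod) auto
      also have "(\<integral>\<^sup>+x. ennreal (L x) \<partial>P0) = 1" using nn_integral_eq_integral[OF L'(3)] L' by simp
      finally show ?thesis by simp
    qed
    have heq: "higher_part (\<lambda>t. v (X t \<omega>)) n = (p \<omega> + (- 1)) + (- linear_part (\<lambda>t. v (X t \<omega>)) n + - quadratic_part (\<lambda>t. v (X t \<omega>)) n)" for \<omega>
      using prod_one_plus_expansion[of "\<lambda>t. v (X t \<omega>)" n] by (simp add: p_def v_def)
    have 1: "(\<integral>\<^sup>+\<omega>. ennreal \<bar>p \<omega> + (- 1)\<bar> \<partial>M) \<le> ennreal (1 + 1)"
      by (rule nn_integral_abs_add[OF pm _ pI]) (auto simp: emeasure_space_1)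
    have 2: "(\<integral>\<^sup>+\<omega>. ennreal \<bar>- linear_part (\<lambda>t. v (X t \<omega>)) n + - quadratic_part (\<lambda>t. v (X t \<omega>)) n\<bar> \<partial>M)
      \<le> ennreal ((sqrt (real n) * (2 * r) + real n * (8 * r\<^sup>2)) + 2 * (real n * (2 * r)\<^sup>2 + (real n * (8 * r\<^sup>2))\<^sup>2))"
      using lin[of n] quad[of n] r q0[of n] by (intro nn_integral_abs_add) auto
    have "(\<integral>\<^sup>+\<omega>. ennreal \<bar>higher_part (\<lambda>t. v (X t \<omega>)) n\<bar> \<partial>M)
       \<le> ennreal ((1 + 1) + ((sqrt (real n) * (2 * r) + real n * (8 * r\<^sup>2)) + 2 * (real n * (2 * r)\<^sup>2 + (real n * (8 * r\<^sup>2))\<^sup>2)))"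
      unfolding heq using r q0[of n] by (intro nn_integral_abs_add 1 2) auto
    also have "\<dots> \<le> ennreal (1088 * (real n)\<^sup>2 * r ^ 3)"
    proof (intro ennreal_leI)
      have sq: "sqrt (real n) * r = sqrt z" using r by (simp add: z_def real_sqrt_mult)
      have z2: "z \<le> z\<^sup>2" "1 \<le> z\<^sup>2" using z by (auto simp: power2_eq_square intro: order.trans[of 1 z])
      have sz: "sqrt z \<le> z" using z z2 by (intro real_le_lsqrt) auto
      have e: "(1 + 1) + ((sqrt (real n) * (2 * r) + real n * (8 * r\<^sup>2)) + 2 * (real n * (2 * r)\<^sup>2 + (real n * (8 * r\<^sup>2))\<^sup>2))
        = 2 + 2 * (sqrt (real n) * r) + 16 * z + 128 * z\<^sup>2"
        by (simp add: z_def power_mult_distrib algebra_simps)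
      have "2 + 2 * sqrt z + 16 * z + 128 * z\<^sup>2 \<le> 148 * z\<^sup>2" using sz z2 by argo
      also have "\<dots> = 148 * (real n)\<^sup>2 * (r ^ 3 * r)" by (simp add: z_def eval_nat_numeral)
      also have "\<dots> \<le> 148 * (real n)\<^sup>2 * (r ^ 3 * 1)" using r by (intro mult_left_mono) auto
      also have "\<dots> \<le> 1088 * (real n)\<^sup>2 * r ^ 3" using r by simp
      finally show "(1 + 1) + ((sqrt (real n) * (2 * r) + real n * (8 * r\<^sup>2)) + 2 * (real n * (2 * r)\<^sup>2 + (real n * (8 * r\<^sup>2))\<^sup>2))
         \<le> 1088 * (real n)\<^sup>2 * r ^ 3" unfolding e sq .
    qed
    finally show ?thesis unfolding veq .
  qed
qed

definition tau_algebra :: "'w measure" where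
  "tau_algebra = vimage_algebra (space M) \<tau> (count_space UNIV)"

lemma tau_fun_measurable: "(\<lambda>\<omega>. f (\<tau> \<omega>)) \<in> borel_measurable M"
  by (rule measurable_compose[OF tau_measurable]) simp

lemma tau_algebra_measurable: "f \<in> borel_measurable (count_space UNIV) \<Longrightarrow> (\<lambda>\<omega>. f (\<tau> \<omega>)) \<in> borel_measurable tau_algebra"
  unfolding tau_algebra_def
  by (rule measurable_compose[OF measurable_vimage_algebra1]) auto

lemma tau_mixture_nn_integral:
  fixes V :: "nat \<Rightarrow> 'w \<Rightarrow> ennreal"
  assumes ind: "indep_set (sets tau_algebra) (sets (gen {1..}))"
    and V: "\<And>n. V n \<in> borel_measurable (gen {1..})" and bd: "\<And>n. (\<integral>\<^sup>+\<omega>. V n \<omega> \<partial>M) \<le> ennreal (b n)"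
    and b: "\<And>n. 0 \<le> b n"
  shows "(\<integral>\<^sup>+\<omega>. V (\<tau> \<omega>) \<omega> \<partial>M) \<le> (\<integral>\<^sup>+\<omega>. ennreal (b (\<tau> \<omega>)) \<partial>M)"
proof -
  have [measurable]: "V n \<in> borel_measurable M" for n using gen_measurable[OF V] by auto
  have [measurable]: "(\<lambda>\<omega>. indicator {n} (\<tau> \<omega>) :: ennreal) \<in> borel_measurable M" for n by (rule tau_fun_measurable)
  have mix: "(\<Sum>n. indicator {n} (\<tau> \<omega>) * f n) = f (\<tau> \<omega>)" for f :: "nat \<Rightarrow> ennreal" and \<omega>
  proof -
    have "(\<Sum>n. indicator {n} (\<tau> \<omega>) * f n) = (\<Sum>n\<in>{\<tau> \<omega>}. indicator {n} (\<tau> \<omega>) * f n)"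
      by (rule suminf_finite) auto
    then show ?thesis by simp
  qed
  have "(\<integral>\<^sup>+\<omega>. V (\<tau> \<omega>) \<omega> \<partial>M) = (\<integral>\<^sup>+\<omega>. (\<Sum>n. indicator {n} (\<tau> \<omega>) * V n \<omega>) \<partial>M)"
    by (intro nn_integral_cong) (rule mix[symmetric])
  also have "\<dots> = (\<Sum>n. \<integral>\<^sup>+\<omega>. indicator {n} (\<tau> \<omega>) * V n \<omega> \<partial>M)" by (intro nn_integral_suminf) measurable
  also have "\<dots> = (\<Sum>n. (\<integral>\<^sup>+\<omega>. indicator {n} (\<tau> \<omega>) \<partial>M) * (\<integral>\<^sup>+\<omega>. V n \<omega> \<partial>M))"
  proof (intro suminf_cong indep_var_nn_integral)
    fix n
    show "indep_var borel (\<lambda>\<omega>. indicator {n} (\<tau> \<omega>) :: ennreal) borel (V n)"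
      by (rule indep_set_imp_indep_var[OF ind _ _ tau_algebra_measurable V]) (auto simp: tau_algebra_def)
  qed
  also have "\<dots> \<le> (\<Sum>n. (\<integral>\<^sup>+\<omega>. indicator {n} (\<tau> \<omega>) \<partial>M) * ennreal (b n))"
    by (intro suminf_le mult_left_mono bd) auto
  also have "\<dots> = (\<Sum>n. \<integral>\<^sup>+\<omega>. indicator {n} (\<tau> \<omega>) * ennreal (b n) \<partial>M)"
    by (intro suminf_cong nn_integral_multc[symmetric]) measurable
  also have "\<dots> = (\<integral>\<^sup>+\<omega>. (\<Sum>n. indicator {n} (\<tau> \<omega>) * ennreal (b n)) \<partial>M)"
    by (intro nn_integral_suminf[symmetric]) measurable
  also have "\<dots> = (\<integral>\<^sup>+\<omega>. ennreal (b (\<tau> \<omega>)) \<partial>M)" by (simp add: mix)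
  finally show ?thesis .
qed

text \<open>For a bounded cost the weight can be trivial, and the constants are multiples of the probabilities
that \<open>\<tau>\<close> reaches both times.  The double series of these probabilities is the second moment of \<open>\<tau>\<close>.\<close>
theorem independent_time_domination:
  assumes "cond_B M P0 X \<tau> h"
  shows "\<exists>a w B c \<theta>. dominated_cost M P0 X \<tau> h a w B c \<and> 0 < \<theta> \<and> integrable P0 (\<lambda>x. exp (\<theta> * a x)) \<and>
    (\<exists>C\<ge>0. \<forall>\<^sub>F r in at_right 0. \<forall>L. entropy_ball_density P0 (r\<^sup>2) L \<longrightarrow>
      (\<integral>\<^sup>+\<omega>. ennreal \<bar>H \<omega> * higher_part (\<lambda>t. L (X t \<omega>) - 1) (\<tau> \<omega>)\<bar> \<partial>M) \<le> ennreal (C * r ^ 3))"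
proof -
  obtain K0 where ind: "indep_set (sets tau_algebra) (sets (gen {1..}))"
    and tau2: "integrable M (\<lambda>\<omega>. (real (\<tau> \<omega>))\<^sup>2)" and HK0: "AE \<omega> in M. \<bar>H \<omega>\<bar> \<le> K0"
    using assms unfolding cond_B_def tau_algebra_def gen_def by blast
  define K where "K = \<bar>K0\<bar>"
  have K: "0 \<le> K" and HK: "AE \<omega> in M. \<bar>H \<omega>\<bar> \<le> K" using HK0 by (auto simp: K_def elim!: eventually_mono)
  define p where "p = (\<lambda>m. \<integral>\<omega>. indicator {m..} (\<tau> \<omega>) \<partial>M :: real)"
  have ind_int: "integrable M (\<lambda>\<omega>. indicator {m..} (\<tau> \<omega>) :: real)" for m
    by (rule integrable_const_bound[of _ 1]) (auto intro: tau_fun_measurable)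
  have p0: "0 \<le> p m" for m unfolding p_def by (intro Bochner_Integration.integral_nonneg) simp
  define w where "w = (\<lambda>t s. K * p (max t s))"
  have drop: "(\<integral>\<^sup>+\<omega>. ennreal \<bar>H \<omega>\<bar> * indicator {\<omega>. m \<le> \<tau> \<omega>} \<omega> * f \<omega> \<partial>M) \<le> ennreal (K * p m) * (\<integral>\<^sup>+\<omega>. f \<omega> \<partial>M)"
    if f: "f \<in> borel_measurable (gen {1..})" for m f
  proof -
    have "(\<integral>\<^sup>+\<omega>. ennreal \<bar>H \<omega>\<bar> * indicator {\<omega>. m \<le> \<tau> \<omega>} \<omega> * f \<omega> \<partial>M) \<le> (\<integral>\<^sup>+\<omega>. ennreal (K * indicator {m..} (\<tau> \<omega>)) * f \<omega> \<partial>M)"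
      using HK by (intro nn_integral_mono_AE) (auto elim!: eventually_mono intro!: mult_right_mono ennreal_leI split: split_indicator)
    also have "\<dots> = (\<integral>\<^sup>+\<omega>. ennreal (K * indicator {m..} (\<tau> \<omega>)) \<partial>M) * (\<integral>\<^sup>+\<omega>. f \<omega> \<partial>M)"
    proof (rule indep_var_nn_integral)
      show "indep_var borel (\<lambda>\<omega>. ennreal (K * indicator {m..} (\<tau> \<omega>))) borel f"
        by (rule indep_set_imp_indep_var[OF ind _ _ tau_algebra_measurable f]) (auto simp: tau_algebra_def)
    qed
    also have "(\<integral>\<^sup>+\<omega>. ennreal (K * indicator {m..} (\<tau> \<omega>)) \<partial>M) = ennreal (K * p m)"
      using ind_int[of m] K by (subst nn_integral_eq_integral) (auto simp: p_def)
    finally show ?thesis .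
  qed
  have f1: "(\<lambda>\<omega>. \<psi> (X t \<omega>)) \<in> borel_measurable (gen {1..})" if "1 \<le> t" "\<psi> \<in> borel_measurable P0" for t and \<psi> :: "'a \<Rightarrow> ennreal"
    by (rule measurable_compose[OF X_gen that(2)]) (use that in auto)
  have f2: "(\<lambda>\<omega>. \<Psi> (X t \<omega>, X s \<omega>)) \<in> borel_measurable (gen {1..})"
    if "1 \<le> t" "1 \<le> s" "\<Psi> \<in> borel_measurable (P0 \<Otimes>\<^sub>M P0)" for t s and \<Psi> :: "'a \<times> 'a \<Rightarrow> ennreal"
  proof -
    have [measurable]: "X t \<in> measurable (gen {1..}) P0" "X s \<in> measurable (gen {1..}) P0" using that by (auto intro!: X_gen)
    have "(\<lambda>\<omega>. (X t \<omega>, X s \<omega>)) \<in> measurable (gen {1..}) (P0 \<Otimes>\<^sub>M P0)" by measurable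
    from measurable_compose[OF this that(3)] show ?thesis .
  qed
  have dom: "dominated_cost M P0 X \<tau> h (\<lambda>_. 1) w (K * (\<integral>\<omega>. (real (\<tau> \<omega>))\<^sup>2 \<partial>M)) K"
  proof (intro dominated_cost.intro dominated_cost_axioms.intro)
    show "cost_model M P0 X \<tau> h" by (rule cost_model_axioms)
    show "0 \<le> w t s" for t s using K p0 by (simp add: w_def)
    show "(\<Sum>t<N. \<Sum>s<N. w (Suc t) (Suc s)) \<le> K * (\<integral>\<omega>. (real (\<tau> \<omega>))\<^sup>2 \<partial>M)" for N
    proof -
      have "(\<Sum>t<N. \<Sum>s<N. w (Suc t) (Suc s)) = K * (\<Sum>t<N. \<Sum>s<N. p (max (Suc t) (Suc s)))"
        by (simp add: w_def sum_distrib_left)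
      also have "(\<Sum>t<N. \<Sum>s<N. p (max (Suc t) (Suc s)))
         = (\<integral>\<omega>. (\<Sum>t<N. \<Sum>s<N. indicator {max (Suc t) (Suc s)..} (\<tau> \<omega>)) \<partial>M)"
        unfolding p_def using ind_int by (simp add: Bochner_Integration.integral_sum del: max_Suc_Suc)
      also have "\<dots> \<le> (\<integral>\<omega>. (real (\<tau> \<omega>))\<^sup>2 \<partial>M)"
      proof (rule integral_mono[OF _ tau2])
        show "integrable M (\<lambda>\<omega>. \<Sum>t<N. \<Sum>s<N. indicator {max (Suc t) (Suc s)..} (\<tau> \<omega>) :: real)"
          using ind_int by (intro Bochner_Integration.integrable_sum) auto
        fix \<omega>
        have "(\<Sum>s<N. indicator {max (Suc t) (Suc s)..} (\<tau> \<omega>) :: real) = (if t < \<tau> \<omega> then real (min N (\<tau> \<omega>)) * 1 else 0)" for t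
        proof -
          have "indicator {max (Suc t) (Suc s)..} (\<tau> \<omega>) = (if t < \<tau> \<omega> then if s < \<tau> \<omega> then 1 else 0 else 0 :: real)" for s
            by (auto simp: indicator_def)
          then show ?thesis using sum_cutoff_le[where N = N and T = "\<tau> \<omega>" and e = 1] by simp
        qed
        then have "(\<Sum>t<N. \<Sum>s<N. indicator {max (Suc t) (Suc s)..} (\<tau> \<omega>) :: real) = real (min N (\<tau> \<omega>)) * (real (min N (\<tau> \<omega>)) * 1)"
          by (simp only: sum_cutoff_le)
        also have "\<dots> \<le> real (\<tau> \<omega>) * (real (\<tau> \<omega>) * 1)" by (intro mult_mono) auto
        finally show "(\<Sum>t<N. \<Sum>s<N. indicator {max (Suc t) (Suc s)..} (\<tau> \<omega>) :: real) \<le> (real (\<tau> \<omega>))\<^sup>2"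
          by (simp add: power2_eq_square)
      qed
      finally show ?thesis using K by (simp add: mult_left_mono)
    qed
    show "(\<integral>\<^sup>+\<omega>. ennreal \<bar>H \<omega>\<bar> * indicator {\<omega>. t \<le> \<tau> \<omega>} \<omega> * \<psi> (X t \<omega>) \<partial>M)
        \<le> ennreal (w t t) * (\<integral>\<^sup>+x. ennreal 1 * \<psi> x \<partial>P0)"
      if "1 \<le> t" "\<psi> \<in> borel_measurable P0" for t \<psi>
      using drop[OF f1[OF that], of t] nn_integral_X[OF that] by (simp add: w_def)
    show "(\<integral>\<^sup>+\<omega>. ennreal \<bar>H \<omega>\<bar> * indicator {\<omega>. max t s \<le> \<tau> \<omega>} \<omega> * \<Psi> (X t \<omega>, X s \<omega>) \<partial>M)
        \<le> ennreal (w t s) * (\<integral>\<^sup>+p. ennreal 1 * ennreal 1 * \<Psi> p \<partial>(P0 \<Otimes>\<^sub>M P0))"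
      if "1 \<le> t" "1 \<le> s" "s \<noteq> t" "\<Psi> \<in> borel_measurable (P0 \<Otimes>\<^sub>M P0)" for t s \<Psi>
      using drop[OF f2[OF that(1,2,4)], of "max t s"] nn_integral_pair[OF that] by (simp add: w_def)
    show "(\<integral>\<^sup>+\<omega>. ennreal \<bar>H \<omega>\<bar> * \<Psi> (X t \<omega>, X s \<omega>) \<partial>M)
        \<le> ennreal K * (\<integral>\<^sup>+p. ennreal 1 * ennreal 1 * \<Psi> p \<partial>(P0 \<Otimes>\<^sub>M P0))"
      if "1 \<le> t" "1 \<le> s" "s \<noteq> t" "\<Psi> \<in> borel_measurable (P0 \<Otimes>\<^sub>M P0)" for t s \<Psi>
    proof -
      have [measurable]: "(\<lambda>\<omega>. \<Psi> (X t \<omega>, X s \<omega>)) \<in> borel_measurable M" using f2[OF that(1,2,4)] by (rule gen_measurable) simp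
      have "(\<integral>\<^sup>+\<omega>. ennreal \<bar>H \<omega>\<bar> * \<Psi> (X t \<omega>, X s \<omega>) \<partial>M) \<le> (\<integral>\<^sup>+\<omega>. ennreal K * \<Psi> (X t \<omega>, X s \<omega>) \<partial>M)"
        using HK by (intro nn_integral_mono_AE) (auto elim!: eventually_mono intro!: mult_right_mono ennreal_leI)
      also have "\<dots> = ennreal K * (\<integral>\<^sup>+\<omega>. \<Psi> (X t \<omega>, X s \<omega>) \<partial>M)" by (rule nn_integral_cmult) measurable
      finally show ?thesis using nn_integral_pair[OF that] by simp
    qed
  qed (use K in simp_all)
  define C where "C = K * (1088 * (\<integral>\<omega>. (real (\<tau> \<omega>))\<^sup>2 \<partial>M))"
  have t0: "0 \<le> (\<integral>\<omega>. (real (\<tau> \<omega>))\<^sup>2 \<partial>M)" by (intro Bochner_Integration.integral_nonneg) simp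
  have "\<forall>\<^sub>F r in at_right 0. \<forall>L. entropy_ball_density P0 (r\<^sup>2) L \<longrightarrow>
      (\<integral>\<^sup>+\<omega>. ennreal \<bar>H \<omega> * higher_part (\<lambda>t. L (X t \<omega>) - 1) (\<tau> \<omega>)\<bar> \<partial>M) \<le> ennreal (C * r ^ 3)"
    using eventually_pos eventually_id_le[OF zero_less_one]
  proof (eventually_elim, intro allI impI)
    case (elim r)
    fix L assume L: "entropy_ball_density P0 (r\<^sup>2) L"
    define V where "V = (\<lambda>n \<omega>. ennreal \<bar>higher_part (\<lambda>t. L (X t \<omega>) - 1) n\<bar>)"
    have Lm: "(\<lambda>x. L x - 1) \<in> borel_measurable P0" using L by (auto simp: entropy_ball_density_def intro!: borel_measurable_diff)
    have Vg: "V n \<in> borel_measurable (gen {1..})" for n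
      unfolding V_def using parts_gen(3)[of n "{1..}", OF _ _ Lm] by auto
    have [measurable]: "(\<lambda>\<omega>. V (\<tau> \<omega>) \<omega>) \<in> borel_measurable M"
      by (rule measurable_compose_countable[OF gen_measurable[OF Vg] tau_measurable]) simp
    have "(\<integral>\<^sup>+\<omega>. ennreal \<bar>H \<omega> * higher_part (\<lambda>t. L (X t \<omega>) - 1) (\<tau> \<omega>)\<bar> \<partial>M) \<le> (\<integral>\<^sup>+\<omega>. ennreal K * V (\<tau> \<omega>) \<omega> \<partial>M)"
      using HK K by (intro nn_integral_mono_AE) (auto elim!: eventually_mono intro!: ennreal_leI mult_right_mono simp: V_def abs_mult ennreal_mult[symmetric])
    also have "\<dots> = ennreal K * (\<integral>\<^sup>+\<omega>. V (\<tau> \<omega>) \<omega> \<partial>M)" by (rule nn_integral_cmult) measurable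
    also have "\<dots> \<le> ennreal K * (\<integral>\<^sup>+\<omega>. ennreal (1088 * (real (\<tau> \<omega>))\<^sup>2 * r ^ 3) \<partial>M)"
      using elim higher_part_L1[OF L] by (intro mult_left_mono tau_mixture_nn_integral[OF ind Vg]) (auto simp: V_def)
    also have "(\<integral>\<^sup>+\<omega>. ennreal (1088 * (real (\<tau> \<omega>))\<^sup>2 * r ^ 3) \<partial>M) = ennreal (1088 * (\<integral>\<omega>. (real (\<tau> \<omega>))\<^sup>2 \<partial>M) * r ^ 3)"
      using tau2 elim by (subst nn_integral_eq_integral) auto
    also have "ennreal K * \<dots> = ennreal (C * r ^ 3)"
      using K t0 elim by (simp add: C_def ennreal_mult[symmetric] mult.assoc)
    finally show "(\<integral>\<^sup>+\<omega>. ennreal \<bar>H \<omega> * higher_part (\<lambda>t. L (X t \<omega>) - 1) (\<tau> \<omega>)\<bar> \<partial>M) \<le> ennreal (C * r ^ 3)" .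
  qed
  moreover have "0 \<le> C" using K t0 by (simp add: C_def)
  moreover have "integrable P0 (\<lambda>x. exp (1 * (\<lambda>_. 1 :: real) x))" by simp
  ultimately show ?thesis using dom zero_less_one by blast
qed

end

section \<open>Passing from the maximum to the minimum of the two times\<close>

context dominated_cost
begin

text \<open>Centred functions of \<open>X t\<close> and \<open>X s\<close>, with \<open>t < s\<close>, do not see the part of the cost on which \<open>\<tau>\<close>
stops between \<open>t\<close> and \<open>s\<close>.\<close>
definition uncorrelated_future :: bool where
  "uncorrelated_future \<longleftrightarrow> (\<forall>u t s. u \<in> borel_measurable P0 \<longrightarrow> integrable P0 (\<lambda>x. a x * \<bar>u x\<bar>) \<longrightarrow>
     (\<integral>x. u x \<partial>P0) = 0 \<longrightarrow> 1 \<le> t \<longrightarrow> t < s \<longrightarrow>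
     (\<integral>\<omega>. u (X t \<omega>) * u (X s \<omega>) * (H \<omega> * indicator {\<omega>. t \<le> \<tau> \<omega>} \<omega>) \<partial>M)
       = (\<integral>\<omega>. u (X t \<omega>) * u (X s \<omega>) * (H \<omega> * indicator {\<omega>. s \<le> \<tau> \<omega>} \<omega>) \<partial>M))"

lemma integrable_of_weighted:
  assumes [measurable]: "u \<in> borel_measurable P0" and "integrable P0 (\<lambda>x. a x * \<bar>u x\<bar>)"
  shows "integrable P0 u"
proof (rule Bochner_Integration.integrable_bound[OF assms(2)])
  show "AE x in P0. norm (u x) \<le> norm (a x * \<bar>u x\<bar>)"
    using a_ge_1 a_nonneg by (intro AE_I2) (simp add: abs_mult mult_le_cancel_right1)
qed simp

lemma uncorrelated_futureI:
  assumes "\<And>u t s. u \<in> borel_measurable P0 \<Longrightarrow> integrable P0 (\<lambda>x. a x * \<bar>u x\<bar>) \<Longrightarrow>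
     (\<integral>x. u x \<partial>P0) = 0 \<Longrightarrow> 1 \<le> t \<Longrightarrow> t < s \<Longrightarrow>
     (\<integral>\<omega>. u (X t \<omega>) * u (X s \<omega>) * (if t \<le> \<tau> \<omega> \<and> \<tau> \<omega> < s then H \<omega> else 0) \<partial>M) = 0"
  shows uncorrelated_future
  unfolding uncorrelated_future_def
proof (intro allI impI)
  fix u :: "'a \<Rightarrow> real" and t s :: nat
  assume u: "u \<in> borel_measurable P0" "integrable P0 (\<lambda>x. a x * \<bar>u x\<bar>)" "(\<integral>x. u x \<partial>P0) = 0" and ts: "1 \<le> t" "t < s"
  have i: "integrable M (\<lambda>\<omega>. u (X t \<omega>) * u (X s \<omega>) * (H \<omega> * indicator {\<omega>. m \<le> \<tau> \<omega>} \<omega>))" for m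
    using pair_term(3)[of t s u u] u ts by simp
  have "(\<integral>\<omega>. u (X t \<omega>) * u (X s \<omega>) * (H \<omega> * indicator {\<omega>. t \<le> \<tau> \<omega>} \<omega>) \<partial>M)
      - (\<integral>\<omega>. u (X t \<omega>) * u (X s \<omega>) * (H \<omega> * indicator {\<omega>. s \<le> \<tau> \<omega>} \<omega>) \<partial>M)
    = (\<integral>\<omega>. u (X t \<omega>) * u (X s \<omega>) * (H \<omega> * indicator {\<omega>. t \<le> \<tau> \<omega>} \<omega>)
      - u (X t \<omega>) * u (X s \<omega>) * (H \<omega> * indicator {\<omega>. s \<le> \<tau> \<omega>} \<omega>) \<partial>M)"
    by (rule Bochner_Integration.integral_diff[symmetric]; rule i)
  also have "\<dots> = (\<integral>\<omega>. u (X t \<omega>) * u (X s \<omega>) * (if t \<le> \<tau> \<omega> \<and> \<tau> \<omega> < s then H \<omega> else 0) \<partial>M)"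
    using ts by (intro Bochner_Integration.integral_cong) (auto split: split_indicator)
  also have "\<dots> = 0" by (rule assms[OF u ts])
  finally show "(\<integral>\<omega>. u (X t \<omega>) * u (X s \<omega>) * (H \<omega> * indicator {\<omega>. t \<le> \<tau> \<omega>} \<omega>) \<partial>M)
       = (\<integral>\<omega>. u (X t \<omega>) * u (X s \<omega>) * (H \<omega> * indicator {\<omega>. s \<le> \<tau> \<omega>} \<omega>) \<partial>M)" by simp
qed

text \<open>On \<open>\<tau> < s\<close> the cost is determined by the information at time \<open>s - 1\<close>, from which \<open>X s\<close> is
independent.\<close>
lemma uncorrelated_future_of_innovations:
  assumes A: "cond_A M P0 X \<tau> h F" and inn: "innovations M P0 X F"
  shows uncorrelated_future
proof (rule uncorrelated_futureI)
  fix u :: "'a \<Rightarrow> real" and t s :: nat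
  assume u: "u \<in> borel_measurable P0" "integrable P0 (\<lambda>x. a x * \<bar>u x\<bar>)" "(\<integral>x. u x \<partial>P0) = 0" and ts: "1 \<le> t" "t < s"
  note [measurable] = u(1)
  have filt: "filtration (space M) F" and XF: "\<And>t. 1 \<le> t \<Longrightarrow> X t \<in> measurable (F t) P0" and st: "stopping_time F \<tau>"
    using A by (auto simp: cond_A_def)
  interpret filtration "space M" F by (rule filt)
  have mono: "f \<in> measurable (F j) N" if "f \<in> measurable (F i) N" "i \<le> j" for f i j N
    using that sets_F_mono[OF that(2)] by (auto simp: measurable_def space_F)
  define m where "m = s - 1"
  have m: "t \<le> m" "Suc m = s" "1 \<le> m" using ts by (auto simp: m_def)
  have Xm: "X i \<in> measurable (F m) P0" if "1 \<le> i" "i \<le> m" for i using mono[OF XF] that by blast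
  define W where "W = (\<lambda>\<omega>. u (X t \<omega>) * (if t \<le> \<tau> \<omega> \<and> \<tau> \<omega> < s then H \<omega> else 0))"
  have [measurable]: "Measurable.pred (F m) (\<lambda>\<omega>. \<tau> \<omega> = n)" if "n \<le> m" for n
  proof -
    have le: "Measurable.pred (F m) (\<lambda>\<omega>. \<tau> \<omega> \<le> k)" if "k \<le> m" for k
      using st mono[of _ k] that unfolding stopping_time_def by blast
    show ?thesis
    proof (cases n)
      case 0
      then show ?thesis using le[of 0] by simp
    next
      case (Suc k)
      then have "(\<lambda>\<omega>. \<tau> \<omega> = n) = (\<lambda>\<omega>. \<tau> \<omega> \<le> n \<and> \<not> \<tau> \<omega> \<le> k)" by auto
      moreover have "Measurable.pred (F m) (\<lambda>\<omega>. \<tau> \<omega> \<le> n \<and> \<not> \<tau> \<omega> \<le> k)"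
        using le[of n] le[of k] \<open>n \<le> m\<close> Suc by (intro pred_intros_logic) auto
      ultimately show ?thesis by simp
    qed
  qed
  have hn: "(\<lambda>\<omega>. h (map (\<lambda>t. X t \<omega>) [1..<Suc n])) \<in> borel_measurable (F m)" if n: "1 \<le> n" "n \<le> m" for n
  proof -
    have r: "(\<lambda>\<omega>. \<lambda>t\<in>{1..n}. X t \<omega>) \<in> measurable (F m) (PiM {1..n} (\<lambda>_. P0))"
      using n by (intro measurable_restrict Xm) auto
    have mh: "(\<lambda>x. h (map x [1..<Suc n])) \<in> borel_measurable (PiM {1..n} (\<lambda>_. P0))"
      using measurable_cost n by (simp add: measurable_cost_def)
    have eq: "map (\<lambda>t\<in>{1..n}. X t \<omega>) [1..<Suc n] = map (\<lambda>t. X t \<omega>) [1..<Suc n]" for \<omega>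
      by (intro map_cong) auto
    from measurable_compose[OF r mh] show ?thesis unfolding eq .
  qed
  have Weq: "W \<omega> = u (X t \<omega>) * (\<Sum>n\<in>{t..m}. if \<tau> \<omega> = n then h (map (\<lambda>t. X t \<omega>) [1..<Suc n]) else 0)" for \<omega>
  proof -
    have "(\<Sum>n\<in>{t..m}. if \<tau> \<omega> = n then h (map (\<lambda>t. X t \<omega>) [1..<Suc n]) else 0) = (if t \<le> \<tau> \<omega> \<and> \<tau> \<omega> < s then H \<omega> else 0)"
      using m by (subst sum.delta') (auto simp: H_eq)
    then show ?thesis by (simp add: W_def)
  qed
  have "(\<lambda>\<omega>. if \<tau> \<omega> = n then h (map (\<lambda>t. X t \<omega>) [1..<Suc n]) else 0) \<in> borel_measurable (F m)" if "n \<in> {t..m}" for n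
    using that ts hn[of n] by (intro measurable_If) auto
  moreover have "(\<lambda>\<omega>. u (X t \<omega>)) \<in> borel_measurable (F m)" using Xm[of t] m ts by (intro measurable_compose[OF _ u(1)]) auto
  ultimately have WF: "W \<in> borel_measurable (F m)"
    unfolding Weq[abs_def] by (intro borel_measurable_times borel_measurable_sum)
  have indF: "indep_set (sets (F m)) (sets (vimage_algebra (space M) (X (Suc m)) P0))"
    using inn m(3) unfolding innovations_def by blast
  have usF: "(\<lambda>\<omega>. u (X s \<omega>)) \<in> borel_measurable (vimage_algebra (space M) (X (Suc m)) P0)"
    unfolding m(2) using measurable_space[OF X_measurable[of s]] ts
    by (intro measurable_compose[OF measurable_vimage_algebra1 u(1)]) auto
  have ind: "indep_var borel W borel (\<lambda>\<omega>. u (X s \<omega>))"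
    by (rule indep_set_imp_indep_var[OF indF _ _ WF usF]) (simp_all add: space_F)
  have [measurable]: "W \<in> borel_measurable M" using ind by (rule indep_var_rv1)
  have Wint: "integrable M W"
  proof (rule Bochner_Integration.integrable_bound[OF single_term(1)[OF ts(1) u(1,2)]])
    show "AE \<omega> in M. norm (W \<omega>) \<le> norm (u (X t \<omega>) * (H \<omega> * indicator {\<omega>. t \<le> \<tau> \<omega>} \<omega>))"
      by (intro AE_I2) (auto simp: W_def)
  qed simp
  have us: "integrable M (\<lambda>\<omega>. u (X s \<omega>))" "(\<integral>\<omega>. u (X s \<omega>) \<partial>M) = 0"
    using integral_X[of s u] integrable_of_weighted[OF u(1,2)] u ts by auto
  have "(\<integral>\<omega>. W \<omega> * u (X s \<omega>) \<partial>M) = 0"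
    using indep_var_lebesgue_integral[OF ind Wint us(1)] us(2) by simp
  then show "(\<integral>\<omega>. u (X t \<omega>) * u (X s \<omega>) * (if t \<le> \<tau> \<omega> \<and> \<tau> \<omega> < s then H \<omega> else 0) \<partial>M) = 0"
    by (simp add: W_def mult_ac)
qed

text \<open>For each value \<open>n < s\<close> of the time, the cost is a function of \<open>X 1, ..., X n\<close>, and both these and
\<open>\<tau>\<close> are independent of \<open>X s\<close>.\<close>
lemma uncorrelated_future_of_independence:
  assumes "cond_B M P0 X \<tau> h"
  shows uncorrelated_future
proof (rule uncorrelated_futureI)
  fix u :: "'a \<Rightarrow> real" and t s :: nat
  assume u: "u \<in> borel_measurable P0" "integrable P0 (\<lambda>x. a x * \<bar>u x\<bar>)" "(\<integral>x. u x \<partial>P0) = 0" and ts: "1 \<le> t" "t < s"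
  note [measurable] = u(1)
  obtain K0 where ind: "indep_set (sets tau_algebra) (sets (gen {1..}))" and HK0: "AE \<omega> in M. \<bar>H \<omega>\<bar> \<le> K0"
    using assms unfolding cond_B_def tau_algebra_def gen_def by blast
  define K where "K = \<bar>K0\<bar>"
  have HK: "AE \<omega> in M. \<bar>H \<omega>\<bar> \<le> K" using HK0 by (auto simp: K_def elim!: eventually_mono)
  have u_int: "integrable P0 u" by (rule integrable_of_weighted[OF u(1,2)])
  (* The cost at a time of probability zero may be unbounded; therefore it is clipped. *)
  define k where "k = (\<lambda>n \<omega>. max (- K) (min K (h (map (\<lambda>t. X t \<omega>) [1..<Suc n]))))"
  have kK: "\<bar>k n \<omega>\<bar> \<le> K" for n \<omega> unfolding k_def K_def by auto
  have kg: "k n \<in> borel_measurable (gen {1..n})" if "1 \<le> n" for n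
    unfolding k_def using path_cost_gen[OF that] by (intro borel_measurable_max borel_measurable_min) auto
  have summand: "integrable M (\<lambda>\<omega>. indicator {n} (\<tau> \<omega>) * (k n \<omega> * u (X t \<omega>) * u (X s \<omega>))) \<and>
     (\<integral>\<omega>. indicator {n} (\<tau> \<omega>) * (k n \<omega> * u (X t \<omega>) * u (X s \<omega>)) \<partial>M) = 0" if n: "t \<le> n" "n < s" for n
  proof -
    define Y where "Y = (\<lambda>\<omega>. k n \<omega> * u (X t \<omega>))"
    have sub: "{1..n} \<subseteq> {1..}" by auto
    have "(\<lambda>\<omega>. u (X t \<omega>)) \<in> borel_measurable (gen {1..n})"
      using n ts sub by (intro measurable_compose[OF X_gen u(1)]) auto
    then have Yg: "Y \<in> borel_measurable (gen {1..n})" unfolding Y_def using kg[of n] n ts by (intro borel_measurable_times) auto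
    have [measurable]: "Y \<in> borel_measurable M" by (rule gen_measurable[OF Yg sub])
    have Yi: "integrable M Y"
    proof (rule Bochner_Integration.integrable_bound)
      show "integrable M (\<lambda>\<omega>. K * \<bar>u (X t \<omega>)\<bar>)" using integral_X(2)[OF ts(1), of "\<lambda>x. \<bar>u x\<bar>"] u_int by simp
      show "AE \<omega> in M. norm (Y \<omega>) \<le> norm (K * \<bar>u (X t \<omega>)\<bar>)"
      proof (intro AE_I2)
        fix \<omega>
        have "\<bar>k n \<omega>\<bar> * \<bar>u (X t \<omega>)\<bar> \<le> K * \<bar>u (X t \<omega>)\<bar>" by (intro mult_right_mono kK) simp
        moreover have "0 \<le> K" by (simp add: K_def)
        ultimately show "norm (Y \<omega>) \<le> norm (K * \<bar>u (X t \<omega>)\<bar>)" by (simp add: Y_def abs_mult)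
      qed
    qed simp
    have usg: "(\<lambda>\<omega>. u (X s \<omega>)) \<in> borel_measurable (gen {s})" using ts by (intro measurable_compose[OF X_gen u(1)]) auto
    have us: "integrable M (\<lambda>\<omega>. u (X s \<omega>))" using integral_X(2)[of s u] u_int ts by simp
    have iv: "indep_var borel Y borel (\<lambda>\<omega>. u (X s \<omega>))" using n ts by (intro gen_indep_var[OF _ _ _ Yg usg]) auto
    have Z0: "(\<integral>\<omega>. Y \<omega> * u (X s \<omega>) \<partial>M) = 0"
      using indep_var_lebesgue_integral[OF iv Yi us] integral_X(1)[of s u] u ts by simp
    have Zi: "integrable M (\<lambda>\<omega>. Y \<omega> * u (X s \<omega>))" by (rule indep_var_integrable[OF iv Yi us])
    have Zg: "(\<lambda>\<omega>. Y \<omega> * u (X s \<omega>)) \<in> borel_measurable (gen {1..})"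
      using gen_mono[OF Yg sub order.refl] gen_mono[OF usg _ order.refl] ts by (intro borel_measurable_times) auto
    have iv2: "indep_var borel (\<lambda>\<omega>. indicator {n} (\<tau> \<omega>) :: real) borel (\<lambda>\<omega>. Y \<omega> * u (X s \<omega>))"
      by (rule indep_set_imp_indep_var[OF ind _ _ tau_algebra_measurable Zg]) (auto simp: tau_algebra_def)
    have ti: "integrable M (\<lambda>\<omega>. indicator {n} (\<tau> \<omega>) :: real)"
      by (rule integrable_const_bound[of _ 1]) (auto intro: tau_fun_measurable)
    show ?thesis
      using indep_var_integrable[OF iv2 ti Zi] indep_var_lebesgue_integral[OF iv2 ti Zi] Z0 by (simp add: Y_def)
  qed
  have "(\<integral>\<omega>. u (X t \<omega>) * u (X s \<omega>) * (if t \<le> \<tau> \<omega> \<and> \<tau> \<omega> < s then H \<omega> else 0) \<partial>M)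
     = (\<integral>\<omega>. (\<Sum>n\<in>{t..<s}. indicator {n} (\<tau> \<omega>) * (k n \<omega> * u (X t \<omega>) * u (X s \<omega>))) \<partial>M)"
  proof (rule integral_cong_AE)
    note [measurable] = X_measurable[OF ts(1)]
    have [measurable]: "X s \<in> measurable M P0" using ts by (intro X_measurable) auto
    show "(\<lambda>\<omega>. u (X t \<omega>) * u (X s \<omega>) * (if t \<le> \<tau> \<omega> \<and> \<tau> \<omega> < s then H \<omega> else 0)) \<in> borel_measurable M" by measurable
    show "(\<lambda>\<omega>. \<Sum>n\<in>{t..<s}. indicator {n} (\<tau> \<omega>) * (k n \<omega> * u (X t \<omega>) * u (X s \<omega>))) \<in> borel_measurable M"
      using summand by (intro borel_measurable_sum) (auto dest!: borel_measurable_integrable)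
    show "AE \<omega> in M. u (X t \<omega>) * u (X s \<omega>) * (if t \<le> \<tau> \<omega> \<and> \<tau> \<omega> < s then H \<omega> else 0)
       = (\<Sum>n\<in>{t..<s}. indicator {n} (\<tau> \<omega>) * (k n \<omega> * u (X t \<omega>) * u (X s \<omega>)))"
      using HK
    proof eventually_elim
      case (elim \<omega>)
      have "(\<Sum>n\<in>{t..<s}. indicator {n} (\<tau> \<omega>) * (k n \<omega> * u (X t \<omega>) * u (X s \<omega>)))
         = (\<Sum>n\<in>{t..<s}. if \<tau> \<omega> = n then k n \<omega> * u (X t \<omega>) * u (X s \<omega>) else 0)"
        by (intro sum.cong) auto
      also have "\<dots> = (if \<tau> \<omega> \<in> {t..<s} then k (\<tau> \<omega>) \<omega> * u (X t \<omega>) * u (X s \<omega>) else 0)"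
        by (subst sum.delta') auto
      also have "k (\<tau> \<omega>) \<omega> = H \<omega>" using elim unfolding k_def H_eq[symmetric] by auto
      finally show ?case by auto
    qed
  qed
  also have "\<dots> = 0" using summand by (subst Bochner_Integration.integral_sum) auto
  finally show "(\<integral>\<omega>. u (X t \<omega>) * u (X s \<omega>) * (if t \<le> \<tau> \<omega> \<and> \<tau> \<omega> < s then H \<omega> else 0) \<partial>M) = 0" .
qed

end

text \<open>The centring of the kernel subtracts a constant, which integrates to \<open>0\<close> against the product of
two centred functions.\<close>
lemma nu_eq_bilinear_form:
  fixes K :: "'a \<Rightarrow> 'a \<Rightarrow> real"
  assumes "prob_space P" and u: "integrable P (\<lambda>x. f x - (\<integral>u. f u \<partial>P))" "(\<integral>x. f x - (\<integral>u. f u \<partial>P) \<partial>P) = 0"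
    and K: "integrable (P \<Otimes>\<^sub>M P) (\<lambda>(x, y). K x y * (f x - (\<integral>u. f u \<partial>P)) * (f y - (\<integral>u. f u \<partial>P)))"
  shows "nu P f K = bilinear_form P K (\<lambda>x. f x - (\<integral>u. f u \<partial>P)) (\<lambda>x. f x - (\<integral>u. f u \<partial>P))"
proof -
  let ?u = "\<lambda>x. f x - (\<integral>u. f u \<partial>P)"
  let ?c = "\<integral>(u, v). K u v \<partial>(P \<Otimes>\<^sub>M P)"
  note pp = integral_pair_product[OF assms(1) u(1) u(1)]
  have "nu P f K = (\<integral>p. (case p of (x, y) \<Rightarrow> K x y * ?u x * ?u y) - ?c * (case p of (x, y) \<Rightarrow> ?u x * ?u y) \<partial>(P \<Otimes>\<^sub>M P))"
    unfolding nu_def by (intro Bochner_Integration.integral_cong) (auto simp: algebra_simps)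
  also have "\<dots> = bilinear_form P K ?u ?u - ?c * (\<integral>(x, y). ?u x * ?u y \<partial>(P \<Otimes>\<^sub>M P))"
    unfolding bilinear_form_def using K pp(1) by (subst Bochner_Integration.integral_diff) auto
  also have "(\<integral>(x, y). ?u x * ?u y \<partial>(P \<Otimes>\<^sub>M P)) = 0" unfolding pp(2) u(2) by simp
  finally show ?thesis by simp
qed

context expanded_cost
begin

lemma g_centred_facts:
  defines "u \<equiv> \<lambda>x. g_sum g x - (\<integral>x. g_sum g x \<partial>P0)"
  assumes sq: "integrable P0 (\<lambda>x. a x * a x)"
  shows "u \<in> borel_measurable P0" "integrable P0 (\<lambda>x. a x * \<bar>u x\<bar>)" "integrable P0 u" "(\<integral>x. u x \<partial>P0) = 0"
    "AE x in P0. \<bar>u x\<bar> \<le> (B + \<bar>\<integral>x. g_sum g x \<partial>P0\<bar>) * a x"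
proof -
  define m where "m = (\<integral>x. g_sum g x \<partial>P0)"
  show um [measurable]: "u \<in> borel_measurable P0" unfolding u_def by measurable
  have gi: "integrable P0 (g_sum g)"
  proof (rule Bochner_Integration.integrable_bound)
    show "integrable P0 (\<lambda>x. B * a x)" using a_integrable by simp
    show "AE x in P0. norm (g_sum g x) \<le> norm (B * a x)"
      using g_sum_bound by eventually_elim (use B_nonneg a_nonneg in simp)
  qed simp
  show "integrable P0 u" unfolding u_def using gi by simp
  show "(\<integral>x. u x \<partial>P0) = 0" unfolding u_def using gi by (simp add: P.prob_space)
  show ub: "AE x in P0. \<bar>u x\<bar> \<le> (B + \<bar>\<integral>x. g_sum g x \<partial>P0\<bar>) * a x"
    using g_sum_bound
  proof eventually_elim
    case (elim x)
    have "\<bar>m\<bar> * 1 \<le> \<bar>m\<bar> * a x" by (intro mult_left_mono a_ge_1) simp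
    then show ?case using elim unfolding u_def m_def[symmetric] distrib_right by linarith
  qed
  show "integrable P0 (\<lambda>x. a x * \<bar>u x\<bar>)"
  proof (rule Bochner_Integration.integrable_bound)
    show "integrable P0 (\<lambda>x. (B + \<bar>m\<bar>) * (a x * a x))" using sq by simp
    show "AE x in P0. norm (a x * \<bar>u x\<bar>) \<le> norm ((B + \<bar>m\<bar>) * (a x * a x))"
      using ub
    proof eventually_elim
      case (elim x)
      then have "a x * \<bar>u x\<bar> \<le> a x * ((B + \<bar>m\<bar>) * a x)" unfolding m_def by (intro mult_left_mono a_nonneg)
      then show ?case using B_nonneg a_nonneg[of x] by (simp add: abs_mult mult_ac)
    qed
  qed simp
qed

lemma G_sum_form_integrable:
  assumes [measurable]: "u \<in> borel_measurable P0" and u: "integrable P0 (\<lambda>x. a x * \<bar>u x\<bar>)"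
  shows "integrable (P0 \<Otimes>\<^sub>M P0) (\<lambda>(x, y). G_sum G x y * u x * u y)"
proof (rule Bochner_Integration.integrable_bound)
  show "integrable (P0 \<Otimes>\<^sub>M P0) (\<lambda>p. B * (case p of (x, y) \<Rightarrow> (a x * \<bar>u x\<bar>) * (a y * \<bar>u y\<bar>)))"
    using integral_pair_product(1)[OF P.prob_space_axioms u u] by simp
  note [measurable] = G_sum_measurable
  show "(\<lambda>(x, y). G_sum G x y * u x * u y) \<in> borel_measurable (P0 \<Otimes>\<^sub>M P0)" by measurable
  show "AE p in P0 \<Otimes>\<^sub>M P0. norm (case p of (x, y) \<Rightarrow> G_sum G x y * u x * u y)
     \<le> norm (B * (case p of (x, y) \<Rightarrow> (a x * \<bar>u x\<bar>) * (a y * \<bar>u y\<bar>)))"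
    using G_sum_bound
  proof eventually_elim
    case (elim p)
    obtain x y where p: "p = (x, y)" by force
    have "\<bar>G_sum G x y\<bar> * (\<bar>u x\<bar> * \<bar>u y\<bar>) \<le> (B * (a x * a y)) * (\<bar>u x\<bar> * \<bar>u y\<bar>)"
      using elim by (intro mult_right_mono) (auto simp: p)
    then show ?case using B_nonneg a_nonneg by (simp add: p abs_mult mult_ac)
  qed
qed

text \<open>Term by term, the integral of the kernel with the minimum of the two times against the product of
the centred functions equals that of the kernel with the maximum, for which the series converges.\<close>

theorem nu_partial_sums_tendsto:
  assumes min_kernel: "second_order_kernel min M P0 X \<tau> h Gmin" and unc: uncorrelated_future
    and sq: "integrable P0 (\<lambda>x. a x * a x)"
  shows "(\<lambda>N. nu P0 (g_sum g) (G_partial_sum Gmin N)) \<longlonglongrightarrow> nu P0 (g_sum g) (G_sum G)"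
proof -
  define u where "u = (\<lambda>x. g_sum g x - (\<integral>x. g_sum g x \<partial>P0))"
  have ux: "g_sum g x - (\<integral>x. g_sum g x \<partial>P0) = u x" for x by (simp add: u_def)
  note uf = g_centred_facts[OF sq, unfolded ux]
  have nuG: "nu P0 (g_sum g) (G_sum G) = bilinear_form P0 (G_sum G) u u"
    using nu_eq_bilinear_form[OF P.prob_space_axioms, of "g_sum g" "G_sum G", unfolded ux] uf G_sum_form_integrable[OF uf(1,2)] by simp
  have summand: "integrable (P0 \<Otimes>\<^sub>M P0) (\<lambda>(x, y). Gmin t s x y * u x * u y) \<and>
     (\<integral>(x, y). Gmin t s x y * u x * u y \<partial>(P0 \<Otimes>\<^sub>M P0))
       = (\<integral>\<omega>. u (X t \<omega>) * u (X s \<omega>) * (H \<omega> * indicator {\<omega>. max t s \<le> \<tau> \<omega>} \<omega>) \<partial>M)"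
    if t: "1 \<le> t" "1 \<le> s" "s \<noteq> t" for t s
  proof -
    have ver: "cond_exp_version M (\<lambda>\<omega>. H \<omega> * indicator {\<omega>. min t s \<le> \<tau> \<omega>} \<omega>) (P0 \<Otimes>\<^sub>M P0)
       (\<lambda>\<omega>. (X t \<omega>, X s \<omega>)) (\<lambda>(x, y). Gmin t s x y)"
      using min_kernel t by (simp add: second_order_kernel_def)
    have [measurable]: "u \<in> borel_measurable P0" by (rule uf(1))
    have int: "integrable M (\<lambda>\<omega>. (case (X t \<omega>, X s \<omega>) of (x, y) \<Rightarrow> u x * u y) * (H \<omega> * indicator {\<omega>. min t s \<le> \<tau> \<omega>} \<omega>))"
      using pair_term(3)[OF t uf(1,1,2,2)] by simp
    have Zm: "(\<lambda>\<omega>. H \<omega> * indicator {\<omega>. min t s \<le> \<tau> \<omega>} \<omega>) \<in> borel_measurable M" by measurable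
    note ce = cond_exp_version_integral[OF prob_space_axioms pair_measurable[OF t(1,2)] pair_distr[OF t] Zm ver _ int]
    have "(\<integral>\<omega>. u (X t \<omega>) * u (X s \<omega>) * (H \<omega> * indicator {\<omega>. min t s \<le> \<tau> \<omega>} \<omega>) \<partial>M)
      = (\<integral>\<omega>. u (X t \<omega>) * u (X s \<omega>) * (H \<omega> * indicator {\<omega>. max t s \<le> \<tau> \<omega>} \<omega>) \<partial>M)"
    proof (cases "t < s")
      case True
      then show ?thesis using unc uf t unfolding uncorrelated_future_def by (simp add: min_def max_def)
    next
      case False
      then have "s < t" using t by simp
      then have "(\<integral>\<omega>. u (X s \<omega>) * u (X t \<omega>) * (H \<omega> * indicator {\<omega>. s \<le> \<tau> \<omega>} \<omega>) \<partial>M)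
        = (\<integral>\<omega>. u (X s \<omega>) * u (X t \<omega>) * (H \<omega> * indicator {\<omega>. t \<le> \<tau> \<omega>} \<omega>) \<partial>M)"
        using unc uf t unfolding uncorrelated_future_def by blast
      then show ?thesis using \<open>s < t\<close> by (simp add: min_def max_def mult.commute[of "u (X s _)"])
    qed
    then show ?thesis using ce by (simp add: case_prod_unfold mult_ac)
  qed
  have nuN: "nu P0 (g_sum g) (G_partial_sum Gmin N) = (\<Sum>t<N. \<Sum>s<N. pair_expectation u t s)" for N
  proof -
    let ?f = "\<lambda>t s p. case p of (x, y) \<Rightarrow> Gmin t s x y * u x * u y"
    have eq: "(\<lambda>(x, y). G_partial_sum Gmin N x y * u x * u y) = (\<lambda>p. \<Sum>t=1..N. \<Sum>s\<in>{1..N} - {t}. ?f t s p)"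
      by (auto simp: G_partial_sum_def fun_eq_iff sum_distrib_right)
    have int: "integrable (P0 \<Otimes>\<^sub>M P0) (\<lambda>(x, y). G_partial_sum Gmin N x y * u x * u y)"
      unfolding eq using summand by (intro Bochner_Integration.integrable_sum) auto
    have "nu P0 (g_sum g) (G_partial_sum Gmin N) = bilinear_form P0 (G_partial_sum Gmin N) u u"
      using nu_eq_bilinear_form[OF P.prob_space_axioms, of "g_sum g" "G_partial_sum Gmin N", unfolded ux] uf int by simp
    also have "\<dots> = (\<Sum>t=1..N. \<Sum>s\<in>{1..N} - {t}. (\<integral>p. ?f t s p \<partial>(P0 \<Otimes>\<^sub>M P0)))"
      unfolding bilinear_form_def eq using summand
      by (subst Bochner_Integration.integral_sum, force intro!: Bochner_Integration.integrable_sum)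
        (intro sum.cong refl Bochner_Integration.integral_sum, auto)
    also have "\<dots> = (\<Sum>t=1..N. \<Sum>s=1..N. if s = t then 0 else
         \<integral>\<omega>. u (X t \<omega>) * u (X s \<omega>) * (H \<omega> * indicator {\<omega>. max t s \<le> \<tau> \<omega>} \<omega>) \<partial>M)"
    proof (rule sum.cong[OF refl])
      fix t assume t: "t \<in> {1..N}"
      show "(\<Sum>s\<in>{1..N} - {t}. (\<integral>p. ?f t s p \<partial>(P0 \<Otimes>\<^sub>M P0))) = (\<Sum>s=1..N. if s = t then 0 else
         \<integral>\<omega>. u (X t \<omega>) * u (X s \<omega>) * (H \<omega> * indicator {\<omega>. max t s \<le> \<tau> \<omega>} \<omega>) \<partial>M)"
        using t summand by (intro sum.mono_neutral_cong_left) auto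
    qed
    also have "\<dots> = (\<Sum>t<N. \<Sum>s<N. pair_expectation u t s)"
      by (simp add: sum.atLeast1_atMost_eq pair_expectation_def[OF uf(1,2)] del: max_Suc_Suc)
    finally show ?thesis .
  qed
  show ?thesis unfolding nuN nuG by (rule second_order_term(4)[OF uf(1,2)])
qed

end

section \<open>The entropy ball in terms of densities\<close>

lemma KL_ball_imp_density:
  assumes "prob_space P" and Pf: "Pf \<in> KL_ball P \<eta>"
  shows "entropy_ball_density P \<eta> (\<lambda>x. enn2real (RN_deriv P Pf x))"
proof -
  interpret prob_space P by fact
  interpret Pf: prob_space Pf using Pf by (simp add: KL_ball_def)
  have s: "sets Pf = sets P" and ac: "absolutely_continuous P Pf"
    and ei: "integrable Pf (entropy_density (exp 1) P Pf)" and kl: "KL_divergence (exp 1) P Pf \<le> \<eta>"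
    using Pf by (auto simp: KL_ball_def)
  define L where "L = (\<lambda>x. enn2real (RN_deriv P Pf x))"
  have Lm [measurable]: "L \<in> borel_measurable P" unfolding L_def by measurable
  have fin: "AE x in P. RN_deriv P Pf x \<noteq> \<infinity>"
    by (rule RN_deriv_finite[OF _ ac s]) unfold_locales
  have "density P (\<lambda>x. ennreal (L x)) = density P (RN_deriv P Pf)"
    by (rule density_cong) (use fin in \<open>auto simp: L_def less_top elim!: eventually_mono\<close>)
  also have "\<dots> = Pf" by (rule density_RN_deriv[OF ac s])
  finally have d: "density P (\<lambda>x. ennreal (L x)) = Pf" .
  have L0: "AE x in P. 0 \<le> L x" by (simp add: L_def)
  have [measurable]: "entropy_density (exp 1) P Pf \<in> borel_measurable P" by (rule measurable_entropy_density)
  have ed: "entropy_density (exp 1) P Pf x = ln (L x)" for x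
    by (simp add: entropy_density_def L_def log_def)
  have edm: "(\<lambda>x. ln (L x)) \<in> borel_measurable P" by measurable
  have i1: "integrable P L" "(\<integral>x. L x \<partial>P) = 1"
  proof -
    have "integrable (density P (\<lambda>x. ennreal (L x))) (\<lambda>_. 1 :: real)" unfolding d by simp
    then show "integrable P L" using integrable_real_density[OF Lm L0, of "\<lambda>_. 1"] by simp
    have "(\<integral>x. 1 \<partial>density P (\<lambda>x. ennreal (L x))) = (1 :: real)" unfolding d by (simp add: Pf.prob_space)
    then show "(\<integral>x. L x \<partial>P) = 1" using integral_real_density[OF Lm L0, of "\<lambda>_. 1"] by simp
  qed
  have "integrable (density P (\<lambda>x. ennreal (L x))) (\<lambda>x. ln (L x))"
    unfolding d using ei unfolding ed[abs_def] .
  then have i2: "integrable P (\<lambda>x. L x * ln (L x))"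
    using integrable_real_density[OF Lm L0 edm] by simp
  have "KL_divergence (exp 1) P Pf = (\<integral>x. ln (L x) \<partial>density P (\<lambda>x. ennreal (L x)))"
    unfolding d KL_divergence_def ed[abs_def] ..
  also have "\<dots> = (\<integral>x. L x * ln (L x) \<partial>P)" using integral_real_density[OF Lm L0 edm] by simp
  finally have "(\<integral>x. L x * ln (L x) \<partial>P) \<le> \<eta>" using kl by simp
  with i1 i2 Lm show ?thesis unfolding entropy_ball_density_def L_def[symmetric] by (simp add: L_def)
qed

lemma density_in_KL_ball:
  assumes "prob_space P" and L: "entropy_ball_density P \<eta> L"
  shows "density P (\<lambda>x. ennreal (L x)) \<in> KL_ball P \<eta>"
    and "AE x in P. enn2real (RN_deriv P (density P (\<lambda>x. ennreal (L x))) x) = L x"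
proof -
  interpret prob_space P by fact
  have Lm [measurable]: "L \<in> borel_measurable P" and L0: "\<And>x. 0 \<le> L x" and Li: "integrable P L" "(\<integral>x. L x \<partial>P) = 1"
    and e: "integrable P (\<lambda>x. L x * ln (L x))" "(\<integral>x. L x * ln (L x) \<partial>P) \<le> \<eta>"
    using L by (auto simp: entropy_ball_density_def)
  define Pf where "Pf = density P (\<lambda>x. ennreal (L x))"
  have "emeasure Pf (space Pf) = (\<integral>\<^sup>+x. ennreal (L x) \<partial>P)"
    unfolding Pf_def by (simp add: emeasure_density cong: nn_integral_cong)
  also have "\<dots> = 1" using nn_integral_eq_integral[OF Li(1)] L0 Li(2) by simp
  finally have pf: "prob_space Pf" by (rule prob_spaceI)
  have L0': "AE x in P. 0 \<le> L x" using L0 by simp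
  have ac: "absolutely_continuous P Pf" unfolding Pf_def by (rule absolutely_continuousI_density) simp
  have rn: "AE x in P. RN_deriv P Pf x = ennreal (L x)"
    using RN_deriv_unique[of "\<lambda>x. ennreal (L x)" Pf] unfolding Pf_def by (auto elim!: eventually_mono)
  then show rnr: "AE x in P. enn2real (RN_deriv P (density P (\<lambda>x. ennreal (L x))) x) = L x"
    unfolding Pf_def[symmetric] by eventually_elim (simp add: L0)
  have edm [measurable]: "entropy_density (exp 1) P Pf \<in> borel_measurable P" by (rule measurable_entropy_density)
  have ae: "AE x in P. L x * entropy_density (exp 1) P Pf x = L x * ln (L x)"
    using rnr unfolding Pf_def[symmetric] by eventually_elim (simp add: entropy_density_def log_def)
  have i: "integrable P (\<lambda>x. L x * entropy_density (exp 1) P Pf x)"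
    by (rule integrable_cong_AE_imp[OF e(1)]) (use ae in \<open>auto elim!: eventually_mono\<close>)
  have int: "integrable Pf (entropy_density (exp 1) P Pf)"
    unfolding Pf_def using integrable_real_density[OF Lm L0' edm] i by (simp add: Pf_def)
  have "KL_divergence (exp 1) P Pf = (\<integral>x. L x * entropy_density (exp 1) P Pf x \<partial>P)"
    unfolding KL_divergence_def using integral_real_density[OF Lm L0' edm] by (simp add: Pf_def)
  also have "\<dots> = (\<integral>x. L x * ln (L x) \<partial>P)"
    by (rule integral_cong_AE) (use ae in auto)
  finally have kl: "KL_divergence (exp 1) P Pf \<le> \<eta>" using e by simp
  have "Pf \<in> KL_ball P \<eta>" using pf ac int kl by (simp add: KL_ball_def) (simp add: Pf_def)
  then show "density P (\<lambda>x. ennreal (L x)) \<in> KL_ball P \<eta>" by (simp add: Pf_def)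
qed

section \<open>The expansion of the optimal value\<close>

lemma bilinear_form_cong_AE:
  assumes "prob_space P" and K [measurable]: "(\<lambda>(x, y). K x y) \<in> borel_measurable (P \<Otimes>\<^sub>M P)"
    and [measurable]: "f \<in> borel_measurable P" "f' \<in> borel_measurable P" and ae: "AE x in P. f x = f' x"
  shows "bilinear_form P K f f = bilinear_form P K f' f'"
proof -
  interpret prob_space P by fact
  interpret PP: pair_prob_space P P ..
  have "AE p in P \<Otimes>\<^sub>M P. f (fst p) = f' (fst p) \<and> f (snd p) = f' (snd p)"
  proof (rule PP.AE_pair_measure)
    show "{p \<in> space (P \<Otimes>\<^sub>M P). f (fst p) = f' (fst p) \<and> f (snd p) = f' (snd p)} \<in> sets (P \<Otimes>\<^sub>M P)" by measurable
    show "AE x in P. AE y in P. f (fst (x, y)) = f' (fst (x, y)) \<and> f (snd (x, y)) = f' (snd (x, y))"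
      using ae by eventually_elim (use ae in \<open>auto elim!: eventually_mono\<close>)
  qed
  then have "AE p in P \<Otimes>\<^sub>M P. (case p of (x, y) \<Rightarrow> K x y * f x * f y) = (case p of (x, y) \<Rightarrow> K x y * f' x * f' y)"
    by eventually_elim (simp add: case_prod_unfold)
  then show ?thesis
    unfolding bilinear_form_def by (intro integral_cong_AE) measurable
qed

lemma eventually_sqrt:
  assumes "\<forall>\<^sub>F \<beta> in at_right (0::real). Q \<beta>" and k: "0 < k"
  shows "\<forall>\<^sub>F \<eta> in at_right 0. Q (sqrt (k * \<eta>))"
proof -
  obtain b where b: "0 < b" "\<And>\<beta>. 0 < \<beta> \<Longrightarrow> \<beta> < b \<Longrightarrow> Q \<beta>"
    using assms(1) unfolding eventually_at_right_field by auto
  have "0 < (b / 2)\<^sup>2" using b by simp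
  from eventually_linear_le[OF this, of k] eventually_pos show ?thesis
  proof eventually_elim
    case (elim \<eta>)
    have "sqrt (k * \<eta>) \<le> b / 2" using elim b by (intro real_le_lsqrt) auto
    then show ?case using b k elim by (intro b(2)) auto
  qed
qed

context expanded_cost
begin

lemma expected_cost_of_density:
  assumes L: "entropy_ball_density P0 \<eta> L" and aL: "integrable P0 (\<lambda>x. a x * \<bar>L x - 1\<bar>)"
    and high: "(\<integral>\<^sup>+\<omega>. ennreal \<bar>H \<omega> * higher_part (\<lambda>t. L (X t \<omega>) - 1) (\<tau> \<omega>)\<bar> \<partial>M) \<le> ennreal e" and e: "0 \<le> e"
  shows "\<bar>(\<integral>\<omega>. H \<omega> * (\<Prod>t=1..\<tau> \<omega>. L (X t \<omega>)) \<partial>M) - ((\<integral>\<omega>. H \<omega> \<partial>M) + (\<integral>x. g_sum g x * (L x - 1) \<partial>P0)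
     + bilinear_form P0 (G_sum G) (\<lambda>x. L x - 1) (\<lambda>x. L x - 1) / 2)\<bar> \<le> e"
proof -
  define u where "u = (\<lambda>x. L x - 1)"
  have um [measurable]: "u \<in> borel_measurable P0"
    unfolding u_def using L by (auto simp: entropy_ball_density_def intro!: borel_measurable_diff)
  have au: "integrable P0 (\<lambda>x. a x * \<bar>u x\<bar>)" using aL by (simp add: u_def)
  let ?h = "\<lambda>\<omega>. H \<omega> * higher_part (\<lambda>t. u (X t \<omega>)) (\<tau> \<omega>)"
  have "(\<lambda>\<omega>. higher_part (\<lambda>t. u (X t \<omega>)) n) \<in> borel_measurable M" for n
    by (rule gen_measurable[OF parts_gen(3)[of n "{1..n}", OF _ _ um]]) auto
  then have "(\<lambda>\<omega>. higher_part (\<lambda>t. u (X t \<omega>)) (\<tau> \<omega>)) \<in> borel_measurable M"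
    by (rule measurable_compose_countable[OF _ tau_measurable])
  then have hm: "?h \<in> borel_measurable M" by (intro borel_measurable_times H_measurable)
  have hi: "integrable M ?h" "(\<integral>\<omega>. \<bar>?h \<omega>\<bar> \<partial>M) \<le> e"
    using nn_bound_imp_integrable[OF hm _ e] high by (auto simp: u_def)
  note first = first_order_term[OF um au]
  note second = second_order_term[OF um au]
  have "(\<integral>\<omega>. H \<omega> * (\<Prod>t=1..\<tau> \<omega>. L (X t \<omega>)) \<partial>M) =
    (\<integral>\<omega>. H \<omega> + H \<omega> * linear_part (\<lambda>t. u (X t \<omega>)) (\<tau> \<omega>) + H \<omega> * quadratic_part (\<lambda>t. u (X t \<omega>)) (\<tau> \<omega>) + ?h \<omega> \<partial>M)"
  proof (intro Bochner_Integration.integral_cong refl)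
    fix \<omega>
    have "(\<Prod>t=1..\<tau> \<omega>. L (X t \<omega>)) = (\<Prod>t=1..\<tau> \<omega>. 1 + u (X t \<omega>))" by (simp add: u_def)
    then show "H \<omega> * (\<Prod>t=1..\<tau> \<omega>. L (X t \<omega>)) = H \<omega> + H \<omega> * linear_part (\<lambda>t. u (X t \<omega>)) (\<tau> \<omega>) + H \<omega> * quadratic_part (\<lambda>t. u (X t \<omega>)) (\<tau> \<omega>) + ?h \<omega>"
      unfolding prod_one_plus_expansion by (simp add: distrib_left)
  qed
  also have "\<dots> = (\<integral>\<omega>. H \<omega> \<partial>M) + (\<integral>x. g_sum g x * u x \<partial>P0) + bilinear_form P0 (G_sum G) u u / 2 + (\<integral>\<omega>. ?h \<omega> \<partial>M)"
    using H_integrable first(2,3) second(1,2) hi(1) by simp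
  finally have "(\<integral>\<omega>. H \<omega> * (\<Prod>t=1..\<tau> \<omega>. L (X t \<omega>)) \<partial>M) - ((\<integral>\<omega>. H \<omega> \<partial>M) + (\<integral>x. g_sum g x * u x \<partial>P0)
     + bilinear_form P0 (G_sum G) u u / 2) = (\<integral>\<omega>. ?h \<omega> \<partial>M)" by simp
  moreover have "\<bar>\<integral>\<omega>. ?h \<omega> \<partial>M\<bar> \<le> e" using integral_abs_bound[of M ?h] hi(2) by linarith
  ultimately show ?thesis by (simp add: u_def)
qed

text \<open>By the expansion of the likelihood ratio the objective is a constant plus the value of the static problem up to
\<open>C * sqrt \<eta> ^ 3\<close>, uniformly over the ball; the expansions of the latter are in the parameter
\<open>\<beta> = sqrt (2 * \<eta> / V)\<close>, where \<open>V\<close> is the variance of \<open>g_sum g\<close>.\<close>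
theorem optimal_value_expansion:
  assumes th: "0 < \<theta>" and em: "integrable P0 (\<lambda>x. exp (\<theta> * a x))"
    and C: "0 \<le> C" and high: "\<forall>\<^sub>F r in at_right 0. \<forall>L. entropy_ball_density P0 (r\<^sup>2) L \<longrightarrow>
      (\<integral>\<^sup>+\<omega>. ennreal \<bar>H \<omega> * higher_part (\<lambda>t. L (X t \<omega>) - 1) (\<tau> \<omega>)\<bar> \<partial>M) \<le> ennreal (C * r ^ 3)"
    and nonconst: "\<not> (\<exists>c. AE x in P0. g_sum g x = c)"
  shows "integrable P0 (\<lambda>x. a x * a x)"
    and "\<forall>\<^sub>F \<eta> in at_right 0. bdd_above (expected_cost M P0 X \<tau> h ` KL_ball P0 \<eta>)"
    and "(\<lambda>\<eta>. optimal_value M P0 X \<tau> h \<eta> -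
       ((\<integral>\<omega>. H \<omega> \<partial>M)
        + sqrt (2 * P.variance (g_sum g)) * \<eta> powr (1/2)
        + 1 / P.variance (g_sum g)
            * (1/3 * kappa3 P0 (g_sum g) + nu P0 (g_sum g) (G_sum G)) * \<eta>))
      \<in> O[at_right 0](\<lambda>\<eta>. \<eta> powr (3/2))"
proof -
  show sq: "integrable P0 (\<lambda>x. a x * a x)"
  proof (rule Bochner_Integration.integrable_bound)
    show "integrable P0 (\<lambda>x. 2 / \<theta>\<^sup>2 * exp (\<theta> * a x))" using em by simp
    show "AE x in P0. norm (a x * a x) \<le> norm (2 / \<theta>\<^sup>2 * exp (\<theta> * a x))"
      using power_mult_exp_le[OF a_nonneg th, of _ 2] by (intro AE_I2) (simp add: power2_eq_square)
  qed simp
  note a_facts = a_measurable a_nonneg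
  define m where "m = (\<integral>x. g_sum g x \<partial>P0)"
  define u where "u = (\<lambda>x. g_sum g x - m)"
  have ux: "g_sum g x - (\<integral>x. g_sum g x \<partial>P0) = u x" for x by (simp add: u_def m_def)
  note uf = g_centred_facts[OF sq, unfolded ux, folded m_def]
  note [measurable] = uf(1)
  (* The bounds on the kernels hold almost surely and up to constants.  The weight is multiplied by k,
     and the centred kernel is changed on a null set to make its bound hold everywhere. *)
  define k where "k = B + \<bar>m\<bar> + 1"
  have k: "1 \<le> k" using B_nonneg by (simp add: k_def)
  define a' where "a' = (\<lambda>x. k * a x)"
  define \<theta>' where "\<theta>' = \<theta> / k"
  define g' where "g' = (\<lambda>x. if \<bar>u x\<bar> \<le> a' x then u x else 0)"
  have a'm [measurable]: "a' \<in> borel_measurable P0" unfolding a'_def by measurable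
  have g'm [measurable]: "g' \<in> borel_measurable P0" unfolding g'_def by measurable
  have ag: "AE x in P0. g' x = u x"
    using uf(5)
  proof eventually_elim
    case (elim x)
    have "(B + \<bar>m\<bar>) * a x \<le> k * a x" by (intro mult_right_mono a_nonneg) (simp add: k_def)
    then show ?case using elim by (simp add: g'_def a'_def)
  qed
  have aa: "a x \<le> a' x" for x using mult_right_mono[OF k a_nonneg, of x] by (simp add: a'_def)
  have gint: "(\<integral>x. g' x ^ n \<partial>P0) = (\<integral>x. u x ^ n \<partial>P0)" for n
    by (rule integral_cong_AE) (use ag in \<open>auto elim!: eventually_mono\<close>)
  have V: "(\<integral>x. g' x ^ 2 \<partial>P0) = P.variance (g_sum g)" unfolding gint by (simp add: u_def m_def)
  have \<kappa>: "(\<integral>x. g' x ^ 3 \<partial>P0) = kappa3 P0 (g_sum g)" unfolding gint by (simp add: u_def m_def kappa3_def)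
  have g'b: "\<bar>g' x\<bar> \<le> a' x" for x using aa[of x] a_nonneg[of x] by (auto simp: g'_def)
  interpret tilting P0 a' g' \<theta>'
  proof
    show "1 \<le> a' x" for x using aa[of x] a_ge_1[of x] by linarith
    show "0 < \<theta>'" using th k by (simp add: \<theta>'_def)
    show "integrable P0 (\<lambda>x. exp (\<theta>' * a' x))" using em k by (simp add: \<theta>'_def a'_def)
    show "(\<integral>x. g' x \<partial>P0) = 0" using gint[of 1] uf(4) by simp
  qed (use g'b in auto)
  interpret entropic_problem P0 a' g' \<theta>' "G_sum G"
  proof
    show "1 \<le> a' x" for x by (rule a_ge_1')
    show "(\<lambda>(x, y). G_sum G x y) \<in> borel_measurable (P0 \<Otimes>\<^sub>M P0)" by (rule G_sum_measurable)
    show "AE (x, y) in P0 \<Otimes>\<^sub>M P0. \<bar>G_sum G x y\<bar> \<le> a' x * a' y"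
      using G_sum_bound
    proof eventually_elim
      case (elim p)
      obtain x y where p: "p = (x, y)" by force
      have "B * (a x * a y) \<le> (k * k) * (a x * a y)"
      proof (rule mult_right_mono)
        have "B \<le> k * 1" by (simp add: k_def)
        also have "\<dots> \<le> k * k" using k by (intro mult_left_mono) auto
        finally show "B \<le> k * k" .
      qed (simp add: a_nonneg)
      then show ?case using elim by (simp add: p a'_def mult_ac)
    qed
    show "0 < (\<integral>x. (g' x)\<^sup>2 \<partial>P0)"
    proof (rule ccontr)
      assume "\<not> ?thesis"
      moreover have "0 \<le> (\<integral>x. (g' x)\<^sup>2 \<partial>P0)" by (intro Bochner_Integration.integral_nonneg) simp
      ultimately have "(\<integral>x. (g' x)\<^sup>2 \<partial>P0) = 0" by simp
      then have "AE x in P0. (g' x)\<^sup>2 = 0"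
        using integral_nonneg_eq_0_iff_AE[OF g_power_integrable[of 2]] by simp
      with ag have "AE x in P0. g_sum g x = m" by eventually_elim (simp add: u_def)
      with nonconst show False by blast
    qed
  qed simp
  have \<nu>: "bilinear_form P0 (G_sum G) g' g' = nu P0 (g_sum g) (G_sum G)"
  proof -
    have "nu P0 (g_sum g) (G_sum G) = bilinear_form P0 (G_sum G) u u"
      using nu_eq_bilinear_form[OF P.prob_space_axioms, of "g_sum g" "G_sum G", unfolded ux] uf G_sum_form_integrable[OF uf(1,2)] by simp
    also have "\<dots> = bilinear_form P0 (G_sum G) g' g'"
      using ag by (intro bilinear_form_cong_AE[OF P.prob_space_axioms G_sum_measurable uf(1) g'm]) (auto elim!: eventually_mono)
    finally show ?thesis by simp
  qed
  define W where "W = P.variance (g_sum g)"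
  have W: "0 < W" using variance_pos unfolding V W_def .
  define \<kappa>3 where "\<kappa>3 = kappa3 P0 (g_sum g)"
  define \<nu>2 where "\<nu>2 = nu P0 (g_sum g) (G_sum G)"
  define E0 where "E0 = (\<integral>\<omega>. H \<omega> \<partial>M)"
  obtain C1 where C1: "\<forall>\<^sub>F \<beta> in at_right 0. \<forall>L. entropy_ball_density P0 (W / 2 * \<beta>\<^sup>2) L \<longrightarrow>
     quadratic_value L \<le> W * \<beta> + (\<kappa>3 / 6 + \<nu>2 / 2) * \<beta>\<^sup>2 + C1 * \<beta> ^ 3"
    using quadratic_value_upper unfolding V \<kappa> \<nu> W_def \<kappa>3_def \<nu>2_def by blast
  obtain C2 where C2: "\<forall>\<^sub>F \<beta> in at_right 0. \<exists>L. entropy_ball_density P0 (W / 2 * \<beta>\<^sup>2) L \<and>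
     W * \<beta> + (\<kappa>3 / 6 + \<nu>2 / 2) * \<beta>\<^sup>2 - C2 * \<beta> ^ 3 \<le> quadratic_value L"
    using quadratic_value_lower unfolding V \<kappa> \<nu> W_def \<kappa>3_def \<nu>2_def by blast
  have qv: "quadratic_value L = (\<integral>x. g_sum g x * (L x - 1) \<partial>P0) + bilinear_form P0 (G_sum G) (\<lambda>x. L x - 1) (\<lambda>x. L x - 1) / 2"
    if L: "entropy_ball_density P0 \<eta> L" and aL: "integrable P0 (\<lambda>x. a x * \<bar>L x - 1\<bar>)" for L \<eta>
  proof -
    have Li: "L \<in> borel_measurable P0" "integrable P0 L" "(\<integral>x. L x \<partial>P0) = 1" using L by (auto simp: entropy_ball_density_def)
    note [measurable] = Li(1)
    have gi: "integrable P0 (\<lambda>x. g_sum g x * (L x - 1))" using first_order_term(1)[of "\<lambda>x. L x - 1"] aL by simp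
    have "(\<integral>x. g' x * (L x - 1) \<partial>P0) = (\<integral>x. g_sum g x * (L x - 1) - m * (L x - 1) \<partial>P0)"
    proof (rule integral_cong_AE)
      show "AE x in P0. g' x * (L x - 1) = g_sum g x * (L x - 1) - m * (L x - 1)"
        using ag by eventually_elim (simp only: u_def left_diff_distrib)
    qed measurable
    also have "\<dots> = (\<integral>x. g_sum g x * (L x - 1) \<partial>P0)" using gi Li by (simp add: P.prob_space)
    finally show ?thesis by (simp add: quadratic_value_def)
  qed
  have cost: "\<bar>(\<integral>\<omega>. H \<omega> * (\<Prod>t=1..\<tau> \<omega>. L (X t \<omega>)) \<partial>M) - (E0 + quadratic_value L)\<bar> \<le> C * sqrt \<eta> ^ 3"
    if L: "entropy_ball_density P0 \<eta> L" and eta: "0 < \<eta>" "sqrt \<eta> \<le> \<theta> / 2"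
      and hb: "\<forall>L. entropy_ball_density P0 ((sqrt \<eta>)\<^sup>2) L \<longrightarrow>
      (\<integral>\<^sup>+\<omega>. ennreal \<bar>H \<omega> * higher_part (\<lambda>t. L (X t \<omega>) - 1) (\<tau> \<omega>)\<bar> \<partial>M) \<le> ennreal (C * sqrt \<eta> ^ 3)" for L \<eta>
  proof -
    have aL: "integrable P0 (\<lambda>x. a x * \<bar>L x - 1\<bar>)"
      by (rule entropy_ball_distance(1)[OF P.prob_space_axioms L a_facts em eta])
    have "0 \<le> C * sqrt \<eta> ^ 3" using C eta by simp
    moreover have "(\<integral>\<^sup>+\<omega>. ennreal \<bar>H \<omega> * higher_part (\<lambda>t. L (X t \<omega>) - 1) (\<tau> \<omega>)\<bar> \<partial>M) \<le> ennreal (C * sqrt \<eta> ^ 3)"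
      using hb L eta by simp
    ultimately show ?thesis
      using expected_cost_of_density[OF L aL] unfolding qv[OF L aL] E0_def by (simp add: add.assoc)
  qed
  have ec: "expected_cost M P0 X \<tau> h Pf = (\<integral>\<omega>. H \<omega> * (\<Prod>t=1..\<tau> \<omega>. enn2real (RN_deriv P0 Pf (X t \<omega>))) \<partial>M)" for Pf
    by (simp add: expected_cost_def)
  have qv_cong: "quadratic_value L = quadratic_value L'"
    if "AE x in P0. L x = L' x" and [measurable]: "L \<in> borel_measurable P0" "L' \<in> borel_measurable P0" for L L'
  proof -
    have "(\<integral>x. g' x * (L x - 1) \<partial>P0) = (\<integral>x. g' x * (L' x - 1) \<partial>P0)"
      by (rule integral_cong_AE) (use that(1) in \<open>auto elim!: eventually_mono\<close>)
    moreover have "bilinear_form P0 (G_sum G) (\<lambda>x. L x - 1) (\<lambda>x. L x - 1) = bilinear_form P0 (G_sum G) (\<lambda>x. L' x - 1) (\<lambda>x. L' x - 1)"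
      using that(1) by (intro bilinear_form_cong_AE[OF P.prob_space_axioms G_sum_measurable]) (auto elim!: eventually_mono)
    ultimately show ?thesis by (simp add: quadratic_value_def)
  qed
  define main where "main = (\<lambda>\<beta>. E0 + (W * \<beta> + (\<kappa>3 / 6 + \<nu>2 / 2) * \<beta>\<^sup>2))"
  define e where "e = (\<lambda>\<eta>. (\<bar>C1\<bar> + \<bar>C2\<bar>) * sqrt (2 / W * \<eta>) ^ 3 + C * sqrt \<eta> ^ 3)"
  have W2: "0 < 2 / W" using W by simp
  have ev: "\<forall>\<^sub>F \<eta> in at_right 0. (\<forall>Pf\<in>KL_ball P0 \<eta>. expected_cost M P0 X \<tau> h Pf \<le> main (sqrt (2 / W * \<eta>)) + e \<eta>) \<and>
      (\<exists>Pf\<in>KL_ball P0 \<eta>. main (sqrt (2 / W * \<eta>)) - e \<eta> \<le> expected_cost M P0 X \<tau> h Pf)"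
    using eventually_sqrt[OF C1 W2] eventually_sqrt[OF C2 W2] eventually_sqrt[OF high zero_less_one]
      eventually_sqrt[OF eventually_id_le[OF half_gt_zero[OF th]] zero_less_one] eventually_pos
  proof eventually_elim
    case (elim \<eta>)
    note eta = elim(5)
    define \<beta> where "\<beta> = sqrt (2 / W * \<eta>)"
    have \<beta>: "0 < \<beta>" "W / 2 * \<beta>\<^sup>2 = \<eta>" using W eta by (simp_all add: \<beta>_def)
    note up = elim(1)[folded \<beta>_def, unfolded \<beta>(2)]
    note lo = elim(2)[folded \<beta>_def, unfolded \<beta>(2)]
    note hb = elim(3)[unfolded mult_1_left]
    have se: "sqrt \<eta> \<le> \<theta> / 2" using elim(4) by simp
    have b3: "C1 * \<beta> ^ 3 \<le> (\<bar>C1\<bar> + \<bar>C2\<bar>) * \<beta> ^ 3" "C2 * \<beta> ^ 3 \<le> (\<bar>C1\<bar> + \<bar>C2\<bar>) * \<beta> ^ 3"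
      using \<beta>(1) by (auto intro!: mult_right_mono)
    show ?case unfolding e_def \<beta>_def[symmetric]
    proof (intro conjI ballI)
      fix Pf assume Pf: "Pf \<in> KL_ball P0 \<eta>"
      note L = KL_ball_imp_density[OF P.prob_space_axioms Pf]
      have "expected_cost M P0 X \<tau> h Pf \<le> E0 + quadratic_value (\<lambda>x. enn2real (RN_deriv P0 Pf x)) + C * sqrt \<eta> ^ 3"
        using cost[OF L eta se hb] unfolding ec by linarith
      moreover have "quadratic_value (\<lambda>x. enn2real (RN_deriv P0 Pf x)) \<le> W * \<beta> + (\<kappa>3 / 6 + \<nu>2 / 2) * \<beta>\<^sup>2 + C1 * \<beta> ^ 3"
        using up L by blast
      ultimately show "expected_cost M P0 X \<tau> h Pf \<le> main \<beta> + ((\<bar>C1\<bar> + \<bar>C2\<bar>) * \<beta> ^ 3 + C * sqrt \<eta> ^ 3)"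
        using b3(1) unfolding main_def by argo
    next
      obtain L where L: "entropy_ball_density P0 \<eta> L" and Lq: "W * \<beta> + (\<kappa>3 / 6 + \<nu>2 / 2) * \<beta>\<^sup>2 - C2 * \<beta> ^ 3 \<le> quadratic_value L"
        using lo by blast
      define Pf where "Pf = density P0 (\<lambda>x. ennreal (L x))"
      note d = density_in_KL_ball[OF P.prob_space_axioms L, folded Pf_def]
      note L' = KL_ball_imp_density[OF P.prob_space_axioms d(1)]
      have "quadratic_value (\<lambda>x. enn2real (RN_deriv P0 Pf x)) = quadratic_value L"
        using d(2) L L' by (intro qv_cong) (auto simp: entropy_ball_density_def)
      then have "E0 + quadratic_value L - C * sqrt \<eta> ^ 3 \<le> expected_cost M P0 X \<tau> h Pf"
        using cost[OF L' eta se hb] unfolding ec by linarith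
      then have "main \<beta> - ((\<bar>C1\<bar> + \<bar>C2\<bar>) * \<beta> ^ 3 + C * sqrt \<eta> ^ 3) \<le> expected_cost M P0 X \<tau> h Pf"
        using b3(2) Lq unfolding main_def by argo
      with d(1) show "\<exists>Pf\<in>KL_ball P0 \<eta>. main \<beta> - ((\<bar>C1\<bar> + \<bar>C2\<bar>) * \<beta> ^ 3 + C * sqrt \<eta> ^ 3) \<le> expected_cost M P0 X \<tau> h Pf"
        by blast
    qed
  qed
  show bdd: "\<forall>\<^sub>F \<eta> in at_right 0. bdd_above (expected_cost M P0 X \<tau> h ` KL_ball P0 \<eta>)"
    using ev by eventually_elim (auto intro!: bdd_aboveI2)
  define D where "D = (\<bar>C1\<bar> + \<bar>C2\<bar>) * sqrt (2 / W) ^ 3 + C"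
  have "\<forall>\<^sub>F \<eta> in at_right 0. norm (optimal_value M P0 X \<tau> h \<eta> -
       (E0 + sqrt (2 * W) * \<eta> powr (1/2) + 1 / W * (1/3 * \<kappa>3 + \<nu>2) * \<eta>)) \<le> D * norm (\<eta> powr (3/2))"
    using ev bdd eventually_pos
  proof eventually_elim
    case (elim \<eta>)
    note eta = elim(3)
    define \<beta> where "\<beta> = sqrt (2 / W * \<eta>)"
    have up: "optimal_value M P0 X \<tau> h \<eta> \<le> main \<beta> + e \<eta>"
      unfolding optimal_value_def \<beta>_def using elim(1) by (intro cSUP_least) auto
    have lo: "main \<beta> - e \<eta> \<le> optimal_value M P0 X \<tau> h \<eta>"
    proof -
      obtain Pf where Pf: "Pf \<in> KL_ball P0 \<eta>" "main \<beta> - e \<eta> \<le> expected_cost M P0 X \<tau> h Pf"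
        using elim(1) unfolding \<beta>_def by blast
      show ?thesis unfolding optimal_value_def
        by (rule order.trans[OF Pf(2) cSUP_upper[OF Pf(1) elim(2)]])
    qed
    have p1: "\<eta> powr (1/2) = sqrt \<eta>" using eta by (simp add: powr_half_sqrt)
    have p3: "\<eta> powr (3/2) = sqrt \<eta> ^ 3"
    proof -
      have "\<eta> powr (3/2) = (\<eta> powr (1/2)) powr (real 3)" using eta by (simp add: powr_powr)
      also have "\<dots> = sqrt \<eta> ^ 3" unfolding p1 using eta by (subst powr_realpow) auto
      finally show ?thesis .
    qed
    have "W * sqrt (2 / W) = sqrt (2 * W)"
      using W by (simp add: real_sqrt_divide real_sqrt_mult real_div_sqrt field_simps)
    then have "W * \<beta> = sqrt (2 * W) * sqrt \<eta>"
      unfolding \<beta>_def real_sqrt_mult[of "2 / W"] by (simp add: mult.assoc[symmetric])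
    moreover have "(\<kappa>3 / 6 + \<nu>2 / 2) * \<beta>\<^sup>2 = 1 / W * (1/3 * \<kappa>3 + \<nu>2) * \<eta>"
      using W eta by (simp add: \<beta>_def field_simps)
    ultimately have "main \<beta> = E0 + sqrt (2 * W) * \<eta> powr (1/2) + 1 / W * (1/3 * \<kappa>3 + \<nu>2) * \<eta>"
      unfolding main_def p1 by simp
    moreover have "e \<eta> = D * \<eta> powr (3/2)"
      unfolding e_def D_def p3 real_sqrt_mult[of "2 / W"] power_mult_distrib by (simp add: algebra_simps)
    ultimately show ?case using up lo eta by (simp add: abs_le_iff)
  qed
  then show "(\<lambda>\<eta>. optimal_value M P0 X \<tau> h \<eta> -
       ((\<integral>\<omega>. H \<omega> \<partial>M) + sqrt (2 * P.variance (g_sum g)) * \<eta> powr (1/2)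
        + 1 / P.variance (g_sum g) * (1/3 * kappa3 P0 (g_sum g) + nu P0 (g_sum g) (G_sum G)) * \<eta>))
      \<in> O[at_right 0](\<lambda>\<eta>. \<eta> powr (3/2))"
    unfolding E0_def W_def \<kappa>3_def \<nu>2_def by (rule bigoI)
qed

end

theorem theorem3p3:
  fixes M :: "'w measure" and P0 :: "'a measure"
    and X :: "nat \<Rightarrow> 'w \<Rightarrow> 'a" and \<tau> :: "'w \<Rightarrow> nat" and h :: "'a list \<Rightarrow> real"
    and g :: "nat \<Rightarrow> 'a \<Rightarrow> real" and G Gmin :: "nat \<Rightarrow> nat \<Rightarrow> 'a \<Rightarrow> 'a \<Rightarrow> real"
  assumes "prob_space M" and "prob_space P0"
    and "iid_sequence M P0 X"
    and "random_time M \<tau>"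
    and "measurable_cost P0 h"
    and "(\<exists>F. cond_A M P0 X \<tau> h F) \<or> cond_B M P0 X \<tau> h"
    and "first_order_kernel M P0 X \<tau> h g"
    and "second_order_kernel max M P0 X \<tau> h G"
    and "second_order_kernel min M P0 X \<tau> h Gmin"
    and "\<not> (\<exists>c. AE x in P0. g_sum g x = c)"
  shows "(\<forall>\<^sub>F \<eta> in at_right 0. bdd_above (expected_cost M P0 X \<tau> h ` KL_ball P0 \<eta>)) \<and>
    (\<lambda>\<eta>. optimal_value M P0 X \<tau> h \<eta> -
       ((\<integral>\<omega>. path_cost h X \<tau> \<omega> \<partial>M)
        + sqrt (2 * prob_space.variance P0 (g_sum g)) * \<eta> powr (1/2)
        + 1 / prob_space.variance P0 (g_sum g)
            * (1/3 * kappa3 P0 (g_sum g) + nu P0 (g_sum g) (G_sum G)) * \<eta>))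
      \<in> O[at_right 0](\<lambda>\<eta>. \<eta> powr (3/2)) \<and>
    ((\<exists>F. cond_A M P0 X \<tau> h F \<and> innovations M P0 X F) \<or> cond_B M P0 X \<tau> h \<longrightarrow>
      (\<lambda>N. nu P0 (g_sum g) (G_partial_sum Gmin N)) \<longlonglongrightarrow> nu P0 (g_sum g) (G_sum G))"
proof -
  interpret P0: prob_space P0 by fact
  interpret cost_model M P0 X \<tau> h
    using assms(1,3,4,5) by (intro cost_model.intro cost_model_axioms.intro) (auto intro: assms(2))
  obtain a w B c \<theta> C where dom: "dominated_cost M P0 X \<tau> h a w B c" and th: "0 < \<theta>"
    and em: "integrable P0 (\<lambda>x. exp (\<theta> * a x))" and C: "0 \<le> C"
    and high: "\<forall>\<^sub>F r in at_right 0. \<forall>L. entropy_ball_density P0 (r\<^sup>2) L \<longrightarrow>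
      (\<integral>\<^sup>+\<omega>. ennreal \<bar>path_cost h X \<tau> \<omega> * higher_part (\<lambda>t. L (X t \<omega>) - 1) (\<tau> \<omega>)\<bar> \<partial>M) \<le> ennreal (C * r ^ 3)"
    using assms(6) bounded_time_domination independent_time_domination by blast
  interpret expanded_cost M P0 X \<tau> h a w B c g G
    by (intro expanded_cost.intro expanded_cost_axioms.intro dom assms(7,8))
  note expansion = optimal_value_expansion[OF th em C high assms(10)]
  have "uncorrelated_future" if "(\<exists>F. cond_A M P0 X \<tau> h F \<and> innovations M P0 X F) \<or> cond_B M P0 X \<tau> h"
    using that uncorrelated_future_of_innovations uncorrelated_future_of_independence by blast
  then show ?thesis
    using expansion(2,3) nu_partial_sums_tendsto[OF assms(9) _ expansion(1)] by blast
qed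

end
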